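(* Consider a family of uniformly refined space-time meshes with $h_t\sim h_s^2$. Let $\epsilon>0$ be a global accuracy, and suppose the level-dependent tolerances of the low-rank (ACA) approximations are chosen as $$\epsilon_{near} = \frac{\epsilon}{\gamma n_T}\, h_s h_t^{1/2},\qquad \epsilon_\ell = \frac{\epsilon\, 2^{-\ell}}{\gamma\, p\log p\,(\ell+1)^2}\, h_s h_t^{-1/2},\quad 0\le \ell\le L-2 .$$ Let $\mathbf{V}$ be the Galerkin matrix of the thermal single layer potential (in hierarchical blocked form) and $\hat{\mathbf V}$ the matrix obtained from it by replacing every near-field spatial block by an approximation with spectral norm error at most $\epsilon_{near}$ and every far-field spatial block of temporal level $\ell$ by an approximation with spectral norm error at most $\epsilon_\ell$. Let $\langle p,(\mathcal V-\hat{\mathcal V})q\rangle$ be the corresponding difference of bilinear forms on the discrete space $S$. Then, for all $p,q\in S$ with coefficient vectors $\mathbf p,\mathbf q$, $$\left\langle p,(\mathcal V-\hat{\mathcal V})q\right\rangle = \mathbf p^T(\mathbf V-\hat{\mathbf V})\mathbf q \;\lesssim\; \epsilon\, h_s^{-2}\,\|p\|_{H^{-1/2,-1/4}(\Gamma\times I)}\,\|q\|_{H^{-1/2,-1/4}(\Gamma\times I)},$$ where $\lesssim$ means that the inequality holds up to a constant independent of the number of mesh refinements.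
   Context: **Kernel and operator.** $\Gamma$ is the boundary of a domain $\Omega\subset\mathbb R^3$, $I=[0,T]$, and $G(\mathbf r,t)=(4\pi t)^{-3/2}\exp(-|\mathbf r|^2/(4t))$ for $t>0$, $G=0$ for $t<0$. The thermal single layer potential is $\mathcal Vq(\mathbf x,t)=\int_0^t\int_\Gamma G(\mathbf x-\mathbf y,t-\tau)q(\mathbf y,\tau)\,ds(\mathbf y)\,d\tau$. The space $H^{-1/2,-1/4}(\Gamma\times I)$ is the anisotropic Sobolev space (orders $-1/2$ in space and $-1/4$ in time) that is the energy space in which $\mathcal V$ is coercive; it is the dual of $H^{1/2,1/4}(\Gamma\times I)=L_2(I;H^{1/2}(\Gamma))\cap H^{1/4}(I;L_2(\Gamma))$ with respect to the $L_2(\Gamma\times I)$ pairing. **Discrete space.** Time: $I$ is split into $N_t=2^Ln_T$ intervals $I_i=[t_{i-1},t_i]$ of length $h_t=T/N_t$, where $n_T$ is a fixed small integer. For each $i$, $\chi_{i1},\dots,\chi_{iD_t}$ is a basis of the polynomials of degree $p_t=D_t-1$ on $I_i$, extended by zero, and obtained from one fixed reference basis by affine transformation; $S_I$ is their span. Space: $\Gamma=\bigcup_{k=1}^{N_s}\Gamma_k$ is divided into triangular patches, each the image of a parameterization of the standard triangle; $h_s$ is the maximal patch diameter; $\phi_{k1},\dots,\phi_{kD_s}$ are the nodal shape functions on $\Gamma_k$ whose pullbacks are polynomials of degree $p_s$, extended by zero; $S_\Gamma$ is their span. The space $S$ is the tensor product of $S_\Gamma$ and $S_I$, with basis $\chi_{ij}\phi_{km}$;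 $\mathbf q$ is the coefficient vector of $q\in S$. An initially coarse mesh is refined uniformly: in each refinement step each spatial patch and each temporal interval is divided into four pieces, so $h_t\sim h_s^2$. **Temporal hierarchy.** For $0\le\ell\le L$ ($\ell=0$ finest) let $I_n^\ell=T2^{\ell-L}[n,n+1)$, $0\le n<2^{L-\ell}$, and let $\mathcal I_n^\ell$ be the set of $i$ with $I_i\subset I_n^\ell$ (up to endpoints). The matrix $\mathbf V$ has entries $\int_{I_i}\int_{I_{i'}}\int_{\Gamma_k}\int_{\Gamma_{k'}}G(\mathbf x-\mathbf y,t-\tau)\chi_{ij}(t)\chi_{i'j'}(\tau)\phi_{km}(\mathbf x)\phi_{k'm'}(\mathbf y)\,ds_{\mathbf y}ds_{\mathbf x}d\tau dt$; it vanishes for $i'>i$ and depends on $i,i'$ only through $i-i'$. Denote by $A_d$ the block (size $N_sD_sD_t$) of all entries with $i-i'=d$. Let $\mathbf c_d^\ell$ be the block of $\mathbf V$ with row indices in $\mathcal I_{n+d}^\ell$ and column indices in $\mathcal I_n^\ell$ (independent of $n$). $\mathbf V$ is partitioned into: near-field blocks $\mathbf c_0^0$ at positions $(n,n)$ and $\mathbf c_1^0$ at positions $(n+1,n)$ of level $0$; and far-field blocks, for $0\le\ell\le L-2$, $\mathbf c_2^\ell$ at all positions $(n+2,n)$ and $\mathbf c_3^\ell$ at positions $(n+3,n)$ with $n$ even, of level $\ell$. The near-field blocks are block matrices whose $n_T\times n_T$ blocks are the matrices $A_d$, $0\le d<2n_T$ (or zero). **Far-field form.** With an integer $p\ge2$,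 the far-field blocks ($d=2,3$) are represented through Chebyshev interpolation in time by $$[\mathbf c_d^\ell]_{ijkm,i'j'k'm'}=\sum_{\beta,\beta'=0}^{p-1}M_{\beta,ij}\,A_{\beta km,\beta'k'm'}\,M_{\beta',i'j'},$$ where $t_\beta,\tau_{\beta'}$ are the $p$ Chebyshev nodes of $I_d^\ell$ and $I_0^\ell$, $M_{\beta',i'j'}=\int_{I_0^\ell}L_{\beta'}(\tau)\chi_{i'j'}(\tau)\,d\tau$ with $L_{\beta'}$ the Lagrange polynomials at the nodes $\tau_{\beta'}$ (and the analogous integral, equal by translation, over $I_d^\ell$ for the row index), and $A_d^\ell$ is the matrix with entries $A_{\beta km,\beta'k'm'}=\int_\Gamma\int_\Gamma G(\mathbf x-\mathbf y,t_\beta-\tau_{\beta'})\phi_{km}(\mathbf x)\phi_{k'm'}(\mathbf y)\,ds_{\mathbf y}ds_{\mathbf x}$. **Spatial blocks.** A cube containing $\Gamma$ is uniformly refined; $\ell_s=0$ is the finest level and $\ell_s=L_s$ that of the initial cube. To each nonempty cube $\nu$ of a level belongs the set of patches $\Gamma_k$ with centroid in it, with diameter $\rho_\nu$ and centroid $\mathbf x_\nu$. For cubes in the same level let $\eta(\nu,\nu')=(\rho_\nu+\rho_{\nu'})/|\mathbf x_\nu-\mathbf x_{\nu'}|$ for $\nu\ne\nu'$ and $\eta(\nu,\nu)=\infty$; the neighbors of $\nu$ are $\mathcal N(\nu)=\{\nu':\eta(\nu,\nu')>\eta_0\}$ with a fixed $\eta_0<1$. Set $\gamma=\max_\nu\#\mathcal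 N(\nu)$. For temporal level $\ell$ the spatial level $\ell_s=\min\{\lfloor\ell/2\rfloor,L_s\}$ is used, and $A_d^\ell$ is partitioned into blocks $A_d^\ell(\nu,\nu')$ according to the cubes $\nu,\nu'$ containing the row and column patches; likewise the near-field matrices $A_d$ are partitioned into blocks $A_d(\nu,\nu')$ for the finest spatial level. Blocks for which $\nu,\nu'$ are not neighbors are set to zero both in $\mathbf V$ and in $\hat{\mathbf V}$. **Approximation.** $\hat{\mathbf V}$ is obtained from $\mathbf V$ by replacing, for neighbors $\nu,\nu'$, the blocks $A_d^\ell(\nu,\nu')$ by matrices $\hat A_d^\ell(\nu,\nu')$ with $\|A_d^\ell(\nu,\nu')-\hat A_d^\ell(\nu,\nu')\|_2\le\epsilon_\ell$ and the near-field blocks $A_d(\nu,\nu')$ by matrices $\hat A_d(\nu,\nu')$ with $\|A_d(\nu,\nu')-\hat A_d(\nu,\nu')\|_2\le\epsilon_{near}$. $\hat{\mathcal V}$ denotes the operator whose bilinear form on $S$ has matrix $\hat{\mathbf V}$.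
   Formalization: The temporal basis is the affinely transported reference basis multiplied by h_t^{-1/2} (L2-normalized); with the unscaled basis the near-field tolerance gives only order h_s^{-3}. Γ is taken to be a Lipschitz boundary with C^1 regular patch parameterizations. *)

theory Defs
  imports "HOL-Analysis.Analysis"
begin

section \<open>Geometry, reference elements and fixed parameters\<close>

definition ref_triangle :: "(real^2) set" where
  "ref_triangle = {u. 0 \<le> u $ 1 \<and> 0 \<le> u $ 2 \<and> u $ 1 + u $ 2 \<le> 1}"

text \<open>Near each boundary point the domain is, after choosing a direction \<open>e\<close>, the set above the graph
  of a Lipschitz function on the plane orthogonal to \<open>e\<close>.\<close>

definition lipschitz_domain :: "(real^3) set \<Rightarrow> bool" where
  "lipschitz_domain \<Omega> \<longleftrightarrow> open \<Omega> \<and> connected \<Omega> \<and> \<Omega> \<noteq> {} \<and>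
     (\<forall>x\<in>frontier \<Omega>. \<exists>\<rho>>0. \<exists>e g K. norm e = 1 \<and> K-lipschitz_on {z. z \<bullet> e = 0} g \<and>
        \<Omega> \<inter> ball x \<rho> = {y \<in> ball x \<rho>. g (y - (y \<bullet> e) *\<^sub>R e) < y \<bullet> e})"

definition poly2 :: "nat \<Rightarrow> (real^2 \<Rightarrow> real) set" where
  "poly2 N = {f. \<exists>c. \<forall>u. f u = (\<Sum>a\<le>N. \<Sum>b\<le>N - a. c a b * (u $ 1) ^ a * (u $ 2) ^ b)}"

text \<open>The data that do not change under mesh refinement, except \<open>cube_depth\<close>: the depth of the cube
  hierarchy (the number \<open>L\<^sub>s\<close>) may depend on the number of refinements.\<close>

record heat_bem =
  domain_of :: "(real^3) set"
  n_patch :: nat                                         (* patches of the initial mesh *)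
  par :: "nat \<Rightarrow> real^2 \<Rightarrow> real^3"                       (* their parameterizations *)
  dpar :: "nat \<Rightarrow> real^2 \<Rightarrow> real^2 \<Rightarrow> real^3"              (* and the derivatives of these *)
  T_end :: real
  n_T :: nat
  L_init :: nat                                          (* the number L of the initial mesh *)
  p_t :: nat
  chi_ref :: "nat \<Rightarrow> real poly"
  p_s :: nat
  node_ref :: "nat \<Rightarrow> real^2"
  phi_ref :: "nat \<Rightarrow> real^2 \<Rightarrow> real"
  cube_corner :: "real^3"
  cube_side :: real
  cube_depth :: "nat \<Rightarrow> nat"
  eta0 :: real

definition D_t :: "heat_bem \<Rightarrow> nat" where
  "D_t P = p_t P + 1"

definition D_s :: "heat_bem \<Rightarrow> nat" where
  "D_s P = (p_s P + 1) * (p_s P + 2) div 2"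

definition Gam :: "heat_bem \<Rightarrow> (real^3) set" where
  "Gam P = frontier (domain_of P)"

text \<open>\<open>\<Gamma>\<close> is a Lipschitz boundary divided into finitely many regular (\<open>C\<^sup>1\<close> up to the boundary, injective,
  immersive) images of the standard triangle whose relative interiors are not met by other patches.
  The reference bases are a basis of the univariate polynomials of degree at most \<open>p_t\<close> and the
  Lagrange basis of the bivariate polynomials of total degree at most \<open>p_s\<close> for some unisolvent
  set of \<open>D_s\<close> nodes.\<close>

definition bem_setup :: "heat_bem \<Rightarrow> bool" where
  "bem_setup P \<longleftrightarrow>
     lipschitz_domain (domain_of P) \<and>
     0 < n_patch P \<and>
     Gam P = (\<Union>k<n_patch P. par P k ` ref_triangle) \<and>
     (\<forall>k<n_patch P. inj_on (par P k) ref_triangle \<and>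
        (\<forall>u\<in>ref_triangle. (par P k has_derivative dpar P k u) (at u within ref_triangle) \<and>
                          inj (dpar P k u)) \<and>
        (\<forall>h. continuous_on ref_triangle (\<lambda>u. dpar P k u h))) \<and>
     (\<forall>k<n_patch P. \<forall>k'<n_patch P. k \<noteq> k' \<longrightarrow>
        par P k ` interior ref_triangle \<inter> par P k' ` ref_triangle = {}) \<and>
     0 < T_end P \<and> 0 < n_T P \<and>
     (\<forall>j<D_t P. degree (chi_ref P j) \<le> p_t P) \<and>
     (\<forall>f. degree f \<le> p_t P \<longrightarrow>
        (\<exists>!c. (\<forall>j\<ge>D_t P. c j = 0) \<and> f = (\<Sum>j<D_t P. smult (c j) (chi_ref P j)))) \<and>
     (\<forall>m<D_s P. node_ref P m \<in> ref_triangle \<and> phi_ref P m \<in> poly2 (p_s P) \<and>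
        (\<forall>m'<D_s P. phi_ref P m (node_ref P m') = (if m = m' then 1 else 0))) \<and>
     0 < cube_side P \<and>
     (\<forall>x\<in>Gam P. \<forall>i. cube_corner P $ i \<le> x $ i \<and> x $ i < cube_corner P $ i + cube_side P) \<and>
     eta0 P < 1"

text \<open>The pushforward, summed over the patches, of Lebesgue measure with the area element
  \<open>\<bar>\<partial>\<^sub>1\<kappa> \<times> \<partial>\<^sub>2\<kappa>\<bar>\<close>. It lives on the Borel sets of the ambient space and is concentrated on \<open>\<Gamma>\<close>.\<close>

definition surf :: "heat_bem \<Rightarrow> (real^3) measure" where
  "surf P = distr
     (density (count_space {..<n_patch P} \<Otimes>\<^sub>M restrict_space lborel ref_triangle)
        (\<lambda>(k, u). ennreal (norm (cross3 (dpar P k u (axis 1 1)) (dpar P k u (axis 2 1))))))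
     borel (\<lambda>(k, u). par P k u)"

definition time_meas :: "heat_bem \<Rightarrow> real measure" where
  "time_meas P = restrict_space lborel {0..T_end P}"

section \<open>Anisotropic Sobolev norms\<close>

text \<open>Squared Sobolev-Slobodeckij norms: the exponent of the distance is \<open>dim + 2 s\<close>, that is
  \<open>2 + 2 * (1/2)\<close> on the surface and \<open>1 + 2 * (1/4)\<close> in time.\<close>

definition L2_Gam_sq :: "heat_bem \<Rightarrow> (real^3 \<Rightarrow> real) \<Rightarrow> ennreal" where
  "L2_Gam_sq P w = (\<integral>\<^sup>+ x. ennreal ((w x)\<^sup>2) \<partial>surf P)"

definition H_half_Gam_sq :: "heat_bem \<Rightarrow> (real^3 \<Rightarrow> real) \<Rightarrow> ennreal" where
  "H_half_Gam_sq P w = L2_Gam_sq P w +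
     (\<integral>\<^sup>+ x. \<integral>\<^sup>+ y. ennreal ((w x - w y)\<^sup>2 / norm (x - y) ^ 3) \<partial>surf P \<partial>surf P)"

definition H_aniso_sq :: "heat_bem \<Rightarrow> ((real^3) \<times> real \<Rightarrow> real) \<Rightarrow> ennreal" where
  "H_aniso_sq P v =
     (\<integral>\<^sup>+ t. H_half_Gam_sq P (\<lambda>x. v (x, t)) \<partial>time_meas P) +
     ((\<integral>\<^sup>+ t. L2_Gam_sq P (\<lambda>x. v (x, t)) \<partial>time_meas P) +
      (\<integral>\<^sup>+ t. \<integral>\<^sup>+ s. L2_Gam_sq P (\<lambda>x. v (x, t) - v (x, s)) / ennreal (\<bar>t - s\<bar> powr (3/2))
         \<partial>time_meas P \<partial>time_meas P))"

text \<open>The norm of \<open>H\<^sup>-\<^sup>1\<^sup>/\<^sup>2\<^sup>,\<^sup>-\<^sup>1\<^sup>/\<^sup>4\<close> on square integrable functions: the dual norm of the above with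
  respect to the \<open>L\<^sub>2(\<Gamma> \<times> I)\<close> pairing.\<close>

definition H_dual_norm :: "heat_bem \<Rightarrow> ((real^3) \<times> real \<Rightarrow> real) \<Rightarrow> real" where
  "H_dual_norm P q =
     (SUP v \<in> {v \<in> borel_measurable (surf P \<Otimes>\<^sub>M time_meas P). H_aniso_sq P v \<le> 1}.
        \<bar>LINT z|(surf P \<Otimes>\<^sub>M time_meas P). q z * v z\<bar>)"

section \<open>The meshes and discrete spaces after \<open>r\<close> uniform refinements\<close>

text \<open>Every refinement cuts each parameter triangle at the midpoints of its edges.\<close>

definition sub_triangle :: "nat \<Rightarrow> real^2 \<Rightarrow> real^2" where
  "sub_triangle a u =
     (if a = 0 then (1/2) *\<^sub>R u
      else if a = 1 then (1/2) *\<^sub>R (axis 1 1 + u)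
      else if a = 2 then (1/2) *\<^sub>R (axis 2 1 + u)
      else (1/2) *\<^sub>R (axis 1 1 + axis 2 1 - u))"

primrec patch_par :: "heat_bem \<Rightarrow> nat \<Rightarrow> nat \<Rightarrow> real^2 \<Rightarrow> real^3" where
  "patch_par P 0 k = par P k"
| "patch_par P (Suc r) k = patch_par P r (k div 4) \<circ> sub_triangle (k mod 4)"

definition N_s :: "heat_bem \<Rightarrow> nat \<Rightarrow> nat" where
  "N_s P r = n_patch P * 4 ^ r"

definition patch :: "heat_bem \<Rightarrow> nat \<Rightarrow> nat \<Rightarrow> (real^3) set" where
  "patch P r k = patch_par P r k ` ref_triangle"

definition h_s :: "heat_bem \<Rightarrow> nat \<Rightarrow> real" where
  "h_s P r = Max ((\<lambda>k. diameter (patch P r k)) ` {..<N_s P r})"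

text \<open>Each refinement divides the time intervals into four.\<close>

definition Lev :: "heat_bem \<Rightarrow> nat \<Rightarrow> nat" where
  "Lev P r = L_init P + 2 * r"

definition N_t :: "heat_bem \<Rightarrow> nat \<Rightarrow> nat" where
  "N_t P r = 2 ^ Lev P r * n_T P"

definition h_t :: "heat_bem \<Rightarrow> nat \<Rightarrow> real" where
  "h_t P r = T_end P / real (N_t P r)"

definition phi :: "heat_bem \<Rightarrow> nat \<Rightarrow> nat \<Rightarrow> nat \<Rightarrow> real^3 \<Rightarrow> real" where
  "phi P r k m x =
     (if x \<in> patch P r k then phi_ref P m (inv_into ref_triangle (patch_par P r k) x) else 0)"

text \<open>Intervals are numbered from 0. The reference basis is transported to the \<open>i\<close>-th interval by the
  affine change of variables, scaled by \<open>h_t powr (-1/2)\<close> so that \<open>L\<^sub>2\<close> inner products are preserved.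
  The scaling matters: the near-field tolerance bounds errors of matrices that contain two temporal
  basis functions. For basis functions of size 1 that tolerance only yields an error of order
  \<open>\<epsilon> h_s powr (-3)\<close>, and this order is attained.\<close>

definition chi_t :: "heat_bem \<Rightarrow> nat \<Rightarrow> nat \<Rightarrow> nat \<Rightarrow> real \<Rightarrow> real" where
  "chi_t P r i j t =
     (if t \<in> {real i * h_t P r ..< real (i + 1) * h_t P r}
      then h_t P r powr (-1/2) * poly (chi_ref P j) ((t - real i * h_t P r) / h_t P r)
      else 0)"

type_synonym dof = "nat \<times> nat \<times> nat \<times> nat"   (* (i, j, k, m) *)

definition dofs :: "heat_bem \<Rightarrow> nat \<Rightarrow> dof set" where
  "dofs P r = {..<N_t P r} \<times> {..<D_t P} \<times> {..<N_s P r} \<times> {..<D_s P}"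

definition fun_of :: "heat_bem \<Rightarrow> nat \<Rightarrow> (dof \<Rightarrow> real) \<Rightarrow> (real^3) \<times> real \<Rightarrow> real" where
  "fun_of P r c = (\<lambda>(x, t). \<Sum>(i, j, k, m)\<in>dofs P r. c (i, j, k, m) * (chi_t P r i j t * phi P r k m x))"

definition S_space :: "heat_bem \<Rightarrow> nat \<Rightarrow> ((real^3) \<times> real \<Rightarrow> real) set" where
  "S_space P r = range (fun_of P r)"

definition coeff_vec :: "heat_bem \<Rightarrow> nat \<Rightarrow> ((real^3) \<times> real \<Rightarrow> real) \<Rightarrow> dof \<Rightarrow> real" where
  "coeff_vec P r q = (THE c. q = fun_of P r c \<and> (\<forall>a. a \<notin> dofs P r \<longrightarrow> c a = 0))"

definition mat_form :: "heat_bem \<Rightarrow> nat \<Rightarrow> (dof \<Rightarrow> dof \<Rightarrow> real) \<Rightarrow> (dof \<Rightarrow> real) \<Rightarrow> (dof \<Rightarrow> real) \<Rightarrow> real" where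
  "mat_form P r A c d = (\<Sum>a\<in>dofs P r. \<Sum>b\<in>dofs P r. c a * A a b * d b)"

text \<open>The bilinear form on the discrete space that has the matrix \<open>A\<close>.\<close>

definition op_form ::
  "heat_bem \<Rightarrow> nat \<Rightarrow> (dof \<Rightarrow> dof \<Rightarrow> real) \<Rightarrow> ((real^3) \<times> real \<Rightarrow> real) \<Rightarrow> ((real^3) \<times> real \<Rightarrow> real) \<Rightarrow> real" where
  "op_form P r A f g = mat_form P r A (coeff_vec P r f) (coeff_vec P r g)"

section \<open>Spatial clusters\<close>

definition centroid :: "heat_bem \<Rightarrow> (real^3) set \<Rightarrow> real^3" where
  "centroid P A = (1 / measure (surf P) A) *\<^sub>R (LINT x:A|surf P. x)"

text \<open>A cube of level \<open>ls\<close> has side \<open>cube_side * 2 ^ ls / 2 ^ cube_depth\<close> and is identified with its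
  integer coordinates in the grid of that level.\<close>

definition cube_of :: "heat_bem \<Rightarrow> nat \<Rightarrow> nat \<Rightarrow> nat \<Rightarrow> int^3" where
  "cube_of P r ls k = (\<chi> i. \<lfloor>(centroid P (patch P r k) $ i - cube_corner P $ i) /
                               (cube_side P * 2 ^ ls / 2 ^ cube_depth P r)\<rfloor>)"

definition cubes :: "heat_bem \<Rightarrow> nat \<Rightarrow> nat \<Rightarrow> (int^3) set" where
  "cubes P r ls = cube_of P r ls ` {..<N_s P r}"

definition cube_patches :: "heat_bem \<Rightarrow> nat \<Rightarrow> nat \<Rightarrow> int^3 \<Rightarrow> nat set" where
  "cube_patches P r ls \<nu> = {k. k < N_s P r \<and> cube_of P r ls k = \<nu>}"

definition cluster :: "heat_bem \<Rightarrow> nat \<Rightarrow> nat \<Rightarrow> int^3 \<Rightarrow> (real^3) set" where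
  "cluster P r ls \<nu> = (\<Union>k\<in>cube_patches P r ls \<nu>. patch P r k)"

definition eta :: "heat_bem \<Rightarrow> nat \<Rightarrow> nat \<Rightarrow> int^3 \<Rightarrow> int^3 \<Rightarrow> ereal" where
  "eta P r ls \<nu> \<nu>' =
     (if \<nu> = \<nu>' then \<infinity>
      else ereal ((diameter (cluster P r ls \<nu>) + diameter (cluster P r ls \<nu>')) /
                  norm (centroid P (cluster P r ls \<nu>) - centroid P (cluster P r ls \<nu>'))))"

definition neighbors :: "heat_bem \<Rightarrow> nat \<Rightarrow> nat \<Rightarrow> int^3 \<Rightarrow> (int^3) set" where
  "neighbors P r ls \<nu> = {\<nu>' \<in> cubes P r ls. eta P r ls \<nu> \<nu>' > ereal (eta0 P)}"

definition gamma_max :: "heat_bem \<Rightarrow> nat \<Rightarrow> nat" where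
  "gamma_max P r =
     Max ((\<lambda>(ls, \<nu>). card (neighbors P r ls \<nu>)) ` (SIGMA ls:{..cube_depth P r}. cubes P r ls))"

text \<open>The spatial level that belongs to temporal level \<open>l\<close>.\<close>

definition space_level :: "heat_bem \<Rightarrow> nat \<Rightarrow> nat \<Rightarrow> nat" where
  "space_level P r l = min (l div 2) (cube_depth P r)"

section \<open>The blocked matrix\<close>

definition heat_kernel :: "real^3 \<Rightarrow> real \<Rightarrow> real" where
  "heat_kernel z t = (if 0 < t then (4 * pi * t) powr (-3/2) * exp (- (norm z)\<^sup>2 / (4 * t)) else 0)"

definition galerkin :: "heat_bem \<Rightarrow> nat \<Rightarrow> dof \<Rightarrow> dof \<Rightarrow> real" where
  "galerkin P r = (\<lambda>(i, j, k, m) (i', j', k', m').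
     LINT t|lborel. LINT s|lborel. LINT x|surf P. LINT y|surf P.
       heat_kernel (x - y) (t - s) * chi_t P r i j t * chi_t P r i' j' s
         * phi P r k m x * phi P r k' m' y)"

type_synonym tri_idx = "nat \<times> nat \<times> nat"

text \<open>The matrix \<open>A\<^sub>d\<close>, with indices \<open>(j, k, m)\<close>. Galerkin entries depend on \<open>i, i'\<close> only through \<open>i - i'\<close>.\<close>

definition A_near :: "heat_bem \<Rightarrow> nat \<Rightarrow> nat \<Rightarrow> tri_idx \<Rightarrow> tri_idx \<Rightarrow> real" where
  "A_near P r d = (\<lambda>(j, k, m) (j', k', m'). galerkin P r (d, j, k, m) (0, j', k', m'))"

text \<open>The \<open>n\<close>-th time cluster of level \<open>l\<close> is \<open>{n * H ..< (n + 1) * H}\<close> with \<open>H = T * 2 ^ l / 2 ^ L\<close>.\<close>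

definition clus_len :: "heat_bem \<Rightarrow> nat \<Rightarrow> nat \<Rightarrow> real" where
  "clus_len P r l = T_end P * 2 ^ l / 2 ^ Lev P r"

definition clus_interval :: "heat_bem \<Rightarrow> nat \<Rightarrow> nat \<Rightarrow> nat \<Rightarrow> real set" where
  "clus_interval P r l n = {real n * clus_len P r l ..< real (n + 1) * clus_len P r l}"

text \<open>The time cluster of level \<open>l\<close> that contains the \<open>i\<close>-th interval.\<close>

definition clus_of :: "heat_bem \<Rightarrow> nat \<Rightarrow> nat \<Rightarrow> nat" where
  "clus_of P l i = i div (2 ^ l * n_T P)"

text \<open>Chebyshev nodes of the first kind, transported to the cluster.\<close>

definition cheb_node :: "heat_bem \<Rightarrow> nat \<Rightarrow> nat \<Rightarrow> nat \<Rightarrow> nat \<Rightarrow> nat \<Rightarrow> real" where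
  "cheb_node P r p l n \<beta> =
     clus_len P r l * (real n + 1/2 + cos (real (2 * \<beta> + 1) * pi / real (2 * p)) / 2)"

definition lagrange :: "heat_bem \<Rightarrow> nat \<Rightarrow> nat \<Rightarrow> nat \<Rightarrow> nat \<Rightarrow> nat \<Rightarrow> real \<Rightarrow> real" where
  "lagrange P r p l n \<beta> t = (\<Prod>\<alpha>\<in>{..<p} - {\<beta>}.
     (t - cheb_node P r p l n \<alpha>) / (cheb_node P r p l n \<beta> - cheb_node P r p l n \<alpha>))"

definition M_moment :: "heat_bem \<Rightarrow> nat \<Rightarrow> nat \<Rightarrow> nat \<Rightarrow> nat \<Rightarrow> nat \<Rightarrow> nat \<Rightarrow> nat \<Rightarrow> real" where
  "M_moment P r p l n \<beta> i j =
     (LINT s:clus_interval P r l n|lborel. lagrange P r p l n \<beta> s * chi_t P r i j s)"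

text \<open>The matrix \<open>A\<^sub>d\<close> of temporal level \<open>l\<close>, with indices \<open>(\<beta>, k, m)\<close>.\<close>

definition A_far :: "heat_bem \<Rightarrow> nat \<Rightarrow> nat \<Rightarrow> nat \<Rightarrow> nat \<Rightarrow> tri_idx \<Rightarrow> tri_idx \<Rightarrow> real" where
  "A_far P r p l d = (\<lambda>(\<beta>, k, m) (\<beta>', k', m').
     LINT x|surf P. LINT y|surf P.
       heat_kernel (x - y) (cheb_node P r p l d \<beta> - cheb_node P r p l 0 \<beta>')
         * phi P r k m x * phi P r k' m' y)"

text \<open>Assembly of the near-field blocks at cluster positions \<open>(n, n)\<close>, \<open>(n + 1, n)\<close> of level 0 and of
  the far-field blocks at positions \<open>(n + 2, n)\<close>, and \<open>(n + 3, n)\<close> with even \<open>n\<close>, of the levels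
  \<open>l \<le> L - 2\<close>, from given matrices \<open>B d\<close> (in place of \<open>A_near\<close>) and \<open>F l d\<close> (in place of
  \<open>A_far\<close>). These positions form a partition, so at most one summand is nonzero. Spatial blocks
  of cubes that are not neighbors are dropped.\<close>

definition blocked_matrix ::
  "heat_bem \<Rightarrow> nat \<Rightarrow> nat \<Rightarrow> (nat \<Rightarrow> tri_idx \<Rightarrow> tri_idx \<Rightarrow> real)
     \<Rightarrow> (nat \<Rightarrow> nat \<Rightarrow> tri_idx \<Rightarrow> tri_idx \<Rightarrow> real) \<Rightarrow> dof \<Rightarrow> dof \<Rightarrow> real" where
  "blocked_matrix P r p B F = (\<lambda>(i, j, k, m) (i', j', k', m').
     (if i' \<le> i \<and> clus_of P 0 i \<le> clus_of P 0 i' + 1 \<and>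
         cube_of P r 0 k' \<in> neighbors P r 0 (cube_of P r 0 k)
      then B (i - i') (j, k, m) (j', k', m') else 0) +
     (\<Sum>l | l + 2 \<le> Lev P r. \<Sum>d\<in>{2, 3}.
        if clus_of P l i = clus_of P l i' + d \<and> (d = 3 \<longrightarrow> even (clus_of P l i')) \<and>
           cube_of P r (space_level P r l) k'
             \<in> neighbors P r (space_level P r l) (cube_of P r (space_level P r l) k)
        then \<Sum>\<beta><p. \<Sum>\<beta>'<p. M_moment P r p l (clus_of P l i) \<beta> i j
                * F l d (\<beta>, k, m) (\<beta>', k', m') * M_moment P r p l (clus_of P l i') \<beta>' i' j'
        else 0))"

definition V_mat :: "heat_bem \<Rightarrow> nat \<Rightarrow> nat \<Rightarrow> dof \<Rightarrow> dof \<Rightarrow> real" where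
  "V_mat P r p = blocked_matrix P r p (A_near P r) (A_far P r p)"

section \<open>Approximation of the spatial blocks\<close>

definition spectral_norm :: "'a set \<Rightarrow> 'b set \<Rightarrow> ('a \<Rightarrow> 'b \<Rightarrow> real) \<Rightarrow> real" where
  "spectral_norm I J A =
     (SUP x \<in> {x. L2_set x J \<le> 1}. L2_set (\<lambda>a. \<Sum>b\<in>J. A a b * x b) I)"

text \<open>The row or column indices of the spatial block of the cube \<open>\<nu>\<close>, where \<open>n\<close> is the range of the
  temporal index.\<close>

definition block_idx :: "heat_bem \<Rightarrow> nat \<Rightarrow> nat \<Rightarrow> nat \<Rightarrow> int^3 \<Rightarrow> tri_idx set" where
  "block_idx P r n ls \<nu> = {..<n} \<times> cube_patches P r ls \<nu> \<times> {..<D_s P}"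

definition near_approx ::
  "heat_bem \<Rightarrow> nat \<Rightarrow> real \<Rightarrow> (nat \<Rightarrow> tri_idx \<Rightarrow> tri_idx \<Rightarrow> real) \<Rightarrow> bool" where
  "near_approx P r \<delta> B \<longleftrightarrow>
     (\<forall>d<2 * n_T P. \<forall>\<nu>\<in>cubes P r 0. \<forall>\<nu>'\<in>neighbors P r 0 \<nu>.
        spectral_norm (block_idx P r (D_t P) 0 \<nu>) (block_idx P r (D_t P) 0 \<nu>')
          (\<lambda>a b. A_near P r d a b - B d a b) \<le> \<delta>)"

definition far_approx ::
  "heat_bem \<Rightarrow> nat \<Rightarrow> nat \<Rightarrow> (nat \<Rightarrow> real) \<Rightarrow> (nat \<Rightarrow> nat \<Rightarrow> tri_idx \<Rightarrow> tri_idx \<Rightarrow> real) \<Rightarrow> bool" where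
  "far_approx P r p \<delta> F \<longleftrightarrow>
     (\<forall>l. l + 2 \<le> Lev P r \<longrightarrow> (\<forall>d\<in>{2, 3}.
        \<forall>\<nu>\<in>cubes P r (space_level P r l). \<forall>\<nu>'\<in>neighbors P r (space_level P r l) \<nu>.
          spectral_norm (block_idx P r p (space_level P r l) \<nu>) (block_idx P r p (space_level P r l) \<nu>')
            (\<lambda>a b. A_far P r p l d a b - F l d a b) \<le> \<delta> l))"

definition eps_near :: "heat_bem \<Rightarrow> nat \<Rightarrow> real \<Rightarrow> real" where
  "eps_near P r \<epsilon> = \<epsilon> / (real (gamma_max P r) * real (n_T P)) * h_s P r * h_t P r powr (1/2)"

definition eps_far :: "heat_bem \<Rightarrow> nat \<Rightarrow> nat \<Rightarrow> real \<Rightarrow> nat \<Rightarrow> real" where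
  "eps_far P r p \<epsilon> l =
     \<epsilon> * 2 powr (- real l) / (real (gamma_max P r) * (real p * ln (real p)) * (real l + 1)\<^sup>2)
       * h_s P r * h_t P r powr (-1/2)"

end

theory Submission
  imports Defs
begin

text \<open>Both tolerances give a matrix error of spectral norm at most a constant times
  \<open>\<epsilon> h\<^sub>s h\<^sub>t powr (1/2)\<close>. In time every cluster meets boundedly many others, and in space
  every cube has at most \<open>\<gamma>\<close> neighbors, so that the Schur test sums the block errors. For the far field,
  the Lagrange polynomials at the Chebyshev nodes are bounded by 2, so the moments of the normalized
  basis functions are of order \<open>h\<^sub>t powr (1/2)\<close>. The factors \<open>2 ^ l\<close> and \<open>p\<close> from the numbers of intervals
  in a time cluster and of nodes cancel against the tolerance, and \<open>1 / (l + 1)\<^sup>2\<close> is summable.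

  It remains to show the inverse estimate \<open>|c| \<le> C h\<^sub>s powr (-2) * norm q\<close> for the coefficients \<open>c\<close> of \<open>q\<close> in the
  dual norm. We test \<open>q\<close> with its product \<open>v\<close> with polynomial bubbles on all space-time cells.
  Norm equivalence on the reference element gives \<open>\<langle>q, v\<rangle> \<ge> \<kappa> h\<^sub>s\<^sup>2 |c|\<^sup>2\<close>. The fractional norm of \<open>v\<close>
  is at most \<open>C |c|\<close>: the value of a bubble is bounded by the distance to the cell boundary, and since
  the domain is Lipschitz, this distance is controlled by the distance to any point of another cell, so
  that \<open>(v x - v y)\<^sup>2\<close> is bounded by \<open>|x - y|\<^sup>2\<close> in space and by \<open>|t - s|\<close> in time, and the
  remaining kernels \<open>1 / |x - y|\<close> and \<open>|t - s| powr (-1/2)\<close> are integrable. The inverse estimate also shows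
  that coefficient vectors are unique.\<close>

section \<open>Sums over sparse patterns\<close>

text \<open>The dual norm is a supremum, so a lower bound for it needs explicit test functions. The
  obvious choice v = q fails: q in general jumps across patch edges, and a jump makes the double
  integral in \<open>H_half_Gam_sq\<close>, with kernel |x - y|^(-3) on a surface, diverge.
  Multiplication by bubbles removes the jumps, and their positivity keeps the pairing coercive. The
  powers of h balance as follows. The fractional norm of the test function carries no power of h: in
  space the factor 4^r from the slope of the bubbles meets the area 4^(-r) of a cell, and in time a
  factor 1/h_t meets that same area, which is the parabolic scaling of h_t against h_s^2. The
  pairing is of order 4^(-r) |c|^2, so bounding a coefficient vector costs 4^r, of order h_s^(-2).
  Two such factors against a matrix error of order epsilon h_s h_t^(1/2), that is epsilon h_s^2,
  leave epsilon h_s^(-2). All constants come from the reference elements and the initial mesh; the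
  refinement number r enters through explicit powers.\<close>

lemma L2_set_sq: "(L2_set f A)\<^sup>2 = (\<Sum>i\<in>A. (f i)\<^sup>2)"
  unfolding L2_set_def by (simp add: sum_nonneg)

text \<open>Cauchy-Schwarz on the set \<open>Z\<close> of related pairs. In the sum of
  \<open>(a i)\<^sup>2\<close> over \<open>Z\<close> an index is counted once per partner, hence at
  most \<open>K\<close> times, and likewise for \<open>b\<close>.\<close>

lemma schur_test_pattern:
  fixes a :: "'a \<Rightarrow> real" and b :: "'b \<Rightarrow> real"
  assumes fin: "finite I" "finite J"
    and row: "\<And>i. i \<in> I \<Longrightarrow> card {j \<in> J. R i j} \<le> K"
    and col: "\<And>j. j \<in> J \<Longrightarrow> card {i \<in> I. R i j} \<le> K"
  shows "(\<Sum>i\<in>I. \<Sum>j\<in>J. if R i j then \<bar>a i\<bar> * \<bar>b j\<bar> else 0) \<le> real K * (L2_set a I * L2_set b J)"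
proof -
  define Z where "Z = (SIGMA i:I. {j \<in> J. R i j})"
  have "(\<Sum>i\<in>I. \<Sum>j\<in>J. if R i j then \<bar>a i\<bar> * \<bar>b j\<bar> else 0)
      = (\<Sum>i\<in>I. \<Sum>j\<in>{j \<in> J. R i j}. \<bar>a i\<bar> * \<bar>b j\<bar>)"
    using fin by (simp add: sum.inter_filter)
  also have "\<dots> = (\<Sum>z\<in>Z. \<bar>a (fst z)\<bar> * \<bar>b (snd z)\<bar>)"
    unfolding Z_def using fin by (subst sum.Sigma) (auto simp: case_prod_unfold)
  also have "\<dots> \<le> L2_set (\<lambda>z. a (fst z)) Z * L2_set (\<lambda>z. b (snd z)) Z"
    by (rule L2_set_mult_ineq)
  also have "\<dots> \<le> (sqrt (real K) * L2_set a I) * (sqrt (real K) * L2_set b J)"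
  proof (intro mult_mono)
    have "(\<Sum>z\<in>Z. (a (fst z))\<^sup>2) = (\<Sum>i\<in>I. \<Sum>j\<in>{j \<in> J. R i j}. (a i)\<^sup>2)"
      unfolding Z_def using fin by (subst sum.Sigma) (auto simp: case_prod_unfold)
    also have "\<dots> \<le> (\<Sum>i\<in>I. real K * (a i)\<^sup>2)"
      using row by (intro sum_mono) (auto intro!: mult_right_mono)
    also have "\<dots> = real K * (\<Sum>i\<in>I. (a i)\<^sup>2)"
      by (simp add: sum_distrib_left)
    finally show "L2_set (\<lambda>z. a (fst z)) Z \<le> sqrt (real K) * L2_set a I"
      unfolding L2_set_def by (simp flip: real_sqrt_mult)
    have "(\<Sum>z\<in>Z. (b (snd z))\<^sup>2) = (\<Sum>i\<in>I. \<Sum>j\<in>{j \<in> J. R i j}. (b j)\<^sup>2)"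
      unfolding Z_def using fin by (subst sum.Sigma) (auto simp: case_prod_unfold)
    also have "\<dots> = (\<Sum>i\<in>I. \<Sum>j\<in>J. if R i j then (b j)\<^sup>2 else 0)"
      using fin by (simp add: sum.inter_filter)
    also have "\<dots> = (\<Sum>j\<in>J. \<Sum>i\<in>I. if R i j then (b j)\<^sup>2 else 0)"
      by (rule sum.swap)
    also have "\<dots> = (\<Sum>j\<in>J. \<Sum>i\<in>{i \<in> I. R i j}. (b j)\<^sup>2)"
      using fin by (simp only: sum.inter_filter)
    also have "\<dots> \<le> (\<Sum>j\<in>J. real K * (b j)\<^sup>2)"
      using col by (intro sum_mono) (auto intro!: mult_right_mono)
    also have "\<dots> = real K * (\<Sum>j\<in>J. (b j)\<^sup>2)"
      by (simp add: sum_distrib_left)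
    finally show "L2_set (\<lambda>z. b (snd z)) Z \<le> sqrt (real K) * L2_set b J"
      unfolding L2_set_def by (simp flip: real_sqrt_mult)
  qed (auto simp: L2_set_nonneg)
  also have "\<dots> = real K * (L2_set a I * L2_set b J)"
    by (simp add: field_simps)
  finally show ?thesis .
qed

lemma L2_set_mult_vec_le_spectral_norm:
  assumes fin: "finite I" "finite J"
  shows "L2_set (\<lambda>a. \<Sum>b\<in>J. A a b * y b) I \<le> spectral_norm I J A * L2_set y J"
proof -
  define S where "S = {x. L2_set x J \<le> 1}"
  \<comment> \<open>\<open>spectral_norm\<close> is a supremum of reals, so it dominates its members
    only once boundedness is known. The sum of all absolute entries is a crude bound on the unit
    ball.\<close>
  have bdd: "bdd_above ((\<lambda>x. L2_set (\<lambda>a. \<Sum>b\<in>J. A a b * x b) I) ` S)"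
  proof (rule bdd_aboveI2)
    fix x assume x: "x \<in> S"
    have "\<bar>x b\<bar> \<le> 1" if "b \<in> J" for b
    proof -
      have "\<bar>x b\<bar> = sqrt ((x b)\<^sup>2)" by simp
      also have "\<dots> \<le> L2_set x J"
        unfolding L2_set_def using fin that
        by (intro real_sqrt_le_mono member_le_sum) auto
      finally show ?thesis using x by (auto simp: S_def)
    qed
    then have *: "\<bar>\<Sum>b\<in>J. A a b * x b\<bar> \<le> (\<Sum>b\<in>J. \<bar>A a b\<bar>)" for a
      by (intro order.trans[OF sum_abs] sum_mono) (auto simp: abs_mult intro: mult_left_le)
    have "L2_set (\<lambda>a. \<Sum>b\<in>J. A a b * x b) I \<le> (\<Sum>a\<in>I. \<bar>\<Sum>b\<in>J. A a b * x b\<bar>)"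
      by (rule L2_set_le_sum_abs)
    also have "\<dots> \<le> (\<Sum>a\<in>I. \<Sum>b\<in>J. \<bar>A a b\<bar>)"
      by (intro sum_mono *)
    finally show "L2_set (\<lambda>a. \<Sum>b\<in>J. A a b * x b) I \<le> (\<Sum>a\<in>I. \<Sum>b\<in>J. \<bar>A a b\<bar>)" .
  qed
  show ?thesis
  proof (cases "L2_set y J = 0")
    case True
    then have "\<forall>b\<in>J. y b = 0" using fin by (simp add: L2_set_eq_0_iff)
    then show ?thesis using True by (simp add: L2_set_def)
  next
    case False
    define s where "s = L2_set y J"
    have s: "s > 0" using False L2_set_nonneg[of y J] unfolding s_def by linarith
    have "L2_set (\<lambda>b. y b / s) J = L2_set y J / s"
      using s by (simp add: L2_set_left_distrib divide_inverse)
    then have "(\<lambda>b. y b / s) \<in> S" using s by (simp add: S_def s_def)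
    then have "L2_set (\<lambda>a. \<Sum>b\<in>J. A a b * (y b / s)) I \<le> spectral_norm I J A"
      unfolding spectral_norm_def S_def[symmetric] by (rule cSUP_upper[OF _ bdd])
    also have "(\<lambda>a. \<Sum>b\<in>J. A a b * (y b / s)) = (\<lambda>a. (\<Sum>b\<in>J. A a b * y b) * inverse s)"
      by (simp add: sum_divide_distrib divide_inverse sum_distrib_right mult.assoc)
    also have "L2_set \<dots> I = L2_set (\<lambda>a. \<Sum>b\<in>J. A a b * y b) I * inverse s"
      using s by (simp add: L2_set_left_distrib)
    finally show ?thesis using s by (simp add: field_simps s_def)
  qed
qed

lemma bilinear_le_spectral_norm:
  assumes fin: "finite I" "finite J" and le: "spectral_norm I J A \<le> \<delta>"
  shows "(\<Sum>a\<in>I. \<Sum>b\<in>J. x a * A a b * y b) \<le> \<delta> * (L2_set x I * L2_set y J)"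
proof -
  have "(\<Sum>a\<in>I. \<Sum>b\<in>J. x a * A a b * y b) = (\<Sum>a\<in>I. x a * (\<Sum>b\<in>J. A a b * y b))"
    by (simp add: sum_distrib_left mult.assoc)
  also have "\<dots> \<le> (\<Sum>a\<in>I. \<bar>x a\<bar> * \<bar>\<Sum>b\<in>J. A a b * y b\<bar>)"
    by (intro sum_mono) (simp flip: abs_mult)
  also have "\<dots> \<le> L2_set x I * L2_set (\<lambda>a. \<Sum>b\<in>J. A a b * y b) I"
    by (rule L2_set_mult_ineq)
  also have "\<dots> \<le> L2_set x I * (spectral_norm I J A * L2_set y J)"
    by (intro mult_left_mono L2_set_mult_vec_le_spectral_norm fin L2_set_nonneg)
  also have "\<dots> \<le> L2_set x I * (\<delta> * L2_set y J)"
    by (intro mult_left_mono mult_right_mono le L2_set_nonneg)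
  finally show ?thesis by (simp add: mult_ac)
qed

text \<open>The Schur test applied to blocks instead of entries: each related block is bounded by
  its spectral norm, and the test acts on the vectors of block norms of \<open>x\<close> and
  \<open>y\<close>. The norm of a vector of block norms is the full norm again, because the blocks
  partition \<open>X\<close>.\<close>

lemma bilinear_block_sparse_le:
  fixes x y :: "'a \<Rightarrow> real" and \<kappa> :: "'a \<Rightarrow> 'b"
  assumes fin: "finite X"
    and block: "\<And>\<nu> \<nu>'. \<nu> \<in> \<kappa> ` X \<Longrightarrow> \<nu>' \<in> \<kappa> ` X \<Longrightarrow> Q \<nu> \<nu>' \<Longrightarrow>
          spectral_norm {a \<in> X. \<kappa> a = \<nu>} {a \<in> X. \<kappa> a = \<nu>'} A \<le> \<delta>"
    and row: "\<And>\<nu>. \<nu> \<in> \<kappa> ` X \<Longrightarrow> card {\<nu>' \<in> \<kappa> ` X. Q \<nu> \<nu>'} \<le> K"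
    and col: "\<And>\<nu>'. \<nu>' \<in> \<kappa> ` X \<Longrightarrow> card {\<nu> \<in> \<kappa> ` X. Q \<nu> \<nu>'} \<le> K"
    and \<delta>: "0 \<le> \<delta>"
  shows "(\<Sum>a\<in>X. \<Sum>b\<in>X. if Q (\<kappa> a) (\<kappa> b) then x a * A a b * y b else 0)
           \<le> \<delta> * real K * (L2_set x X * L2_set y X)"
proof -
  define B where "B \<nu> = {a \<in> X. \<kappa> a = \<nu>}" for \<nu>
  have finB: "finite (B \<nu>)" for \<nu> using fin by (simp add: B_def)
  have grp: "(\<Sum>a\<in>X. h a) = (\<Sum>\<nu>\<in>\<kappa> ` X. \<Sum>a\<in>B \<nu>. h a)" for h :: "'a \<Rightarrow> real"
    unfolding B_def by (rule sum.group[symmetric]) (use fin in auto)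
  have "(\<Sum>a\<in>X. \<Sum>b\<in>X. if Q (\<kappa> a) (\<kappa> b) then x a * A a b * y b else 0)
     = (\<Sum>\<nu>\<in>\<kappa> ` X. \<Sum>a\<in>B \<nu>. \<Sum>\<nu>'\<in>\<kappa> ` X. \<Sum>b\<in>B \<nu>'. if Q (\<kappa> a) (\<kappa> b) then x a * A a b * y b else 0)"
    by (simp only: grp)
  also have "\<dots> = (\<Sum>\<nu>\<in>\<kappa> ` X. \<Sum>\<nu>'\<in>\<kappa> ` X. \<Sum>a\<in>B \<nu>. \<Sum>b\<in>B \<nu>'. if Q (\<kappa> a) (\<kappa> b) then x a * A a b * y b else 0)"
    by (intro sum.cong refl sum.swap)
  also have "\<dots> = (\<Sum>\<nu>\<in>\<kappa> ` X. \<Sum>\<nu>'\<in>\<kappa> ` X. if Q \<nu> \<nu>' then \<Sum>a\<in>B \<nu>. \<Sum>b\<in>B \<nu>'. x a * A a b * y b else 0)"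
    by (intro sum.cong refl) (auto simp: B_def)
  also have "\<dots> \<le> (\<Sum>\<nu>\<in>\<kappa> ` X. \<Sum>\<nu>'\<in>\<kappa> ` X. \<delta> * (if Q \<nu> \<nu>' then \<bar>L2_set x (B \<nu>)\<bar> * \<bar>L2_set y (B \<nu>')\<bar> else 0))"
    using bilinear_le_spectral_norm[OF finB finB block[folded B_def]]
    by (intro sum_mono) (auto simp: L2_set_nonneg)
  also have "\<dots> = \<delta> * (\<Sum>\<nu>\<in>\<kappa> ` X. \<Sum>\<nu>'\<in>\<kappa> ` X. if Q \<nu> \<nu>' then \<bar>L2_set x (B \<nu>)\<bar> * \<bar>L2_set y (B \<nu>')\<bar> else 0)"
    by (simp only: sum_distrib_left)
  also have "\<dots> \<le> \<delta> * (real K * (L2_set (\<lambda>\<nu>. L2_set x (B \<nu>)) (\<kappa> ` X) * L2_set (\<lambda>\<nu>. L2_set y (B \<nu>)) (\<kappa> ` X)))"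
    using fin row col \<delta> by (intro mult_left_mono schur_test_pattern) auto
  finally show ?thesis
    by (simp only: L2_set_def[of _ "\<kappa> ` X"] L2_set_sq grp[symmetric] L2_set_def[of _ X, symmetric] mult.assoc)
qed

section \<open>Lagrange polynomials at the Chebyshev nodes\<close>

fun chebyshev :: "nat \<Rightarrow> real poly" where
  "chebyshev 0 = 1"
| "chebyshev (Suc 0) = [:0, 1:]"
| "chebyshev (Suc (Suc n)) = [:0, 2:] * chebyshev (Suc n) - chebyshev n"

lemma poly_chebyshev_cos: "poly (chebyshev n) (cos \<theta>) = cos (real n * \<theta>)"
proof (induction n rule: chebyshev.induct)
  case (3 n)
  have "cos (real (Suc (Suc n)) * \<theta>) + cos (real n * \<theta>) = 2 * cos (real (Suc n) * \<theta>) * cos \<theta>"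
    using cos_add[of "real (Suc n) * \<theta>" \<theta>] cos_diff[of "real (Suc n) * \<theta>" \<theta>]
    by (simp add: algebra_simps)
  with 3 show ?case by (simp add: algebra_simps)
qed auto

lemma degree_chebyshev_le: "degree (chebyshev n) \<le> n"
proof (induction n rule: chebyshev.induct)
  case (3 n)
  have "degree ([:0, 2:] * chebyshev (Suc n)) \<le> Suc (Suc n)"
    using 3 degree_mult_le[of "[:0, 2:]" "chebyshev (Suc n)"] by auto
  with 3 show ?case by (auto intro: degree_diff_le)
qed auto

lemma dirichlet_kernel:
  "(1 + 2 * (\<Sum>k=1..n. cos (real k * \<phi>))) * sin (\<phi> / 2) = sin ((real n + 1/2) * \<phi>)"
proof (induction n)
  case (Suc n)
  have "2 * cos (real (Suc n) * \<phi>) * sin (\<phi> / 2)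
      = sin ((real (Suc n) + 1/2) * \<phi>) - sin ((real n + 1/2) * \<phi>)"
  proof -
    have "(real (Suc n) + 1/2) * \<phi> = real (Suc n) * \<phi> + \<phi> / 2"
      "(real n + 1/2) * \<phi> = real (Suc n) * \<phi> - \<phi> / 2"
      by (simp_all add: field_simps)
    then show ?thesis by (simp only: sin_add sin_diff)
  qed
  with Suc show ?case by (simp add: algebra_simps)
qed simp

text \<open>For n = p - 1 and \<phi> = j pi / p the argument (n + 1/2) \<phi> equals j pi - \<phi> /
  2, so the closed form of the Dirichlet kernel is a signed multiple of sin (\<phi> / 2). The bounds
  on \<open>j\<close> keep \<phi> / 2 strictly between 0 and pi, where this sine can be
  cancelled.\<close>

lemma dirichlet_kernel_at_multiple:
  assumes "0 < j" "j < 2 * p"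
  shows "1 + 2 * (\<Sum>k=1..p-1. cos (real k * (real j * pi / real p))) = - ((-1) ^ j)"
proof -
  define \<phi> where "\<phi> = real j * pi / real p"
  have p: "p > 0" using assms by auto
  have "0 < \<phi> / 2" "\<phi> / 2 < pi"
    using assms p by (auto simp: \<phi>_def field_simps)
  then have s: "sin (\<phi> / 2) > 0" by (rule sin_gt_zero)
  have "(real (p - 1) + 1/2) * \<phi> = real j * pi - \<phi> / 2"
    using p by (simp add: \<phi>_def of_nat_diff field_simps)
  then have "sin ((real (p - 1) + 1/2) * \<phi>) = - ((-1) ^ j) * sin (\<phi> / 2)"
    by (simp add: sin_diff cos_npi)
  then have "(1 + 2 * (\<Sum>k=1..p-1. cos (real k * \<phi>))) * sin (\<phi> / 2) = - ((-1) ^ j) * sin (\<phi> / 2)"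
    unfolding dirichlet_kernel .
  then have "1 + 2 * (\<Sum>k=1..p-1. cos (real k * \<phi>)) = - ((-1) ^ j)"
    using s by (simp only: mult_cancel_right) auto
  then show ?thesis unfolding \<phi>_def .
qed

text \<open>The cosines of these angles are the zeros of the Chebyshev polynomial of degree
  \<open>p\<close>, that is, the nodes \<open>cheb_node\<close> referred to [-1, 1].\<close>

definition cheb_angle :: "nat \<Rightarrow> nat \<Rightarrow> real" where
  "cheb_angle p \<alpha> = real (2 * \<alpha> + 1) * pi / real (2 * p)"

text \<open>A product of cosines is half the sum of the cosines of the sum and of the difference of
  the angles. Twice the left side is therefore a sum of two Dirichlet kernels, taken at multiples of
  pi / p.\<close>

lemma cheb_orthogonality:
  assumes "\<alpha> < p" "\<beta> < p"
  shows "1 + 2 * (\<Sum>k=1..p-1. cos (real k * cheb_angle p \<beta>) * cos (real k * cheb_angle p \<alpha>))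
           = (if \<alpha> = \<beta> then real p else 0)"
proof -
  have p: "p > 0" using assms by auto
  define D where "D j = 1 + 2 * (\<Sum>k=1..p-1. cos (real k * (real j * pi / real p)))" for j
  \<comment> \<open>In truncated subtraction
    \<open>\<alpha> - \<beta> + (\<beta> - \<alpha>)\<close> is the absolute difference of the
    indices.\<close>
  have sumD: "2 * (1 + 2 * (\<Sum>k=1..p-1. cos (real k * cheb_angle p \<beta>) * cos (real k * cheb_angle p \<alpha>)))
      = D (\<alpha> + \<beta> + 1) + D (\<alpha> - \<beta> + (\<beta> - \<alpha>))"
  proof -
    have 1: "cheb_angle p \<beta> + cheb_angle p \<alpha> = real (\<alpha> + \<beta> + 1) * pi / real p"
      using p by (simp add: cheb_angle_def field_simps)
    have ang: "cheb_angle p \<gamma> = (real \<gamma> + 1/2) * (pi / real p)" for \<gamma>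
      using p by (simp add: cheb_angle_def field_simps)
    have 2: "cos (real k * cheb_angle p \<beta> - real k * cheb_angle p \<alpha>)
        = cos (real k * (real (\<alpha> - \<beta> + (\<beta> - \<alpha>)) * pi / real p))" for k
    proof (cases "\<alpha> \<le> \<beta>")
      case True
      then have "real k * (real (\<alpha> - \<beta> + (\<beta> - \<alpha>)) * pi / real p)
          = - (real k * cheb_angle p \<alpha> - real k * cheb_angle p \<beta>)"
        by (simp add: ang of_nat_diff algebra_simps diff_divide_distrib)
      then show ?thesis by (simp only: minus_diff_eq)
    next
      case False
      then have "real k * (real (\<alpha> - \<beta> + (\<beta> - \<alpha>)) * pi / real p)
          = - (real k * cheb_angle p \<beta> - real k * cheb_angle p \<alpha>)"
        by (simp add: ang of_nat_diff algebra_simps diff_divide_distrib)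
      then show ?thesis by (simp only: cos_minus)
    qed
    have "2 * (cos (real k * cheb_angle p \<beta>) * cos (real k * cheb_angle p \<alpha>))
        = cos (real k * (real (\<alpha> + \<beta> + 1) * pi / real p))
          + cos (real k * (real (\<alpha> - \<beta> + (\<beta> - \<alpha>)) * pi / real p))" for k
      unfolding 1[symmetric] 2[symmetric] by (simp add: cos_times_cos distrib_left)
    then have "2 * (\<Sum>k=1..p-1. cos (real k * cheb_angle p \<beta>) * cos (real k * cheb_angle p \<alpha>))
        = (\<Sum>k=1..p-1. cos (real k * (real (\<alpha> + \<beta> + 1) * pi / real p)))
          + (\<Sum>k=1..p-1. cos (real k * (real (\<alpha> - \<beta> + (\<beta> - \<alpha>)) * pi / real p)))"
      by (simp only: sum_distrib_left sum.distrib)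
    moreover have "2 * (1 + 2 * S) = (1 + 2 * S1) + (1 + 2 * S2)" if "2 * S = S1 + S2" for S S1 S2 :: real
      using that by simp
    ultimately show ?thesis unfolding D_def by blast
  qed
  have D1: "D j = - ((-1) ^ j)" if "0 < j" "j < 2 * p" for j
    unfolding D_def by (rule dirichlet_kernel_at_multiple[OF that])
  have D0: "D 0 = 2 * real p - 1"
    using p by (simp add: D_def of_nat_diff)
  show ?thesis
  proof (cases "\<alpha> = \<beta>")
    case True
    have "D (\<alpha> + \<beta> + 1) = 1" using assms True by (subst D1) auto
    then show ?thesis using sumD True D0 by simp
  next
    case False
    \<comment> \<open>The sum of the indices plus 1 and their absolute difference have opposite
      parity, so the two kernels cancel.\<close>
    have "(- 1 :: real) ^ (\<alpha> + \<beta> + 1) + (- 1) ^ (\<alpha> - \<beta> + (\<beta> - \<alpha>)) = 0"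
      using False by (cases "even \<alpha>"; cases "even \<beta>"; cases "\<alpha> \<le> \<beta>") (auto simp: power_add uminus_power_if)
    then have "D (\<alpha> + \<beta> + 1) + D (\<alpha> - \<beta> + (\<beta> - \<alpha>)) = 0"
      using assms False by (subst (1 2) D1) auto
    then show ?thesis using sumD False by simp
  qed
qed

lemma cheb_angle_bounds:
  assumes "\<alpha> < p" shows "0 < cheb_angle p \<alpha>" "cheb_angle p \<alpha> < pi"
proof -
  have "real (2 * \<alpha> + 1) * pi < real (2 * p) * pi"
    using assms by (intro mult_strict_right_mono) auto
  then show "cheb_angle p \<alpha> < pi"
    using assms by (simp add: cheb_angle_def divide_less_eq mult.commute)
qed (use assms in \<open>simp add: cheb_angle_def\<close>)

lemma inj_on_cos_cheb_angle: "inj_on (\<lambda>\<alpha>. cos (cheb_angle p \<alpha>)) {..<p}"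
proof (rule inj_onI)
  fix \<alpha> \<beta> assume *: "\<alpha> \<in> {..<p}" "\<beta> \<in> {..<p}" "cos (cheb_angle p \<alpha>) = cos (cheb_angle p \<beta>)"
  then have "cheb_angle p \<alpha> = cheb_angle p \<beta>"
    using cheb_angle_bounds[of \<alpha> p] cheb_angle_bounds[of \<beta> p]
    by (intro cos_inj_pi[OF _ _ _ _ *(3)]) auto
  then have "real (2 * \<alpha> + 1) = real (2 * \<beta> + 1)"
    using * unfolding cheb_angle_def by (subst (asm) divide_cancel_right) auto
  then show "\<alpha> = \<beta>" by linarith
qed

text \<open>By discrete orthogonality the Lagrange polynomial equals
  \<open>(1 + 2 * (\<Sum>k=1..p-1. T\<^sub>k x\<^sub>\<beta> * T\<^sub>k x)) / p\<close>.\<close>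

lemma abs_cheb_lagrange_le:
  assumes \<beta>: "\<beta> < p" and x: "\<bar>x\<bar> \<le> 1"
  shows "\<bar>\<Prod>\<alpha>\<in>{..<p} - {\<beta>}. (x - cos (cheb_angle p \<alpha>)) / (cos (cheb_angle p \<beta>) - cos (cheb_angle p \<alpha>))\<bar> \<le> 2"
proof -
  define c where "c \<alpha> = cos (cheb_angle p \<alpha>)" for \<alpha>
  have p: "p > 0" using \<beta> by auto
  define A where "A = {..<p} - {\<beta>}"
  define l where "l = (\<Prod>\<alpha>\<in>A. smult (1 / (c \<beta> - c \<alpha>)) [:- c \<alpha>, 1:])"
  define q where "q = smult (1 / real p) (1 + (\<Sum>k=1..p-1. smult (2 * cos (real k * cheb_angle p \<beta>)) (chebyshev k)))"
  have poly_l: "poly l x = (\<Prod>\<alpha>\<in>A. (x - c \<alpha>) / (c \<beta> - c \<alpha>))" for x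
    unfolding l_def poly_prod by (intro prod.cong) (auto simp: diff_divide_distrib)
  have poly_q: "poly q (cos \<theta>)
      = (1 + 2 * (\<Sum>k=1..p-1. cos (real k * cheb_angle p \<beta>) * cos (real k * \<theta>))) / real p" for \<theta>
    unfolding q_def by (simp add: poly_sum poly_chebyshev_cos sum_distrib_left mult.assoc)
  have cA: "card A = p - 1" using \<beta> by (simp add: A_def)
  have "degree l \<le> (\<Sum>\<alpha>\<in>A. degree (smult (1 / (c \<beta> - c \<alpha>)) [:- c \<alpha>, 1:]))"
    unfolding l_def by (rule order.trans[OF degree_prod_sum_le]) (auto simp: A_def)
  also have "\<dots> \<le> (\<Sum>\<alpha>\<in>A. 1)"
    by (intro sum_mono) (auto intro: order.trans[OF degree_smult_le])
  finally have deg_l: "degree l < p" using cA p by simp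
  have "degree q \<le> p - 1"
    unfolding q_def
    by (intro order.trans[OF degree_smult_le] degree_add_le degree_sum_le)
       (auto intro!: order.trans[OF degree_smult_le] order.trans[OF degree_chebyshev_le])
  then have deg_q: "degree q < p" using p by simp
  have inj: "inj_on c {..<p}" using inj_on_cos_cheb_angle unfolding c_def .
  \<comment> \<open>The Lagrange product and the cosine expansion have degree below \<open>p\<close>
    and agree at \<open>p\<close> distinct nodes.\<close>
  have "l = q"
  proof (rule poly_eqI_degree[of "c ` {..<p}"])
    fix y assume "y \<in> c ` {..<p}"
    then obtain \<alpha> where \<alpha>: "\<alpha> < p" "y = c \<alpha>" by auto
    have "poly q y = (if \<alpha> = \<beta> then 1 else 0)"
      using cheb_orthogonality[OF \<alpha>(1) \<beta>] p unfolding \<alpha>(2) c_def poly_q by simp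
    moreover have "poly l y = (if \<alpha> = \<beta> then 1 else 0)"
    proof (cases "\<alpha> = \<beta>")
      case True
      have "c \<beta> - c \<gamma> \<noteq> 0" if "\<gamma> \<in> A" for \<gamma>
        using inj_onD[OF inj, of \<beta> \<gamma>] that \<beta> by (auto simp: A_def)
      then show ?thesis using True unfolding poly_l \<alpha>(2) by (simp add: prod.neutral)
    next
      case False
      then have "\<alpha> \<in> A" using \<alpha> by (auto simp: A_def)
      then show ?thesis using False unfolding poly_l \<alpha>(2)
        by (auto simp: A_def intro!: prod_zero bexI[of _ \<alpha>])
    qed
    ultimately show "poly l y = poly q y" by simp
  qed (use deg_l deg_q inj in \<open>auto simp: card_image\<close>)
  \<comment> \<open>At a cosine every Chebyshev polynomial is bounded by 1, so the expansion is at
    most (1 + 2 (p - 1)) / p, which is below 2.\<close>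
  have "x = cos (arccos x)" using x by (simp add: cos_arccos_abs)
  then have "poly q x = (1 + 2 * (\<Sum>k=1..p-1. cos (real k * cheb_angle p \<beta>) * cos (real k * arccos x))) / real p"
    using poly_q[of "arccos x"] by simp
  moreover have "\<bar>\<Sum>k=1..p-1. cos (real k * cheb_angle p \<beta>) * cos (real k * arccos x)\<bar> \<le> real (p - 1)"
  proof -
    have "\<bar>\<Sum>k=1..p-1. cos (real k * cheb_angle p \<beta>) * cos (real k * arccos x)\<bar> \<le> (\<Sum>k=1..p-1. 1)"
      by (intro order.trans[OF sum_abs] sum_mono) (auto simp: abs_mult intro!: mult_le_one)
    then show ?thesis by simp
  qed
  ultimately have "real p * \<bar>poly q x\<bar> \<le> real p * 2"
    using p by (simp add: abs_le_iff of_nat_diff flip: abs_mult)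
  then have "\<bar>poly q x\<bar> \<le> 2" using p by simp
  then show ?thesis using poly_l[of x] unfolding \<open>l = q\<close> A_def c_def by simp
qed

section \<open>Compactness and coercivity\<close>

text \<open>The estimates for pairs of surface points are proved by different arguments near the
  diagonal and away from it. Finitely many neighborhoods cover the compact set, and by monotonicity
  the largest local constant serves everywhere.\<close>

lemma compact_uniform_constant:
  fixes Q :: "real \<Rightarrow> 'a::metric_space \<Rightarrow> bool"
  assumes A: "compact A"
    and mono: "\<And>K K' x. Q K x \<Longrightarrow> K \<le> K' \<Longrightarrow> Q K' x"
    and loc: "\<And>x. x \<in> A \<Longrightarrow> \<exists>K. \<exists>e>0. \<forall>x'\<in>A. dist x' x < e \<longrightarrow> Q K x'"
  shows "\<exists>K>0. \<forall>x\<in>A. Q K x"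
proof -
  obtain K e where Ke: "\<And>x. x \<in> A \<Longrightarrow> e x > 0 \<and> (\<forall>x'\<in>A. dist x' x < e x \<longrightarrow> Q (K x) x')"
    using loc by metis
  obtain C where C: "C \<subseteq> A" "finite C" "A \<subseteq> (\<Union>c\<in>C. ball c (e c))"
  proof (rule compactE_image[OF A, of A "\<lambda>c. ball c (e c)"])
    show "A \<subseteq> (\<Union>c\<in>A. ball c (e c))" using Ke by fastforce
  qed (auto intro: that)
  define M where "M = Max (insert 1 (K ` C))"
  have M: "1 \<le> M" "\<And>c. c \<in> C \<Longrightarrow> K c \<le> M"
    using C by (auto simp: M_def)
  have "Q M x" if x: "x \<in> A" for x
  proof -
    obtain c where c: "c \<in> C" "x \<in> ball c (e c)" using C x by blast
    then have "Q (K c) x" using Ke[of c] C x by (auto simp: dist_commute)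
    then show ?thesis using mono M c by blast
  qed
  then show ?thesis using M by (intro exI[of _ M]) auto
qed

lemma positive_form_coercive:
  fixes G :: "nat \<Rightarrow> nat \<Rightarrow> real"
  assumes pos: "\<And>d. \<exists>m<n. d m \<noteq> 0 \<Longrightarrow> 0 < (\<Sum>m<n. \<Sum>l<n. d m * d l * G m l)"
  shows "\<exists>\<kappa>>0. \<forall>d. \<kappa> * (\<Sum>m<n. (d m)\<^sup>2) \<le> (\<Sum>m<n. \<Sum>l<n. d m * d l * G m l)"
proof (cases "n = 0")
  case True
  then show ?thesis by (intro exI[of _ 1]) simp
next
  case False
  define Q where "Q d = (\<Sum>m<n. \<Sum>l<n. d m * d l * G m l)" for d
  \<comment> \<open>Vectors are functions on all of \<open>nat\<close>. Freezing the coordinates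
    from \<open>n\<close> on at 0 makes the box, and with it the unit sphere \<open>S\<close>,
    compact in the product topology, so the form attains a positive minimum there.\<close>
  define B where "B = (\<Pi>\<^sub>E m\<in>UNIV. if m < n then {-1..1::real} else {0})"
  define S where "S = B \<inter> {d. (\<Sum>m<n. (d m)\<^sup>2) = 1}"
  have "compactin (product_topology (\<lambda>_. euclidean) UNIV) B"
    unfolding B_def by (subst compactin_PiE) auto
  then have "compact B" by (simp add: euclidean_product_topology)
  moreover have "closed {d::nat \<Rightarrow> real. (\<Sum>m<n. (d m)\<^sup>2) = 1}"
    by (intro closed_Collect_eq continuous_intros continuous_on_product_coordinates)
  ultimately have "compact S" unfolding S_def by (rule compact_Int_closed)
  moreover have "S \<noteq> {}"
  proof -
    have "(\<Sum>m<n. ((if m = 0 then 1 else 0 :: real))\<^sup>2) = (\<Sum>m<n. if m = 0 then 1 else 0)"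
      by (intro sum.cong) auto
    also have "\<dots> = 1" using False by simp
    finally have "(\<lambda>m. if m = 0 then 1 else 0) \<in> S"
      using False by (auto simp: S_def B_def)
    then show ?thesis by blast
  qed
  moreover have "continuous_on S Q"
    unfolding Q_def by (intro continuous_intros continuous_on_subset[OF continuous_on_product_coordinates]) auto
  ultimately obtain d0 where d0: "d0 \<in> S" "\<And>d. d \<in> S \<Longrightarrow> Q d0 \<le> Q d"
    using continuous_attains_inf[of S Q] by blast
  have "\<exists>m<n. d0 m \<noteq> 0"
  proof (rule ccontr)
    assume "\<not> ?thesis"
    then have "(\<Sum>m<n. (d0 m)\<^sup>2) = 0" by (intro sum.neutral) auto
    then show False using d0 by (simp add: S_def)
  qed
  then have "0 < Q d0" unfolding Q_def by (rule pos)
  moreover have "Q d0 * (\<Sum>m<n. (d m)\<^sup>2) \<le> Q d" for d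
  proof (cases "\<forall>m<n. d m = 0")
    case True
    then show ?thesis by (simp add: Q_def)
  next
    case False
    define s where "s = (\<Sum>m<n. (d m)\<^sup>2)"
    obtain m where "m < n" "d m \<noteq> 0" using False by blast
    then have s: "s > 0"
      unfolding s_def by (intro sum_pos2[of _ m]) auto
    define d' where "d' m = (if m < n then d m / sqrt s else 0)" for m
    have s1: "(\<Sum>m<n. (d' m)\<^sup>2) = 1"
      using s by (simp add: d'_def power_divide sum_divide_distrib[symmetric] flip: s_def)
    have "\<bar>d' m\<bar> \<le> 1" if "m < n" for m
    proof -
      have "(d' m)\<^sup>2 \<le> 1" unfolding s1[symmetric] using that by (intro member_le_sum) auto
      then show ?thesis by (simp add: abs_square_le_1)
    qed
    then have "d' \<in> S" using s1 by (auto simp: S_def B_def abs_le_iff minus_le_iff) (auto simp: d'_def)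
    then have "Q d0 \<le> Q d'" by (rule d0)
    also have "Q d' = (\<Sum>m<n. \<Sum>l<n. (d m * d l * G m l) / s)"
      unfolding Q_def using s by (intro sum.cong refl) (simp add: d'_def)
    also have "\<dots> = Q d / s" by (simp add: Q_def sum_divide_distrib)
    finally show ?thesis using s by (simp add: field_simps s_def)
  qed
  ultimately show ?thesis unfolding Q_def[symmetric] by blast
qed

text \<open>A vanishing integral would make the set of points of \<open>U\<close> with
  \<open>g u \<noteq> 0\<close> a null set. This set is open and nonempty, and nonempty open sets
  are not negligible.\<close>

lemma continuous_nonneg_integral_pos:
  fixes g :: "'a::euclidean_space \<Rightarrow> real"
  assumes U: "open U" and g: "continuous_on UNIV g" "\<And>u. u \<in> U \<Longrightarrow> 0 \<le> g u"
    and u: "u \<in> U" "g u \<noteq> 0"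
  shows "0 < (\<integral>\<^sup>+u. ennreal (g u) * indicator U u \<partial>lborel)"
proof (rule ccontr)
  assume "\<not> ?thesis"
  then have "(\<integral>\<^sup>+u. ennreal (g u) * indicator U u \<partial>lborel) = 0" by simp
  moreover have [measurable]: "g \<in> borel_measurable borel" "U \<in> sets borel"
    using g U by (auto intro: borel_measurable_continuous_onI)
  ultimately have "AE u in lborel. ennreal (g u) * indicator U u = 0"
    by (subst (asm) nn_integral_0_iff_AE) auto
  then have "AE u in lborel. u \<notin> {u \<in> U. g u \<noteq> 0}"
    by eventually_elim (use g(2) in \<open>force simp: ennreal_eq_0_iff split: split_indicator_asm\<close>)
  moreover have op: "open {u \<in> U. g u \<noteq> 0}"
    using U g(1) by (auto intro!: open_Collect_conj open_Collect_neq simp: Collect_conj_eq[of "\<lambda>u. u \<in> U"])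
  ultimately have "{u \<in> U. g u \<noteq> 0} \<in> null_sets lborel"
    by (subst AE_iff_null_sets) auto
  then have "negligible {u \<in> U. g u \<noteq> 0}"
    by (simp add: negligible_iff_null_sets null_sets_completionI)
  then show False using open_not_negligible[OF op] u by auto
qed

text \<open>The norm equivalence on a reference element, stated once for the triangle and for the
  unit interval, with the bubble as weight \<open>w\<close>. The Gram matrix is positive definite
  because a combination that vanishes on \<open>U\<close> has zero coefficients. The integral is
  kept as a nonnegative one, since all later estimates are chains of such integrals.\<close>

lemma weighted_gram_coercive:
  fixes f :: "nat \<Rightarrow> 'a::euclidean_space \<Rightarrow> real"
  assumes U: "open U" "bounded U"
    and w: "continuous_on UNIV w" "\<And>u. u \<in> U \<Longrightarrow> 0 < w u"
    and f: "\<And>m. m < n \<Longrightarrow> continuous_on UNIV (f m)"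
    and indep: "\<And>d m. (\<And>u. u \<in> U \<Longrightarrow> (\<Sum>m<n. d m * f m u) = 0) \<Longrightarrow> m < n \<Longrightarrow> d m = 0"
  shows "\<exists>\<kappa>>0. \<forall>d. ennreal (\<kappa> * (\<Sum>m<n. (d m)\<^sup>2))
           \<le> (\<integral>\<^sup>+u. ennreal (w u * (\<Sum>m<n. d m * f m u)\<^sup>2) * indicator U u \<partial>lborel)"
proof -
  define P where "P d u = (\<Sum>m<n. d m * f m u)" for d u
  define G where "G m l = (LINT u|lborel. indicator U u * (w u * f m u * f l u))" for m l
  have Um[measurable]: "U \<in> sets borel" using U by auto
  have contP: "continuous_on UNIV (P d)" for d
    unfolding P_def by (intro continuous_intros) (use f in auto)
  have int: "integrable lborel (\<lambda>u. indicator U u * g u)" if g: "continuous_on UNIV g" for g :: "'a \<Rightarrow> real"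
  proof -
    obtain K where K: "compact K" "U \<subseteq> K"
      using U(2) by (meson bounded_subset_cball compact_cball)
    have "integrable lborel (\<lambda>u. indicator K u *\<^sub>R g u)"
      using K(1) g by (intro borel_integrable_compact) (auto intro: continuous_on_subset)
    then show ?thesis
      using K(2) borel_measurable_continuous_onI[OF g]
      by (elim Bochner_Integration.integrable_bound) (auto split: split_indicator)
  qed
  have eqQ: "(\<integral>\<^sup>+u. ennreal (w u * (P d u)\<^sup>2) * indicator U u \<partial>lborel)
      = ennreal (\<Sum>m<n. \<Sum>l<n. d m * d l * G m l)" for d
  proof -
    have "(\<integral>\<^sup>+u. ennreal (w u * (P d u)\<^sup>2) * indicator U u \<partial>lborel)
        = (\<integral>\<^sup>+u. ennreal (indicator U u * (w u * (P d u)\<^sup>2)) \<partial>lborel)"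
      by (intro nn_integral_cong) (auto split: split_indicator)
    also have "\<dots> = ennreal (LINT u|lborel. indicator U u * (w u * (P d u)\<^sup>2))"
      using w by (intro nn_integral_eq_integral int continuous_intros contP)
        (auto split: split_indicator intro!: mult_nonneg_nonneg less_imp_le[of 0 "w _"] AE_I2)
    also have "(LINT u|lborel. indicator U u * (w u * (P d u)\<^sup>2))
        = (LINT u|lborel. (\<Sum>m<n. \<Sum>l<n. (d m * d l) * (indicator U u * (w u * f m u * f l u))))"
      by (intro Bochner_Integration.integral_cong refl)
        (auto simp: P_def power2_eq_square sum_product sum_distrib_left mult_ac)
    also have "\<dots> = (\<Sum>m<n. \<Sum>l<n. d m * d l * G m l)"
    proof -
      have i: "integrable lborel (\<lambda>u. (d m * d l) * (indicator U u * (w u * f m u * f l u)))" if "m < n" "l < n" for m l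
        using that by (intro integrable_mult_right int continuous_intros w f)
      have "(LINT u|lborel. (\<Sum>m<n. \<Sum>l<n. (d m * d l) * (indicator U u * (w u * f m u * f l u))))
          = (\<Sum>m<n. LINT u|lborel. (\<Sum>l<n. (d m * d l) * (indicator U u * (w u * f m u * f l u))))"
        using i by (intro Bochner_Integration.integral_sum Bochner_Integration.integrable_sum) auto
      also have "\<dots> = (\<Sum>m<n. \<Sum>l<n. LINT u|lborel. (d m * d l) * (indicator U u * (w u * f m u * f l u)))"
        using i by (intro sum.cong refl Bochner_Integration.integral_sum) auto
      finally show ?thesis by (simp add: G_def)
    qed
    finally show ?thesis .
  qed
  have "\<exists>\<kappa>>0. \<forall>d. \<kappa> * (\<Sum>m<n. (d m)\<^sup>2) \<le> (\<Sum>m<n. \<Sum>l<n. d m * d l * G m l)"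
  proof (rule positive_form_coercive)
    fix d :: "nat \<Rightarrow> real" assume "\<exists>m<n. d m \<noteq> 0"
    then obtain u where u: "u \<in> U" "P d u \<noteq> 0"
      using indep[of d] unfolding P_def by blast
    have "0 < (\<integral>\<^sup>+u. ennreal (w u * (P d u)\<^sup>2) * indicator U u \<partial>lborel)"
      using w u by (intro continuous_nonneg_integral_pos[OF U(1) _ _ u(1)] continuous_intros contP) force+
    then show "0 < (\<Sum>m<n. \<Sum>l<n. d m * d l * G m l)" unfolding eqQ by simp
  qed
  then show ?thesis
    unfolding P_def[symmetric] eqQ by (auto intro!: ennreal_leI)
qed

section \<open>Integrals of weakly singular kernels\<close>

lemma nn_integral_inverse_sqrt_le:
  fixes s R :: real
  assumes R: "0 \<le> R"
  shows "(\<integral>\<^sup>+t. ennreal (\<bar>s - t\<bar> powr (-1/2)) * indicator {t. \<bar>s - t\<bar> \<le> R} t \<partial>lborel) \<le> ennreal (4 * sqrt R)"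
proof -
  define g where "g t = ennreal (\<bar>t\<bar> powr (-1/2)) * indicator {t. \<bar>t\<bar> \<le> R} t" for t :: real
  have [measurable]: "g \<in> borel_measurable borel" unfolding g_def by measurable
  have I: "(\<integral>\<^sup>+t. ennreal (t powr (-1/2)) * indicator {0..R} t \<partial>lborel) = ennreal (2 * sqrt R)"
  proof -
    have "((\<lambda>x. x powr (-1/2)) has_integral (R powr (-1/2 + 1) / (-1/2 + 1))) {0..R}"
      using R by (intro has_integral_powr_from_0) auto
    then have "((\<lambda>x. x powr (-1/2)) has_integral (2 * sqrt R)) {0..R}"
      using R by (simp add: powr_half_sqrt mult.commute)
    then show ?thesis by (intro nn_integral_has_integral_lebesgue') auto
  qed
  have "(\<integral>\<^sup>+t. ennreal (\<bar>s - t\<bar> powr (-1/2)) * indicator {t. \<bar>s - t\<bar> \<le> R} t \<partial>lborel)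
      = (\<integral>\<^sup>+t. g (s + (-1) * t) \<partial>lborel)"
    by (intro nn_integral_cong) (auto simp: g_def split: split_indicator)
  also have "\<dots> = (\<integral>\<^sup>+t. g t \<partial>lborel)"
    using nn_integral_real_affine[of g "-1" s] by simp
  also have "\<dots> \<le> (\<integral>\<^sup>+t. ennreal (t powr (-1/2)) * indicator {0..R} t
      + ennreal ((0 + (-1) * t) powr (-1/2)) * indicator {0..R} (0 + (-1) * t) \<partial>lborel)"
    by (intro nn_integral_mono) (auto simp: g_def abs_if split: split_indicator)
  also have "\<dots> = (\<integral>\<^sup>+t. ennreal (t powr (-1/2)) * indicator {0..R} t \<partial>lborel)
      + (\<integral>\<^sup>+t. ennreal ((0 + (-1) * t) powr (-1/2)) * indicator {0..R} (0 + (-1) * t) \<partial>lborel)"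
    by (rule nn_integral_add) auto
  also have "(\<integral>\<^sup>+t. ennreal ((0 + (-1) * t) powr (-1/2)) * indicator {0..R} (0 + (-1) * t) \<partial>lborel)
      = (\<integral>\<^sup>+t. ennreal (t powr (-1/2)) * indicator {0..R} t \<partial>lborel)"
    using nn_integral_real_affine[of "\<lambda>t. ennreal (t powr (-1/2)) * indicator {0..R} t" "-1" 0] by simp
  also have "(\<integral>\<^sup>+t. ennreal (t powr (-1/2)) * indicator {0..R} t \<partial>lborel)
      + (\<integral>\<^sup>+t. ennreal (t powr (-1/2)) * indicator {0..R} t \<partial>lborel) = ennreal (4 * sqrt R)"
    unfolding I using R by (simp flip: ennreal_plus)
  finally show ?thesis .
qed

text \<open>In the plane, \<open>1 / |u|\<close> is dominated by the product of the functions \<open>|u\<^sub>i| powr (-1/2)\<close>.\<close>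

lemma nn_integral_inverse_norm_plane_le:
  fixes c :: "real^2"
  assumes R: "0 \<le> R"
  shows "(\<integral>\<^sup>+u. ennreal (1 / norm (c - u)) * indicator (cball c R) u \<partial>lborel) \<le> ennreal (16 * R)"
proof -
  define g where "g b t = ennreal (\<bar>c \<bullet> b - t\<bar> powr (-1/2)) * indicator {t. \<bar>c \<bullet> b - t\<bar> \<le> R} t" for b t
  define b1 b2 :: "real^2" where "b1 = axis 1 1" and "b2 = axis 2 1"
  have Basis2: "Basis = {b1, b2}"
    by (auto simp: Basis_vec_def UNIV_2 b1_def b2_def)
  have ne: "b1 \<noteq> b2" by (simp add: b1_def b2_def axis_eq_axis)
  have [measurable]: "g b \<in> borel_measurable borel" for b unfolding g_def by measurable
  have "(\<integral>\<^sup>+u. ennreal (1 / norm (c - u)) * indicator (cball c R) u \<partial>lborel)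
      \<le> (\<integral>\<^sup>+u. (\<Prod>b\<in>Basis. g b (u \<bullet> b)) \<partial>lborel)"
  proof (intro nn_integral_mono_AE)
    \<comment> \<open>On a coordinate line through \<open>c\<close> the majorant is 0, since
      \<open>0 powr (-1/2) = 0\<close>. These null sets are removed before comparing.\<close>
    have "AE u in lborel. u \<notin> {u. u \<bullet> b = c \<bullet> b}" if b: "b \<in> Basis" for b :: "real^2"
    proof -
      have "negligible {u. u \<bullet> b = c \<bullet> b}"
        using negligible_standard_hyperplane[OF b] .
      moreover have "{u. u \<bullet> b = c \<bullet> b} \<in> sets borel" by measurable
      ultimately have "{u. u \<bullet> b = c \<bullet> b} \<in> null_sets lborel"
        by (auto simp: negligible_iff_null_sets null_sets_def)
      then show ?thesis by (rule AE_not_in)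
    qed
    then have "AE u in lborel. \<forall>b\<in>Basis. u \<bullet> b \<noteq> c \<bullet> b"
      by (subst AE_finite_all) auto
    then show "AE u in lborel. ennreal (1 / norm (c - u)) * indicator (cball c R) u \<le> (\<Prod>b\<in>Basis. g b (u \<bullet> b))"
    proof eventually_elim
      fix u assume u: "\<forall>b\<in>Basis. u \<bullet> b \<noteq> c \<bullet> b"
      show "ennreal (1 / norm (c - u)) * indicator (cball c R) u \<le> (\<Prod>b\<in>Basis. g b (u \<bullet> b))"
      proof (cases "u \<in> cball c R")
        case True
        define x y where "x = \<bar>(c - u) \<bullet> b1\<bar>" and "y = \<bar>(c - u) \<bullet> b2\<bar>"
        have xy: "0 < x" "0 < y" using u by (auto simp: x_def y_def Basis2 inner_diff_left)
        have le: "x \<le> norm (c - u)" "y \<le> norm (c - u)"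
          unfolding x_def y_def by (auto intro!: Basis_le_norm simp: Basis2)
        have nR: "norm (c - u) \<le> R" using True by (simp add: dist_norm)
        \<comment> \<open>Both coordinates are at most the norm, so the norm dominates their
          geometric mean.\<close>
        have "sqrt x * sqrt y \<le> sqrt (norm (c - u)) * sqrt (norm (c - u))"
          using le xy by (intro mult_mono) auto
        then have "1 / norm (c - u) \<le> 1 / (sqrt x * sqrt y)"
          using xy by (intro divide_left_mono) (auto intro!: mult_pos_pos order.strict_trans2[OF xy(1) le(1)])
        also have "\<dots> = x powr (-1/2) * y powr (-1/2)"
          using xy by (simp add: powr_minus powr_half_sqrt[symmetric] inverse_eq_divide)
        finally have "ennreal (1 / norm (c - u)) \<le> ennreal (x powr (-1/2)) * ennreal (y powr (-1/2))"
          by (simp add: ennreal_leI flip: ennreal_mult')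
        moreover have "x \<le> R" "y \<le> R" using le nR by auto
        ultimately show ?thesis
        proof -
          have "indicator (cball c R) u = (1::ennreal)" using True by (rule indicator_simps)
          then show ?thesis
            using ne \<open>x \<le> R\<close> \<open>y \<le> R\<close> \<open>ennreal (1 / norm (c - u)) \<le> _\<close>
            by (simp add: Basis2 g_def x_def y_def inner_diff_left del: mem_cball)
        qed
      qed simp
    qed
  qed
  also have "\<dots> = (\<Prod>b\<in>Basis. \<integral>\<^sup>+t. g b t \<partial>lborel)"
    by (rule nn_integral_lborel_prod) auto
  also have "\<dots> \<le> (\<Prod>b\<in>(Basis :: (real^2) set). ennreal (4 * sqrt R))"
    unfolding g_def by (intro prod_mono_ennreal nn_integral_inverse_sqrt_le R)
  also have "\<dots> = ennreal ((4 * sqrt R) * (4 * sqrt R))"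
    using ne R by (simp add: Basis2 flip: ennreal_mult)
  also have "(4 * sqrt R) * (4 * sqrt R) = 16 * R" using R by simp
  finally show ?thesis .
qed

lemma nn_integral_affine_change:
  fixes F :: "'a::euclidean_space \<Rightarrow> ennreal"
  assumes [measurable]: "F \<in> borel_measurable borel" and s: "s \<noteq> 0"
  shows "(\<integral>\<^sup>+u. F u \<partial>lborel) = ennreal (\<bar>s\<bar> ^ DIM('a)) * (\<integral>\<^sup>+u. F (a + s *\<^sub>R u) \<partial>lborel)"
  by (subst lborel_affine[OF s, of a]) (simp add: nn_integral_density nn_integral_distr nn_integral_cmult)

section \<open>Functions supported in disjoint cells\<close>

lemma sum_disjoint_support:
  fixes w :: "'k \<Rightarrow> 'x \<Rightarrow> real"
  assumes "finite I" "disjoint_family_on U I"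
    and "\<And>k x. k \<in> I \<Longrightarrow> x \<notin> U k \<Longrightarrow> w k x = 0"
    and "k \<in> I" "x \<in> U k"
  shows "(\<Sum>k\<in>I. w k x) = w k x"
proof -
  have "w l x = 0" if "l \<in> I - {k}" for l
    using assms(3)[of l x] assms(2,4,5) that unfolding disjoint_family_on_def by blast
  then show ?thesis using assms by (simp add: sum.remove[of I k] sum.neutral)
qed

text \<open>At most one summand is nonzero at \<open>x\<close>, so squaring produces no mixed terms.
  The indicators stay on the right-hand side so that the bound can be integrated cell by
  cell.\<close>

lemma sum_disjoint_support_sq_le:
  fixes w :: "'k \<Rightarrow> 'x \<Rightarrow> real"
  assumes fin: "finite I" and dj: "disjoint_family_on U I"
    and supp: "\<And>k x. k \<in> I \<Longrightarrow> x \<notin> U k \<Longrightarrow> w k x = 0"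
    and D: "\<And>k. k \<in> I \<Longrightarrow> 0 \<le> D k"
    and le: "\<And>k. k \<in> I \<Longrightarrow> x \<in> U k \<Longrightarrow> (w k x)\<^sup>2 \<le> D k * \<rho>" and \<rho>: "0 \<le> \<rho>"
  shows "(\<Sum>k\<in>I. w k x)\<^sup>2 \<le> (\<Sum>k\<in>I. D k * indicator (U k) x) * \<rho>"
proof (cases "\<exists>k\<in>I. x \<in> U k")
  case True
  then obtain k where k: "k \<in> I" "x \<in> U k" by blast
  have "(\<Sum>k\<in>I. w k x) = w k x" by (rule sum_disjoint_support[OF fin dj supp k])
  moreover have "(\<Sum>k\<in>I. D k * indicator (U k) x) = D k * indicator (U k) x"
    by (rule sum_disjoint_support[OF fin dj _ k]) auto
  ultimately show ?thesis using le[OF k] k by simp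
next
  case False
  then have "(\<Sum>k\<in>I. w k x) = 0" using supp by (intro sum.neutral) auto
  then show ?thesis using D \<rho> by (auto intro!: mult_nonneg_nonneg sum_nonneg)
qed

lemma power2_diff_le: "(a - b :: real)\<^sup>2 \<le> 2 * a\<^sup>2 + 2 * b\<^sup>2"
  using sum_squares_bound[of a "-b"] by (simp add: power2_diff)

text \<open>Two points of the same cell are compared directly. Otherwise each value is small, because
  the functions vanish on the cell boundaries, which separate the points.\<close>

lemma sum_disjoint_support_diff_sq_le:
  fixes w :: "'k \<Rightarrow> 'x \<Rightarrow> real"
  assumes fin: "finite I" and dj: "disjoint_family_on U I"
    and supp: "\<And>k x. k \<in> I \<Longrightarrow> x \<notin> U k \<Longrightarrow> w k x = 0"
    and D: "\<And>k. k \<in> I \<Longrightarrow> 0 \<le> D k" and \<rho>: "0 \<le> \<rho>"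
    and same: "\<And>k. k \<in> I \<Longrightarrow> x \<in> U k \<Longrightarrow> y \<in> U k \<Longrightarrow> (w k x - w k y)\<^sup>2 \<le> D k * \<rho>"
    and x: "\<And>k. k \<in> I \<Longrightarrow> x \<in> U k \<Longrightarrow> y \<notin> U k \<Longrightarrow> (w k x)\<^sup>2 \<le> D k * \<rho>"
    and y: "\<And>k. k \<in> I \<Longrightarrow> y \<in> U k \<Longrightarrow> x \<notin> U k \<Longrightarrow> (w k y)\<^sup>2 \<le> D k * \<rho>"
  shows "((\<Sum>k\<in>I. w k x) - (\<Sum>k\<in>I. w k y))\<^sup>2
    \<le> 2 * ((\<Sum>k\<in>I. D k * indicator (U k) x) + (\<Sum>k\<in>I. D k * indicator (U k) y)) * \<rho>"
    (is "?l \<le> 2 * (?X + ?Y) * \<rho>")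
proof -
  have XY: "0 \<le> ?X" "0 \<le> ?Y" using D by (auto intro!: sum_nonneg)
  show ?thesis
  proof (cases "\<exists>k\<in>I. x \<in> U k \<and> y \<in> U k")
    case True
    then obtain k where k: "k \<in> I" "x \<in> U k" "y \<in> U k" by blast
    have "(\<Sum>k\<in>I. w k z) = w k z" if "z \<in> U k" for z
      by (rule sum_disjoint_support[OF fin dj supp k(1) that])
    moreover have "(\<Sum>k\<in>I. D k * indicator (U k) z) = D k * indicator (U k) z" if "z \<in> U k" for z
      by (rule sum_disjoint_support[OF fin dj _ k(1) that]) auto
    moreover have "D k * \<rho> \<le> 2 * (D k + D k) * \<rho>"
      using D[OF k(1)] \<rho> by (intro mult_right_mono) auto
    ultimately show ?thesis using same[OF k] k by (simp only: indicator_simps mult_1_right)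
  next
    case False
    have "(\<Sum>k\<in>I. w k x)\<^sup>2 \<le> ?X * \<rho>"
      by (rule sum_disjoint_support_sq_le[OF fin dj supp D _ \<rho>]) (use x False in auto)
    moreover have "(\<Sum>k\<in>I. w k y)\<^sup>2 \<le> ?Y * \<rho>"
      by (rule sum_disjoint_support_sq_le[OF fin dj supp D _ \<rho>]) (use y False in auto)
    moreover note power2_diff_le[of "\<Sum>k\<in>I. w k x" "\<Sum>k\<in>I. w k y"]
    ultimately show ?thesis by (simp add: algebra_simps)
  qed
qed

section \<open>The error in terms of the coefficient vectors\<close>

abbreviation space_dofs :: "heat_bem \<Rightarrow> nat \<Rightarrow> (nat \<times> nat) set" where
  "space_dofs P r \<equiv> {..<N_s P r} \<times> {..<D_s P}"

lemma D_s_pos: "0 < D_s P"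
proof -
  have "2 \<le> (p_s P + 1) * (p_s P + 2)" by simp
  then show ?thesis unfolding D_s_def by (simp add: div_greater_zero_iff)
qed

lemma finite_cubes: "finite (cubes P r ls)"
  by (simp add: cubes_def)

text \<open>\<gamma> counts the neighbors in a row of blocks. Symmetry of \<open>eta\<close> gives
  the same count for the columns, as the Schur test requires.\<close>

lemma neighbors_sym:
  assumes "\<nu> \<in> cubes P r ls" "\<nu>' \<in> cubes P r ls"
  shows "\<nu>' \<in> neighbors P r ls \<nu> \<longleftrightarrow> \<nu> \<in> neighbors P r ls \<nu>'"
proof -
  have "eta P r ls \<nu> \<nu>' = eta P r ls \<nu>' \<nu>"
    by (simp add: eta_def norm_minus_commute add.commute)
  then show ?thesis using assms by (simp add: neighbors_def)
qed

lemma card_neighbors_le_gamma_max: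
  assumes "ls \<le> cube_depth P r" "\<nu> \<in> cubes P r ls"
  shows "card (neighbors P r ls \<nu>) \<le> gamma_max P r"
  unfolding gamma_max_def using assms finite_cubes
  by (intro Max_ge) (auto intro!: rev_image_eqI[of "(ls, \<nu>)"])

text \<open>Every cube is its own neighbor because \<open>eta\<close> is infinite on the diagonal.
  The tolerances divide by \<gamma>, which has to cancel later.\<close>

lemma gamma_max_pos:
  assumes "0 < N_s P r"
  shows "0 < gamma_max P r"
proof -
  have \<nu>: "cube_of P r 0 0 \<in> cubes P r 0" using assms by (simp add: cubes_def)
  then have "cube_of P r 0 0 \<in> neighbors P r 0 (cube_of P r 0 0)"
    by (simp add: neighbors_def eta_def)
  moreover have "finite (neighbors P r 0 (cube_of P r 0 0))"
    using finite_cubes by (simp add: neighbors_def)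
  ultimately have "0 < card (neighbors P r 0 (cube_of P r 0 0))"
    by (auto simp: card_gt_0_iff)
  then show ?thesis using card_neighbors_le_gamma_max[OF _ \<nu>] by simp
qed

text \<open>The spatial half of the estimate, for one fixed pair of time intervals. The block key of
  an index is the cube of its patch; \<open>n\<close> is the number of temporal basis functions in
  the near field and the number of interpolation nodes in the far field.\<close>

lemma spatial_bilinear_le:
  fixes x y :: "tri_idx \<Rightarrow> real"
  assumes ls: "ls \<le> cube_depth P r" and \<delta>: "0 \<le> \<delta>"
    and block: "\<And>\<nu> \<nu>'. \<nu> \<in> cubes P r ls \<Longrightarrow> \<nu>' \<in> neighbors P r ls \<nu> \<Longrightarrow>
      spectral_norm (block_idx P r n ls \<nu>) (block_idx P r n ls \<nu>') A \<le> \<delta>"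
  defines "X \<equiv> {..<n} \<times> space_dofs P r"
  shows "(\<Sum>a\<in>X. \<Sum>b\<in>X. if cube_of P r ls (fst (snd b)) \<in> neighbors P r ls (cube_of P r ls (fst (snd a)))
            then x a * A a b * y b else 0) \<le> \<delta> * real (gamma_max P r) * (L2_set x X * L2_set y X)"
proof -
  define \<kappa> where "\<kappa> a = cube_of P r ls (fst (snd a))" for a :: tri_idx
  have fin: "finite X" by (simp add: X_def)
  have sub: "\<kappa> ` X \<subseteq> cubes P r ls" by (auto simp: X_def \<kappa>_def cubes_def)
  have idx: "{a \<in> X. \<kappa> a = \<nu>} = block_idx P r n ls \<nu>" for \<nu>
    by (auto simp: X_def \<kappa>_def block_idx_def cube_patches_def)
  have row: "card {\<nu>' \<in> \<kappa> ` X. \<nu>' \<in> neighbors P r ls \<nu>} \<le> gamma_max P r" if "\<nu> \<in> \<kappa> ` X" for \<nu>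
  proof -
    have "card {\<nu>' \<in> \<kappa> ` X. \<nu>' \<in> neighbors P r ls \<nu>} \<le> card (neighbors P r ls \<nu>)"
      using finite_cubes by (intro card_mono) (auto simp: neighbors_def)
    also have "\<dots> \<le> gamma_max P r" using sub that ls by (intro card_neighbors_le_gamma_max) auto
    finally show ?thesis .
  qed
  have col: "{\<nu> \<in> \<kappa> ` X. \<nu>' \<in> neighbors P r ls \<nu>} = {\<nu> \<in> \<kappa> ` X. \<nu> \<in> neighbors P r ls \<nu>'}" if "\<nu>' \<in> \<kappa> ` X" for \<nu>'
    using that sub by (auto simp: neighbors_sym subset_iff)
  have "(\<Sum>a\<in>X. \<Sum>b\<in>X. if \<kappa> b \<in> neighbors P r ls (\<kappa> a) then x a * A a b * y b else 0)
      \<le> \<delta> * real (gamma_max P r) * (L2_set x X * L2_set y X)"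
    by (rule bilinear_block_sparse_le[where Q = "\<lambda>\<nu> \<nu>'. \<nu>' \<in> neighbors P r ls \<nu>", OF fin])
      (use sub idx block row col \<delta> in auto)
  then show ?thesis unfolding \<kappa>_def .
qed

section \<open>Rearranging the bilinear form of the blocked matrix\<close>

lemma sum_Times_swap:
  "(\<Sum>a\<in>J \<times> Y. \<Sum>b\<in>J \<times> Y. h a b) = (\<Sum>q\<in>Y. \<Sum>q'\<in>Y. \<Sum>j\<in>J. \<Sum>j'\<in>J. h (j, q) (j', q'))"
proof -
  have "(\<Sum>a\<in>J \<times> Y. \<Sum>b\<in>J \<times> Y. h a b) = (\<Sum>j\<in>J. \<Sum>q\<in>Y. \<Sum>j'\<in>J. \<Sum>q'\<in>Y. h (j, q) (j', q'))"
    by (simp add: sum.cartesian_product')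
  also have "\<dots> = (\<Sum>q\<in>Y. \<Sum>j\<in>J. \<Sum>q'\<in>Y. \<Sum>j'\<in>J. h (j, q) (j', q'))"
    by (subst sum.swap) (intro sum.cong refl sum.swap)
  also have "\<dots> = (\<Sum>q\<in>Y. \<Sum>q'\<in>Y. \<Sum>j\<in>J. \<Sum>j'\<in>J. h (j, q) (j', q'))"
    by (intro sum.cong refl sum.swap)
  finally show ?thesis .
qed

text \<open>A far-field block factors through the moments. Contracting the coefficients with the
  moments first leaves the bilinear form of \<open>F\<close> in the node indices, the indices for
  which its error is controlled.\<close>

lemma moment_form_eq:
  fixes c d :: "'j \<times> 'q \<Rightarrow> real"
  shows "(\<Sum>a\<in>J \<times> Y. \<Sum>b\<in>J \<times> Y. c a * (if N (snd a) (snd b)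
        then \<Sum>\<beta>\<in>B. \<Sum>\<beta>'\<in>B. M \<beta> (fst a) * F (\<beta>, snd a) (\<beta>', snd b) * M' \<beta>' (fst b) else 0) * d b)
    = (\<Sum>a\<in>B \<times> Y. \<Sum>b\<in>B \<times> Y. if N (snd a) (snd b)
        then (\<Sum>j\<in>J. c (j, snd a) * M (fst a) j) * F a b * (\<Sum>j\<in>J. d (j, snd b) * M' (fst b) j) else 0)"
proof -
  have "(\<Sum>j\<in>J. \<Sum>j'\<in>J. c (j, q) * (\<Sum>\<beta>\<in>B. \<Sum>\<beta>'\<in>B. M \<beta> j * F (\<beta>, q) (\<beta>', q') * M' \<beta>' j') * d (j', q'))
      = (\<Sum>\<beta>\<in>B. \<Sum>\<beta>'\<in>B. (\<Sum>j\<in>J. c (j, q) * M \<beta> j) * F (\<beta>, q) (\<beta>', q') * (\<Sum>j\<in>J. d (j, q') * M' \<beta>' j))"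
    for q q'
  proof -
    have "(\<Sum>j\<in>J. \<Sum>j'\<in>J. c (j, q) * (\<Sum>\<beta>\<in>B. \<Sum>\<beta>'\<in>B. M \<beta> j * F (\<beta>, q) (\<beta>', q') * M' \<beta>' j') * d (j', q'))
        = (\<Sum>z\<in>J \<times> J. \<Sum>w\<in>B \<times> B. c (fst z, q) * (M (fst w) (fst z) * F (fst w, q) (snd w, q') * M' (snd w) (snd z)) * d (snd z, q'))"
      by (simp add: sum.cartesian_product' sum_distrib_left sum_distrib_right)
    also have "\<dots> = (\<Sum>w\<in>B \<times> B. \<Sum>z\<in>J \<times> J. c (fst z, q) * (M (fst w) (fst z) * F (fst w, q) (snd w, q') * M' (snd w) (snd z)) * d (snd z, q'))"
      by (rule sum.swap)
    also have "\<dots> = (\<Sum>\<beta>\<in>B. \<Sum>\<beta>'\<in>B. (\<Sum>j\<in>J. c (j, q) * M \<beta> j) * F (\<beta>, q) (\<beta>', q') * (\<Sum>j\<in>J. d (j, q') * M' \<beta>' j))"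
      by (simp add: sum.cartesian_product' sum_distrib_left sum_distrib_right mult_ac)
    finally show ?thesis .
  qed
  then have "(\<Sum>j\<in>J. \<Sum>j'\<in>J. c (j, q) * (if n then \<Sum>\<beta>\<in>B. \<Sum>\<beta>'\<in>B. M \<beta> j * F (\<beta>, q) (\<beta>', q') * M' \<beta>' j' else 0) * d (j', q'))
      = (\<Sum>\<beta>\<in>B. \<Sum>\<beta>'\<in>B. if n then (\<Sum>j\<in>J. c (j, q) * M \<beta> j) * F (\<beta>, q) (\<beta>', q') * (\<Sum>j\<in>J. d (j, q') * M' \<beta>' j) else 0)"
    for q q' n
    by (cases n) simp_all
  then show ?thesis
    unfolding sum_Times_swap by (simp only: fst_conv snd_conv)
qed

text \<open>The assembly is linear in the given matrices, so the total error is the matrix assembled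
  from the block errors.\<close>

lemma blocked_matrix_diff:
  "blocked_matrix P r p A A' a b - blocked_matrix P r p B F a b
     = blocked_matrix P r p (\<lambda>d a b. A d a b - B d a b) (\<lambda>l d a b. A' l d a b - F l d a b) a b"
proof -
  obtain i j k m where a: "a = (i, j, k, m)" by (cases a)
  obtain i' j' k' m' where b: "b = (i', j', k', m')" by (cases b)
  have if_diff: "(if c then x else 0) - (if c then y else 0) = (if c then z else 0)" if "x - y = z"
    for c and x y z :: real
    using that by simp
  show ?thesis
    unfolding blocked_matrix_def a b prod.case add_diff_add sum_subtractf[symmetric]
    by (intro arg_cong2[of _ _ _ _ "(+)"] sum.cong refl if_diff)
      (simp_all add: left_diff_distrib right_diff_distrib sum_subtractf)
qed

lemma mat_form_eq_time_sum:
  "mat_form P r A c d = (\<Sum>i<N_t P r. \<Sum>i'<N_t P r.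
     \<Sum>a\<in>{..<D_t P} \<times> space_dofs P r. \<Sum>b\<in>{..<D_t P} \<times> space_dofs P r. c (i, a) * A (i, a) (i', b) * d (i', b))"
proof -
  have "mat_form P r A c d = (\<Sum>i<N_t P r. \<Sum>a\<in>{..<D_t P} \<times> space_dofs P r.
     \<Sum>i'<N_t P r. \<Sum>b\<in>{..<D_t P} \<times> space_dofs P r. c (i, a) * A (i, a) (i', b) * d (i', b))"
    unfolding mat_form_def dofs_def by (simp add: sum.cartesian_product')
  also have "\<dots> = (\<Sum>i<N_t P r. \<Sum>i'<N_t P r. \<Sum>a\<in>{..<D_t P} \<times> space_dofs P r.
     \<Sum>b\<in>{..<D_t P} \<times> space_dofs P r. c (i, a) * A (i, a) (i', b) * d (i', b))"
    by (intro sum.cong refl sum.swap)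
  finally show ?thesis .
qed

lemma L2_set_dofs:
  "L2_set (\<lambda>i. L2_set (\<lambda>a. c (i, a)) ({..<D_t P} \<times> space_dofs P r)) {..<N_t P r} = L2_set c (dofs P r)"
  unfolding L2_set_def[of _ "{..<N_t P r}"] L2_set_sq dofs_def
  by (simp only: L2_set_def sum.cartesian_product')

text \<open>The pair of time intervals stands outermost and the pair of spatial indices inside, so
  that the temporal and the spatial sparsity pattern can be estimated one after the other.
  \<open>far_form\<close> has the same arrangement.\<close>

definition near_form :: "heat_bem \<Rightarrow> nat \<Rightarrow> (nat \<Rightarrow> tri_idx \<Rightarrow> tri_idx \<Rightarrow> real) \<Rightarrow> (dof \<Rightarrow> real) \<Rightarrow> (dof \<Rightarrow> real) \<Rightarrow> real" where
  "near_form P r E c d = (\<Sum>i<N_t P r. \<Sum>i'<N_t P r.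
     if i' \<le> i \<and> clus_of P 0 i \<le> clus_of P 0 i' + 1 then
       \<Sum>a\<in>{..<D_t P} \<times> space_dofs P r. \<Sum>b\<in>{..<D_t P} \<times> space_dofs P r.
         if cube_of P r 0 (fst (snd b)) \<in> neighbors P r 0 (cube_of P r 0 (fst (snd a)))
         then c (i, a) * E (i - i') a b * d (i', b) else 0
     else 0)"

text \<open>The coefficients on interval \<open>i\<close> contracted with the moments: the index of
  the temporal basis function is traded for that of a Chebyshev node.\<close>

definition moment_vec :: "heat_bem \<Rightarrow> nat \<Rightarrow> nat \<Rightarrow> nat \<Rightarrow> (dof \<Rightarrow> real) \<Rightarrow> nat \<Rightarrow> tri_idx \<Rightarrow> real" where
  "moment_vec P r p l c i a = (\<Sum>j<D_t P. c (i, j, snd a) * M_moment P r p l (clus_of P l i) (fst a) i j)"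

definition far_form ::
  "heat_bem \<Rightarrow> nat \<Rightarrow> nat \<Rightarrow> nat \<Rightarrow> nat \<Rightarrow> (tri_idx \<Rightarrow> tri_idx \<Rightarrow> real) \<Rightarrow> (dof \<Rightarrow> real) \<Rightarrow> (dof \<Rightarrow> real) \<Rightarrow> real" where
  "far_form P r p l q E c d = (\<Sum>i<N_t P r. \<Sum>i'<N_t P r.
     if clus_of P l i = clus_of P l i' + q \<and> (q = 3 \<longrightarrow> even (clus_of P l i')) then
       \<Sum>a\<in>{..<p} \<times> space_dofs P r. \<Sum>b\<in>{..<p} \<times> space_dofs P r.
         if cube_of P r (space_level P r l) (fst (snd b))
              \<in> neighbors P r (space_level P r l) (cube_of P r (space_level P r l) (fst (snd a)))
         then moment_vec P r p l c i a * E a b * moment_vec P r p l d i' b else 0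
     else 0)"

lemma mat_form_blocked_matrix:
  "mat_form P r (blocked_matrix P r p B F) c d
     = near_form P r B c d + (\<Sum>l | l + 2 \<le> Lev P r. \<Sum>q\<in>{2, 3}. far_form P r p l q (F l q) c d)"
proof -
  let ?X = "{..<D_t P} \<times> space_dofs P r"
  define nr where "nr i i' a b = (if i' \<le> i \<and> clus_of P 0 i \<le> clus_of P 0 i' + 1 \<and>
     cube_of P r 0 (fst (snd b)) \<in> neighbors P r 0 (cube_of P r 0 (fst (snd a)))
     then B (i - i') a b else 0)" for i i' and a b :: tri_idx
  define R where "R l q i i' \<longleftrightarrow> clus_of P l i = clus_of P l i' + q \<and> (q = 3 \<longrightarrow> even (clus_of P l i'))" for l q i i'
  define N where "N l z z' \<longleftrightarrow> cube_of P r (space_level P r l) (fst z')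
     \<in> neighbors P r (space_level P r l) (cube_of P r (space_level P r l) (fst z))" for l and z z' :: "nat \<times> nat"
  define fr where "fr l q i i' a b = (if R l q i i' then if N l (snd a) (snd b)
     then \<Sum>\<beta><p. \<Sum>\<beta>'<p. M_moment P r p l (clus_of P l i) \<beta> i (fst a) * F l q (\<beta>, snd a) (\<beta>', snd b)
            * M_moment P r p l (clus_of P l i') \<beta>' i' (fst b) else 0 else 0)" for l q i i' and a b :: tri_idx
  have entry: "blocked_matrix P r p B F (i, a) (i', b)
      = nr i i' a b + (\<Sum>l | l + 2 \<le> Lev P r. \<Sum>q\<in>{2, 3}. fr l q i i' a b)" for i i' a b
    by (cases a; cases b)
      (auto simp: blocked_matrix_def nr_def fr_def R_def N_def intro!: sum.cong)
  have "mat_form P r (blocked_matrix P r p B F) c d =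
     (\<Sum>i<N_t P r. \<Sum>i'<N_t P r. \<Sum>a\<in>?X. \<Sum>b\<in>?X. c (i, a) * nr i i' a b * d (i', b)) +
     (\<Sum>i<N_t P r. \<Sum>i'<N_t P r. \<Sum>a\<in>?X. \<Sum>b\<in>?X. \<Sum>l | l + 2 \<le> Lev P r. \<Sum>q\<in>{2, 3}. c (i, a) * fr l q i i' a b * d (i', b))"
    unfolding mat_form_eq_time_sum entry
    by (simp add: distrib_left distrib_right sum.distrib sum_distrib_left sum_distrib_right)
  also have "(\<Sum>i<N_t P r. \<Sum>i'<N_t P r. \<Sum>a\<in>?X. \<Sum>b\<in>?X. c (i, a) * nr i i' a b * d (i', b)) = near_form P r B c d"
    unfolding near_form_def nr_def by (intro sum.cong refl) (auto intro!: sum.cong sum.neutral)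
  also have "(\<Sum>i<N_t P r. \<Sum>i'<N_t P r. \<Sum>a\<in>?X. \<Sum>b\<in>?X. \<Sum>l | l + 2 \<le> Lev P r. \<Sum>q\<in>{2, 3}. c (i, a) * fr l q i i' a b * d (i', b))
     = (\<Sum>l | l + 2 \<le> Lev P r. \<Sum>q\<in>{2, 3}. \<Sum>i<N_t P r. \<Sum>i'<N_t P r. \<Sum>a\<in>?X. \<Sum>b\<in>?X. c (i, a) * fr l q i i' a b * d (i', b))"
    by (simp only: sum.swap[of _ "{l. l + 2 \<le> Lev P r}" ?X] sum.swap[of _ "{2, 3}" ?X]
        sum.swap[of _ "{l. l + 2 \<le> Lev P r}" "{..<N_t P r}"] sum.swap[of _ "{2, 3}" "{..<N_t P r}"])
  also have "\<dots> = (\<Sum>l | l + 2 \<le> Lev P r. \<Sum>q\<in>{2, 3}. far_form P r p l q (F l q) c d)"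
  proof (intro sum.cong refl)
    fix l q
    have "(\<Sum>a\<in>?X. \<Sum>b\<in>?X. c (i, a) * fr l q i i' a b * d (i', b))
      = (if R l q i i' then \<Sum>a\<in>{..<p} \<times> space_dofs P r. \<Sum>b\<in>{..<p} \<times> space_dofs P r.
           if N l (snd a) (snd b) then moment_vec P r p l c i a * F l q a b * moment_vec P r p l d i' b else 0
         else 0)" for i i'
    proof (cases "R l q i i'")
      case True
      show ?thesis
        using moment_form_eq[of "\<lambda>a. c (i, a)" "N l" "\<lambda>\<beta> j. M_moment P r p l (clus_of P l i) \<beta> i j" "F l q"
          "\<lambda>\<beta> j. M_moment P r p l (clus_of P l i') \<beta> i' j" "{..<p}" "\<lambda>b. d (i', b)" "{..<D_t P}" "space_dofs P r"]
        by (simp only: True if_True fr_def moment_vec_def)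
    qed (simp add: fr_def)
    then show "(\<Sum>i<N_t P r. \<Sum>i'<N_t P r. \<Sum>a\<in>?X. \<Sum>b\<in>?X. c (i, a) * fr l q i i' a b * d (i', b))
       = far_form P r p l q (F l q) c d"
      unfolding far_form_def N_def R_def by simp
  qed
  finally show ?thesis .
qed

section \<open>Bounds for the near-field and far-field error forms\<close>

lemma time_pattern_le:
  fixes S :: "nat \<Rightarrow> nat \<Rightarrow> real"
  assumes S: "\<And>i i'. i < N \<Longrightarrow> i' < N \<Longrightarrow> R i i' \<Longrightarrow> S i i' \<le> \<delta> * (\<bar>\<alpha> i\<bar> * \<bar>\<beta> i'\<bar>)"
    and row: "\<And>i. card {i'. i' < N \<and> R i i'} \<le> K" and col: "\<And>i'. card {i. i < N \<and> R i i'} \<le> K"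
    and \<delta>: "0 \<le> \<delta>"
  shows "(\<Sum>i<N. \<Sum>i'<N. if R i i' then S i i' else 0) \<le> \<delta> * real K * (L2_set \<alpha> {..<N} * L2_set \<beta> {..<N})"
proof -
  have "(\<Sum>i<N. \<Sum>i'<N. if R i i' then S i i' else 0)
      \<le> (\<Sum>i<N. \<Sum>i'<N. \<delta> * (if R i i' then \<bar>\<alpha> i\<bar> * \<bar>\<beta> i'\<bar> else 0))"
    using S by (intro sum_mono) auto
  also have "\<dots> = \<delta> * (\<Sum>i<N. \<Sum>i'<N. if R i i' then \<bar>\<alpha> i\<bar> * \<bar>\<beta> i'\<bar> else 0)"
    by (simp add: sum_distrib_left)
  also have "\<dots> \<le> \<delta> * (real K * (L2_set \<alpha> {..<N} * L2_set \<beta> {..<N}))"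
    using row col \<delta> by (intro mult_left_mono schur_test_pattern) auto
  finally show ?thesis by (simp add: mult.assoc)
qed

text \<open>Coupled intervals lie in equal or adjacent clusters of \<open>n_T\<close> intervals
  each. Hence their distance is below \<open>2 * n_T\<close>, which bounds the number of partners
  and also guarantees that the matrix with index \<open>i - i'\<close> is among those controlled by
  \<open>block\<close>.\<close>

lemma near_form_le:
  assumes nT: "0 < n_T P" and \<delta>: "0 \<le> \<delta>"
    and block: "\<And>d \<nu> \<nu>'. d < 2 * n_T P \<Longrightarrow> \<nu> \<in> cubes P r 0 \<Longrightarrow> \<nu>' \<in> neighbors P r 0 \<nu> \<Longrightarrow>
      spectral_norm (block_idx P r (D_t P) 0 \<nu>) (block_idx P r (D_t P) 0 \<nu>') (E d) \<le> \<delta>"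
  shows "near_form P r E x y
    \<le> \<delta> * real (gamma_max P r) * real (2 * n_T P) * (L2_set x (dofs P r) * L2_set y (dofs P r))"
proof -
  define R where "R i i' \<longleftrightarrow> i' \<le> i \<and> clus_of P 0 i \<le> clus_of P 0 i' + 1" for i i'
  have R: "i' \<le> i \<and> i < i' + 2 * n_T P" if "R i i'" for i i'
  proof -
    have "i < (i div n_T P + 1) * n_T P" using nT by (simp add: dividend_less_div_times)
    also have "\<dots> \<le> (i' div n_T P + 2) * n_T P"
      using that by (intro mult_right_mono) (auto simp: R_def clus_of_def)
    also have "\<dots> \<le> i' + 2 * n_T P" by (simp add: distrib_right)
    finally show ?thesis using that by (simp add: R_def)
  qed
  let ?X = "{..<D_t P} \<times> space_dofs P r"
  have "near_form P r E x y \<le> (\<delta> * real (gamma_max P r)) * real (2 * n_T P) *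
     (L2_set (\<lambda>i. L2_set (\<lambda>a. x (i, a)) ?X) {..<N_t P r} * L2_set (\<lambda>i. L2_set (\<lambda>a. y (i, a)) ?X) {..<N_t P r})"
    unfolding near_form_def R_def[symmetric]
  proof (rule time_pattern_le)
    fix i i' assume "R i i'"
    then have "i - i' < 2 * n_T P" using R[of i i'] by auto
    then show "(\<Sum>a\<in>?X. \<Sum>b\<in>?X. if cube_of P r 0 (fst (snd b)) \<in> neighbors P r 0 (cube_of P r 0 (fst (snd a)))
        then x (i, a) * E (i - i') a b * y (i', b) else 0)
      \<le> \<delta> * real (gamma_max P r) * (\<bar>L2_set (\<lambda>a. x (i, a)) ?X\<bar> * \<bar>L2_set (\<lambda>b. y (i', b)) ?X\<bar>)"
      unfolding abs_of_nonneg[OF L2_set_nonneg]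
      by (intro spatial_bilinear_le \<delta> block) auto
  next
    fix i
    have "card {i'. i' < N_t P r \<and> R i i'} \<le> card {i + 1 - 2 * n_T P..<i + 1}"
      using R by (intro card_mono) force+
    also have "\<dots> \<le> 2 * n_T P" by simp
    finally show "card {i'. i' < N_t P r \<and> R i i'} \<le> 2 * n_T P" .
    have "card {i'. i' < N_t P r \<and> R i' i} \<le> card {i..<i + 2 * n_T P}"
      using R by (intro card_mono) force+
    then show "card {i'. i' < N_t P r \<and> R i' i} \<le> 2 * n_T P" by simp
  qed (use \<delta> in auto)
  then show ?thesis unfolding L2_set_dofs .
qed

text \<open>Cauchy-Schwarz over the temporal basis functions gives the factor \<open>D_t\<close>;
  the same sum of squared coefficients then occurs once for each of the \<open>p\<close>
  nodes.\<close>

lemma L2_set_moment_vec_le: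
  assumes \<mu>: "\<And>n \<beta> i j. \<beta> < p \<Longrightarrow> j < D_t P \<Longrightarrow> \<bar>M_moment P r p l n \<beta> i j\<bar> \<le> \<mu>" "0 \<le> \<mu>"
  shows "L2_set (moment_vec P r p l x i) ({..<p} \<times> space_dofs P r)
    \<le> sqrt (real p * real (D_t P)) * \<mu> * L2_set (\<lambda>a. x (i, a)) ({..<D_t P} \<times> space_dofs P r)"
proof -
  have "(\<Sum>a\<in>{..<p} \<times> space_dofs P r. (moment_vec P r p l x i a)\<^sup>2)
      \<le> (\<Sum>a\<in>{..<p} \<times> space_dofs P r. real (D_t P) * \<mu>\<^sup>2 * (\<Sum>j<D_t P. (x (i, j, snd a))\<^sup>2))"
  proof (rule sum_mono)
    fix a assume a: "a \<in> {..<p} \<times> space_dofs P r"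
    have "(moment_vec P r p l x i a)\<^sup>2 \<le> (\<Sum>j<D_t P. (x (i, j, snd a))\<^sup>2) *
        (\<Sum>j<D_t P. (M_moment P r p l (clus_of P l i) (fst a) i j)\<^sup>2)"
      unfolding moment_vec_def by (rule Cauchy_Schwarz_ineq_sum)
    also have "\<dots> \<le> (\<Sum>j<D_t P. (x (i, j, snd a))\<^sup>2) * (\<Sum>j<D_t P. \<mu>\<^sup>2)"
      using a \<mu> by (intro mult_left_mono sum_mono sum_nonneg) (auto simp: abs_le_square_iff[symmetric])
    finally show "(moment_vec P r p l x i a)\<^sup>2 \<le> real (D_t P) * \<mu>\<^sup>2 * (\<Sum>j<D_t P. (x (i, j, snd a))\<^sup>2)"
      by (simp add: mult_ac)
  qed
  also have "\<dots> = real p * (real (D_t P) * \<mu>\<^sup>2 * (\<Sum>z\<in>space_dofs P r. \<Sum>j<D_t P. (x (i, j, z))\<^sup>2))"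
    by (simp add: sum.cartesian_product'[of _ "{..<p}"] sum_distrib_left)
  also have "(\<Sum>z\<in>space_dofs P r. \<Sum>j<D_t P. (x (i, j, z))\<^sup>2) = (\<Sum>a\<in>{..<D_t P} \<times> space_dofs P r. (x (i, a))\<^sup>2)"
    by (subst sum.swap) (simp add: sum.cartesian_product'[of _ "{..<D_t P}"])
  finally show ?thesis
    unfolding L2_set_def using \<mu>(2) by (intro real_le_lsqrt)
      (auto simp: power_mult_distrib sum_nonneg mult_ac)
qed

text \<open>The partners of an interval fill at most one cluster of level \<open>l\<close>, which
  has \<open>2 ^ l * n_T\<close> intervals. The factor \<open>p * D_t * \<mu>\<^sup>2\<close> is the
  product of the bounds for the two moment vectors.\<close>

lemma far_form_le:
  assumes nT: "0 < n_T P" and \<delta>: "0 \<le> \<delta>"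
    and \<mu>: "\<And>n \<beta> i j. \<beta> < p \<Longrightarrow> j < D_t P \<Longrightarrow> \<bar>M_moment P r p l n \<beta> i j\<bar> \<le> \<mu>" "0 \<le> \<mu>"
    and block: "\<And>\<nu> \<nu>'. \<nu> \<in> cubes P r (space_level P r l) \<Longrightarrow> \<nu>' \<in> neighbors P r (space_level P r l) \<nu> \<Longrightarrow>
      spectral_norm (block_idx P r p (space_level P r l) \<nu>) (block_idx P r p (space_level P r l) \<nu>') E \<le> \<delta>"
  shows "far_form P r p l q E x y
    \<le> \<delta> * real (gamma_max P r) * (real p * real (D_t P) * \<mu>\<^sup>2) * (2 ^ l * real (n_T P))
       * (L2_set x (dofs P r) * L2_set y (dofs P r))"
proof -
  define w where "w = 2 ^ l * n_T P"
  have w: "w > 0" using nT by (simp add: w_def)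
  define R where "R i i' \<longleftrightarrow> clus_of P l i = clus_of P l i' + q \<and> (q = 3 \<longrightarrow> even (clus_of P l i'))" for i i'
  let ?X = "{..<D_t P} \<times> space_dofs P r" and ?Y = "{..<p} \<times> space_dofs P r"
  \<comment> \<open>Clusters of level \<open>l\<close> are the fibres of division by
    \<open>w\<close>; fixing the cluster of one partner fixes that of the other.\<close>
  have card_fibre: "card {i. i < N_t P r \<and> Q i} \<le> w" if Q: "\<And>i. Q i \<Longrightarrow> i div w = n" for n Q
  proof -
    have "i \<in> {n * w..<n * w + w}" if "Q i" for i
      using Q[OF that] w by (auto simp: dividend_less_div_times mult.commute[of w] dest: sym)
         (metis add.commute dividend_less_div_times mult.commute)
    then have "card {i. i < N_t P r \<and> Q i} \<le> card {n * w..<n * w + w}"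
      by (intro card_mono) auto
    then show ?thesis by simp
  qed
  let ?c = "sqrt (real p * real (D_t P)) * \<mu>"
  have "far_form P r p l q E x y \<le> (\<delta> * real (gamma_max P r) * (?c * ?c)) * real w *
     (L2_set (\<lambda>i. L2_set (\<lambda>a. x (i, a)) ?X) {..<N_t P r} * L2_set (\<lambda>i. L2_set (\<lambda>a. y (i, a)) ?X) {..<N_t P r})"
    unfolding far_form_def R_def[symmetric]
  proof (rule time_pattern_le)
    fix i i' assume "R i i'"
    have "(\<Sum>a\<in>?Y. \<Sum>b\<in>?Y. if cube_of P r (space_level P r l) (fst (snd b))
              \<in> neighbors P r (space_level P r l) (cube_of P r (space_level P r l) (fst (snd a)))
         then moment_vec P r p l x i a * E a b * moment_vec P r p l y i' b else 0)
      \<le> \<delta> * real (gamma_max P r) * (L2_set (moment_vec P r p l x i) ?Y * L2_set (moment_vec P r p l y i') ?Y)"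
      by (intro spatial_bilinear_le \<delta> block) (auto simp: space_level_def)
    also have "\<dots> \<le> \<delta> * real (gamma_max P r) * ((?c * L2_set (\<lambda>a. x (i, a)) ?X) * (?c * L2_set (\<lambda>b. y (i', b)) ?X))"
      using \<mu> \<delta> by (intro mult_left_mono mult_mono L2_set_moment_vec_le) (auto simp: L2_set_nonneg)
    finally show "(\<Sum>a\<in>?Y. \<Sum>b\<in>?Y. if cube_of P r (space_level P r l) (fst (snd b))
              \<in> neighbors P r (space_level P r l) (cube_of P r (space_level P r l) (fst (snd a)))
         then moment_vec P r p l x i a * E a b * moment_vec P r p l y i' b else 0)
      \<le> \<delta> * real (gamma_max P r) * (?c * ?c) * (\<bar>L2_set (\<lambda>a. x (i, a)) ?X\<bar> * \<bar>L2_set (\<lambda>b. y (i', b)) ?X\<bar>)"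
      unfolding abs_of_nonneg[OF L2_set_nonneg] by (simp only: mult_ac)
  next
    fix i
    show "card {i'. i' < N_t P r \<and> R i i'} \<le> w"
      by (rule card_fibre[of _ "clus_of P l i - q"]) (auto simp: R_def clus_of_def w_def)
    show "card {i'. i' < N_t P r \<and> R i' i} \<le> w"
      by (rule card_fibre[of _ "clus_of P l i + q"]) (auto simp: R_def clus_of_def w_def)
  qed (use \<delta> in auto)
  also have "?c * ?c = real p * real (D_t P) * \<mu>\<^sup>2"
    by (simp add: power2_eq_square mult_ac)
  finally show ?thesis unfolding L2_set_dofs by (simp add: w_def mult_ac)
qed

section \<open>Time moments and summation over the temporal levels\<close>

locale heat_bem_setup =
  fixes P :: heat_bem
  assumes bem: "bem_setup P"
begin

lemma T_end_pos: "0 < T_end P" and n_T_pos: "0 < n_T P" and n_patch_pos: "0 < n_patch P"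
  using bem by (auto simp: bem_setup_def)

lemma N_s_pos: "0 < N_s P r" and N_t_pos: "0 < N_t P r"
  using n_patch_pos n_T_pos by (auto simp: N_s_def N_t_def)

lemma h_t_pos: "0 < h_t P r"
  using T_end_pos N_t_pos by (simp add: h_t_def)

lemma h_t_eq: "h_t P r = h_t P 0 / 4 ^ r"
  by (simp add: h_t_def N_t_def Lev_def power_add power_mult)

lemma clus_len_pos: "0 < clus_len P r l"
  using T_end_pos by (simp add: clus_len_def)

lemma abs_lagrange_le:
  assumes "\<beta> < p" and t: "t \<in> clus_interval P r l n"
  shows "\<bar>lagrange P r p l n \<beta> t\<bar> \<le> 2"
proof -
  define H where "H = clus_len P r l"
  have H: "H > 0" using clus_len_pos by (simp add: H_def)
  \<comment> \<open>The coordinate of \<open>t\<close> on [-1, 1]. Each factor of a Lagrange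
    polynomial is a quotient of differences, so the affine change of variables cancels.\<close>
  define x where "x = 2 * (t / H - real n) - 1"
  have x: "\<bar>x\<bar> \<le> 1"
    using t H by (auto simp: x_def clus_interval_def H_def[symmetric] abs_le_iff field_simps)
  have t_eq: "t = H * (real n + 1/2 + x / 2)" using H by (simp add: x_def field_simps)
  have "lagrange P r p l n \<beta> t =
      (\<Prod>\<alpha>\<in>{..<p} - {\<beta>}. (x - cos (cheb_angle p \<alpha>)) / (cos (cheb_angle p \<beta>) - cos (cheb_angle p \<alpha>)))"
    unfolding lagrange_def
  proof (intro prod.cong refl)
    fix \<alpha>
    have "t - cheb_node P r p l n \<alpha> = H / 2 * (x - cos (cheb_angle p \<alpha>))"
      unfolding t_eq cheb_node_def cheb_angle_def H_def[symmetric] by (simp add: algebra_simps)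
    moreover have "cheb_node P r p l n \<beta> - cheb_node P r p l n \<alpha> = H / 2 * (cos (cheb_angle p \<beta>) - cos (cheb_angle p \<alpha>))"
      unfolding cheb_node_def cheb_angle_def H_def[symmetric] by (simp add: algebra_simps)
    ultimately show "(t - cheb_node P r p l n \<alpha>) / (cheb_node P r p l n \<beta> - cheb_node P r p l n \<alpha>)
        = (x - cos (cheb_angle p \<alpha>)) / (cos (cheb_angle p \<beta>) - cos (cheb_angle p \<alpha>))"
      using H by (simp only: mult_divide_mult_cancel_left_if) simp
  qed
  then show ?thesis using abs_cheb_lagrange_le[OF assms(1) x] by simp
qed

lemma chi_ref_bounded: "\<exists>K>0. \<forall>j<D_t P. \<forall>\<tau>\<in>{0..1}. \<bar>poly (chi_ref P j) \<tau>\<bar> \<le> K"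
proof -
  have "\<exists>K. \<forall>\<tau>\<in>{0..1}. \<bar>poly (chi_ref P j) \<tau>\<bar> \<le> K" for j
  proof -
    have "compact (poly (chi_ref P j) ` {0..1})"
      by (intro compact_continuous_image continuous_on_poly continuous_on_id compact_Icc)
    then obtain K where "\<forall>y\<in>poly (chi_ref P j) ` {0..1}. norm y \<le> K"
      using compact_imp_bounded bounded_iff by metis
    then show ?thesis by auto
  qed
  then obtain K where K: "\<And>j \<tau>. \<tau> \<in> {0..1} \<Longrightarrow> \<bar>poly (chi_ref P j) \<tau>\<bar> \<le> K j" by metis
  have "\<bar>poly (chi_ref P j) \<tau>\<bar> \<le> 1 + (\<Sum>j<D_t P. \<bar>K j\<bar>)" if "j < D_t P" "\<tau> \<in> {0..1}" for j \<tau>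
  proof -
    have "\<bar>K j\<bar> \<le> (\<Sum>j<D_t P. \<bar>K j\<bar>)" using that by (intro member_le_sum) auto
    then show ?thesis using K[OF that(2), of j] by linarith
  qed
  moreover have "0 < 1 + (\<Sum>j<D_t P. \<bar>K j\<bar>)" by (intro add_pos_nonneg sum_nonneg) auto
  ultimately show ?thesis by blast
qed

definition cell_t :: "nat \<Rightarrow> nat \<Rightarrow> real set" where
  "cell_t r i = {real i * h_t P r ..< real (i + 1) * h_t P r}"

lemma cell_t_coord:
  assumes "t \<in> cell_t r i"
  shows "(t - real i * h_t P r) / h_t P r \<in> {0..<1}"
  using assms h_t_pos[of r] by (auto simp: cell_t_def field_simps)

lemma chi_t_eq:
  "chi_t P r i j t = indicator (cell_t r i) t * (h_t P r powr (-1/2) * poly (chi_ref P j) ((t - real i * h_t P r) / h_t P r))"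
  by (simp add: chi_t_def cell_t_def)

text \<open>The integrand is bounded by a multiple of \<open>h_t powr (-1/2)\<close>, from the
  normalization of the basis, and is supported in an interval of length \<open>h_t\<close>. The
  bound holds for every pair of interval and cluster, since the integrand vanishes off their
  intersection.\<close>

lemma M_moment_bounded:
  "\<exists>K>0. \<forall>r p l n \<beta> i j. \<beta> < p \<longrightarrow> j < D_t P \<longrightarrow> \<bar>M_moment P r p l n \<beta> i j\<bar> \<le> K * h_t P r powr (1/2)"
proof -
  obtain K where K: "K > 0" "\<And>j \<tau>. j < D_t P \<Longrightarrow> \<tau> \<in> {0..1} \<Longrightarrow> \<bar>poly (chi_ref P j) \<tau>\<bar> \<le> K"
    using chi_ref_bounded by blast
  have "\<bar>M_moment P r p l n \<beta> i j\<bar> \<le> (2 * K) * h_t P r powr (1/2)" if \<beta>: "\<beta> < p" and j: "j < D_t P" for r p l n \<beta> i j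
  proof -
    define h where "h = h_t P r"
    have h: "h > 0" using h_t_pos by (simp add: h_def)
    define B where "B = 2 * (h powr (-1/2) * K)"
    have bound: "norm (indicator (clus_interval P r l n) s *\<^sub>R (lagrange P r p l n \<beta> s * chi_t P r i j s))
        \<le> indicator (cell_t r i) s * B" for s
    proof (cases "s \<in> clus_interval P r l n \<and> s \<in> cell_t r i")
      case True
      then have "\<bar>lagrange P r p l n \<beta> s\<bar> \<le> 2" using abs_lagrange_le[OF \<beta>] by blast
      moreover have "\<bar>chi_t P r i j s\<bar> \<le> h powr (-1/2) * K"
        using True K(2)[OF j] cell_t_coord[of s r i] unfolding chi_t_eq h_def[symmetric]
        by (auto simp: abs_mult intro!: mult_left_mono)
      ultimately have "\<bar>lagrange P r p l n \<beta> s\<bar> * \<bar>chi_t P r i j s\<bar> \<le> B"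
        unfolding B_def by (intro mult_mono) auto
      then show ?thesis using True by (simp add: abs_mult)
    qed (use K h in \<open>auto simp: chi_t_eq B_def\<close>)
    have int: "integrable lborel (\<lambda>s. indicator (cell_t r i) s * B)"
      unfolding cell_t_def by (intro integrable_mult_left integrable_real_indicator)
        (use h in \<open>auto simp flip: h_def simp del: of_nat_add\<close>)
    have "\<bar>M_moment P r p l n \<beta> i j\<bar> \<le>
       (LINT s|lborel. norm (indicator (clus_interval P r l n) s *\<^sub>R (lagrange P r p l n \<beta> s * chi_t P r i j s)))"
      unfolding M_moment_def set_lebesgue_integral_def real_norm_def[symmetric] by (rule integral_norm_bound)
    also have "\<dots> \<le> (LINT s|lborel. indicator (cell_t r i) s * B)"
      using bound K h by (intro integral_mono'[OF int]) (auto simp: B_def)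
    also have "\<dots> = h * B"
    proof -
      have "measure lborel (cell_t r i) = h"
        using h by (simp add: cell_t_def h_def algebra_simps)
      then show ?thesis by (simp add: cell_t_def)
    qed
    also have "\<dots> = (2 * K) * h powr (1/2)"
      using h by (simp add: B_def powr_minus powr_half_sqrt field_simps real_div_sqrt)
    finally show ?thesis unfolding h_def .
  qed
  then show ?thesis using K(1) by (intro exI[of _ "2 * K"]) auto
qed

lemma sum_inverse_squares_le: "(\<Sum>l<n. 1 / (real l + 1)\<^sup>2) \<le> 2"
proof -
  \<comment> \<open>The subtracted term makes the induction telescope against 1 / (n (n +
    1)).\<close>
  have "(\<Sum>l<Suc n. 1 / (real l + 1)\<^sup>2) \<le> 2 - 1 / real (Suc n)" for n
  proof (induction n)
    case (Suc n)
    have "1 / (real (Suc n) + 1)\<^sup>2 \<le> 1 / (real (Suc n) * (real (Suc n) + 1))"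
      by (intro divide_left_mono) (auto simp: power2_eq_square intro!: mult_pos_pos add_pos_nonneg)
    also have "\<dots> = 1 / real (Suc n) - 1 / real (Suc (Suc n))"
      by (simp add: field_simps)
    finally show ?case using Suc by simp
  qed simp
  from this[of n] have "(\<Sum>l<Suc n. 1 / (real l + 1)\<^sup>2) \<le> 2"
    by (rule order.trans) simp
  moreover have "(\<Sum>l<n. 1 / (real l + 1)\<^sup>2) \<le> (\<Sum>l<Suc n. 1 / (real l + 1)\<^sup>2)"
    by simp
  ultimately show ?thesis by linarith
qed

lemma mat_form_error_le:
  "\<exists>C>0. \<forall>r p \<epsilon> B F x y. 2 \<le> p \<longrightarrow> 0 < \<epsilon> \<longrightarrow> 0 \<le> h_s P r \<longrightarrow>
     near_approx P r (eps_near P r \<epsilon>) B \<longrightarrow> far_approx P r p (eps_far P r p \<epsilon>) F \<longrightarrow>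
     mat_form P r (\<lambda>a b. V_mat P r p a b - blocked_matrix P r p B F a b) x y
       \<le> C * \<epsilon> * (h_s P r * h_t P r powr (1/2)) * (L2_set x (dofs P r) * L2_set y (dofs P r))"
proof -
  obtain K where K: "K > 0" "\<And>r p l n \<beta> i j. \<beta> < p \<Longrightarrow> j < D_t P \<Longrightarrow>
      \<bar>M_moment P r p l n \<beta> i j\<bar> \<le> K * h_t P r powr (1/2)"
    using M_moment_bounded by metis
  \<comment> \<open>The denominator \<open>ln 2\<close> comes from replacing \<open>1 / ln p\<close>
    by its largest value, at \<open>p = 2\<close>.\<close>
  define C0 where "C0 = real (D_t P) * K\<^sup>2 * real (n_T P) / ln 2"
  have C0: "0 \<le> C0" using K by (simp add: C0_def)
  \<comment> \<open>In the constant, 2 is the number of clusters met in the near field. The 4 is the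
    two values 2 and 3 of the cluster distance times the bound 2 for the sum of 1 / (l +
    1)^2.\<close>
  have "mat_form P r (\<lambda>a b. V_mat P r p a b - blocked_matrix P r p B F a b) x y
       \<le> (2 + 4 * C0) * \<epsilon> * (h_s P r * h_t P r powr (1/2)) * (L2_set x (dofs P r) * L2_set y (dofs P r))"
    if p: "2 \<le> p" and \<epsilon>: "0 < \<epsilon>" and hs: "0 \<le> h_s P r"
      and near: "near_approx P r (eps_near P r \<epsilon>) B" and far: "far_approx P r p (eps_far P r p \<epsilon>) F"
    for r p \<epsilon> B F x y
  proof -
    define h where "h = h_t P r"
    define g where "g = real (gamma_max P r)"
    define X where "X = L2_set x (dofs P r) * L2_set y (dofs P r)"
    define Z where "Z = \<epsilon> * (h_s P r * h powr (1/2))"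
    have h: "0 < h" using h_t_pos by (simp add: h_def)
    have g: "0 < g" using gamma_max_pos[OF N_s_pos] by (simp add: g_def)
    have X: "0 \<le> X" by (simp add: X_def L2_set_nonneg)
    have Z: "0 \<le> Z" using \<epsilon> hs by (simp add: Z_def)
    have lnp: "ln 2 \<le> ln (real p)" using p by simp
    then have lnp0: "0 < ln (real p)" using ln_gt_zero[of "2::real"] by linarith
    \<comment> \<open>The far-field tolerance contributes the exponent -1/2 and each of the two
      moments the exponent 1/2. This is how the far field reaches the same order as the near
      field.\<close>
    have hh: "h powr (-1/2) * (h powr (1/2))\<^sup>2 = h powr (1/2)"
    proof -
      have "h powr (-1/2) * (h powr (1/2))\<^sup>2 = h powr (-1/2 + (1/2 + 1/2))"
        using h by (simp only: powr_add power2_eq_square)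
      then show ?thesis by simp
    qed
    have "near_form P r (\<lambda>d a b. A_near P r d a b - B d a b) x y \<le> eps_near P r \<epsilon> * g * real (2 * n_T P) * X"
      unfolding g_def X_def
      using near n_T_pos hs \<epsilon> by (intro near_form_le) (auto simp: near_approx_def eps_near_def)
    also have "eps_near P r \<epsilon> * g * real (2 * n_T P) = 2 * Z"
      using g n_T_pos by (simp add: eps_near_def Z_def g_def h_def)
    finally have near_le: "near_form P r (\<lambda>d a b. A_near P r d a b - B d a b) x y \<le> 2 * Z * X" .
    have far_le: "far_form P r p l q (\<lambda>a b. A_far P r p l q a b - F l q a b) x y \<le> C0 * (1 / (real l + 1)\<^sup>2) * Z * X"
      if l: "l + 2 \<le> Lev P r" and q: "q \<in> {2, 3}" for l q
    proof -
      have "far_form P r p l q (\<lambda>a b. A_far P r p l q a b - F l q a b) x y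
         \<le> eps_far P r p \<epsilon> l * g * (real p * real (D_t P) * (K * h powr (1/2))\<^sup>2) * (2 ^ l * real (n_T P)) * X"
        unfolding g_def X_def h_def
        using far n_T_pos hs \<epsilon> K l q lnp0
        by (intro far_form_le) (auto simp: far_approx_def eps_far_def)
      also have "eps_far P r p \<epsilon> l * g * (real p * real (D_t P) * (K * h powr (1/2))\<^sup>2) * (2 ^ l * real (n_T P))
          = (2 powr - real l * 2 ^ l) * (real (D_t P) * K\<^sup>2 * real (n_T P) / ln (real p)) * (1 / (real l + 1)\<^sup>2)
            * (\<epsilon> * (h_s P r * (h powr (-1/2) * (h powr (1/2))\<^sup>2)))"
        using g p by (simp add: eps_far_def g_def h_def power_mult_distrib)
      also have "(2::real) powr - real l * 2 ^ l = 1"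
        by (simp add: powr_minus powr_realpow)
      also have "1 * (real (D_t P) * K\<^sup>2 * real (n_T P) / ln (real p)) * (1 / (real l + 1)\<^sup>2)
            * (\<epsilon> * (h_s P r * (h powr (-1/2) * (h powr (1/2))\<^sup>2))) \<le> C0 * (1 / (real l + 1)\<^sup>2) * Z"
        unfolding hh Z_def[symmetric] C0_def mult_1 using lnp lnp0 Z
        by (intro mult_right_mono divide_left_mono) auto
      finally show ?thesis using X by (simp add: mult_right_mono)
    qed
    have "mat_form P r (\<lambda>a b. V_mat P r p a b - blocked_matrix P r p B F a b) x y
        = near_form P r (\<lambda>d a b. A_near P r d a b - B d a b) x y +
          (\<Sum>l | l + 2 \<le> Lev P r. \<Sum>q\<in>{2, 3}. far_form P r p l q (\<lambda>a b. A_far P r p l q a b - F l q a b) x y)"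
      unfolding V_mat_def blocked_matrix_diff mat_form_blocked_matrix ..
    also have "\<dots> \<le> 2 * Z * X + (\<Sum>l | l + 2 \<le> Lev P r. \<Sum>q\<in>{2, 3::nat}. C0 * (1 / (real l + 1)\<^sup>2) * Z * X)"
      by (intro add_mono near_le sum_mono far_le) auto
    also have "(\<Sum>l | l + 2 \<le> Lev P r. \<Sum>q\<in>{2, 3::nat}. C0 * (1 / (real l + 1)\<^sup>2) * Z * X)
        = 2 * C0 * Z * X * (\<Sum>l | l + 2 \<le> Lev P r. 1 / (real l + 1)\<^sup>2)"
      by (simp add: sum_distrib_left mult_ac)
    also have "\<dots> \<le> 2 * C0 * Z * X * 2"
    proof (intro mult_left_mono)
      have "(\<Sum>l | l + 2 \<le> Lev P r. 1 / (real l + 1)\<^sup>2) \<le> (\<Sum>l<Lev P r. 1 / (real l + 1)\<^sup>2)"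
        by (intro sum_mono2) auto
      also have "\<dots> \<le> 2" by (rule sum_inverse_squares_le)
      finally show "(\<Sum>l | l + 2 \<le> Lev P r. 1 / (real l + 1)\<^sup>2) \<le> 2" .
    qed (use C0 Z X in auto)
    also have "2 * Z * X + 2 * C0 * Z * X * 2 = (2 + 4 * C0) * \<epsilon> * (h_s P r * h powr (1/2)) * X"
      by (simp add: Z_def algebra_simps)
    finally show ?thesis by (simp add: X_def h_def)
  qed
  then show ?thesis using C0 by (intro exI[of _ "2 + 4 * C0"]) auto
qed

end

section \<open>The geometry of the surface\<close>

definition tri_int :: "(real^2) set" where
  "tri_int = {u. 0 < u $ 1 \<and> 0 < u $ 2 \<and> u $ 1 + u $ 2 < 1}"

text \<open>The product of the three barycentric coordinates.\<close>

definition bubble :: "real^2 \<Rightarrow> real" where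
  "bubble u = u $ 1 * u $ 2 * (1 - u $ 1 - u $ 2)"

lemma open_tri_int: "open tri_int"
  unfolding tri_int_def by (intro open_Collect_conj open_Collect_less continuous_intros)

lemma tri_int_subset: "tri_int \<subseteq> ref_triangle"
  by (auto simp: tri_int_def ref_triangle_def)

lemma tri_int_subset_interior: "tri_int \<subseteq> interior ref_triangle"
  by (rule interior_maximal[OF tri_int_subset open_tri_int])

lemma norm_ref_triangle_le: "u \<in> ref_triangle \<Longrightarrow> norm u \<le> 2"
  using norm_le_l1_cart[of u] by (auto simp: ref_triangle_def sum_2)

lemma compact_ref_triangle: "compact ref_triangle"
proof -
  have "closed ref_triangle"
    unfolding ref_triangle_def by (intro closed_Collect_conj closed_Collect_le continuous_intros)
  moreover have "bounded ref_triangle"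
    unfolding bounded_iff using norm_ref_triangle_le by blast
  ultimately show ?thesis by (simp add: compact_eq_bounded_closed)
qed

lemma convex_ref_triangle: "convex ref_triangle"
proof -
  have eq: "ref_triangle = {u. axis 1 1 \<bullet> u \<ge> 0} \<inter> {u. axis 2 1 \<bullet> u \<ge> 0} \<inter> {u. (axis 1 1 + axis 2 1) \<bullet> u \<le> 1}"
    by (auto simp: ref_triangle_def inner_add_left inner_axis')
  show ?thesis
    by (subst eq) (intro convex_Int convex_halfspace_ge convex_halfspace_le)
qed

lemma zero_in_ref_triangle: "0 \<in> ref_triangle" "0 \<notin> tri_int"
  by (auto simp: ref_triangle_def tri_int_def)

lemma bubble_nonneg: "u \<in> ref_triangle \<Longrightarrow> 0 \<le> bubble u"
  by (auto simp: bubble_def ref_triangle_def)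

lemma bubble_pos: "u \<in> tri_int \<Longrightarrow> 0 < bubble u"
  by (auto simp: bubble_def tri_int_def)

lemma bubble_zero: "u \<in> ref_triangle \<Longrightarrow> u \<notin> tri_int \<Longrightarrow> bubble u = 0"
  by (force simp: bubble_def tri_int_def ref_triangle_def)

lemma bubble_le_one:
  assumes "u \<in> ref_triangle" shows "bubble u \<le> 1"
  using assms unfolding bubble_def ref_triangle_def by (auto intro!: mult_le_one)

text \<open>Each of the three factors of the bubble is at most 1 and one of them is nonpositive at \<open>z\<close>.\<close>

lemma bubble_le_dist:
  assumes u: "u \<in> ref_triangle" and z: "z \<notin> tri_int"
  shows "bubble u \<le> 2 * norm (u - z)"
proof -
  have c: "\<bar>u $ 1 - z $ 1\<bar> \<le> norm (u - z)" "\<bar>u $ 2 - z $ 2\<bar> \<le> norm (u - z)"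
    using component_le_norm_cart[of "u - z" 1] component_le_norm_cart[of "u - z" 2] by auto
  have u': "0 \<le> u $ 1" "0 \<le> u $ 2" "u $ 1 + u $ 2 \<le> 1" using u by (auto simp: ref_triangle_def)
  have b: "bubble u \<le> u $ 1" "bubble u \<le> u $ 2" "bubble u \<le> 1 - u $ 1 - u $ 2"
  proof -
    have "(u $ 1 * u $ 2) * (1 - u $ 1 - u $ 2) \<le> (u $ 1 * 1) * 1" using u' by (intro mult_mono) auto
    then show "bubble u \<le> u $ 1" by (simp add: bubble_def)
    have "(u $ 1 * u $ 2) * (1 - u $ 1 - u $ 2) \<le> (1 * u $ 2) * 1" using u' by (intro mult_mono) auto
    then show "bubble u \<le> u $ 2" by (simp add: bubble_def)
    have "(u $ 1 * u $ 2) * (1 - u $ 1 - u $ 2) \<le> (1 * 1) * (1 - u $ 1 - u $ 2)" using u' by (intro mult_mono) auto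
    then show "bubble u \<le> 1 - u $ 1 - u $ 2" by (simp add: bubble_def)
  qed
  consider "z $ 1 \<le> 0" | "z $ 2 \<le> 0" | "1 \<le> z $ 1 + z $ 2"
    using z by (auto simp: tri_int_def not_less)
  then show ?thesis by cases (use b c in linarith)+
qed

text \<open>The set \<open>S\<close> is the lift to the graph of the straight segment between the
  projections of \<open>x\<close> and \<open>y\<close> along \<open>e\<close>. The projection has
  Lipschitz constant at most 2 and the height function \<open>g\<close> has constant
  \<open>K\<close>, whence the factor \<open>2 * (1 + K)\<close>. Any two nearby surface points are
  thus joined inside the surface by a set of comparable size.\<close>

lemma segment_in_frontier_graph:
  fixes \<Omega> :: "(real^3) set"
  assumes op: "open \<Omega>" and e: "norm e = 1"
    and g: "K-lipschitz_on {z. z \<bullet> e = 0} g" and \<rho>: "0 < \<rho>"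
    and eq: "\<Omega> \<inter> ball p \<rho> = {y \<in> ball p \<rho>. g (y - (y \<bullet> e) *\<^sub>R e) < y \<bullet> e}"
  shows "\<exists>\<rho>'>0. \<forall>x\<in>frontier \<Omega> \<inter> ball p \<rho>'. \<forall>y\<in>frontier \<Omega> \<inter> ball p \<rho>'.
      \<exists>S. connected S \<and> S \<subseteq> frontier \<Omega> \<and> x \<in> S \<and> y \<in> S \<and> (\<forall>z\<in>S. norm (x - z) \<le> 2 * (1 + K) * norm (x - y))"
proof -
  define \<pi> where "\<pi> y = y - (y \<bullet> e) *\<^sub>R e" for y
  have ee: "e \<bullet> e = 1" using e by (simp add: norm_eq_1)
  have \<pi>e: "\<pi> y \<bullet> e = 0" for y by (simp add: \<pi>_def inner_diff_left ee)
  have K: "0 \<le> K" using g by (rule lipschitz_on_nonneg)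
  have \<pi>_add: "\<pi> (y + c *\<^sub>R e) = \<pi> y" for y c by (simp add: \<pi>_def inner_add_left ee algebra_simps)
  have \<pi>_diff: "norm (\<pi> x - \<pi> y) \<le> 2 * norm (x - y)" for x y
  proof -
    have "\<pi> x - \<pi> y = (x - y) - ((x - y) \<bullet> e) *\<^sub>R e" by (simp add: \<pi>_def inner_diff_left algebra_simps)
    then have "norm (\<pi> x - \<pi> y) \<le> norm (x - y) + \<bar>(x - y) \<bullet> e\<bar>"
      using norm_triangle_ineq4[of "x - y" "((x - y) \<bullet> e) *\<^sub>R e"] e by simp
    also have "\<bar>(x - y) \<bullet> e\<bar> \<le> norm (x - y)" using Cauchy_Schwarz_ineq2[of "x - y" e] e by simp
    finally show ?thesis by simp
  qed
  have cont: "continuous_on UNIV (\<lambda>y. g (\<pi> y))"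
    using lipschitz_on_continuous_on[OF g] \<pi>e
    by (intro continuous_on_compose2[of _ g UNIV \<pi>]) (auto simp: \<pi>_def intro!: continuous_intros)
  have in_\<Omega>: "y \<in> \<Omega> \<longleftrightarrow> g (\<pi> y) < y \<bullet> e" if "y \<in> ball p \<rho>" for y
    using eq that unfolding \<pi>_def by blast
  have graph: "g (\<pi> z) = z \<bullet> e" if z: "z \<in> frontier \<Omega>" "z \<in> ball p \<rho>" for z
  proof (rule antisym)
    have "z \<notin> \<Omega>" using z op by (simp add: frontier_def interior_open)
    then have "\<not> g (\<pi> z) < z \<bullet> e" using in_\<Omega> z by blast
    \<comment> \<open>The points strictly below the graph form an open set that misses \<Omega> near
      \<open>p\<close>, so none of them lies in the closure of \<Omega>.\<close>
    moreover have "\<not> z \<bullet> e < g (\<pi> z)"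
    proof
      assume *: "z \<bullet> e < g (\<pi> z)"
      have "open {y. y \<bullet> e < g (\<pi> y)}" by (intro open_Collect_less continuous_intros cont)
      then have "open ({y. y \<bullet> e < g (\<pi> y)} \<inter> ball p \<rho>)" by auto
      moreover have "({y. y \<bullet> e < g (\<pi> y)} \<inter> ball p \<rho>) \<inter> \<Omega> = {}" using in_\<Omega> by force
      ultimately have "({y. y \<bullet> e < g (\<pi> y)} \<inter> ball p \<rho>) \<inter> closure \<Omega> = {}"
        using open_Int_closure_eq_empty by blast
      then show False using * z by (auto simp: frontier_def)
    qed
    ultimately show "g (\<pi> z) \<le> z \<bullet> e" "z \<bullet> e \<le> g (\<pi> z)" by auto
  qed
  \<comment> \<open>A point of the graph is not in \<Omega>, but it is the limit of its translates
    by small positive multiples of \<open>e\<close>, which lie above the graph.\<close>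
  have on_graph: "z \<in> frontier \<Omega>" if z: "z \<in> ball p \<rho>" "g (\<pi> z) = z \<bullet> e" for z
  proof -
    have "z \<notin> \<Omega>" using in_\<Omega> z by simp
    moreover have "z \<in> closure \<Omega>"
      unfolding closure_approachable
    proof (intro allI impI)
      fix \<epsilon> :: real assume \<epsilon>: "0 < \<epsilon>"
      define \<delta> where "\<delta> = min (\<epsilon> / 2) ((\<rho> - dist p z) / 2)"
      have \<delta>: "0 < \<delta>" "\<delta> < \<epsilon>" "\<delta> < \<rho> - dist p z"
        using \<epsilon> z by (auto simp: \<delta>_def min_less_iff_disj)
      define y where "y = z + \<delta> *\<^sub>R e"
      have d: "dist y z = \<delta>" using e \<delta> by (simp add: y_def dist_norm)
      have "y \<in> ball p \<rho>" using \<delta> d dist_triangle[of p y z] by (auto simp: dist_commute)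
      moreover have "g (\<pi> y) < y \<bullet> e" using z \<delta> by (simp add: y_def \<pi>_add inner_add_left ee)
      ultimately have "y \<in> \<Omega>" using in_\<Omega> by blast
      then show "\<exists>y\<in>\<Omega>. dist y z < \<epsilon>" using d \<delta> by auto
    qed
    ultimately show ?thesis using op by (simp add: frontier_def interior_open)
  qed
  \<comment> \<open>Two points of the small ball are less than \<open>2 * \<rho>'\<close> apart, so
    the lifted segment stays within \<open>\<rho>' + 2 * (1 + K) * (2 * \<rho>')\<close> of
    \<open>p\<close>. The denominator makes this at most \<rho>, where the graph describes the
    frontier.\<close>
  define \<rho>' where "\<rho>' = \<rho> / (2 + 4 * (1 + K))"
  have \<rho>': "0 < \<rho>'" "\<rho>' * (2 + 4 * (1 + K)) = \<rho>" using \<rho> K by (auto simp: \<rho>'_def)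
  have "\<exists>S. connected S \<and> S \<subseteq> frontier \<Omega> \<and> x \<in> S \<and> y \<in> S \<and> (\<forall>z\<in>S. norm (x - z) \<le> 2 * (1 + K) * norm (x - y))"
    if x: "x \<in> frontier \<Omega> \<inter> ball p \<rho>'" and y: "y \<in> frontier \<Omega> \<inter> ball p \<rho>'" for x y
  proof -
    have "\<rho>' * 1 \<le> \<rho>' * (2 + 4 * (1 + K))" using \<rho>' K by (intro mult_left_mono) auto
    then have le: "\<rho>' \<le> \<rho>" unfolding \<rho>'(2) by simp
    have gx: "g (\<pi> x) = x \<bullet> e" and gy: "g (\<pi> y) = y \<bullet> e" using graph x y le by auto
    define w where "w s = \<pi> x + s *\<^sub>R (\<pi> y - \<pi> x)" for s :: real
    define z where "z s = w s + g (w s) *\<^sub>R e" for s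
    have we: "w s \<bullet> e = 0" for s by (simp add: w_def inner_add_left inner_diff_left \<pi>e)
    have \<pi>z: "\<pi> (z s) = w s" for s by (simp add: \<pi>_def z_def inner_add_left we ee)
    have ze: "z s \<bullet> e = g (w s)" for s by (simp add: z_def inner_add_left we ee)
    have x_eq: "x = \<pi> x + g (\<pi> x) *\<^sub>R e" and y_eq: "y = \<pi> y + g (\<pi> y) *\<^sub>R e"
      unfolding gx gy by (simp_all add: \<pi>_def)
    have z0: "z 0 = x" and z1: "z 1 = y" using x_eq y_eq by (simp_all add: z_def w_def)
    have dist_z: "norm (x - z s) \<le> 2 * (1 + K) * norm (x - y)" if s: "s \<in> {0..1}" for s
    proof -
      have wx: "norm (w s - \<pi> x) \<le> 2 * norm (x - y)"
      proof -
        have "norm (w s - \<pi> x) = \<bar>s\<bar> * norm (\<pi> y - \<pi> x)" by (simp add: w_def)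
        also have "\<dots> \<le> 1 * norm (\<pi> y - \<pi> x)" using s by (intro mult_right_mono) auto
        also have "\<dots> \<le> 2 * norm (x - y)" using \<pi>_diff[of y x] by (simp add: norm_minus_commute)
        finally show ?thesis .
      qed
      have "\<bar>g (w s) - g (\<pi> x)\<bar> \<le> K * norm (w s - \<pi> x)"
        using lipschitz_onD[OF g, of "w s" "\<pi> x"] we \<pi>e by (simp add: dist_norm)
      also have "\<dots> \<le> K * (2 * norm (x - y))" using wx K by (intro mult_left_mono) auto
      finally have gb: "\<bar>g (w s) - g (\<pi> x)\<bar> \<le> K * (2 * norm (x - y))" .
      have "x - z s = (\<pi> x - w s) + (g (\<pi> x) - g (w s)) *\<^sub>R e"
        by (subst x_eq) (simp add: z_def algebra_simps)
      then have "norm (x - z s) \<le> norm (\<pi> x - w s) + \<bar>g (\<pi> x) - g (w s)\<bar>"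
        using norm_triangle_ineq[of "\<pi> x - w s" "(g (\<pi> x) - g (w s)) *\<^sub>R e"] e by simp
      also have "\<dots> \<le> 2 * norm (x - y) + K * (2 * norm (x - y))"
        using wx gb by (simp add: norm_minus_commute abs_minus_commute)
      finally show ?thesis by (simp add: algebra_simps)
    qed
    have xy: "norm (x - y) \<le> 2 * \<rho>'"
      using x y dist_triangle[of x y p] by (auto simp: dist_norm[symmetric] dist_commute)
    have "z s \<in> frontier \<Omega>" if s: "s \<in> {0..1}" for s
    proof (rule on_graph)
      have "dist p (z s) \<le> dist p x + norm (x - z s)" using dist_triangle[of p "z s" x] by (simp add: dist_norm)
      also have "\<dots> < \<rho>' + 2 * (1 + K) * (2 * \<rho>')"
      proof -
        have "2 * (1 + K) * norm (x - y) \<le> 2 * (1 + K) * (2 * \<rho>')"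
          using xy K by (intro mult_left_mono) auto
        moreover have "dist p x < \<rho>'" using x by simp
        ultimately show ?thesis using dist_z[OF s] by linarith
      qed
      also have "\<dots> \<le> \<rho>' * (2 + 4 * (1 + K))" using \<rho>'(1) by (simp add: algebra_simps)
      also have "\<dots> = \<rho>" by (rule \<rho>'(2))
      finally show "z s \<in> ball p \<rho>" by simp
      show "g (\<pi> (z s)) = z s \<bullet> e" by (simp add: \<pi>z ze)
    qed
    moreover have "connected (z ` {0..1})"
    proof (rule connected_continuous_image)
      have "continuous_on {0..1} (\<lambda>s. g (w s))"
        using lipschitz_on_continuous_on[OF g] we
        by (intro continuous_on_compose2[of _ g "{0..1}" w]) (auto simp: w_def intro!: continuous_intros)
      then show "continuous_on {0..1} z"
        unfolding z_def w_def by (intro continuous_intros) (auto simp: w_def)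
    qed auto
    ultimately show ?thesis
      using z0 z1 dist_z by (intro exI[of _ "z ` {0..1}"]) (auto intro: rev_image_eqI)
  qed
  then show ?thesis using \<rho>' by blast
qed

section \<open>Inverse Lipschitz bounds for the patches and separation of different patches\<close>

context heat_bem_setup
begin

lemma inj_par: "k < n_patch P \<Longrightarrow> inj_on (par P k) ref_triangle"
  and par_has_derivative: "k < n_patch P \<Longrightarrow> u \<in> ref_triangle \<Longrightarrow>
    (par P k has_derivative dpar P k u) (at u within ref_triangle)"
  and inj_dpar: "k < n_patch P \<Longrightarrow> u \<in> ref_triangle \<Longrightarrow> inj (dpar P k u)"
  and continuous_dpar: "k < n_patch P \<Longrightarrow> continuous_on ref_triangle (\<lambda>u. dpar P k u h)"
  and Gam_eq: "Gam P = (\<Union>k<n_patch P. par P k ` ref_triangle)"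
  using bem by (auto simp: bem_setup_def)

lemma par_interior_disjoint:
  assumes "k < n_patch P" "k' < n_patch P" "k \<noteq> k'" "u \<in> tri_int" "u' \<in> ref_triangle"
  shows "par P k u \<noteq> par P k' u'"
proof -
  have "\<forall>k<n_patch P. \<forall>k'<n_patch P. k \<noteq> k' \<longrightarrow> par P k ` interior ref_triangle \<inter> par P k' ` ref_triangle = {}"
    using bem by (simp add: bem_setup_def)
  then have "par P k ` interior ref_triangle \<inter> par P k' ` ref_triangle = {}"
    using assms by simp
  moreover have "par P k u \<in> par P k ` interior ref_triangle"
    using assms(4) tri_int_subset_interior by (intro imageI) auto
  moreover have "par P k' u' \<in> par P k' ` ref_triangle" using assms(5) by (rule imageI)
  ultimately show ?thesis by (metis IntI empty_iff)
qed

lemma continuous_par: "k < n_patch P \<Longrightarrow> continuous_on ref_triangle (par P k)"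
  using par_has_derivative by (intro has_derivative_continuous_on) auto

lemma compact_par: "k < n_patch P \<Longrightarrow> compact (par P k ` ref_triangle)"
  by (intro compact_continuous_image continuous_par compact_ref_triangle)

lemma linear_dpar: "k < n_patch P \<Longrightarrow> u \<in> ref_triangle \<Longrightarrow> linear (dpar P k u)"
  using par_has_derivative has_derivative_linear by blast

text \<open>The quantitative form of local injectivity for an immersion: the derivative
  \<open>L\<close> at \<open>u\<close> is bounded below by \<open>m\<close>, and near
  \<open>u\<close> the parameterization deviates from \<open>L\<close> by a map with Lipschitz
  constant \<open>m / 2\<close>, which is absorbed. The mean value estimate uses the convexity of
  the triangle, so boundary points \<open>u\<close> need no separate treatment.\<close>

lemma par_inverse_lipschitz_local:
  assumes k: "k < n_patch P" and u: "u \<in> ref_triangle"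
  shows "\<exists>K. \<exists>e>0. \<forall>v\<in>ref_triangle \<inter> ball u e. \<forall>v'\<in>ref_triangle \<inter> ball u e.
           norm (v - v') \<le> K * norm (par P k v - par P k v')"
proof -
  define L where "L = dpar P k u"
  have linL: "linear L" "inj L" using linear_dpar inj_dpar k u by (auto simp: L_def)
  obtain m where m: "0 < m" "\<And>h. m * norm h \<le> norm (L h)"
    using linear_inj_bounded_below_pos[OF linL] by blast
  \<comment> \<open>Continuity of the derivative is given direction by direction. The sum over a
    basis is continuous and dominates the operator norm of the deviation from
    \<open>L\<close>.\<close>
  define S where "S w = (\<Sum>b\<in>Basis. norm (dpar P k w b - L b))" for w
  have "continuous_on ref_triangle S"
    unfolding S_def by (intro continuous_intros continuous_dpar k)
  then obtain e where e0: "0 < e" "\<forall>w\<in>ref_triangle. dist w u < e \<longrightarrow> dist (S w) (S u) < m / 2"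
    unfolding continuous_on_iff using u m(1) half_gt_zero by meson
  have "S u = 0" by (simp add: S_def L_def)
  then have e: "0 < e" "\<And>w. w \<in> ref_triangle \<Longrightarrow> dist w u < e \<Longrightarrow> (\<Sum>b\<in>Basis. norm (dpar P k w b - L b)) < m / 2"
    using e0 by (force simp: dist_real_def S_def)+
  have "norm (v - v') \<le> (2 / m) * norm (par P k v - par P k v')"
    if v: "v \<in> ref_triangle \<inter> ball u e" "v' \<in> ref_triangle \<inter> ball u e" for v v'
  proof -
    define \<phi> where "\<phi> w = par P k w - L w" for w
    have "norm (\<phi> v - \<phi> v') \<le> m / 2 * norm (v - v')"
    proof (rule differentiable_bound[of "ref_triangle \<inter> ball u e" \<phi> "\<lambda>w h. dpar P k w h - L h"])
      show "convex (ref_triangle \<inter> ball u e)" by (intro convex_Int convex_ref_triangle convex_ball)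
      fix w assume w: "w \<in> ref_triangle \<inter> ball u e"
      show "(\<phi> has_derivative (\<lambda>h. dpar P k w h - L h)) (at w within ref_triangle \<inter> ball u e)"
        unfolding \<phi>_def using w linL
        by (intro has_derivative_diff has_derivative_subset[OF par_has_derivative[OF k]]
            linear_imp_has_derivative) auto
      have lin: "linear (\<lambda>h. dpar P k w h - L h)"
        using w linL linear_dpar[OF k] by (intro linear_compose_sub) auto
      show "onorm (\<lambda>h. dpar P k w h - L h) \<le> m / 2"
      proof (rule onorm_le)
        fix h
        define D where "D h = dpar P k w h - L h" for h
        have linD: "linear D" using lin by (simp add: D_def[abs_def])
        have "D h = D (\<Sum>b\<in>Basis. (h \<bullet> b) *\<^sub>R b)" by (simp only: euclidean_representation)
        also have "\<dots> = (\<Sum>b\<in>Basis. (h \<bullet> b) *\<^sub>R D b)"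
          by (simp only: linear_sum[OF linD] linear_scale[OF linD])
        finally have "norm (dpar P k w h - L h) = norm (\<Sum>b\<in>Basis. (h \<bullet> b) *\<^sub>R (dpar P k w b - L b))"
          unfolding D_def by (rule arg_cong)
        also have "\<dots> \<le> (\<Sum>b\<in>Basis. norm h * norm (dpar P k w b - L b))"
          by (intro order.trans[OF norm_sum] sum_mono) (auto intro!: mult_right_mono Basis_le_norm)
        also have "\<dots> = norm h * (\<Sum>b\<in>Basis. norm (dpar P k w b - L b))" by (simp add: sum_distrib_left)
        also have "\<dots> \<le> norm h * (m / 2)" using e(2)[of w] w by (intro mult_left_mono) (auto simp: dist_commute)
        finally show "norm (dpar P k w h - L h) \<le> m / 2 * norm h" by (simp add: mult.commute)
      qed
    qed (use v in auto)
    moreover have "m * norm (v - v') \<le> norm (L (v - v'))" by (rule m)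
    moreover have "L (v - v') = (par P k v - par P k v') - (\<phi> v - \<phi> v')"
      by (simp add: \<phi>_def linear_diff[OF linL(1)])
    then have "norm (L (v - v')) \<le> norm (par P k v - par P k v') + norm (\<phi> v - \<phi> v')"
      by (metis norm_triangle_ineq4)
    ultimately have "m * norm (v - v') \<le> norm (par P k v - par P k v') + m / 2 * norm (v - v')" by linarith
    then show ?thesis using m by (simp add: field_simps)
  qed
  then show ?thesis using e by blast
qed

text \<open>Compactness of the set of pairs: the local bound covers the pairs near the diagonal, and
  elsewhere injectivity keeps the images a positive distance apart.\<close>

lemma par_inverse_lipschitz_each:
  assumes k: "k < n_patch P"
  shows "\<exists>K>0. \<forall>v\<in>ref_triangle. \<forall>v'\<in>ref_triangle. norm (v - v') \<le> K * norm (par P k v - par P k v')"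
proof -
  let ?Q = "\<lambda>K x. norm (fst x - snd x) \<le> K * norm (par P k (fst x) - par P k (snd x))"
  have "\<exists>K>0. \<forall>x\<in>ref_triangle \<times> ref_triangle. ?Q K x"
  proof (rule compact_uniform_constant)
    show "compact (ref_triangle \<times> ref_triangle)" by (intro compact_Times compact_ref_triangle)
    show "?Q K' x" if "?Q K x" "K \<le> K'" for K K' x
      using that mult_right_mono[of K K' "norm (par P k (fst x) - par P k (snd x))"] by auto
    fix x :: "(real^2) \<times> (real^2)" assume x: "x \<in> ref_triangle \<times> ref_triangle"
    obtain u u' where xu: "x = (u, u')" by (cases x)
    show "\<exists>K. \<exists>e>0. \<forall>x'\<in>ref_triangle \<times> ref_triangle. dist x' x < e \<longrightarrow> ?Q K x'"
    proof (cases "u = u'")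
      case True
      then obtain K e where Ke: "e > 0" "\<And>v v'. v \<in> ref_triangle \<inter> ball u e \<Longrightarrow> v' \<in> ref_triangle \<inter> ball u e \<Longrightarrow>
           norm (v - v') \<le> K * norm (par P k v - par P k v')"
        using par_inverse_lipschitz_local[OF k, of u] x xu by (metis mem_Sigma_iff)
      have "?Q K x'" if "x' \<in> ref_triangle \<times> ref_triangle" "dist x' x < e" for x'
        using that True Ke(2)[of "fst x'" "snd x'"] dist_fst_le[of x' x] dist_snd_le[of x' x]
        by (auto simp: xu dist_commute)
      then show ?thesis using Ke(1) by blast
    next
      case False
      define m where "m = norm (par P k u - par P k u')"
      have m: "m > 0" using False inj_par[OF k] x xu by (auto simp: m_def inj_on_def)
      define N where "N x = norm (par P k (fst x) - par P k (snd x))" for x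
      have "continuous_on (ref_triangle \<times> ref_triangle) N"
        unfolding N_def by (intro continuous_intros continuous_on_compose2[OF continuous_par[OF k]]) auto
      then obtain e where e0: "e > 0" "\<forall>x'\<in>ref_triangle \<times> ref_triangle. dist x' x < e \<longrightarrow> dist (N x') (N x) < m / 2"
        unfolding continuous_on_iff using x half_gt_zero[OF m] by meson
      then have e: "e > 0" "\<And>x'. x' \<in> ref_triangle \<times> ref_triangle \<Longrightarrow> dist x' x < e \<Longrightarrow>
          \<bar>norm (par P k (fst x') - par P k (snd x')) - m\<bar> < m / 2"
        by (auto simp: dist_real_def N_def m_def xu)
      \<comment> \<open>The parameters differ by at most 4, while the images differ by at least
        \<open>m / 2\<close>.\<close>
      have "?Q (8 / m) x'" if x': "x' \<in> ref_triangle \<times> ref_triangle" "dist x' x < e" for x'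
      proof -
        have "norm (fst x' - snd x') \<le> norm (fst x') + norm (snd x')" by (rule norm_triangle_ineq4)
        also have "\<dots> \<le> 4" using x' norm_ref_triangle_le[of "fst x'"] norm_ref_triangle_le[of "snd x'"] by auto
        finally have "norm (fst x' - snd x') \<le> 4" .
        moreover have "m / 2 \<le> norm (par P k (fst x') - par P k (snd x'))"
          using e(2)[OF x'] by linarith
        then have "8 / m * (m / 2) \<le> 8 / m * norm (par P k (fst x') - par P k (snd x'))"
          using m by (intro mult_left_mono) auto
        ultimately show ?thesis using m by simp
      qed
      then show ?thesis using e(1) by blast
    qed
  qed
  then show ?thesis by fastforce
qed

lemma uniform_over_patches:
  fixes Q :: "real \<Rightarrow> nat \<Rightarrow> bool"
  assumes "\<And>K K' k. Q K k \<Longrightarrow> K \<le> K' \<Longrightarrow> Q K' k" "\<And>k. k < n_patch P \<Longrightarrow> \<exists>K>0. Q K k"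
  shows "\<exists>K>0. \<forall>k<n_patch P. Q K k"
proof -
  obtain K where K: "\<And>k. k < n_patch P \<Longrightarrow> K k > 0 \<and> Q (K k) k" using assms(2) by metis
  have "Q (Max (K ` {..<n_patch P})) k" if "k < n_patch P" for k
  proof (rule assms(1))
    show "Q (K k) k" using K that by blast
    show "K k \<le> Max (K ` {..<n_patch P})" using that by (intro Max_ge) auto
  qed
  moreover have "0 < Max (K ` {..<n_patch P})"
    using K n_patch_pos by (subst Max_gr_iff) auto
  ultimately show ?thesis by blast
qed

lemma par_inverse_lipschitz:
  "\<exists>K>0. \<forall>k<n_patch P. \<forall>v\<in>ref_triangle. \<forall>v'\<in>ref_triangle. norm (v - v') \<le> K * norm (par P k v - par P k v')"
  by (rule uniform_over_patches[OF _ par_inverse_lipschitz_each])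
     (meson mult_right_mono norm_ge_zero order.trans)

lemma frontier_locally_quasiconvex:
  assumes "p \<in> Gam P"
  shows "\<exists>K \<rho>. 0 < \<rho> \<and> (\<forall>x\<in>Gam P \<inter> ball p \<rho>. \<forall>y\<in>Gam P \<inter> ball p \<rho>.
      \<exists>S. connected S \<and> S \<subseteq> Gam P \<and> x \<in> S \<and> y \<in> S \<and> (\<forall>z\<in>S. norm (x - z) \<le> K * norm (x - y)))"
proof -
  have op: "open (domain_of P)" and L: "\<exists>\<rho>>0. \<exists>e g K. norm e = 1 \<and> K-lipschitz_on {z. z \<bullet> e = 0} g \<and>
        domain_of P \<inter> ball p \<rho> = {y \<in> ball p \<rho>. g (y - (y \<bullet> e) *\<^sub>R e) < y \<bullet> e}"
    using bem assms by (auto simp: bem_setup_def lipschitz_domain_def Gam_def)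
  then obtain \<rho> e g K where *: "0 < \<rho>" "norm e = 1" "K-lipschitz_on {z. z \<bullet> e = 0} g"
      "domain_of P \<inter> ball p \<rho> = {y \<in> ball p \<rho>. g (y - (y \<bullet> e) *\<^sub>R e) < y \<bullet> e}"
    by blast
  show ?thesis
    using segment_in_frontier_graph[OF op *(2,3,1,4)] unfolding Gam_def by blast
qed

text \<open>On the surface one cannot pass from one patch to another without crossing the edge of
  the first. If \<open>x\<close> and \<open>y\<close> are close, a connected subset of the surface
  of size comparable to their distance joins them, and it contains a point that the first patch
  shares with some other patch; such a point has no parameter in the open triangle. If
  \<open>x\<close> and \<open>y\<close> stay apart, any edge point will do.\<close>

lemma boundary_point_between_patches_each:
  assumes k: "k < n_patch P" and k': "k' < n_patch P" and ne: "k \<noteq> k'"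
  shows "\<exists>K>0. \<forall>x\<in>par P k ` ref_triangle. \<forall>y\<in>par P k' ` ref_triangle.
           \<exists>u\<in>ref_triangle. u \<notin> tri_int \<and> norm (x - par P k u) \<le> K * norm (x - y)"
proof -
  let ?A = "par P k ` ref_triangle \<times> par P k' ` ref_triangle"
  let ?Q = "\<lambda>K x. \<exists>u\<in>ref_triangle. u \<notin> tri_int \<and> norm (fst x - par P k u) \<le> K * norm (fst x - snd x)"
  have sub: "par P k ` ref_triangle \<subseteq> Gam P" "par P k' ` ref_triangle \<subseteq> Gam P"
    using k k' unfolding Gam_eq by auto
  have bd: "u \<notin> tri_int" if "par P k u \<in> par P j ` ref_triangle" "j < n_patch P" "j \<noteq> k" for u j
    using par_interior_disjoint[OF k that(2)] that by blast
  have "\<exists>K>0. \<forall>x\<in>?A. ?Q K x"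
  proof (rule compact_uniform_constant)
    show "compact ?A" by (intro compact_Times compact_par k k')
    show "?Q K' x" if "?Q K x" "K \<le> K'" for K K' x
      using that by (meson mult_right_mono norm_ge_zero order.trans)
    fix x0 assume x0: "x0 \<in> ?A"
    obtain p q where pq: "x0 = (p, q)" by (cases x0)
    show "\<exists>K. \<exists>e>0. \<forall>x\<in>?A. dist x x0 < e \<longrightarrow> ?Q K x"
    proof (cases "p = q")
      case True
      have "p \<in> Gam P" using x0 pq sub by auto
      from frontier_locally_quasiconvex[OF this]
      obtain K \<rho> where K: "0 < \<rho>" "\<forall>x\<in>Gam P \<inter> ball p \<rho>. \<forall>y\<in>Gam P \<inter> ball p \<rho>.
          \<exists>S. connected S \<and> S \<subseteq> Gam P \<and> x \<in> S \<and> y \<in> S \<and> (\<forall>z\<in>S. norm (x - z) \<le> K * norm (x - y))"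
        by (elim exE conjE)
      have "?Q K (x, y)" if x: "x \<in> par P k ` ref_triangle" and y: "y \<in> par P k' ` ref_triangle"
        and d: "dist (x, y) x0 < \<rho>" for x y
      proof -
        have "x \<in> Gam P \<inter> ball p \<rho>" "y \<in> Gam P \<inter> ball p \<rho>"
          using x y sub d dist_fst_le[of "(x, y)" x0] dist_snd_le[of "(x, y)" x0] True
          by (auto simp: pq dist_commute)
        then have "\<exists>S. connected S \<and> S \<subseteq> Gam P \<and> x \<in> S \<and> y \<in> S \<and> (\<forall>z\<in>S. norm (x - z) \<le> K * norm (x - y))"
          by (rule K(2)[THEN bspec, THEN bspec])
        then obtain S where S: "connected S" "S \<subseteq> Gam P" "x \<in> S" "y \<in> S" "\<forall>z\<in>S. norm (x - z) \<le> K * norm (x - y)"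
          by (elim exE conjE)
        \<comment> \<open>The crossing may lead into a third patch, so the complement of patch
          \<open>k\<close> is covered by all other patches together. Two closed sets that cover the
          connected \<open>S\<close> and both meet it must meet inside it.\<close>
        let ?C = "\<Union>j\<in>{..<n_patch P} - {k}. par P j ` ref_triangle"
        have "closed (par P k ` ref_triangle)" using compact_par[OF k] compact_imp_closed by blast
        moreover have "closed ?C" using compact_par compact_imp_closed by (intro closed_UN) auto
        moreover have "S \<subseteq> par P k ` ref_triangle \<union> ?C" using S(2) unfolding Gam_eq by blast
        moreover have "par P k ` ref_triangle \<inter> S \<noteq> {}" using x S by blast
        moreover have "?C \<inter> S \<noteq> {}" using y S k' ne by blast
        ultimately have "par P k ` ref_triangle \<inter> ?C \<inter> S \<noteq> {}"
          using connected_closedD[OF S(1), of "par P k ` ref_triangle" ?C] by metis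
        then obtain z where z: "z \<in> par P k ` ref_triangle" "z \<in> ?C" "z \<in> S" by blast
        obtain u where "u \<in> ref_triangle" "z = par P k u" using z(1) by (rule imageE)
        moreover obtain j where "j < n_patch P" "j \<noteq> k" "z \<in> par P j ` ref_triangle"
          using z(2) by (metis DiffE UN_E lessThan_iff singletonI)
        ultimately have u: "u \<in> ref_triangle" "par P k u \<in> S" "par P k u \<in> par P j ` ref_triangle" "j < n_patch P" "j \<noteq> k"
          using z(3) by simp_all
        then show ?thesis using S(5)[THEN bspec, OF u(2)] bd[OF u(3-5)] by auto
      qed
      then have "\<forall>x\<in>?A. dist x x0 < \<rho> \<longrightarrow> ?Q K x" by (metis mem_Sigma_iff prod.collapse)
      then show ?thesis using K(1) by (intro exI[of _ K] exI[of _ \<rho>] conjI)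
    next
      case False
      define \<delta> where "\<delta> = norm (p - q)"
      have \<delta>: "\<delta> > 0" using False by (simp add: \<delta>_def)
      obtain D where D: "\<And>x. x \<in> par P k ` ref_triangle \<Longrightarrow> norm x \<le> D"
        using compact_imp_bounded[OF compact_par[OF k]] unfolding bounded_iff by blast
      \<comment> \<open>The numerator is at most \<open>2 * D\<close> and the denominator at least
        \<open>\<delta> / 2\<close>. The parameter 0 is a vertex of the triangle.\<close>
      have "?Q (4 * D / \<delta>) x" if x: "x \<in> ?A" "dist x x0 < \<delta> / 4" for x
      proof (intro bexI conjI)
        have "dist (fst x) p < \<delta> / 4" "dist (snd x) q < \<delta> / 4"
          using x dist_fst_le[of x x0] dist_snd_le[of x x0] by (auto simp: pq)
        then have "\<delta> \<le> norm (fst x - snd x) + \<delta> / 2"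
          using dist_triangle[of p q "fst x"] dist_triangle[of "fst x" q "snd x"]
          by (auto simp: \<delta>_def dist_norm norm_minus_commute)
        then have "\<delta> / 2 \<le> norm (fst x - snd x)" by simp
        moreover have "0 \<le> D" using x(1) D by (metis mem_Times_iff norm_ge_zero order.trans)
        ultimately have "4 * D / \<delta> * (\<delta> / 2) \<le> 4 * D / \<delta> * norm (fst x - snd x)"
          using \<delta> by (intro mult_left_mono) auto
        moreover have "norm (fst x - par P k 0) \<le> D + D"
          using x zero_in_ref_triangle by (intro order.trans[OF norm_triangle_ineq4] add_mono D) auto
        ultimately show "norm (fst x - par P k 0) \<le> 4 * D / \<delta> * norm (fst x - snd x)"
          using \<delta> by simp
      qed (use zero_in_ref_triangle in auto)
      then show ?thesis using \<delta> by (intro exI[of _ "4 * D / \<delta>"] exI[of _ "\<delta> / 4"]) auto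
    qed
  qed
  then show ?thesis by fastforce
qed

lemma boundary_point_between_patches:
  "\<exists>K>0. \<forall>k<n_patch P. \<forall>k'<n_patch P. k \<noteq> k' \<longrightarrow> (\<forall>x\<in>par P k ` ref_triangle. \<forall>y\<in>par P k' ` ref_triangle.
      \<exists>u\<in>ref_triangle. u \<notin> tri_int \<and> norm (x - par P k u) \<le> K * norm (x - y))"
proof -
  let ?Q = "\<lambda>K k k'. k \<noteq> k' \<longrightarrow> (\<forall>x\<in>par P k ` ref_triangle. \<forall>y\<in>par P k' ` ref_triangle.
      \<exists>u\<in>ref_triangle. u \<notin> tri_int \<and> norm (x - par P k u) \<le> K * norm (x - y))"
  have mono: "?Q K k k' \<Longrightarrow> K \<le> K' \<Longrightarrow> ?Q K' k k'" for K K' k k'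
    using mult_right_mono[of K K' "norm _"] by (meson norm_ge_zero order.trans)
  have *: "\<exists>K>0. \<forall>k'<n_patch P. ?Q K k k'" if "k < n_patch P" for k
  proof (rule uniform_over_patches)
    show "?Q K k k' \<Longrightarrow> K \<le> K' \<Longrightarrow> ?Q K' k k'" for K K' k' by (rule mono)
    show "\<exists>K>0. ?Q K k k'" if "k' < n_patch P" for k'
      using boundary_point_between_patches_each[OF \<open>k < n_patch P\<close> that]
      by (cases "k = k'") (auto intro: exI[of _ 1])
  qed
  show ?thesis
  proof (rule uniform_over_patches)
    fix K K' k assume "\<forall>k'<n_patch P. ?Q K k k'" "K \<le> K'"
    then show "\<forall>k'<n_patch P. ?Q K' k k'" using mono[of k _ K K'] by simp
  qed (rule *)
qed

section \<open>The area element\<close>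

definition jac :: "nat \<Rightarrow> real^2 \<Rightarrow> real" where
  "jac k u = norm (cross3 (dpar P k u (axis 1 1)) (dpar P k u (axis 2 1)))"

lemma continuous_jac: "k < n_patch P \<Longrightarrow> continuous_on ref_triangle (jac k)"
  unfolding jac_def by (intro continuous_intros continuous_on_cross continuous_dpar)

text \<open>The derivative is injective, so the two tangent vectors are linearly independent and
  their cross product is nonzero.\<close>

lemma jac_pos:
  assumes k: "k < n_patch P" and u: "u \<in> ref_triangle"
  shows "0 < jac k u"
proof -
  define L where "L = dpar P k u"
  have L: "linear L" "inj L" using linear_dpar inj_dpar k u by (auto simp: L_def)
  have inj: "x = y" if "L x = L y" for x y using L(2) that by (auto simp: inj_def)
  have a: "axis 1 1 \<noteq> (0::real^2)" "axis 2 1 \<noteq> (0::real^2)" "axis 2 1 \<noteq> c *\<^sub>R (axis 1 1 :: real^2)" for c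
    by (auto simp: axis_eq_0_iff vec_eq_iff axis_def exI[of _ 2])
  have "L (axis 1 1) \<noteq> 0" "L (axis 2 1) \<noteq> 0" "L (axis 2 1) \<noteq> c *\<^sub>R L (axis 1 1)" for c
    using a inj[of _ 0] inj[of "axis 2 1" "c *\<^sub>R axis 1 1"] linear_0[OF L(1)] linear_scale[OF L(1)] by metis+
  then have "cross3 (L (axis 1 1)) (L (axis 2 1)) \<noteq> 0"
    by (auto simp: cross_eq_0 collinear_lemma)
  then show ?thesis by (simp add: jac_def L_def)
qed

lemma jac_bounds: "\<exists>m M. 0 < m \<and> 0 < M \<and> (\<forall>k<n_patch P. \<forall>u\<in>ref_triangle. m \<le> jac k u \<and> jac k u \<le> M)"
proof -
  have "\<exists>M>0. \<forall>k<n_patch P. \<forall>u\<in>ref_triangle. jac k u \<le> M"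
  proof (rule uniform_over_patches)
    fix k assume k: "k < n_patch P"
    obtain b where b: "b \<in> ref_triangle" "\<And>u. u \<in> ref_triangle \<Longrightarrow> jac k u \<le> jac k b"
      using continuous_attains_sup[OF compact_ref_triangle _ continuous_jac[OF k]] zero_in_ref_triangle by blast
    then show "\<exists>M>0. \<forall>u\<in>ref_triangle. jac k u \<le> M" using jac_pos[OF k b(1)] by blast
  qed force
  \<comment> \<open>The lower bound is phrased with a large constant on the right, because
    \<open>uniform_over_patches\<close> takes the maximum over the patches.\<close>
  moreover have "\<exists>K>0. \<forall>k<n_patch P. \<forall>u\<in>ref_triangle. 1 \<le> K * jac k u"
  proof (rule uniform_over_patches)
    fix k assume k: "k < n_patch P"
    obtain a where a: "a \<in> ref_triangle" "\<And>u. u \<in> ref_triangle \<Longrightarrow> jac k a \<le> jac k u"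
      using continuous_attains_inf[OF compact_ref_triangle _ continuous_jac[OF k]] zero_in_ref_triangle by blast
    then show "\<exists>K>0. \<forall>u\<in>ref_triangle. 1 \<le> K * jac k u"
      using jac_pos[OF k a(1)] by (intro exI[of _ "1 / jac k a"]) (auto simp: field_simps)
  next
    fix K K' k assume "\<forall>u\<in>ref_triangle. 1 \<le> K * jac k u" "K \<le> K'"
    then show "\<forall>u\<in>ref_triangle. 1 \<le> K' * jac k u"
      using mult_right_mono[of K K' "jac k _"] unfolding jac_def by (meson norm_ge_zero order.trans mult_right_mono)
  qed
  ultimately obtain M K where "0 < M" "0 < K" "\<forall>k<n_patch P. \<forall>u\<in>ref_triangle. jac k u \<le> M"
      "\<forall>k<n_patch P. \<forall>u\<in>ref_triangle. 1 \<le> K * jac k u"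
    by blast
  then show ?thesis by (intro exI[of _ "1 / K"] exI[of _ M]) (auto simp: field_simps)
qed

end

section \<open>The surface measure\<close>

context heat_bem_setup
begin

lemma ref_triangle_borel[measurable]: "ref_triangle \<in> sets borel"
  using compact_ref_triangle by (simp add: borel_compact)

lemma tri_int_borel[measurable]: "tri_int \<in> sets borel"
  using open_tri_int by simp

lemma measurable_on_ref_triangle:
  assumes "continuous_on ref_triangle f"
  shows "f \<in> measurable (restrict_space lborel ref_triangle) borel"
proof -
  have "f \<in> measurable (restrict_space borel ref_triangle) borel"
    by (rule borel_measurable_continuous_on_restrict[OF assms])
  then show ?thesis
    by (subst measurable_cong_sets[OF sets_restrict_space_cong[OF sets_lborel] refl])
qed

abbreviation param_meas :: "(nat \<times> (real^2)) measure" where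
  "param_meas \<equiv> count_space {..<n_patch P} \<Otimes>\<^sub>M restrict_space lborel ref_triangle"

lemma measurable_par[measurable]: "(\<lambda>(k, u). par P k u) \<in> measurable param_meas borel"
  using continuous_par by (intro measurable_pair_measure_countable1) (auto intro!: measurable_on_ref_triangle)

lemma measurable_jac[measurable]: "(\<lambda>(k, u). jac k u) \<in> measurable param_meas borel"
  using continuous_jac by (intro measurable_pair_measure_countable1) (auto intro!: measurable_on_ref_triangle)

lemma sets_surf[measurable_cong, simp]: "sets (surf P) = sets borel"
  and space_surf[simp]: "space (surf P) = UNIV"
  by (simp_all add: surf_def)

lemma nn_integral_surf:
  assumes [measurable]: "F \<in> borel_measurable borel"
  shows "(\<integral>\<^sup>+x. F x \<partial>surf P)
    = (\<Sum>k<n_patch P. \<integral>\<^sup>+u. (ennreal (jac k u) * F (par P k u)) * indicator ref_triangle u \<partial>lborel)"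
proof -
  interpret T: sigma_finite_measure "restrict_space lborel ref_triangle"
    by (intro sigma_finite_measure_restrict_space) (auto simp: lborel.sigma_finite_measure_axioms)
  have [measurable]: "(\<lambda>(k, u). ennreal (jac k u)) \<in> borel_measurable param_meas"
    using measurable_compose[OF measurable_jac measurable_ennreal] by (simp add: case_prod_unfold)
  have "(\<integral>\<^sup>+x. F x \<partial>surf P)
      = (\<integral>\<^sup>+z. (case z of (k, u) \<Rightarrow> ennreal (jac k u)) * F (case z of (k, u) \<Rightarrow> par P k u) \<partial>param_meas)"
    unfolding surf_def jac_def[symmetric] by (simp add: nn_integral_distr nn_integral_density)
  also have "\<dots> = (\<integral>\<^sup>+k. \<integral>\<^sup>+u. ennreal (jac k u) * F (par P k u) \<partial>restrict_space lborel ref_triangle \<partial>count_space {..<n_patch P})"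
    by (subst T.nn_integral_fst[symmetric]) auto
  also have "\<dots> = (\<Sum>k<n_patch P. \<integral>\<^sup>+u. (ennreal (jac k u) * F (par P k u)) * indicator ref_triangle u \<partial>lborel)"
    by (simp add: nn_integral_count_space_finite nn_integral_restrict_space)
  finally show ?thesis .
qed

lemma measurable_par_indicator[measurable]:
  fixes F :: "real^3 \<Rightarrow> ennreal"
  assumes "k < n_patch P" "F \<in> borel_measurable borel"
  shows "(\<lambda>u. F (par P k u) * indicator ref_triangle u) \<in> borel_measurable borel"
proof -
  have "(\<lambda>u. F (par P k u)) \<in> borel_measurable (restrict_space lborel ref_triangle)"
    using assms by (intro measurable_compose[OF measurable_on_ref_triangle[OF continuous_par]])
  then show ?thesis
    by (subst (asm) borel_measurable_restrict_space_iff_ennreal) auto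
qed

text \<open>With a density between two positive constants, surface integrals may be exchanged for
  plane Lebesgue integrals over the reference triangle. This direction serves the norm bounds,
  \<open>surf_lower\<close> the coercivity.\<close>

lemma surf_upper:
  "\<exists>M>0. \<forall>F. F \<in> borel_measurable borel \<longrightarrow> (\<integral>\<^sup>+x. F x \<partial>surf P)
     \<le> ennreal M * (\<Sum>k<n_patch P. \<integral>\<^sup>+u. F (par P k u) * indicator ref_triangle u \<partial>lborel)"
proof -
  obtain m M where M: "0 < M" "\<And>k u. k < n_patch P \<Longrightarrow> u \<in> ref_triangle \<Longrightarrow> jac k u \<le> M"
    using jac_bounds by blast
  have "(\<integral>\<^sup>+x. F x \<partial>surf P) \<le> ennreal M * (\<Sum>k<n_patch P. \<integral>\<^sup>+u. F (par P k u) * indicator ref_triangle u \<partial>lborel)"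
    if F: "F \<in> borel_measurable borel" for F
    unfolding nn_integral_surf[OF F] sum_distrib_left
  proof (intro sum_mono)
    fix k assume k: "k \<in> {..<n_patch P}"
    have "(\<integral>\<^sup>+u. (ennreal (jac k u) * F (par P k u)) * indicator ref_triangle u \<partial>lborel)
        \<le> (\<integral>\<^sup>+u. ennreal M * (F (par P k u) * indicator ref_triangle u) \<partial>lborel)"
      using M k by (intro nn_integral_mono) (auto split: split_indicator intro!: mult_right_mono ennreal_leI)
    also have "\<dots> = ennreal M * (\<integral>\<^sup>+u. F (par P k u) * indicator ref_triangle u \<partial>lborel)"
      using k F by (intro nn_integral_cmult) auto
    finally show "(\<integral>\<^sup>+u. (ennreal (jac k u) * F (par P k u)) * indicator ref_triangle u \<partial>lborel)
        \<le> ennreal M * (\<integral>\<^sup>+u. F (par P k u) * indicator ref_triangle u \<partial>lborel)" .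
  qed
  then show ?thesis using M(1) by blast
qed

lemma surf_lower:
  "\<exists>m>0. \<forall>F. F \<in> borel_measurable borel \<longrightarrow>
     ennreal m * (\<Sum>k<n_patch P. \<integral>\<^sup>+u. F (par P k u) * indicator ref_triangle u \<partial>lborel) \<le> (\<integral>\<^sup>+x. F x \<partial>surf P)"
proof -
  obtain m M where m: "0 < m" "\<And>k u. k < n_patch P \<Longrightarrow> u \<in> ref_triangle \<Longrightarrow> m \<le> jac k u"
    using jac_bounds by blast
  have "ennreal m * (\<Sum>k<n_patch P. \<integral>\<^sup>+u. F (par P k u) * indicator ref_triangle u \<partial>lborel) \<le> (\<integral>\<^sup>+x. F x \<partial>surf P)"
    if F: "F \<in> borel_measurable borel" for F
    unfolding nn_integral_surf[OF F] sum_distrib_left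
  proof (intro sum_mono)
    fix k assume k: "k \<in> {..<n_patch P}"
    have "ennreal m * (\<integral>\<^sup>+u. F (par P k u) * indicator ref_triangle u \<partial>lborel)
        = (\<integral>\<^sup>+u. ennreal m * (F (par P k u) * indicator ref_triangle u) \<partial>lborel)"
      using k F by (intro nn_integral_cmult[symmetric]) auto
    also have "\<dots> \<le> (\<integral>\<^sup>+u. (ennreal (jac k u) * F (par P k u)) * indicator ref_triangle u \<partial>lborel)"
      using m k by (intro nn_integral_mono) (auto split: split_indicator intro!: mult_right_mono ennreal_leI)
    finally show "ennreal m * (\<integral>\<^sup>+u. F (par P k u) * indicator ref_triangle u \<partial>lborel)
      \<le> (\<integral>\<^sup>+u. (ennreal (jac k u) * F (par P k u)) * indicator ref_triangle u \<partial>lborel)" .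
  qed
  then show ?thesis using m(1) by blast
qed

lemma emeasure_ref_triangle_finite: "emeasure lborel ref_triangle < \<infinity>"
  using compact_ref_triangle by (rule emeasure_compact_finite)

lemma finite_measure_surf: "finite_measure (surf P)"
proof (rule finite_measureI)
  obtain M where M: "\<And>F. F \<in> borel_measurable borel \<Longrightarrow> (\<integral>\<^sup>+x. F x \<partial>surf P)
     \<le> ennreal M * (\<Sum>k<n_patch P. \<integral>\<^sup>+u. F (par P k u) * indicator ref_triangle u \<partial>lborel)"
    using surf_upper by blast
  have "emeasure (surf P) (space (surf P)) = (\<integral>\<^sup>+x. 1 \<partial>surf P)" by simp
  also have "\<dots> \<le> ennreal M * (\<Sum>k<n_patch P. emeasure lborel ref_triangle)"
    using M[of "\<lambda>_. 1"] by simp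
  also have "\<dots> < \<infinity>" using emeasure_ref_triangle_finite
    by (auto simp: ennreal_mult_less_top of_nat_less_top)
  finally show "emeasure (surf P) (space (surf P)) \<noteq> \<infinity>" by simp
qed

sublocale surf: finite_measure "surf P"
  by (rule finite_measure_surf)

lemma compact_Gam: "compact (Gam P)"
  unfolding Gam_eq by (intro compact_UN) (auto intro: compact_par)

text \<open>\<open>surf\<close> is a measure on the ambient space, while the pointwise difference
  bounds hold for points of the surface.\<close>

lemma AE_surf_Gam: "AE x in surf P. x \<in> Gam P"
proof -
  have [measurable]: "Gam P \<in> sets borel" using compact_Gam by (simp add: borel_compact)
  have "(\<integral>\<^sup>+x. indicator (- Gam P) x \<partial>surf P)
      = (\<Sum>k<n_patch P. \<integral>\<^sup>+u. (ennreal (jac k u) * indicator (- Gam P) (par P k u)) * indicator ref_triangle u \<partial>lborel)"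
    by (rule nn_integral_surf) measurable
  also have "\<dots> = (\<Sum>k<n_patch P. \<integral>\<^sup>+(u::real^2). 0 \<partial>lborel)"
    by (intro sum.cong nn_integral_cong refl) (auto simp: Gam_eq split: split_indicator)
  finally have "(\<integral>\<^sup>+x. indicator (- Gam P) x \<partial>surf P) = 0" by simp
  then have "emeasure (surf P) (- Gam P) = 0" by simp
  then show ?thesis by (intro AE_I'[of "- Gam P"]) (auto simp: null_sets_def)
qed

text \<open>On each patch the kernel is compared with \<open>1 / norm (v - u)\<close> in the
  parameter plane, which is integrable. The bound is uniform in \<open>x\<close>, which may lie
  anywhere in space.\<close>

lemma surf_kernel_bound:
  "\<exists>C>0. \<forall>x. (\<integral>\<^sup>+y. ennreal (1 / norm (x - y)) \<partial>surf P) \<le> ennreal C"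
proof -
  obtain M where M: "M > 0" "\<And>F. F \<in> borel_measurable borel \<Longrightarrow> (\<integral>\<^sup>+x. F x \<partial>surf P)
     \<le> ennreal M * (\<Sum>k<n_patch P. \<integral>\<^sup>+u. F (par P k u) * indicator ref_triangle u \<partial>lborel)"
    using surf_upper by blast
  obtain K where K: "K > 0" "\<And>k v v'. k < n_patch P \<Longrightarrow> v \<in> ref_triangle \<Longrightarrow> v' \<in> ref_triangle \<Longrightarrow>
      norm (v - v') \<le> K * norm (par P k v - par P k v')"
    using par_inverse_lipschitz by blast
  have each: "(\<integral>\<^sup>+u. ennreal (1 / norm (x - par P k u)) * indicator ref_triangle u \<partial>lborel) \<le> ennreal (2 * K * 64)"
    if k: "k < n_patch P" for x k
  proof -
    \<comment> \<open>The inverse Lipschitz bound needs a point of the patch. Passing from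
      \<open>x\<close> to its nearest point \<open>z\<close> on the patch at most doubles distances
      to points of the patch.\<close>
    obtain z where z: "z \<in> par P k ` ref_triangle" "\<And>y. y \<in> par P k ` ref_triangle \<Longrightarrow> dist x z \<le> dist x y"
      using distance_attains_inf[of "par P k ` ref_triangle" x] compact_par[OF k] compact_imp_closed zero_in_ref_triangle
      by (metis empty_iff image_eqI)
    then obtain v where v: "v \<in> ref_triangle" "z = par P k v" by blast
    have le: "norm (v - u) \<le> 2 * K * norm (x - par P k u)" if u: "u \<in> ref_triangle" for u
    proof -
      have "norm (v - u) \<le> K * norm (z - par P k u)" using K(2)[OF k v(1) u] v by simp
      also have "norm (z - par P k u) \<le> norm (x - z) + norm (x - par P k u)"
        using norm_triangle_ineq4[of "x - par P k u" "x - z"] by (simp add: algebra_simps)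
      also have "norm (x - z) \<le> norm (x - par P k u)" using z(2)[of "par P k u"] u by (simp add: dist_norm)
      finally show ?thesis using K(1) by simp
    qed
    have "(\<integral>\<^sup>+u. ennreal (1 / norm (x - par P k u)) * indicator ref_triangle u \<partial>lborel)
        \<le> (\<integral>\<^sup>+u. ennreal (2 * K) * (ennreal (1 / norm (v - u)) * indicator (cball v 4) u) \<partial>lborel)"
    \<comment> \<open>The point \<open>v\<close> is excluded because the right-hand side is 1 / 0 =
      0 there.\<close>
    proof (intro nn_integral_mono_AE, use AE_lborel_singleton[of v] in eventually_elim)
      fix u assume uv: "u \<noteq> v"
      show "ennreal (1 / norm (x - par P k u)) * indicator ref_triangle u
          \<le> ennreal (2 * K) * (ennreal (1 / norm (v - u)) * indicator (cball v 4) u)"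
      proof (cases "u \<in> ref_triangle")
        case True
        have "norm (v - u) \<le> norm v + norm u" by (rule norm_triangle_ineq4)
        then have "u \<in> cball v 4"
          using norm_ref_triangle_le[OF True] norm_ref_triangle_le[OF v(1)] by (simp add: dist_norm)
        moreover have "1 / norm (x - par P k u) \<le> 2 * K * (1 / norm (v - u))"
        \<comment> \<open>If \<open>x\<close> is the image of \<open>u\<close>, the left-hand side
          is 1 / 0 = 0.\<close>
        proof (cases "x = par P k u")
          case False
          then show ?thesis using le[OF True] uv K(1) by (simp add: field_simps)
        qed (use K in simp)
        ultimately show ?thesis using True K(1)
          by (simp add: ennreal_leI del: mem_cball flip: ennreal_mult)
      qed simp
    qed
    also have "\<dots> = ennreal (2 * K) * (\<integral>\<^sup>+u. ennreal (1 / norm (v - u)) * indicator (cball v 4) u \<partial>lborel)"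
    proof (intro nn_integral_cmult)
      have [measurable]: "cball v 4 \<in> sets borel" by (intro borel_closed closed_cball)
      show "(\<lambda>u. ennreal (1 / norm (v - u)) * indicator (cball v 4) u) \<in> borel_measurable lborel"
        by measurable
    qed
    also have "\<dots> \<le> ennreal (2 * K) * ennreal (16 * 4)"
      by (intro mult_left_mono nn_integral_inverse_norm_plane_le) auto
    also have "\<dots> = ennreal (2 * K * 64)" using K(1) by (subst ennreal_mult[symmetric]) auto
    finally show ?thesis .
  qed
  have "(\<integral>\<^sup>+y. ennreal (1 / norm (x - y)) \<partial>surf P) \<le> ennreal (M * (real (n_patch P) * (2 * K * 64)))" for x
  proof -
    have "(\<integral>\<^sup>+y. ennreal (1 / norm (x - y)) \<partial>surf P)
       \<le> ennreal M * (\<Sum>k<n_patch P. \<integral>\<^sup>+u. ennreal (1 / norm (x - par P k u)) * indicator ref_triangle u \<partial>lborel)"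
      by (rule M(2)) measurable
    also have "\<dots> \<le> ennreal M * (\<Sum>k<n_patch P. ennreal (2 * K * 64))"
      using each by (intro mult_left_mono sum_mono) auto
    also have "\<dots> = ennreal (M * (real (n_patch P) * (2 * K * 64)))"
      using M K by (simp add: ennreal_mult ennreal_of_nat_eq_real_of_nat)
    finally show ?thesis .
  qed
  then show ?thesis using M(1) K(1) n_patch_pos
    by (intro exI[of _ "M * (real (n_patch P) * (2 * K * 64))"]) auto
qed

end

section \<open>The refined patches\<close>

text \<open>The scaling factor carries a sign because the middle triangle is reflected.\<close>

lemma sub_triangle_affine: "\<exists>a s. \<bar>s\<bar> = 1/2 \<and> (\<forall>u. sub_triangle q u = a + s *\<^sub>R u)"
proof -
  consider "q = 0" | "q = 1" | "q = 2" | "q \<noteq> 0" "q \<noteq> 1" "q \<noteq> 2" by blast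
  then show ?thesis
  proof cases
    case 1
    then show ?thesis by (intro exI[of _ 0] exI[of _ "1/2"]) (simp add: sub_triangle_def)
  next
    case 2
    then show ?thesis
      by (intro exI[of _ "(1/2) *\<^sub>R axis 1 1"] exI[of _ "1/2"]) (simp add: sub_triangle_def scaleR_add_right)
  next
    case 3
    then show ?thesis
      by (intro exI[of _ "(1/2) *\<^sub>R axis 2 1"] exI[of _ "1/2"]) (simp add: sub_triangle_def scaleR_add_right)
  next
    case 4
    then show ?thesis
      by (intro exI[of _ "(1/2) *\<^sub>R (axis 1 1 + axis 2 1)"] exI[of _ "-(1/2)"])
        (simp add: sub_triangle_def scaleR_diff_right)
  qed
qed

lemma dist_sub_triangle: "norm (sub_triangle q u - sub_triangle q v) = norm (u - v) / 2"
proof -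
  obtain a s where s: "\<bar>s\<bar> = 1/2" "\<And>u. sub_triangle q u = a + s *\<^sub>R u"
    using sub_triangle_affine[of q] by blast
  then have "sub_triangle q u - sub_triangle q v = s *\<^sub>R (u - v)" by (simp add: scaleR_diff_right)
  then show ?thesis using s by simp
qed

lemma surj_sub_triangle: "\<exists>v. sub_triangle q v = u"
proof -
  obtain a s where s: "\<bar>s\<bar> = 1/2" "\<And>u. sub_triangle q u = a + s *\<^sub>R u"
    using sub_triangle_affine[of q] by blast
  then have "sub_triangle q ((1 / s) *\<^sub>R (u - a)) = u" by auto
  then show ?thesis ..
qed

lemma sub_triangle_simps:
  "sub_triangle q u $ 1 = (if q = 0 \<or> q = 2 then u $ 1 / 2 else if q = 1 then (1 + u $ 1) / 2 else (1 - u $ 1) / 2)"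
  "sub_triangle q u $ 2 = (if q = 0 \<or> q = 1 then u $ 2 / 2 else if q = 2 then (1 + u $ 2) / 2 else (1 - u $ 2) / 2)"
  by (simp_all add: sub_triangle_def axis_def)

lemma sub_triangle_ref: "u \<in> ref_triangle \<Longrightarrow> sub_triangle q u \<in> ref_triangle"
  unfolding ref_triangle_def mem_Collect_eq sub_triangle_simps by (auto simp: field_simps)

lemma sub_triangle_int: "u \<in> tri_int \<Longrightarrow> sub_triangle q u \<in> tri_int"
  unfolding tri_int_def mem_Collect_eq sub_triangle_simps by (auto simp: field_simps)

lemma sub_triangle_disjoint:
  assumes "a < 4" "b < 4" "a \<noteq> b" "u \<in> tri_int" "v \<in> ref_triangle"
  shows "sub_triangle a u \<noteq> sub_triangle b v"
proof
  assume eq: "sub_triangle a u = sub_triangle b v"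
  have "False" if "(if a = 0 \<or> a = 2 then x / 2 else if a = 1 then (1 + x) / 2 else (1 - x) / 2)
      = (if b = 0 \<or> b = 2 then x' / 2 else if b = 1 then (1 + x') / 2 else (1 - x') / 2)"
    "(if a = 0 \<or> a = 1 then y / 2 else if a = 2 then (1 + y) / 2 else (1 - y) / 2)
      = (if b = 0 \<or> b = 1 then y' / 2 else if b = 2 then (1 + y') / 2 else (1 - y') / 2)"
    "0 < x" "0 < y" "x + y < 1" "0 \<le> x'" "0 \<le> y'" "x' + y' \<le> 1" for x y x' y' :: real
  proof -
    have "a = 0 \<or> a = 1 \<or> a = 2 \<or> a = 3" "b = 0 \<or> b = 1 \<or> b = 2 \<or> b = 3"
      using assms(1,2) by auto
    then show False using that assms(3) by (elim disjE; simp; linarith)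
  qed
  from this[OF arg_cong[OF eq, of "\<lambda>z. z $ 1", unfolded sub_triangle_simps]
      arg_cong[OF eq, of "\<lambda>z. z $ 2", unfolded sub_triangle_simps]]
  show False using assms(4,5) by (simp add: tri_int_def ref_triangle_def)
qed

context heat_bem_setup
begin

text \<open>A refined patch is the initial patch with index \<open>k div 4 ^ r\<close>, its
  ancestor, precomposed with an affine contraction. Thus the constants of the initial mesh, with
  explicit powers of 2, serve all refinements.\<close>

lemma patch_par_affine:
  "\<exists>a s. \<bar>s\<bar> = (1/2) ^ r \<and> (\<forall>u. patch_par P r k u = par P (k div 4 ^ r) (a + s *\<^sub>R u)) \<and>
     (\<forall>u\<in>ref_triangle. a + s *\<^sub>R u \<in> ref_triangle) \<and> (\<forall>u\<in>tri_int. a + s *\<^sub>R u \<in> tri_int)"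
  proof (induction r arbitrary: k)
    case 0
    show ?case by (intro exI[of _ 0] exI[of _ 1]) simp
  next
    case (Suc r)
    obtain a s where as: "\<bar>s\<bar> = (1/2) ^ r" "\<And>u. patch_par P r (k div 4) u = par P (k div 4 div 4 ^ r) (a + s *\<^sub>R u)"
       "\<And>u. u \<in> ref_triangle \<Longrightarrow> a + s *\<^sub>R u \<in> ref_triangle" "\<And>u. u \<in> tri_int \<Longrightarrow> a + s *\<^sub>R u \<in> tri_int"
      using Suc[of "k div 4"] by blast
    obtain b t where bt: "\<bar>t\<bar> = 1/2" "\<And>u. sub_triangle (k mod 4) u = b + t *\<^sub>R u"
      using sub_triangle_affine[of "k mod 4"] by blast
    have eq: "a + s *\<^sub>R sub_triangle (k mod 4) u = (a + s *\<^sub>R b) + (s * t) *\<^sub>R u" for u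
      by (simp add: bt scaleR_add_right add.assoc)
    show ?case
    proof (intro exI conjI allI ballI)
      show "\<bar>s * t\<bar> = (1/2) ^ Suc r" using as(1) bt(1) by (simp add: abs_mult)
      show "patch_par P (Suc r) k u = par P (k div 4 ^ Suc r) ((a + s *\<^sub>R b) + (s * t) *\<^sub>R u)" for u
        by (simp add: as(2) div_mult2_eq flip: eq)
      show "(a + s *\<^sub>R b) + (s * t) *\<^sub>R u \<in> ref_triangle" if "u \<in> ref_triangle" for u
        unfolding eq[symmetric] by (intro as sub_triangle_ref that)
      show "(a + s *\<^sub>R b) + (s * t) *\<^sub>R u \<in> tri_int" if "u \<in> tri_int" for u
        unfolding eq[symmetric] by (intro as sub_triangle_int that)
    qed
  qed

lemma macro_index: "k < N_s P r \<Longrightarrow> k div 4 ^ r < n_patch P"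
  by (simp add: N_s_def less_mult_imp_div_less)

lemma parent_index: "k < N_s P (Suc r) \<Longrightarrow> k div 4 < N_s P r"
  by (simp add: N_s_def less_mult_imp_div_less)

lemma continuous_patch_par:
  assumes "k < N_s P r"
  shows "continuous_on ref_triangle (patch_par P r k)"
proof -
  obtain a s where as: "\<bar>s\<bar> = (1/2) ^ r" "\<And>u. patch_par P r k u = par P (k div 4 ^ r) (a + s *\<^sub>R u)"
    "\<And>u. u \<in> ref_triangle \<Longrightarrow> a + s *\<^sub>R u \<in> ref_triangle"
    using patch_par_affine[of r k] by metis
  have "continuous_on ref_triangle (\<lambda>u. par P (k div 4 ^ r) (a + s *\<^sub>R u))"
    using as(3) by (intro continuous_on_compose2[OF continuous_par[OF macro_index[OF assms]]] continuous_intros) auto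
  then show ?thesis by (simp only: as(2)[symmetric])
qed

lemma inj_patch_par:
  assumes "k < N_s P r"
  shows "inj_on (patch_par P r k) ref_triangle"
proof (rule inj_onI)
  obtain a s where as: "\<bar>s\<bar> = (1/2) ^ r" "\<And>u. patch_par P r k u = par P (k div 4 ^ r) (a + s *\<^sub>R u)"
    "\<And>u. u \<in> ref_triangle \<Longrightarrow> a + s *\<^sub>R u \<in> ref_triangle"
    using patch_par_affine[of r k] by metis
  fix u v assume "u \<in> ref_triangle" "v \<in> ref_triangle" "patch_par P r k u = patch_par P r k v"
  then have "a + s *\<^sub>R u = a + s *\<^sub>R v"
    using inj_onD[OF inj_par[OF macro_index[OF assms]]] as(2,3) by metis
  moreover have "s \<noteq> 0" using as(1) by auto
  ultimately show "u = v" by simp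
qed

text \<open>Children of one parent are separated in the parameter triangle, where the
  parameterization of the parent is injective; children of different parents are separated by
  induction.\<close>

lemma patch_par_disjoint:
  "k < N_s P r \<Longrightarrow> k' < N_s P r \<Longrightarrow> k \<noteq> k' \<Longrightarrow> u \<in> tri_int \<Longrightarrow> u' \<in> ref_triangle \<Longrightarrow>
    patch_par P r k u \<noteq> patch_par P r k' u'"
proof (induction r arbitrary: k k' u u')
  case 0
  then show ?case using par_interior_disjoint by (simp add: N_s_def)
next
  case (Suc r)
  show ?case
  proof (cases "k div 4 = k' div 4")
    case True
    then have "k mod 4 \<noteq> k' mod 4" using Suc.prems(3) by (metis div_mult_mod_eq)
    then have "sub_triangle (k mod 4) u \<noteq> sub_triangle (k' mod 4) u'"
      using Suc.prems by (intro sub_triangle_disjoint) auto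
    moreover have "sub_triangle (k mod 4) u \<in> ref_triangle" "sub_triangle (k' mod 4) u' \<in> ref_triangle"
      using Suc.prems tri_int_subset by (auto intro!: sub_triangle_ref)
    ultimately show ?thesis
      using inj_onD[OF inj_patch_par[OF parent_index[OF Suc.prems(1)]]] True by auto
  next
    case False
    then show ?thesis
      using Suc.IH[OF parent_index parent_index False] Suc.prems sub_triangle_int sub_triangle_ref by simp
  qed
qed

lemma patch_par_inverse_lipschitz:
  "\<exists>K>0. \<forall>r k. k < N_s P r \<longrightarrow> (\<forall>u\<in>ref_triangle. \<forall>v\<in>ref_triangle.
      norm (u - v) \<le> K * 2 ^ r * norm (patch_par P r k u - patch_par P r k v))"
proof -
  obtain K where K: "K > 0" "\<And>k v v'. k < n_patch P \<Longrightarrow> v \<in> ref_triangle \<Longrightarrow> v' \<in> ref_triangle \<Longrightarrow>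
      norm (v - v') \<le> K * norm (par P k v - par P k v')"
    using par_inverse_lipschitz by blast
  have "norm (u - v) \<le> K * 2 ^ r * norm (patch_par P r k u - patch_par P r k v)"
    if "k < N_s P r" "u \<in> ref_triangle" "v \<in> ref_triangle" for r k u v
    using that
  proof (induction r arbitrary: k u v)
    case 0
    then show ?case using K(2) by (simp add: N_s_def)
  next
    case (Suc r)
    have "norm (u - v) = 2 * norm (sub_triangle (k mod 4) u - sub_triangle (k mod 4) v)"
      by (simp add: dist_sub_triangle)
    also have "\<dots> \<le> 2 * (K * 2 ^ r * norm (patch_par P (Suc r) k u - patch_par P (Suc r) k v))"
      using Suc.IH[OF parent_index sub_triangle_ref sub_triangle_ref] Suc.prems by simp
    finally show ?case by (simp add: mult_ac)
  qed
  then show ?thesis using K(1) by blast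
qed

text \<open>A point of a cell is at least as far from any surface point outside the cell as, up to
  scaling, its parameter is from the complement of the open triangle. Together with
  \<open>bubble_le_dist\<close> this bounds the bubble by the distance. The witness \<open>z\<close>
  need not lie in the reference triangle, which lets the induction over refinements go
  through.\<close>

lemma patch_par_separation:
  "\<exists>K>0. \<forall>r k. k < N_s P r \<longrightarrow> (\<forall>u\<in>ref_triangle. \<forall>y\<in>Gam P - patch_par P r k ` tri_int.
      \<exists>z. z \<notin> tri_int \<and> norm (u - z) \<le> K * 2 ^ r * norm (patch_par P r k u - y))"
proof -
  obtain K1 where K1: "K1 > 0" "\<And>r k u v. k < N_s P r \<Longrightarrow> u \<in> ref_triangle \<Longrightarrow> v \<in> ref_triangle \<Longrightarrow>
      norm (u - v) \<le> K1 * 2 ^ r * norm (patch_par P r k u - patch_par P r k v)"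
    using patch_par_inverse_lipschitz by blast
  from boundary_point_between_patches
  obtain K2 where "K2 > 0" and K2: "\<forall>k<n_patch P. \<forall>k'<n_patch P. k \<noteq> k' \<longrightarrow>
      (\<forall>x\<in>par P k ` ref_triangle. \<forall>y\<in>par P k' ` ref_triangle.
         \<exists>u\<in>ref_triangle. u \<notin> tri_int \<and> norm (x - par P k u) \<le> K2 * norm (x - y))"
    by (elim exE conjE)
  define K where "K = max K1 (K1 * K2)"
  have K: "K > 0" "K1 \<le> K" "K1 * K2 \<le> K" using K1 by (auto simp: K_def)
  have "\<exists>z. z \<notin> tri_int \<and> norm (u - z) \<le> K * 2 ^ r * norm (patch_par P r k u - y)"
    if "k < N_s P r" "u \<in> ref_triangle" "y \<in> Gam P" "y \<notin> patch_par P r k ` tri_int" for r k u y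
    using that
  proof (induction r arbitrary: k u)
    case 0
    then have k: "k < n_patch P" by (simp add: N_s_def)
    obtain k' v where v: "k' < n_patch P" "v \<in> ref_triangle" "y = par P k' v"
      using \<open>y \<in> Gam P\<close> unfolding Gam_eq by auto
    show ?case
    proof (cases "k' = k")
      case True
      have "norm (u - v) \<le> K1 * norm (par P k u - y)" using K1(2)[OF 0(1,2) v(2)] v True by simp
      also have "\<dots> \<le> K * norm (par P k u - y)" using K by (intro mult_right_mono) auto
      finally have "norm (u - v) \<le> K * 2 ^ 0 * norm (patch_par P 0 k u - y)" by simp
      moreover have "v \<notin> tri_int" using 0(4) v True by auto
      ultimately show ?thesis by blast
    next
      case False
      obtain w where w: "w \<in> ref_triangle" "w \<notin> tri_int" "norm (par P k u - par P k w) \<le> K2 * norm (par P k u - y)"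
        using K2[rule_format, OF k v(1), of "par P k u" y] False 0(2) v by auto
      have "norm (u - w) \<le> K1 * norm (par P k u - par P k w)" using K1(2)[OF 0(1,2) w(1)] by simp
      also have "\<dots> \<le> K1 * (K2 * norm (par P k u - y))" using w K1 by (intro mult_left_mono) auto
      also have "\<dots> \<le> K * norm (par P k u - y)" using mult_right_mono[OF K(3), of "norm (par P k u - y)"] by (simp add: mult.assoc)
      finally show ?thesis using w(2) by auto
    qed
  next
    case (Suc r)
    let ?u = "sub_triangle (k mod 4) u"
    have u: "?u \<in> ref_triangle" using Suc.prems by (intro sub_triangle_ref)
    have k: "k div 4 < N_s P r" using Suc.prems parent_index by blast
    \<comment> \<open>If \<open>y\<close> lies in the parent cell, its own parameter is outside the
      subtriangle and serves as \<open>z\<close>. Otherwise the witness for the parent is outside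
      the parent's open triangle, hence outside the subtriangle.\<close>
    have "\<exists>z. z \<notin> sub_triangle (k mod 4) ` tri_int \<and> norm (?u - z) \<le> K * 2 ^ r * norm (patch_par P (Suc r) k u - y)"
    proof (cases "y \<in> patch_par P r (k div 4) ` tri_int")
      case True
      then obtain w where w: "w \<in> tri_int" "y = patch_par P r (k div 4) w" by blast
      have "w \<notin> sub_triangle (k mod 4) ` tri_int" using Suc.prems(4) w(2) by auto
      moreover have "norm (?u - w) \<le> K * 2 ^ r * norm (patch_par P r (k div 4) ?u - patch_par P r (k div 4) w)"
      proof -
        have "norm (?u - w) \<le> K1 * 2 ^ r * norm (patch_par P r (k div 4) ?u - patch_par P r (k div 4) w)"
          using K1(2)[OF k u] w tri_int_subset by blast
        also have "\<dots> \<le> K * 2 ^ r * norm (patch_par P r (k div 4) ?u - patch_par P r (k div 4) w)"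
          using K by (intro mult_right_mono) auto
        finally show ?thesis .
      qed
      ultimately show ?thesis using w(2) by auto
    next
      case False
      then obtain z where "z \<notin> tri_int" "norm (?u - z) \<le> K * 2 ^ r * norm (patch_par P (Suc r) k u - y)"
        using Suc.IH[OF k u Suc.prems(3)] by auto
      moreover from this(1) have "z \<notin> sub_triangle (k mod 4) ` tri_int" using sub_triangle_int by blast
      ultimately show ?thesis by blast
    qed
    then obtain z where z: "z \<notin> sub_triangle (k mod 4) ` tri_int" "norm (?u - z) \<le> K * 2 ^ r * norm (patch_par P (Suc r) k u - y)"
      by blast
    \<comment> \<open>The affine map is onto the whole plane, so the witness can be pulled back even
      when it leaves the reference triangle; this doubles its distance from
      \<open>u\<close>.\<close>
    obtain v where v: "sub_triangle (k mod 4) v = z" using surj_sub_triangle by blast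
    then have "v \<notin> tri_int" using z(1) by blast
    moreover have "norm (u - v) = 2 * norm (?u - z)" using dist_sub_triangle[of "k mod 4" u v] v by simp
    then have "norm (u - v) \<le> K * 2 ^ Suc r * norm (patch_par P (Suc r) k u - y)" using z(2) by simp
    ultimately show ?case by blast
  qed
  then show ?thesis using K(1) by blast
qed

section \<open>Open cells and their surface measure\<close>

definition cell_s :: "nat \<Rightarrow> nat \<Rightarrow> (real^3) set" where
  "cell_s r k = patch_par P r k ` tri_int"

text \<open>Closed patches share edges; the images of the open triangles are disjoint, and they
  carry all values of the bubbles.\<close>

lemma disjoint_cell_s: "disjoint_family_on (cell_s r) {..<N_s P r}"
  unfolding disjoint_family_on_def cell_s_def
  using patch_par_disjoint tri_int_subset by blast

lemma compact_patch: "k < N_s P r \<Longrightarrow> compact (patch P r k)"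
  unfolding patch_def by (intro compact_continuous_image continuous_patch_par compact_ref_triangle)

text \<open>A continuous image of an open set need not be Borel in general. Here injectivity
  presents the cell as the difference of two compact images.\<close>

lemma cell_s_borel:
  assumes k: "k < N_s P r"
  shows "cell_s r k \<in> sets borel"
proof -
  have "cell_s r k = patch P r k - patch_par P r k ` (ref_triangle - tri_int)"
    using inj_patch_par[OF k] tri_int_subset unfolding cell_s_def patch_def inj_on_def by blast
  moreover have "compact (ref_triangle - tri_int)"
    by (intro compact_diff compact_ref_triangle open_tri_int)
  then have "compact (patch_par P r k ` (ref_triangle - tri_int))"
    by (intro compact_continuous_image continuous_on_subset[OF continuous_patch_par[OF k]]) auto
  ultimately show ?thesis
    using compact_patch[OF k] by (simp only:) (intro sets.Diff borel_compact)
qed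

lemma nn_integral_cell:
  assumes k: "k < N_s P r" and F[measurable]: "F \<in> borel_measurable borel"
    and a: "\<bar>s\<bar> = (1/2) ^ r" "\<And>u. patch_par P r k u = par P (k div 4 ^ r) (a + s *\<^sub>R u)"
       "\<And>u. u \<in> ref_triangle \<Longrightarrow> a + s *\<^sub>R u \<in> ref_triangle"
  shows "(\<integral>\<^sup>+u. F (par P (k div 4 ^ r) u) * indicator ref_triangle u * indicator tri_int ((1 / s) *\<^sub>R (u - a)) \<partial>lborel)
    = ennreal ((1/4) ^ r) * (\<integral>\<^sup>+u. F (patch_par P r k u) * indicator tri_int u \<partial>lborel)"
proof -
  have s: "s \<noteq> 0" using a(1) by auto
  have [measurable]: "(\<lambda>u. F (par P (k div 4 ^ r) u) * indicator ref_triangle u) \<in> borel_measurable borel"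
    by (intro measurable_par_indicator macro_index k F)
  have "\<bar>s\<bar> ^ DIM(real^2) = (1/4) ^ r"
    by (simp add: a(1) power2_eq_square flip: power_mult_distrib power_mult)
  then have "(\<integral>\<^sup>+u. F (par P (k div 4 ^ r) u) * indicator ref_triangle u * indicator tri_int ((1 / s) *\<^sub>R (u - a)) \<partial>lborel)
    = ennreal ((1/4) ^ r) * (\<integral>\<^sup>+u. F (par P (k div 4 ^ r) (a + s *\<^sub>R u)) * indicator ref_triangle (a + s *\<^sub>R u)
        * indicator tri_int ((1 / s) *\<^sub>R (a + s *\<^sub>R u - a)) \<partial>lborel)"
    by (subst nn_integral_affine_change[OF _ s, of _ a]) simp_all
  also have "(\<integral>\<^sup>+u. F (par P (k div 4 ^ r) (a + s *\<^sub>R u)) * indicator ref_triangle (a + s *\<^sub>R u)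
        * indicator tri_int ((1 / s) *\<^sub>R (a + s *\<^sub>R u - a)) \<partial>lborel)
     = (\<integral>\<^sup>+u. F (patch_par P r k u) * indicator tri_int u \<partial>lborel)"
    using s a(3) tri_int_subset by (intro nn_integral_cong) (auto simp: a(2) split: split_indicator)
  finally show ?thesis .
qed

lemma emeasure_cell_s_le:
  "\<exists>C>0. \<forall>r k. k < N_s P r \<longrightarrow> emeasure (surf P) (cell_s r k) \<le> ennreal (C * (1/4) ^ r)"
proof -
  obtain M where M: "M > 0" "\<And>F. F \<in> borel_measurable borel \<Longrightarrow> (\<integral>\<^sup>+x. F x \<partial>surf P)
     \<le> ennreal M * (\<Sum>k<n_patch P. \<integral>\<^sup>+u. F (par P k u) * indicator ref_triangle u \<partial>lborel)"
    using surf_upper by blast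
  obtain c where c: "0 < c" "emeasure lborel tri_int \<le> ennreal c"
  proof -
    have "emeasure lborel tri_int \<le> emeasure lborel ref_triangle"
      using tri_int_subset by (intro emeasure_mono) auto
    also have "\<dots> = ennreal (measure lborel ref_triangle)"
      using emeasure_ref_triangle_finite by (intro emeasure_eq_ennreal_measure) auto
    also have "\<dots> \<le> ennreal (measure lborel ref_triangle + 1)" by (intro ennreal_leI) simp
    finally show ?thesis using that[of "measure lborel ref_triangle + 1"] by (simp add: add_nonneg_pos)
  qed
  have "emeasure (surf P) (cell_s r k) \<le> ennreal (M * c * (1/4) ^ r)" if k: "k < N_s P r" for r k
  proof -
    obtain a s where as: "\<bar>s\<bar> = (1/2) ^ r" "\<And>u. patch_par P r k u = par P (k div 4 ^ r) (a + s *\<^sub>R u)"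
        "\<And>u. u \<in> ref_triangle \<Longrightarrow> a + s *\<^sub>R u \<in> ref_triangle" "\<And>u. u \<in> tri_int \<Longrightarrow> a + s *\<^sub>R u \<in> tri_int"
      using patch_par_affine[of r k] by metis
    have s: "s \<noteq> 0" using as(1) by auto
    note m = macro_index[OF k]
    have [measurable]: "cell_s r k \<in> sets borel" by (rule cell_s_borel[OF k])
    have zero: "(\<integral>\<^sup>+u. indicator (cell_s r k) (par P j u) * indicator ref_triangle u \<partial>lborel) = (0::ennreal)"
      if j: "j < n_patch P" "j \<noteq> k div 4 ^ r" for j
    proof -
      have "par P j u \<notin> cell_s r k" if "u \<in> ref_triangle" for u
        using par_interior_disjoint[OF m j(1) j(2)[symmetric] as(4) that] unfolding cell_s_def as(2) by force
      then have "(\<integral>\<^sup>+u. indicator (cell_s r k) (par P j u) * indicator ref_triangle u \<partial>lborel) = (\<integral>\<^sup>+(u::real^2). (0::ennreal) \<partial>lborel)"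
        by (intro nn_integral_cong) (auto split: split_indicator)
      then show ?thesis by simp
    qed
    have "emeasure (surf P) (cell_s r k) = (\<integral>\<^sup>+x. indicator (cell_s r k) x \<partial>surf P)" by simp
    also have "\<dots> \<le> ennreal M * (\<Sum>j<n_patch P. \<integral>\<^sup>+u. indicator (cell_s r k) (par P j u) * indicator ref_triangle u \<partial>lborel)"
      by (rule M(2)) measurable
    also have "(\<Sum>j<n_patch P. \<integral>\<^sup>+u. indicator (cell_s r k) (par P j u) * indicator ref_triangle u \<partial>lborel)
        = (\<integral>\<^sup>+u. indicator (cell_s r k) (par P (k div 4 ^ r) u) * indicator ref_triangle u \<partial>lborel)"
      using m zero by (subst sum.remove[of _ "k div 4 ^ r"]) auto
    also have "\<dots> \<le> (\<integral>\<^sup>+u. 1 * indicator ref_triangle u * indicator tri_int ((1 / s) *\<^sub>R (u - a)) \<partial>lborel)"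
    proof (intro nn_integral_mono)
      fix u
      have "u = a + s *\<^sub>R v" if "u \<in> ref_triangle" "par P (k div 4 ^ r) u = patch_par P r k v" "v \<in> tri_int" for v
        using inj_onD[OF inj_par[OF m], of u "a + s *\<^sub>R v"] that as(2,3) tri_int_subset by auto
      then have "(1 / s) *\<^sub>R (u - a) \<in> tri_int" if "u \<in> ref_triangle" "par P (k div 4 ^ r) u \<in> cell_s r k"
        using that s unfolding cell_s_def by auto
      then show "indicator (cell_s r k) (par P (k div 4 ^ r) u) * indicator ref_triangle u
          \<le> (1::ennreal) * indicator ref_triangle u * indicator tri_int ((1 / s) *\<^sub>R (u - a))"
        by (auto split: split_indicator)
    qed
    also have "\<dots> = ennreal ((1/4) ^ r) * (\<integral>\<^sup>+u. 1 * indicator tri_int u \<partial>lborel)"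
      using nn_integral_cell[OF k _ as(1-3), of "\<lambda>_. 1"] by simp
    also have "\<dots> \<le> ennreal ((1/4) ^ r) * ennreal c" using c by (intro mult_left_mono) auto
    also have "ennreal M * (ennreal ((1/4) ^ r) * ennreal c) = ennreal (M * c * (1/4) ^ r)"
      using M c by (simp add: mult_ac flip: ennreal_mult)
    finally show ?thesis by (simp add: mult_left_mono)
  qed
  then show ?thesis using M(1) c(1) by (intro exI[of _ "M * c"]) auto
qed

text \<open>The cells descending from one initial patch correspond to disjoint triangles inside its
  reference triangle, so their integrals add up to at most the integral over that triangle. The
  factor (1/4)^r is the Jacobian of the affine maps.\<close>

lemma surf_cells_lower:
  "\<exists>m>0. \<forall>r F. F \<in> borel_measurable borel \<longrightarrow>
     ennreal (m * (1/4) ^ r) * (\<Sum>k<N_s P r. \<integral>\<^sup>+u. F (patch_par P r k u) * indicator tri_int u \<partial>lborel) \<le> (\<integral>\<^sup>+x. F x \<partial>surf P)"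
proof -
  obtain m where m: "m > 0" "\<And>F. F \<in> borel_measurable borel \<Longrightarrow>
     ennreal m * (\<Sum>k<n_patch P. \<integral>\<^sup>+u. F (par P k u) * indicator ref_triangle u \<partial>lborel) \<le> (\<integral>\<^sup>+x. F x \<partial>surf P)"
    using surf_lower by blast
  have "ennreal (m * (1/4) ^ r) * (\<Sum>k<N_s P r. \<integral>\<^sup>+u. F (patch_par P r k u) * indicator tri_int u \<partial>lborel) \<le> (\<integral>\<^sup>+x. F x \<partial>surf P)"
    if F: "F \<in> borel_measurable borel" for r F
  proof -
    define Q where "Q k a s \<longleftrightarrow> \<bar>s\<bar> = (1/2) ^ r \<and> (\<forall>u. patch_par P r k u = par P (k div 4 ^ r) (a + s *\<^sub>R u)) \<and>
        (\<forall>u\<in>ref_triangle. a + s *\<^sub>R u \<in> ref_triangle)" for k a s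
    have "\<forall>k. \<exists>a s. Q k a s" using patch_par_affine[of r] unfolding Q_def by blast
    then obtain a s where "\<And>k. Q k (a k) (s k)" by metis
    then have as: "\<And>k. \<bar>s k\<bar> = (1/2) ^ r" "\<And>k u. patch_par P r k u = par P (k div 4 ^ r) (a k + s k *\<^sub>R u)"
        "\<And>k u. u \<in> ref_triangle \<Longrightarrow> a k + s k *\<^sub>R u \<in> ref_triangle"
      unfolding Q_def by simp_all
    have s: "s k \<noteq> 0" for k using as(1)[of k] by auto
    have "(\<Sum>k<N_s P r. ennreal ((1/4) ^ r) * (\<integral>\<^sup>+u. F (patch_par P r k u) * indicator tri_int u \<partial>lborel))
        = (\<Sum>k<N_s P r. \<integral>\<^sup>+u. F (par P (k div 4 ^ r) u) * indicator ref_triangle u * indicator tri_int ((1 / s k) *\<^sub>R (u - a k)) \<partial>lborel)"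
      using nn_integral_cell[OF _ F as] by (intro sum.cong refl) auto
    also have "\<dots> = (\<Sum>j<n_patch P. \<Sum>k | k < N_s P r \<and> k div 4 ^ r = j.
        \<integral>\<^sup>+u. F (par P (k div 4 ^ r) u) * indicator ref_triangle u * indicator tri_int ((1 / s k) *\<^sub>R (u - a k)) \<partial>lborel)"
      using macro_index by (subst sum.group[symmetric, of _ "{..<n_patch P}" "\<lambda>k. k div 4 ^ r"]) auto
    also have "\<dots> \<le> (\<Sum>j<n_patch P. \<integral>\<^sup>+u. F (par P j u) * indicator ref_triangle u \<partial>lborel)"
    proof (rule sum_mono)
      fix j assume j: "j \<in> {..<n_patch P}"
      let ?I = "{k. k < N_s P r \<and> k div 4 ^ r = j}"
      have [measurable]: "(\<lambda>u. F (par P j u) * indicator ref_triangle u) \<in> borel_measurable borel"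
        using j F by (intro measurable_par_indicator) auto
      have "(\<Sum>k\<in>?I. \<integral>\<^sup>+u. F (par P (k div 4 ^ r) u) * indicator ref_triangle u * indicator tri_int ((1 / s k) *\<^sub>R (u - a k)) \<partial>lborel)
          = (\<Sum>k\<in>?I. \<integral>\<^sup>+u. F (par P j u) * indicator ref_triangle u * indicator tri_int ((1 / s k) *\<^sub>R (u - a k)) \<partial>lborel)"
        by (intro sum.cong) auto
      also have "\<dots> = (\<integral>\<^sup>+u. (\<Sum>k\<in>?I. F (par P j u) * indicator ref_triangle u * indicator tri_int ((1 / s k) *\<^sub>R (u - a k))) \<partial>lborel)"
        by (rule nn_integral_sum[symmetric]) measurable
      also have "\<dots> \<le> (\<integral>\<^sup>+u. F (par P j u) * indicator ref_triangle u \<partial>lborel)"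
      proof (rule nn_integral_mono)
        fix u
        have dj: "k = k'" if k: "k \<in> ?I" "(1 / s k) *\<^sub>R (u - a k) \<in> tri_int" and k': "k' \<in> ?I" "(1 / s k') *\<^sub>R (u - a k') \<in> tri_int" for k k'
        proof (rule ccontr)
          assume "k \<noteq> k'"
          then have "patch_par P r k ((1 / s k) *\<^sub>R (u - a k)) \<noteq> patch_par P r k' ((1 / s k') *\<^sub>R (u - a k'))"
            using k k' tri_int_subset by (intro patch_par_disjoint) auto
          then show False using s k(1) k'(1) by (simp add: as(2))
        qed
        have "(\<Sum>k\<in>?I. indicator tri_int ((1 / s k) *\<^sub>R (u - a k))) \<le> (1::ennreal)"
        proof (cases "\<exists>k\<in>?I. (1 / s k) *\<^sub>R (u - a k) \<in> tri_int")
          case True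
          then obtain k where k: "k \<in> ?I" "(1 / s k) *\<^sub>R (u - a k) \<in> tri_int" by blast
          have "(\<Sum>k\<in>?I. indicator tri_int ((1 / s k) *\<^sub>R (u - a k))) = (\<Sum>k'\<in>{k}. indicator tri_int ((1 / s k') *\<^sub>R (u - a k')) :: ennreal)"
          proof (intro sum.mono_neutral_right ballI)
            fix i assume i: "i \<in> ?I - {k}"
            have "(1 / s i) *\<^sub>R (u - a i) \<notin> tri_int"
            proof
              assume *: "(1 / s i) *\<^sub>R (u - a i) \<in> tri_int"
              have "i \<in> ?I" using i by simp
              from dj[OF this * k] i show False by simp
            qed
            then show "indicator tri_int ((1 / s i) *\<^sub>R (u - a i)) = (0::ennreal)" by simp
          qed (use k in auto)
          then show ?thesis using k by simp
        next
          case False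
          then have "(\<Sum>k\<in>?I. indicator tri_int ((1 / s k) *\<^sub>R (u - a k))) = (0::ennreal)"
            by (intro sum.neutral) auto
          then show ?thesis by simp
        qed
        then have "F (par P j u) * indicator ref_triangle u * (\<Sum>k\<in>?I. indicator tri_int ((1 / s k) *\<^sub>R (u - a k)))
            \<le> F (par P j u) * indicator ref_triangle u * 1" by (intro mult_left_mono) auto
        then show "(\<Sum>k\<in>?I. F (par P j u) * indicator ref_triangle u * indicator tri_int ((1 / s k) *\<^sub>R (u - a k)))
            \<le> F (par P j u) * indicator ref_triangle u" by (simp add: sum_distrib_left)
      qed
      finally show "(\<Sum>k\<in>?I. \<integral>\<^sup>+u. F (par P (k div 4 ^ r) u) * indicator ref_triangle u * indicator tri_int ((1 / s k) *\<^sub>R (u - a k)) \<partial>lborel)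
        \<le> (\<integral>\<^sup>+u. F (par P j u) * indicator ref_triangle u \<partial>lborel)" .
    qed
    finally have "ennreal m * (\<Sum>k<N_s P r. ennreal ((1/4) ^ r) * (\<integral>\<^sup>+u. F (patch_par P r k u) * indicator tri_int u \<partial>lborel)) \<le> (\<integral>\<^sup>+x. F x \<partial>surf P)"
      using m(2)[OF F] by (meson mult_left_mono order.trans zero_le)
    then show ?thesis using m(1) by (simp add: ennreal_mult mult.assoc sum_distrib_left)
  qed
  then show ?thesis using m(1) by blast
qed

end

section \<open>Test functions in space\<close>

text \<open>Boundedness is included because it makes the class closed under products; hence it
  contains all polynomials on the triangle.\<close>

definition bounded_lipschitz :: "(real^2 \<Rightarrow> real) \<Rightarrow> bool" where
  "bounded_lipschitz f \<longleftrightarrow> (\<exists>C. \<forall>u\<in>ref_triangle. \<forall>v\<in>ref_triangle. \<bar>f u\<bar> \<le> C \<and> \<bar>f u - f v\<bar> \<le> C * norm (u - v))"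

lemma bounded_lipschitzD:
  assumes "bounded_lipschitz f"
  shows "\<exists>C\<ge>0. (\<forall>u\<in>ref_triangle. \<bar>f u\<bar> \<le> C) \<and>
    (\<forall>u\<in>ref_triangle. \<forall>v\<in>ref_triangle. \<bar>f u - f v\<bar> \<le> C * norm (u - v))"
proof -
  obtain C where C: "\<And>u v. u \<in> ref_triangle \<Longrightarrow> v \<in> ref_triangle \<Longrightarrow> \<bar>f u\<bar> \<le> C \<and> \<bar>f u - f v\<bar> \<le> C * norm (u - v)"
    using assms unfolding bounded_lipschitz_def by blast
  have "0 \<le> C" using C[of 0 0] zero_in_ref_triangle by force
  then show ?thesis using C by blast
qed

lemma bounded_lipschitz_const: "bounded_lipschitz (\<lambda>_. c)"
  unfolding bounded_lipschitz_def by (intro exI[of _ "\<bar>c\<bar>"]) auto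

lemma bounded_lipschitz_component: "bounded_lipschitz (\<lambda>u. u $ i)"
proof -
  have "\<bar>u $ i\<bar> \<le> 2 \<and> \<bar>u $ i - v $ i\<bar> \<le> 2 * norm (u - v)" if "u \<in> ref_triangle" for u v :: "real^2"
    using component_le_norm_cart[of u i] component_le_norm_cart[of "u - v" i] norm_ref_triangle_le[OF that]
    by (auto intro: order.trans)
  then show ?thesis unfolding bounded_lipschitz_def by blast
qed

lemma bounded_lipschitz_add:
  assumes "bounded_lipschitz f" "bounded_lipschitz g"
  shows "bounded_lipschitz (\<lambda>u. f u + g u)"
proof -
  obtain C where C: "0 \<le> C" "\<And>u. u \<in> ref_triangle \<Longrightarrow> \<bar>f u\<bar> \<le> C"
    "\<And>u v. u \<in> ref_triangle \<Longrightarrow> v \<in> ref_triangle \<Longrightarrow> \<bar>f u - f v\<bar> \<le> C * norm (u - v)"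
    using bounded_lipschitzD[OF assms(1)] by blast
  obtain D where D: "0 \<le> D" "\<And>u. u \<in> ref_triangle \<Longrightarrow> \<bar>g u\<bar> \<le> D"
    "\<And>u v. u \<in> ref_triangle \<Longrightarrow> v \<in> ref_triangle \<Longrightarrow> \<bar>g u - g v\<bar> \<le> D * norm (u - v)"
    using bounded_lipschitzD[OF assms(2)] by blast
  have "\<bar>f u + g u\<bar> \<le> C + D \<and> \<bar>(f u + g u) - (f v + g v)\<bar> \<le> (C + D) * norm (u - v)"
    if "u \<in> ref_triangle" "v \<in> ref_triangle" for u v
    using C(2)[OF that(1)] D(2)[OF that(1)] C(3)[OF that] D(3)[OF that] by (auto simp: distrib_right)
  then show ?thesis unfolding bounded_lipschitz_def by blast
qed

lemma bounded_lipschitz_mult: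
  assumes "bounded_lipschitz f" "bounded_lipschitz g"
  shows "bounded_lipschitz (\<lambda>u. f u * g u)"
proof -
  obtain C where C: "0 \<le> C" "\<And>u. u \<in> ref_triangle \<Longrightarrow> \<bar>f u\<bar> \<le> C"
    "\<And>u v. u \<in> ref_triangle \<Longrightarrow> v \<in> ref_triangle \<Longrightarrow> \<bar>f u - f v\<bar> \<le> C * norm (u - v)"
    using bounded_lipschitzD[OF assms(1)] by blast
  obtain D where D: "0 \<le> D" "\<And>u. u \<in> ref_triangle \<Longrightarrow> \<bar>g u\<bar> \<le> D"
    "\<And>u v. u \<in> ref_triangle \<Longrightarrow> v \<in> ref_triangle \<Longrightarrow> \<bar>g u - g v\<bar> \<le> D * norm (u - v)"
    using bounded_lipschitzD[OF assms(2)] by blast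
  have "\<bar>f u * g u\<bar> \<le> 2 * C * D \<and> \<bar>f u * g u - f v * g v\<bar> \<le> 2 * C * D * norm (u - v)"
    if u: "u \<in> ref_triangle" and v: "v \<in> ref_triangle" for u v
  proof
    have "\<bar>f u\<bar> * \<bar>g u\<bar> \<le> C * D" using C D u by (intro mult_mono) auto
    moreover have "0 \<le> C * D" using C D by simp
    ultimately show "\<bar>f u * g u\<bar> \<le> 2 * C * D" by (simp add: abs_mult)
    have "f u * g u - f v * g v = f u * (g u - g v) + (f u - f v) * g v" by (simp add: algebra_simps)
    then have "\<bar>f u * g u - f v * g v\<bar> \<le> \<bar>f u\<bar> * \<bar>g u - g v\<bar> + \<bar>f u - f v\<bar> * \<bar>g v\<bar>"
      using abs_triangle_ineq[of "f u * (g u - g v)" "(f u - f v) * g v"] by (simp add: abs_mult)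
    also have "\<dots> \<le> C * (D * norm (u - v)) + (C * norm (u - v)) * D"
      using C D u v by (intro add_mono mult_mono) auto
    finally show "\<bar>f u * g u - f v * g v\<bar> \<le> 2 * C * D * norm (u - v)" by (simp add: algebra_simps)
  qed
  then show ?thesis unfolding bounded_lipschitz_def by blast
qed

lemma bounded_lipschitz_power: "bounded_lipschitz f \<Longrightarrow> bounded_lipschitz (\<lambda>u. f u ^ n)"
  by (induction n) (auto intro: bounded_lipschitz_const bounded_lipschitz_mult)

lemma bounded_lipschitz_sum:
  "(\<And>i. i \<in> I \<Longrightarrow> bounded_lipschitz (f i)) \<Longrightarrow> bounded_lipschitz (\<lambda>u. \<Sum>i\<in>I. f i u)"
  by (induction I rule: infinite_finite_induct) (auto intro: bounded_lipschitz_const bounded_lipschitz_add)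

lemma bounded_lipschitz_poly2: "f \<in> poly2 N \<Longrightarrow> bounded_lipschitz f"
  unfolding poly2_def
proof (elim CollectE exE)
  fix c assume "\<forall>u. f u = (\<Sum>a\<le>N. \<Sum>b\<le>N - a. c a b * (u $ 1) ^ a * (u $ 2) ^ b)"
  then have "f = (\<lambda>u. \<Sum>a\<le>N. \<Sum>b\<le>N - a. c a b * (u $ 1) ^ a * (u $ 2) ^ b)" by blast
  then show "bounded_lipschitz f"
    by (simp only:) (intro bounded_lipschitz_sum bounded_lipschitz_mult bounded_lipschitz_power
        bounded_lipschitz_component bounded_lipschitz_const)
qed

lemma continuous_poly2: "f \<in> poly2 N \<Longrightarrow> continuous_on A f"
  unfolding poly2_def
proof (elim CollectE exE)
  fix c assume "\<forall>u. f u = (\<Sum>a\<le>N. \<Sum>b\<le>N - a. c a b * (u $ 1) ^ a * (u $ 2) ^ b)"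
  then have "f = (\<lambda>u. \<Sum>a\<le>N. \<Sum>b\<le>N - a. c a b * (u $ 1) ^ a * (u $ 2) ^ b)" by blast
  then show "continuous_on A f" by (simp only:) (intro continuous_intros)
qed

lemma bounded_lipschitz_bubble: "bounded_lipschitz bubble"
proof -
  have eq: "bubble = (\<lambda>u. u $ 1 * u $ 2 * (1 + ((-1) * u $ 1 + (-1) * u $ 2)))"
    by (auto simp: bubble_def algebra_simps)
  show ?thesis
    by (subst eq) (intro bounded_lipschitz_add bounded_lipschitz_mult bounded_lipschitz_component bounded_lipschitz_const)
qed

lemma continuous_bubble: "continuous_on A bubble"
  unfolding bubble_def by (intro continuous_intros)

text \<open>A small contraction towards the barycenter moves any point of the triangle into its
  interior. This carries identities from the open triangle to the nodes, which may lie on its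
  edges.\<close>

lemma ref_triangle_subset_closure: "ref_triangle \<subseteq> closure tri_int"
proof
  fix u :: "real^2" assume u: "u \<in> ref_triangle"
  define c :: "real^2" where "c = (\<chi> i. 1/3)"
  show "u \<in> closure tri_int"
    unfolding closure_approachable
  proof (intro allI impI)
    fix e :: real assume e: "0 < e"
    define t where "t = min (1/2) (e / (2 * (norm (c - u) + 1)))"
    have n: "0 < norm (c - u) + 1" using norm_ge_zero[of "c - u"] by linarith
    have t: "0 < t" using e n by (simp add: t_def)
    have t2: "t \<le> 1/2" unfolding t_def by (rule min.cobounded1)
    have "t * norm (c - u) \<le> e / (2 * (norm (c - u) + 1)) * (norm (c - u) + 1)"
      using t n e by (intro mult_mono) (simp_all add: t_def)
    also have "\<dots> = e / 2"
    proof -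
      have "e / (2 * N) * N = e / 2" if "0 < N" for N :: real using that by simp
      then show ?thesis using n .
    qed
    finally have d: "t * norm (c - u) < e" using e by simp
    define v where "v = u + t *\<^sub>R (c - u)"
    have v: "v $ i = (1 - t) * u $ i + t / 3" for i by (simp add: v_def c_def algebra_simps)
    have "0 \<le> (1 - t) * u $ 1" "0 \<le> (1 - t) * u $ 2" "(1 - t) * (u $ 1 + u $ 2) \<le> (1 - t) * 1"
      using u t2 by (auto simp: ref_triangle_def intro!: mult_nonneg_nonneg mult_left_mono)
    then have "v \<in> tri_int" using t t2 unfolding tri_int_def mem_Collect_eq v by (auto simp: distrib_left)
    moreover have "dist v u < e" using d t by (simp add: v_def dist_norm)
    ultimately show "\<exists>v\<in>tri_int. dist v u < e" by blast
  qed
qed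

context heat_bem_setup
begin

lemma phi_ref_poly2: "m < D_s P \<Longrightarrow> phi_ref P m \<in> poly2 (p_s P)"
  using bem by (simp add: bem_setup_def)

text \<open>A combination of shape functions that vanishes on the open triangle vanishes by
  continuity at every node, where its value is the corresponding coefficient.\<close>

lemma phi_ref_coercive:
  "\<exists>\<kappa>>0. \<forall>d. ennreal (\<kappa> * (\<Sum>m<D_s P. (d m)\<^sup>2))
     \<le> (\<integral>\<^sup>+u. ennreal (bubble u * (\<Sum>m<D_s P. d m * phi_ref P m u)\<^sup>2) * indicator tri_int u \<partial>lborel)"
proof (rule weighted_gram_coercive)
  show "bounded tri_int"
    using compact_imp_bounded[OF compact_ref_triangle] tri_int_subset by (rule bounded_subset)
  fix d :: "nat \<Rightarrow> real" and m
  assume z: "\<And>u. u \<in> tri_int \<Longrightarrow> (\<Sum>m<D_s P. d m * phi_ref P m u) = 0" and m: "m < D_s P"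
  have "closed {u. (\<Sum>m<D_s P. d m * phi_ref P m u) = 0}"
    by (intro closed_Collect_eq continuous_intros continuous_poly2[OF phi_ref_poly2]) auto
  then have "closure tri_int \<subseteq> {u. (\<Sum>m<D_s P. d m * phi_ref P m u) = 0}"
    using z by (intro closure_minimal) auto
  moreover have "node_ref P m \<in> ref_triangle" using bem m by (simp add: bem_setup_def)
  ultimately have "(\<Sum>l<D_s P. d l * phi_ref P l (node_ref P m)) = 0"
    using ref_triangle_subset_closure by blast
  also have "(\<Sum>l<D_s P. d l * phi_ref P l (node_ref P m)) = (\<Sum>l<D_s P. if l = m then d l else 0)"
    using bem m by (intro sum.cong) (auto simp: bem_setup_def)
  finally show "d m = 0" using m by simp
qed (auto intro: open_tri_int bubble_pos continuous_bubble continuous_poly2[OF phi_ref_poly2])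

definition bubble_s :: "nat \<Rightarrow> nat \<Rightarrow> real^3 \<Rightarrow> real" where
  "bubble_s r k x = (if x \<in> patch P r k then bubble (inv_into ref_triangle (patch_par P r k) x) else 0)"

lemma pullback_patch:
  assumes "k < N_s P r" "u \<in> ref_triangle"
  shows "inv_into ref_triangle (patch_par P r k) (patch_par P r k u) = u"
  using assms inj_patch_par by simp

lemma phi_patch_par: "k < N_s P r \<Longrightarrow> u \<in> ref_triangle \<Longrightarrow> phi P r k m (patch_par P r k u) = phi_ref P m u"
  by (simp add: phi_def patch_def pullback_patch)

lemma bubble_s_patch_par: "k < N_s P r \<Longrightarrow> u \<in> ref_triangle \<Longrightarrow> bubble_s r k (patch_par P r k u) = bubble u"
  by (simp add: bubble_s_def patch_def pullback_patch)

lemma bubble_s_zero: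
  assumes "k < N_s P r" "x \<notin> cell_s r k"
  shows "bubble_s r k x = 0"
proof (cases "x \<in> patch P r k")
  case True
  then obtain u where u: "u \<in> ref_triangle" "x = patch_par P r k u" by (auto simp: patch_def)
  then have "u \<notin> tri_int" using assms(2) by (auto simp: cell_s_def)
  then show ?thesis using u assms(1) by (simp add: bubble_s_patch_par bubble_zero)
qed (simp add: bubble_s_def)

text \<open>The inverse of a continuous injection on a compact set is continuous, so the pullback is
  continuous on a compact patch and extended by zero.\<close>

lemma borel_measurable_pullback:
  assumes k: "k < N_s P r" and f: "continuous_on ref_triangle f"
  shows "(\<lambda>x. if x \<in> patch P r k then f (inv_into ref_triangle (patch_par P r k) x) else 0 :: real) \<in> borel_measurable borel"
proof -
  have "continuous_on (patch P r k) (inv_into ref_triangle (patch_par P r k))"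
    unfolding patch_def by (rule continuous_on_inv[OF continuous_patch_par[OF k] compact_ref_triangle])
      (simp add: pullback_patch[OF k])
  then have "continuous_on (patch P r k) (\<lambda>x. f (inv_into ref_triangle (patch_par P r k) x))"
    by (rule continuous_on_compose2[OF f]) (auto simp: patch_def intro: inv_into_into)
  then have "(\<lambda>x. indicator (patch P r k) x *\<^sub>R f (inv_into ref_triangle (patch_par P r k) x)) \<in> borel_measurable borel"
    using compact_patch[OF k] by (intro borel_measurable_continuous_on_indicator) (auto intro: borel_compact)
  moreover have "(\<lambda>x. indicator (patch P r k) x *\<^sub>R f (inv_into ref_triangle (patch_par P r k) x))
      = (\<lambda>x. if x \<in> patch P r k then f (inv_into ref_triangle (patch_par P r k) x) else 0)"
    by (auto split: split_indicator)
  ultimately show ?thesis by simp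
qed

lemma borel_measurable_phi[measurable]: "k < N_s P r \<Longrightarrow> m < D_s P \<Longrightarrow> phi P r k m \<in> borel_measurable borel"
  unfolding phi_def[abs_def] by (intro borel_measurable_pullback continuous_poly2[OF phi_ref_poly2])

lemma borel_measurable_bubble_s[measurable]: "k < N_s P r \<Longrightarrow> bubble_s r k \<in> borel_measurable borel"
  unfolding bubble_s_def[abs_def] by (intro borel_measurable_pullback continuous_bubble)

lemma phi_ref_bounds:
  "\<exists>C>0. \<forall>m<D_s P. \<forall>u\<in>ref_triangle. \<bar>phi_ref P m u\<bar> \<le> C \<and>
     (\<forall>v\<in>ref_triangle. \<bar>bubble u * phi_ref P m u - bubble v * phi_ref P m v\<bar> \<le> C * norm (u - v))"
proof -
  have "\<exists>C. 0 \<le> C \<and> (\<forall>u\<in>ref_triangle. \<bar>phi_ref P m u\<bar> \<le> C \<and>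
     (\<forall>v\<in>ref_triangle. \<bar>bubble u * phi_ref P m u - bubble v * phi_ref P m v\<bar> \<le> C * norm (u - v)))" if m: "m < D_s P" for m
  proof -
    have b: "bounded_lipschitz (phi_ref P m)" using phi_ref_poly2[OF m] by (rule bounded_lipschitz_poly2)
    obtain C1 where C1: "0 \<le> C1" "\<And>u. u \<in> ref_triangle \<Longrightarrow> \<bar>phi_ref P m u\<bar> \<le> C1"
      using bounded_lipschitzD[OF b] by blast
    obtain C2 where C2: "0 \<le> C2" "\<And>u v. u \<in> ref_triangle \<Longrightarrow> v \<in> ref_triangle \<Longrightarrow>
        \<bar>bubble u * phi_ref P m u - bubble v * phi_ref P m v\<bar> \<le> C2 * norm (u - v)"
      using bounded_lipschitzD[OF bounded_lipschitz_mult[OF bounded_lipschitz_bubble b]] by blast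
    have "C2 * norm (u - v) \<le> (C1 + C2) * norm (u - v)" for u v :: "real^2"
      using C1(1) by (intro mult_right_mono) auto
    then have "\<bar>bubble u * phi_ref P m u - bubble v * phi_ref P m v\<bar> \<le> (C1 + C2) * norm (u - v)"
      if "u \<in> ref_triangle" "v \<in> ref_triangle" for u v
      using C2(2)[OF that] by (rule order.trans[rotated])
    moreover have "\<bar>phi_ref P m u\<bar> \<le> C1 + C2" if "u \<in> ref_triangle" for u
      using C1(2)[OF that] C2(1) by simp
    ultimately show ?thesis using C1(1) C2(1) by (intro exI[of _ "C1 + C2"]) simp
  qed
  then obtain C where C: "\<And>m. m < D_s P \<Longrightarrow> 0 \<le> C m" "\<And>m u. m < D_s P \<Longrightarrow> u \<in> ref_triangle \<Longrightarrow> \<bar>phi_ref P m u\<bar> \<le> C m"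
     "\<And>m u v. m < D_s P \<Longrightarrow> u \<in> ref_triangle \<Longrightarrow> v \<in> ref_triangle \<Longrightarrow>
        \<bar>bubble u * phi_ref P m u - bubble v * phi_ref P m v\<bar> \<le> C m * norm (u - v)"
    by metis
  define S where "S = 1 + (\<Sum>m<D_s P. C m)"
  have S: "C m \<le> S" if "m < D_s P" for m
  proof -
    have "C m \<le> (\<Sum>m<D_s P. C m)" using that C(1) by (intro member_le_sum) auto
    then show ?thesis by (simp add: S_def)
  qed
  have "0 < S" unfolding S_def using C(1) by (intro add_pos_nonneg sum_nonneg) auto
  moreover have "\<bar>bubble u * phi_ref P m u - bubble v * phi_ref P m v\<bar> \<le> S * norm (u - v)"
    if "m < D_s P" "u \<in> ref_triangle" "v \<in> ref_triangle" for m u v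
    using C(3)[OF that] mult_right_mono[OF S[OF that(1)], of "norm (u - v)"] by simp
  moreover have "\<bar>phi_ref P m u\<bar> \<le> S" if "m < D_s P" "u \<in> ref_triangle" for m u
    using C(2)[OF that] S[OF that(1)] by simp
  ultimately show ?thesis by blast
qed

section \<open>Fractional norm and coercivity for the spatial test functions\<close>

definition s_fun :: "nat \<Rightarrow> (nat \<Rightarrow> nat \<Rightarrow> real) \<Rightarrow> real^3 \<Rightarrow> real" where
  "s_fun r d x = (\<Sum>k<N_s P r. \<Sum>m<D_s P. d k m * phi P r k m x)"

definition s_test :: "nat \<Rightarrow> (nat \<Rightarrow> nat \<Rightarrow> real) \<Rightarrow> real^3 \<Rightarrow> real" where
  "s_test r d x = (\<Sum>k<N_s P r. \<Sum>m<D_s P. d k m * (bubble_s r k x * phi P r k m x))"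

definition s_sq :: "nat \<Rightarrow> (nat \<Rightarrow> nat \<Rightarrow> real) \<Rightarrow> real" where
  "s_sq r d = (\<Sum>k<N_s P r. \<Sum>m<D_s P. (d k m)\<^sup>2)"

text \<open>The squared coefficients spread over their cells. Pointwise bounds are stated in terms
  of this function, and its integral is of the order of the cell area times
  \<open>s_sq\<close>.\<close>

definition s_density :: "nat \<Rightarrow> (nat \<Rightarrow> nat \<Rightarrow> real) \<Rightarrow> real^3 \<Rightarrow> real" where
  "s_density r d x = (\<Sum>k<N_s P r. (\<Sum>m<D_s P. (d k m)\<^sup>2) * indicator (cell_s r k) x)"

lemma borel_measurable_s_fun[measurable]: "s_fun r d \<in> borel_measurable borel"
  unfolding s_fun_def[abs_def] by (intro borel_measurable_sum borel_measurable_times borel_measurable_const borel_measurable_phi) auto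

lemma borel_measurable_s_test[measurable]: "s_test r d \<in> borel_measurable borel"
  unfolding s_test_def[abs_def]
  by (intro borel_measurable_sum borel_measurable_times borel_measurable_const borel_measurable_phi borel_measurable_bubble_s) auto

lemma borel_measurable_s_density[measurable]: "s_density r d \<in> borel_measurable borel"
  unfolding s_density_def[abs_def]
  by (intro borel_measurable_sum borel_measurable_times borel_measurable_const borel_measurable_indicator cell_s_borel) auto

lemma s_density_nonneg: "0 \<le> s_density r d x"
  unfolding s_density_def by (intro sum_nonneg mult_nonneg_nonneg) auto

lemma s_sq_nonneg: "0 \<le> s_sq r d"
  unfolding s_sq_def by (intro sum_nonneg) auto

lemma nn_integral_s_density_le:
  "\<exists>C>0. \<forall>r d. (\<integral>\<^sup>+x. ennreal (s_density r d x) \<partial>surf P) \<le> ennreal (C * (1/4) ^ r * s_sq r d)"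
proof -
  obtain C where C: "C > 0" "\<And>r k. k < N_s P r \<Longrightarrow> emeasure (surf P) (cell_s r k) \<le> ennreal (C * (1/4) ^ r)"
    using emeasure_cell_s_le by blast
  have "(\<integral>\<^sup>+x. ennreal (s_density r d x) \<partial>surf P) \<le> ennreal (C * (1/4) ^ r * s_sq r d)" for r d
  proof -
    have "(\<integral>\<^sup>+x. ennreal (s_density r d x) \<partial>surf P)
        = (\<integral>\<^sup>+x. (\<Sum>k<N_s P r. ennreal (\<Sum>m<D_s P. (d k m)\<^sup>2) * indicator (cell_s r k) x) \<partial>surf P)"
      unfolding s_density_def
    proof (intro nn_integral_cong)
      fix x
      have "ennreal (\<Sum>k<N_s P r. (\<Sum>m<D_s P. (d k m)\<^sup>2) * indicator (cell_s r k) x)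
          = (\<Sum>k<N_s P r. ennreal ((\<Sum>m<D_s P. (d k m)\<^sup>2) * indicator (cell_s r k) x))"
        by (rule sum_ennreal[symmetric]) (auto intro!: mult_nonneg_nonneg sum_nonneg)
      also have "\<dots> = (\<Sum>k<N_s P r. ennreal (\<Sum>m<D_s P. (d k m)\<^sup>2) * indicator (cell_s r k) x)"
        by (intro sum.cong refl) (auto split: split_indicator)
      finally show "ennreal (\<Sum>k<N_s P r. (\<Sum>m<D_s P. (d k m)\<^sup>2) * indicator (cell_s r k) x)
          = (\<Sum>k<N_s P r. ennreal (\<Sum>m<D_s P. (d k m)\<^sup>2) * indicator (cell_s r k) x)" .
    qed
    also have "\<dots> = (\<Sum>k<N_s P r. \<integral>\<^sup>+x. ennreal (\<Sum>m<D_s P. (d k m)\<^sup>2) * indicator (cell_s r k) x \<partial>surf P)"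
      using cell_s_borel by (intro nn_integral_sum) auto
    also have "\<dots> = (\<Sum>k<N_s P r. ennreal (\<Sum>m<D_s P. (d k m)\<^sup>2) * emeasure (surf P) (cell_s r k))"
      using cell_s_borel by (intro sum.cong refl nn_integral_cmult_indicator) auto
    also have "\<dots> \<le> (\<Sum>k<N_s P r. ennreal (\<Sum>m<D_s P. (d k m)\<^sup>2) * ennreal (C * (1/4) ^ r))"
      using C by (intro sum_mono mult_left_mono) auto
    also have "\<dots> = ennreal (C * (1/4) ^ r * s_sq r d)"
      using C(1) by (simp add: s_sq_def sum_nonneg mult.commute sum_distrib_left flip: ennreal_mult)
    finally show ?thesis .
  qed
  then show ?thesis using C(1) by blast
qed

text \<open>Within a cell the difference is bounded by the slope of the shape functions times
  bubbles. For points not in a common cell each value is bounded by its bubble, hence by the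
  distance. Parameters are magnified by 2^r against the surface, which gives 4^r after
  squaring.\<close>

lemma s_test_pointwise:
  "\<exists>C>0. (\<forall>r d x. (s_test r d x)\<^sup>2 \<le> s_density r d x * C) \<and>
     (\<forall>r d. \<forall>x\<in>Gam P. \<forall>y\<in>Gam P. (s_test r d x - s_test r d y)\<^sup>2
        \<le> 2 * (s_density r d x + s_density r d y) * (C * 4 ^ r * (norm (x - y))\<^sup>2))"
proof -
  obtain C where C: "C > 0" "\<And>m u. m < D_s P \<Longrightarrow> u \<in> ref_triangle \<Longrightarrow> \<bar>phi_ref P m u\<bar> \<le> C"
     "\<And>m u v. m < D_s P \<Longrightarrow> u \<in> ref_triangle \<Longrightarrow> v \<in> ref_triangle \<Longrightarrow>
         \<bar>bubble u * phi_ref P m u - bubble v * phi_ref P m v\<bar> \<le> C * norm (u - v)"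
    using phi_ref_bounds by metis
  obtain K1 where K1: "K1 > 0" "\<And>r k u v. k < N_s P r \<Longrightarrow> u \<in> ref_triangle \<Longrightarrow> v \<in> ref_triangle \<Longrightarrow>
      norm (u - v) \<le> K1 * 2 ^ r * norm (patch_par P r k u - patch_par P r k v)"
    using patch_par_inverse_lipschitz by blast
  obtain K2 where K2: "K2 > 0" "\<And>r k u y. k < N_s P r \<Longrightarrow> u \<in> ref_triangle \<Longrightarrow> y \<in> Gam P \<Longrightarrow> y \<notin> cell_s r k \<Longrightarrow>
      \<exists>z. z \<notin> tri_int \<and> norm (u - z) \<le> K2 * 2 ^ r * norm (patch_par P r k u - y)"
    using patch_par_separation unfolding cell_s_def by (metis DiffI)
  define c0 where "c0 = real (D_s P) * C\<^sup>2"
  \<comment> \<open>\<open>c0\<close> comes from Cauchy-Schwarz over the shape functions. The three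
    summands cover the plain bound of the value, two points of one cell, and points separated by a
    cell boundary, where \<open>bubble_le_dist\<close> adds the factor 2.\<close>
  define B where "B = c0 * (1 + K1\<^sup>2 + (2 * K2)\<^sup>2)"
  have c0: "0 < c0" using C D_s_pos by (simp add: c0_def)
  have pos: "0 < 1 + K1\<^sup>2 + (2 * K2)\<^sup>2" by (intro add_pos_nonneg) auto
  have B: "0 < B" using c0 pos by (simp add: B_def)
  have B_ge: "c0 * q \<le> B" if "q \<le> 1 + K1\<^sup>2 + (2 * K2)\<^sup>2" for q
    using that c0 unfolding B_def by (intro mult_left_mono) auto
  have CS: "(\<Sum>m<D_s P. e m * f m)\<^sup>2 \<le> (\<Sum>m<D_s P. (e m)\<^sup>2) * (c0 * t\<^sup>2)"
    if "\<And>m. m < D_s P \<Longrightarrow> \<bar>f m\<bar> \<le> C * t" for e f :: "nat \<Rightarrow> real" and t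
  proof -
    have "(f m)\<^sup>2 \<le> (C * t)\<^sup>2" if "m < D_s P" for m
      using \<open>\<And>m. m < D_s P \<Longrightarrow> \<bar>f m\<bar> \<le> C * t\<close>[OF that] by (intro power2_le_iff_abs_le[THEN iffD2]) auto
    then have "(\<Sum>m<D_s P. (f m)\<^sup>2) \<le> (\<Sum>m<D_s P. (C * t)\<^sup>2)" by (intro sum_mono) auto
    also have "\<dots> = c0 * t\<^sup>2" by (simp add: c0_def power_mult_distrib)
    finally show ?thesis
      by (intro order.trans[OF Cauchy_Schwarz_ineq_sum] mult_left_mono) (auto intro: sum_nonneg)
  qed
  define w where "w r d k x = (\<Sum>m<D_s P. d k m * (bubble_s r k x * phi P r k m x))" for r and d :: "nat \<Rightarrow> nat \<Rightarrow> real" and k x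
  have w_par: "w r d k (patch_par P r k u) = (\<Sum>m<D_s P. d k m * (bubble u * phi_ref P m u))"
    if "k < N_s P r" "u \<in> ref_triangle" for r d k u
    using that by (simp add: w_def bubble_s_patch_par phi_patch_par)
  have w_supp: "w r d k x = 0" if "k \<in> {..<N_s P r}" "x \<notin> cell_s r k" for r d k x
    using that by (simp add: w_def bubble_s_zero)
  have w_bound: "(w r d k (patch_par P r k u))\<^sup>2 \<le> (\<Sum>m<D_s P. (d k m)\<^sup>2) * (c0 * t\<^sup>2)"
    if "k < N_s P r" "u \<in> ref_triangle" "bubble u \<le> t" for r d k u t
    unfolding w_par[OF that(1,2)]
  proof (rule CS)
    fix m assume m: "m < D_s P"
    have "\<bar>phi_ref P m u\<bar> * bubble u \<le> C * t"
      using C(1) C(2)[OF m that(2)] bubble_nonneg[OF that(2)] that(3) by (intro mult_mono) auto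
    then show "\<bar>bubble u * phi_ref P m u\<bar> \<le> C * t"
      using bubble_nonneg[OF that(2)] by (simp add: abs_mult mult.commute)
  qed
  have eq: "s_test r d x = (\<Sum>k<N_s P r. w r d k x)" for r d x by (simp add: s_test_def w_def)
  have "(s_test r d x)\<^sup>2 \<le> s_density r d x * B" for r d x
    unfolding eq s_density_def
  proof (rule sum_disjoint_support_sq_le[OF _ disjoint_cell_s w_supp])
    fix k assume k: "k \<in> {..<N_s P r}" "x \<in> cell_s r k"
    then obtain u where u: "u \<in> ref_triangle" "x = patch_par P r k u"
      using tri_int_subset by (auto simp: cell_s_def)
    have "(w r d k x)\<^sup>2 \<le> (\<Sum>m<D_s P. (d k m)\<^sup>2) * (c0 * 1\<^sup>2)"
      using w_bound[of k r u 1] u k bubble_le_one by auto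
    also have "\<dots> \<le> (\<Sum>m<D_s P. (d k m)\<^sup>2) * B"
      using B_ge[of 1] by (intro mult_left_mono sum_nonneg) auto
    finally show "(w r d k x)\<^sup>2 \<le> (\<Sum>m<D_s P. (d k m)\<^sup>2) * B" .
  qed (use B in \<open>auto intro: sum_nonneg\<close>)
  moreover have "(s_test r d x - s_test r d y)\<^sup>2 \<le> 2 * (s_density r d x + s_density r d y) * (B * 4 ^ r * (norm (x - y))\<^sup>2)"
    if x: "x \<in> Gam P" and y: "y \<in> Gam P" for r d x y
  proof -
    have four: "(q * 2 ^ r * n)\<^sup>2 = q\<^sup>2 * 4 ^ r * n\<^sup>2" for q n :: real
      by (simp add: power_mult_distrib flip: power_mult) (simp add: power_mult mult.commute[of r])
    have scale: "(\<Sum>m<D_s P. (d k m)\<^sup>2) * (c0 * (q * 2 ^ r * n)\<^sup>2) \<le> (\<Sum>m<D_s P. (d k m)\<^sup>2) * (B * 4 ^ r * n\<^sup>2)"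
      if "q\<^sup>2 \<le> 1 + K1\<^sup>2 + (2 * K2)\<^sup>2" for k q n
    proof -
      have "c0 * q\<^sup>2 * (4 ^ r * n\<^sup>2) \<le> B * (4 ^ r * n\<^sup>2)" using B_ge[OF that] by (intro mult_right_mono) auto
      then show ?thesis unfolding four by (intro mult_left_mono sum_nonneg) (auto simp: mult.assoc)
    qed
    have outside: "(w r d k a)\<^sup>2 \<le> (\<Sum>m<D_s P. (d k m)\<^sup>2) * (B * 4 ^ r * (norm (a - b))\<^sup>2)"
      if k: "k \<in> {..<N_s P r}" "a \<in> cell_s r k" "b \<notin> cell_s r k" "b \<in> Gam P" for k a b
    proof -
      obtain u where u: "u \<in> ref_triangle" "a = patch_par P r k u" using k tri_int_subset by (auto simp: cell_s_def)
      obtain z where z: "z \<notin> tri_int" "norm (u - z) \<le> K2 * 2 ^ r * norm (a - b)"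
        using K2(2)[of k r u b] k u by auto
      have "bubble u \<le> 2 * K2 * 2 ^ r * norm (a - b)" using bubble_le_dist[OF u(1) z(1)] z(2) by simp
      then have "(w r d k a)\<^sup>2 \<le> (\<Sum>m<D_s P. (d k m)\<^sup>2) * (c0 * (2 * K2 * 2 ^ r * norm (a - b))\<^sup>2)"
        unfolding u(2) using w_bound[of k r u] k u(1) by auto
      also have "\<dots> \<le> (\<Sum>m<D_s P. (d k m)\<^sup>2) * (B * 4 ^ r * (norm (a - b))\<^sup>2)" by (rule scale) auto
      finally show ?thesis .
    qed
    show ?thesis
      unfolding eq s_density_def
    proof (rule sum_disjoint_support_diff_sq_le[OF _ disjoint_cell_s w_supp])
      fix k assume k: "k \<in> {..<N_s P r}" "x \<in> cell_s r k" "y \<in> cell_s r k"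
      obtain u where u: "u \<in> ref_triangle" "x = patch_par P r k u" using k tri_int_subset by (auto simp: cell_s_def)
      obtain v where v: "v \<in> ref_triangle" "y = patch_par P r k v" using k tri_int_subset by (auto simp: cell_s_def)
      have "w r d k x - w r d k y = (\<Sum>m<D_s P. d k m * (bubble u * phi_ref P m u - bubble v * phi_ref P m v))"
        using k u v by (simp add: w_par right_diff_distrib sum_subtractf)
      moreover have "\<dots>\<^sup>2 \<le> (\<Sum>m<D_s P. (d k m)\<^sup>2) * (c0 * (K1 * 2 ^ r * norm (x - y))\<^sup>2)"
      proof (rule CS)
        fix m assume m: "m < D_s P"
        have "\<bar>bubble u * phi_ref P m u - bubble v * phi_ref P m v\<bar> \<le> C * norm (u - v)" by (rule C(3)[OF m u(1) v(1)])
        also have "\<dots> \<le> C * (K1 * 2 ^ r * norm (x - y))" using K1(2)[of k r u v] k u v C(1) by (intro mult_left_mono) auto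
        finally show "\<bar>bubble u * phi_ref P m u - bubble v * phi_ref P m v\<bar> \<le> C * (K1 * 2 ^ r * norm (x - y))" .
      qed
      moreover have "(\<Sum>m<D_s P. (d k m)\<^sup>2) * (c0 * (K1 * 2 ^ r * norm (x - y))\<^sup>2)
          \<le> (\<Sum>m<D_s P. (d k m)\<^sup>2) * (B * 4 ^ r * (norm (x - y))\<^sup>2)" by (rule scale) auto
      ultimately show "(w r d k x - w r d k y)\<^sup>2 \<le> (\<Sum>m<D_s P. (d k m)\<^sup>2) * (B * 4 ^ r * (norm (x - y))\<^sup>2)" by simp
    next
      fix k assume "k \<in> {..<N_s P r}" "x \<in> cell_s r k" "y \<notin> cell_s r k"
      then show "(w r d k x)\<^sup>2 \<le> (\<Sum>m<D_s P. (d k m)\<^sup>2) * (B * 4 ^ r * (norm (x - y))\<^sup>2)" using outside y by blast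
    next
      fix k assume "k \<in> {..<N_s P r}" "y \<in> cell_s r k" "x \<notin> cell_s r k"
      then show "(w r d k y)\<^sup>2 \<le> (\<Sum>m<D_s P. (d k m)\<^sup>2) * (B * 4 ^ r * (norm (x - y))\<^sup>2)"
        using outside[of k y x] x by (simp add: norm_minus_commute)
    qed (use B in \<open>auto intro: sum_nonneg\<close>)
  qed
  ultimately show ?thesis using B by blast
qed

lemma L2_s_test_le:
  "\<exists>C>0. \<forall>r d. L2_Gam_sq P (s_test r d) \<le> ennreal (C * (1/4) ^ r * s_sq r d)"
proof -
  obtain C where C: "C > 0" "\<And>r d x. (s_test r d x)\<^sup>2 \<le> s_density r d x * C"
    using s_test_pointwise by blast
  obtain C' where C': "C' > 0" "\<And>r d. (\<integral>\<^sup>+x. ennreal (s_density r d x) \<partial>surf P) \<le> ennreal (C' * (1/4) ^ r * s_sq r d)"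
    using nn_integral_s_density_le by blast
  have "L2_Gam_sq P (s_test r d) \<le> ennreal (C * C' * (1/4) ^ r * s_sq r d)" for r d
  proof -
    have "L2_Gam_sq P (s_test r d) \<le> (\<integral>\<^sup>+x. ennreal C * ennreal (s_density r d x) \<partial>surf P)"
      unfolding L2_Gam_sq_def using C s_density_nonneg
      by (intro nn_integral_mono) (simp add: ennreal_leI mult.commute flip: ennreal_mult)
    also have "\<dots> = ennreal C * (\<integral>\<^sup>+x. ennreal (s_density r d x) \<partial>surf P)"
      by (rule nn_integral_cmult) measurable
    also have "\<dots> \<le> ennreal C * ennreal (C' * (1/4) ^ r * s_sq r d)" by (intro mult_left_mono C') auto
    also have "\<dots> = ennreal (C * C' * (1/4) ^ r * s_sq r d)"
      using C C' s_sq_nonneg by (simp add: mult.assoc flip: ennreal_mult)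
    finally show ?thesis .
  qed
  then show ?thesis using C(1) C'(1) by (intro exI[of _ "C * C'"]) auto
qed

text \<open>The squared difference cancels two of the three powers of the kernel, and the remaining
  one is integrable. The factor 4^r from the slopes cancels against the cell area in the integral of
  \<open>s_density\<close>, so the constant is independent of \<open>r\<close>.\<close>

lemma H_half_s_test_le:
  "\<exists>C>0. \<forall>r d. H_half_Gam_sq P (s_test r d) \<le> ennreal (C * s_sq r d)"
proof -
  obtain C where C: "C > 0" "\<And>r d x y. x \<in> Gam P \<Longrightarrow> y \<in> Gam P \<Longrightarrow> (s_test r d x - s_test r d y)\<^sup>2
        \<le> 2 * (s_density r d x + s_density r d y) * (C * 4 ^ r * (norm (x - y))\<^sup>2)"
    using s_test_pointwise by blast
  obtain C0 where C0: "C0 > 0" "\<And>r d. L2_Gam_sq P (s_test r d) \<le> ennreal (C0 * (1/4) ^ r * s_sq r d)"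
    using L2_s_test_le by blast
  obtain C1 where C1: "C1 > 0" "\<And>r d. (\<integral>\<^sup>+x. ennreal (s_density r d x) \<partial>surf P) \<le> ennreal (C1 * (1/4) ^ r * s_sq r d)"
    using nn_integral_s_density_le by blast
  obtain C2 where C2: "C2 > 0" "\<And>x. (\<integral>\<^sup>+y. ennreal (1 / norm (x - y)) \<partial>surf P) \<le> ennreal C2"
    using surf_kernel_bound by blast
  interpret pair_sigma_finite "surf P" "surf P" ..
  have "H_half_Gam_sq P (s_test r d) \<le> ennreal ((C0 + 4 * C * C1 * C2) * s_sq r d)" for r d
  proof -
    define a where "a x = ennreal (s_density r d x)" for x
    define N where "N x y = ennreal (1 / norm (x - y))" for x y :: "real^3"
    define c where "c = ennreal (2 * C * 4 ^ r)"
    have [measurable]: "a \<in> borel_measurable borel" unfolding a_def by measurable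
    have N[measurable]: "(\<lambda>z. N (fst z) (snd z)) \<in> borel_measurable (borel \<Otimes>\<^sub>M borel)"
      unfolding N_def by measurable
    have pt: "ennreal ((s_test r d x - s_test r d y)\<^sup>2 / norm (x - y) ^ 3) \<le> c * (a x * N x y + a y * N x y)"
      if x: "x \<in> Gam P" and y: "y \<in> Gam P" for x y
    proof (cases "x = y")
      case False
      then have n: "norm (x - y) > 0" by simp
      have "(s_test r d x - s_test r d y)\<^sup>2 / norm (x - y) ^ 3
          \<le> 2 * (s_density r d x + s_density r d y) * (C * 4 ^ r * (norm (x - y))\<^sup>2) / norm (x - y) ^ 3"
        using C(2)[OF x y] by (intro divide_right_mono) auto
      also have "\<dots> = (2 * C * 4 ^ r) * (s_density r d x * (1 / norm (x - y)) + s_density r d y * (1 / norm (x - y)))"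
        using n by (simp add: field_simps power2_eq_square power3_eq_cube)
      finally show ?thesis
        using C(1) s_density_nonneg
        by (simp add: c_def a_def N_def ennreal_leI flip: ennreal_mult ennreal_plus)
    qed simp
    have I: "(\<integral>\<^sup>+x. \<integral>\<^sup>+y. a x * N x y \<partial>surf P \<partial>surf P) \<le> ennreal C2 * (\<integral>\<^sup>+x. a x \<partial>surf P)"
    proof -
      have "(\<integral>\<^sup>+x. \<integral>\<^sup>+y. a x * N x y \<partial>surf P \<partial>surf P) = (\<integral>\<^sup>+x. a x * (\<integral>\<^sup>+y. N x y \<partial>surf P) \<partial>surf P)"
        unfolding N_def by (intro nn_integral_cong nn_integral_cmult) measurable
      also have "\<dots> \<le> (\<integral>\<^sup>+x. a x * ennreal C2 \<partial>surf P)"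
        unfolding N_def by (intro nn_integral_mono mult_left_mono C2) auto
      also have "\<dots> = ennreal C2 * (\<integral>\<^sup>+x. a x \<partial>surf P)"
        by (subst nn_integral_multc) (auto simp: mult.commute)
      finally show ?thesis .
    qed
    \<comment> \<open>The density at the inner variable is reduced to the other case by Fubini and
      the symmetry of the kernel.\<close>
    have swap: "(\<integral>\<^sup>+x. \<integral>\<^sup>+y. a y * N x y \<partial>surf P \<partial>surf P) = (\<integral>\<^sup>+x. \<integral>\<^sup>+y. a x * N x y \<partial>surf P \<partial>surf P)"
    proof -
      have "(\<integral>\<^sup>+x. \<integral>\<^sup>+y. a y * N x y \<partial>surf P \<partial>surf P) = (\<integral>\<^sup>+y. \<integral>\<^sup>+x. a y * N x y \<partial>surf P \<partial>surf P)"
        by (rule Fubini'[symmetric]) (simp add: case_prod_unfold N_def)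
      then show ?thesis by (simp add: N_def norm_minus_commute)
    qed
    have "(\<integral>\<^sup>+x. \<integral>\<^sup>+y. ennreal ((s_test r d x - s_test r d y)\<^sup>2 / norm (x - y) ^ 3) \<partial>surf P \<partial>surf P)
        \<le> (\<integral>\<^sup>+x. \<integral>\<^sup>+y. c * (a x * N x y + a y * N x y) \<partial>surf P \<partial>surf P)"
    proof (intro nn_integral_mono_AE, use AE_surf_Gam in eventually_elim)
      fix x assume x: "x \<in> Gam P"
      show "(\<integral>\<^sup>+y. ennreal ((s_test r d x - s_test r d y)\<^sup>2 / norm (x - y) ^ 3) \<partial>surf P)
          \<le> (\<integral>\<^sup>+y. c * (a x * N x y + a y * N x y) \<partial>surf P)"
        by (intro nn_integral_mono_AE, use AE_surf_Gam in eventually_elim) (rule pt[OF x])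
    qed
    also have "\<dots> = c * ((\<integral>\<^sup>+x. \<integral>\<^sup>+y. a x * N x y \<partial>surf P \<partial>surf P) + (\<integral>\<^sup>+x. \<integral>\<^sup>+y. a y * N x y \<partial>surf P \<partial>surf P))"
      unfolding N_def by (simp add: nn_integral_cmult nn_integral_add)
    also have "\<dots> \<le> c * (ennreal C2 * (\<integral>\<^sup>+x. a x \<partial>surf P) + ennreal C2 * (\<integral>\<^sup>+x. a x \<partial>surf P))"
      unfolding swap by (intro mult_left_mono add_mono I) auto
    also have "\<dots> \<le> c * (ennreal C2 * ennreal (C1 * (1/4) ^ r * s_sq r d) + ennreal C2 * ennreal (C1 * (1/4) ^ r * s_sq r d))"
      unfolding a_def by (intro mult_left_mono add_mono C1) auto
    also have "\<dots> = ennreal ((2 * C * 4 ^ r) * (C2 * (C1 * (1/4) ^ r * s_sq r d) + C2 * (C1 * (1/4) ^ r * s_sq r d)))"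
      using C(1) C1(1) C2(1) s_sq_nonneg by (simp add: c_def flip: ennreal_mult ennreal_plus)
    also have "(2 * C * 4 ^ r) * (C2 * (C1 * (1/4) ^ r * s_sq r d) + C2 * (C1 * (1/4) ^ r * s_sq r d))
        = 4 * C * C1 * C2 * s_sq r d"
      by (simp add: power_divide field_simps)
    finally have semi: "(\<integral>\<^sup>+x. \<integral>\<^sup>+y. ennreal ((s_test r d x - s_test r d y)\<^sup>2 / norm (x - y) ^ 3) \<partial>surf P \<partial>surf P)
        \<le> ennreal (4 * C * C1 * C2 * s_sq r d)" .
    have "C0 * (1/4) ^ r * s_sq r d \<le> C0 * 1 * s_sq r d"
      using C0(1) s_sq_nonneg by (intro mult_right_mono mult_left_mono power_le_one) auto
    then have "L2_Gam_sq P (s_test r d) \<le> ennreal (C0 * s_sq r d)"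
      using C0(2)[of r d] by (auto intro: order.trans ennreal_leI)
    then have "H_half_Gam_sq P (s_test r d) \<le> ennreal (C0 * s_sq r d) + ennreal (4 * C * C1 * C2 * s_sq r d)"
      unfolding H_half_Gam_sq_def by (intro add_mono semi)
    also have "\<dots> = ennreal ((C0 + 4 * C * C1 * C2) * s_sq r d)"
      using C(1) C0(1) C1(1) C2(1) s_sq_nonneg by (simp add: distrib_right flip: ennreal_plus)
    finally show ?thesis .
  qed
  then show ?thesis using C(1) C0(1) C1(1) C2(1)
    by (intro exI[of _ "C0 + 4 * C * C1 * C2"]) (auto intro: add_pos_nonneg)
qed

lemma s_fun_s_test_cell:
  assumes k: "k < N_s P r" and u: "u \<in> tri_int"
  shows "s_fun r d (patch_par P r k u) * s_test r d (patch_par P r k u)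
    = bubble u * (\<Sum>m<D_s P. d k m * phi_ref P m u)\<^sup>2"
proof -
  define x where "x = patch_par P r k u"
  have uT: "u \<in> ref_triangle" using u tri_int_subset by blast
  have z: "phi P r l m x = 0" if "l < N_s P r" "l \<noteq> k" for l m
    using patch_par_disjoint[OF k that(1) that(2)[symmetric] u] by (auto simp: phi_def patch_def x_def)
  have "s_fun r d x = (\<Sum>l\<in>{k}. \<Sum>m<D_s P. d l m * phi P r l m x)"
    unfolding s_fun_def using k z by (intro sum.mono_neutral_right) auto
  then have 1: "s_fun r d x = (\<Sum>m<D_s P. d k m * phi_ref P m u)"
    using k uT by (simp add: x_def phi_patch_par)
  have "s_test r d x = (\<Sum>l\<in>{k}. \<Sum>m<D_s P. d l m * (bubble_s r l x * phi P r l m x))"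
    unfolding s_test_def using k z by (intro sum.mono_neutral_right) auto
  then have 2: "s_test r d x = bubble u * (\<Sum>m<D_s P. d k m * phi_ref P m u)"
    using k uT by (simp add: x_def phi_patch_par bubble_s_patch_par sum_distrib_left mult_ac)
  show ?thesis using 1 2 by (simp add: x_def power2_eq_square)
qed

lemma s_fun_s_test_nonneg: "0 \<le> s_fun r d x * s_test r d x"
proof (cases "\<exists>k<N_s P r. x \<in> cell_s r k")
  case True
  then obtain k u where "k < N_s P r" "u \<in> tri_int" "x = patch_par P r k u" by (auto simp: cell_s_def)
  then show ?thesis using bubble_pos[of u] by (simp add: s_fun_s_test_cell)
next
  case False
  then have "s_test r d x = 0" unfolding s_test_def by (intro sum.neutral) (auto simp: bubble_s_zero)
  then show ?thesis by simp
qed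

lemma s_coercive:
  "\<exists>\<kappa>>0. \<forall>r d. ennreal (\<kappa> * (1/4) ^ r * s_sq r d) \<le> (\<integral>\<^sup>+x. ennreal (s_fun r d x * s_test r d x) \<partial>surf P)"
proof -
  obtain \<kappa> where \<kappa>: "\<kappa> > 0" "\<And>d. ennreal (\<kappa> * (\<Sum>m<D_s P. (d m)\<^sup>2))
     \<le> (\<integral>\<^sup>+u. ennreal (bubble u * (\<Sum>m<D_s P. d m * phi_ref P m u)\<^sup>2) * indicator tri_int u \<partial>lborel)"
    using phi_ref_coercive by blast
  obtain c where c: "c > 0" "\<And>r F. F \<in> borel_measurable borel \<Longrightarrow>
     ennreal (c * (1/4) ^ r) * (\<Sum>k<N_s P r. \<integral>\<^sup>+u. F (patch_par P r k u) * indicator tri_int u \<partial>lborel) \<le> (\<integral>\<^sup>+x. F x \<partial>surf P)"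
    using surf_cells_lower by blast
  have "ennreal (c * \<kappa> * (1/4) ^ r * s_sq r d) \<le> (\<integral>\<^sup>+x. ennreal (s_fun r d x * s_test r d x) \<partial>surf P)" for r d
  proof -
    have "ennreal (c * \<kappa> * (1/4) ^ r * s_sq r d) = ennreal (c * (1/4) ^ r) * (\<Sum>k<N_s P r. ennreal (\<kappa> * (\<Sum>m<D_s P. (d k m)\<^sup>2)))"
      using c(1) \<kappa>(1) by (simp add: s_sq_def sum_nonneg sum_distrib_left mult_ac flip: ennreal_mult)
    also have "\<dots> \<le> ennreal (c * (1/4) ^ r) * (\<Sum>k<N_s P r.
        \<integral>\<^sup>+u. ennreal (bubble u * (\<Sum>m<D_s P. d k m * phi_ref P m u)\<^sup>2) * indicator tri_int u \<partial>lborel)"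
      by (intro mult_left_mono sum_mono \<kappa>) auto
    also have "(\<Sum>k<N_s P r. \<integral>\<^sup>+u. ennreal (bubble u * (\<Sum>m<D_s P. d k m * phi_ref P m u)\<^sup>2) * indicator tri_int u \<partial>lborel)
       = (\<Sum>k<N_s P r. \<integral>\<^sup>+u. ennreal (s_fun r d (patch_par P r k u) * s_test r d (patch_par P r k u)) * indicator tri_int u \<partial>lborel)"
      by (intro sum.cong nn_integral_cong refl) (auto simp: s_fun_s_test_cell split: split_indicator)
    also have "ennreal (c * (1/4) ^ r) * \<dots> \<le> (\<integral>\<^sup>+x. ennreal (s_fun r d x * s_test r d x) \<partial>surf P)"
      by (rule c(2)) measurable
    finally show ?thesis .
  qed
  then show ?thesis using c(1) \<kappa>(1) by (intro exI[of _ "c * \<kappa>"]) auto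
qed

end

section \<open>Test functions in time\<close>

lemma poly_bounded_on_unit_interval: "\<exists>K\<ge>0. \<forall>\<tau>\<in>{0..1}. \<bar>poly p \<tau>\<bar> \<le> (K::real)"
proof -
  have "compact (poly p ` {0..1})"
    by (intro compact_continuous_image continuous_on_poly continuous_on_id compact_Icc)
  then obtain K where "\<forall>y\<in>poly p ` {0..1}. norm y \<le> K"
    using compact_imp_bounded bounded_iff by metis
  moreover from this have "0 \<le> K" by force
  ultimately show ?thesis by auto
qed

lemma poly_lipschitz_on_unit_interval:
  "\<exists>K\<ge>0. \<forall>\<tau>\<in>{0..1}. \<forall>\<sigma>\<in>{0..1}. \<bar>poly p \<tau> - poly p \<sigma>\<bar> \<le> K * \<bar>\<tau> - \<sigma> :: real\<bar>"
proof -
  obtain K where K: "0 \<le> K" "\<And>\<tau>. \<tau> \<in> {0..1} \<Longrightarrow> \<bar>poly (pderiv p) \<tau>\<bar> \<le> K"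
    using poly_bounded_on_unit_interval by blast
  have lt: "\<bar>poly p \<tau> - poly p \<sigma>\<bar> \<le> K * \<bar>\<tau> - \<sigma>\<bar>" if ts: "\<tau> \<in> {0..1}" "\<sigma> \<in> {0..1}" "\<tau> < \<sigma>" for \<tau> \<sigma>
  proof -
    obtain x where x: "\<tau> < x" "x < \<sigma>" "poly p \<sigma> - poly p \<tau> = (\<sigma> - \<tau>) * poly (pderiv p) x"
      using poly_MVT[OF ts(3), of p] by blast
    have "\<bar>poly p \<sigma> - poly p \<tau>\<bar> \<le> \<bar>\<sigma> - \<tau>\<bar> * K"
      unfolding x(3) abs_mult using x ts by (intro mult_left_mono K) auto
    then show ?thesis by (simp add: abs_minus_commute mult.commute)
  qed
  have "\<bar>poly p \<tau> - poly p \<sigma>\<bar> \<le> K * \<bar>\<tau> - \<sigma>\<bar>" if "\<tau> \<in> {0..1}" "\<sigma> \<in> {0..1}" for \<tau> \<sigma>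
    using lt[of \<tau> \<sigma>] lt[of \<sigma> \<tau>] that
    by (cases \<tau> \<sigma> rule: linorder_cases) (auto simp: abs_minus_commute)
  then show ?thesis using K(1) by blast
qed

context heat_bem_setup
begin

lemma chi_ref_bounds:
  "\<exists>C>0. \<forall>j<D_t P. \<forall>\<tau>\<in>{0..1}. \<bar>poly (chi_ref P j) \<tau>\<bar> \<le> C \<and>
     (\<forall>\<sigma>\<in>{0..1}. \<bar>\<tau> * (1 - \<tau>) * poly (chi_ref P j) \<tau> - \<sigma> * (1 - \<sigma>) * poly (chi_ref P j) \<sigma>\<bar> \<le> C * \<bar>\<tau> - \<sigma>\<bar>)"
proof -
  obtain A where A: "A > 0" "\<And>j \<tau>. j < D_t P \<Longrightarrow> \<tau> \<in> {0..1} \<Longrightarrow> \<bar>poly (chi_ref P j) \<tau>\<bar> \<le> A"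
    using chi_ref_bounded by blast
  have "\<exists>K\<ge>0. \<forall>\<tau>\<in>{0..1}. \<forall>\<sigma>\<in>{0..1}.
      \<bar>\<tau> * (1 - \<tau>) * poly (chi_ref P j) \<tau> - \<sigma> * (1 - \<sigma>) * poly (chi_ref P j) \<sigma>\<bar> \<le> K * \<bar>\<tau> - \<sigma>\<bar>" for j
    using poly_lipschitz_on_unit_interval[of "[:0, 1, -1:] * chi_ref P j"] by (simp add: algebra_simps)
  then obtain K where K: "\<And>j. 0 \<le> K j" "\<And>j \<tau> \<sigma>. \<tau> \<in> {0..1} \<Longrightarrow> \<sigma> \<in> {0..1} \<Longrightarrow>
      \<bar>\<tau> * (1 - \<tau>) * poly (chi_ref P j) \<tau> - \<sigma> * (1 - \<sigma>) * poly (chi_ref P j) \<sigma>\<bar> \<le> K j * \<bar>\<tau> - \<sigma>\<bar>"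
    by metis
  define C where "C = A + (\<Sum>j<D_t P. K j)"
  have sum0: "0 \<le> (\<Sum>j<D_t P. K j)" using K(1) by (intro sum_nonneg)
  have KC: "K j \<le> C" if "j < D_t P" for j
  proof -
    have "K j \<le> (\<Sum>j<D_t P. K j)" using that K(1) by (intro member_le_sum) auto
    then show ?thesis using A(1) by (simp add: C_def)
  qed
  have "\<bar>\<tau> * (1 - \<tau>) * poly (chi_ref P j) \<tau> - \<sigma> * (1 - \<sigma>) * poly (chi_ref P j) \<sigma>\<bar> \<le> C * \<bar>\<tau> - \<sigma>\<bar>"
    if "j < D_t P" "\<tau> \<in> {0..1}" "\<sigma> \<in> {0..1}" for j \<tau> \<sigma>
    using K(2)[OF that(2,3), of j] mult_right_mono[OF KC[OF that(1)], of "\<bar>\<tau> - \<sigma>\<bar>"] by simp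
  moreover have "\<bar>poly (chi_ref P j) \<tau>\<bar> \<le> C" if "j < D_t P" "\<tau> \<in> {0..1}" for j \<tau>
    using A(2)[OF that] sum0 by (simp add: C_def)
  moreover have "0 < C" using A(1) sum0 by (simp add: C_def)
  ultimately show ?thesis by blast
qed

lemma chi_ref_coercive:
  "\<exists>\<kappa>>0. \<forall>d. ennreal (\<kappa> * (\<Sum>j<D_t P. (d j)\<^sup>2))
     \<le> (\<integral>\<^sup>+\<tau>. ennreal (\<tau> * (1 - \<tau>) * (\<Sum>j<D_t P. d j * poly (chi_ref P j) \<tau>)\<^sup>2) * indicator {0<..<1} \<tau> \<partial>lborel)"
proof (rule weighted_gram_coercive)
  fix d :: "nat \<Rightarrow> real" and j
  assume z: "\<And>\<tau>. \<tau> \<in> {0<..<1} \<Longrightarrow> (\<Sum>j<D_t P. d j * poly (chi_ref P j) \<tau>) = 0" and j: "j < D_t P"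
  define p where "p = (\<Sum>j<D_t P. smult (d j) (chi_ref P j))"
  have "poly p \<tau> = 0" if "\<tau> \<in> {0<..<1}" for \<tau>
    using z[OF that] by (simp add: p_def poly_sum)
  then have "{0<..<1::real} \<subseteq> {\<tau>. poly p \<tau> = 0}" by blast
  then have "infinite {\<tau>. poly p \<tau> = 0}" using infinite_Ioo[of "0::real" 1] by (rule infinite_super) simp
  then have p0: "p = 0" using poly_roots_finite by blast
  have "\<forall>f. degree f \<le> p_t P \<longrightarrow> (\<exists>!c. (\<forall>j\<ge>D_t P. c j = 0) \<and> f = (\<Sum>j<D_t P. smult (c j) (chi_ref P j)))"
    using bem by (simp add: bem_setup_def)
  then have "degree (0 :: real poly) \<le> p_t P \<longrightarrow> (\<exists>!c. (\<forall>j\<ge>D_t P. c j = 0) \<and> 0 = (\<Sum>j<D_t P. smult (c j) (chi_ref P j)))"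
    by (rule spec)
  define Q where "Q c \<longleftrightarrow> (\<forall>j\<ge>D_t P. c j = 0) \<and> 0 = (\<Sum>j<D_t P. smult (c j) (chi_ref P j))" for c
  have ex1: "\<exists>!c. Q c"
    unfolding Q_def using \<open>degree (0 :: real poly) \<le> p_t P \<longrightarrow> _\<close> by simp
  define c where "c j = (if j < D_t P then d j else 0)" for j
  have "Q c" using p0 by (auto simp: p_def c_def Q_def)
  moreover have "Q (\<lambda>_. 0)" by (simp add: Q_def)
  ultimately have "c = (\<lambda>_. 0)" using ex1 by blast
  then show "d j = 0" using j by (auto simp: c_def fun_eq_iff split: if_splits)
qed (auto intro!: continuous_intros)

text \<open>One periodic formula for the quadratic bubbles of all intervals; it vanishes at every
  mesh point. In time the test function is therefore a plain product, with no sum over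
  cells.\<close>

definition bubble_t :: "nat \<Rightarrow> real \<Rightarrow> real" where
  "bubble_t r t = frac (t / h_t P r) * (1 - frac (t / h_t P r))"

definition t_fun :: "nat \<Rightarrow> (nat \<Rightarrow> nat \<Rightarrow> real) \<Rightarrow> real \<Rightarrow> real" where
  "t_fun r e t = (\<Sum>i<N_t P r. \<Sum>j<D_t P. e i j * chi_t P r i j t)"

definition t_sq :: "nat \<Rightarrow> (nat \<Rightarrow> nat \<Rightarrow> real) \<Rightarrow> real" where
  "t_sq r e = (\<Sum>i<N_t P r. \<Sum>j<D_t P. (e i j)\<^sup>2)"

definition t_density :: "nat \<Rightarrow> (nat \<Rightarrow> nat \<Rightarrow> real) \<Rightarrow> real \<Rightarrow> real" where
  "t_density r e t = (\<Sum>i<N_t P r. (\<Sum>j<D_t P. (e i j)\<^sup>2) * indicator (cell_t r i) t)"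

abbreviation t_test :: "nat \<Rightarrow> (nat \<Rightarrow> nat \<Rightarrow> real) \<Rightarrow> real \<Rightarrow> real" where
  "t_test r e t \<equiv> bubble_t r t * t_fun r e t"

lemma t_sq_nonneg: "0 \<le> t_sq r e" and t_density_nonneg: "0 \<le> t_density r e t"
  by (auto simp: t_sq_def t_density_def intro!: sum_nonneg mult_nonneg_nonneg)

lemma bubble_t_bounds: "0 \<le> bubble_t r t" "bubble_t r t \<le> 1"
proof -
  have "0 \<le> frac (t / h_t P r)" "frac (t / h_t P r) \<le> 1"
    using frac_lt_1[of "t / h_t P r"] by auto
  then show "0 \<le> bubble_t r t" "bubble_t r t \<le> 1"
    unfolding bubble_t_def by (auto intro!: mult_le_one)
qed

lemma bubble_t_eq:
  assumes "t \<in> cell_t r i"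
  defines "\<tau> \<equiv> (t - real i * h_t P r) / h_t P r"
  shows "bubble_t r t = \<tau> * (1 - \<tau>)"
proof -
  have "frac (t / h_t P r) = \<tau>"
    unfolding frac_unique_iff using cell_t_coord[OF assms(1)] h_t_pos[of r]
    by (auto simp: \<tau>_def diff_divide_distrib)
  then show ?thesis by (simp add: bubble_t_def)
qed

lemma cell_t_borel[measurable]: "cell_t r i \<in> sets borel"
  by (simp add: cell_t_def)

lemma disjoint_cell_t: "disjoint_family_on (cell_t r) I"
proof (unfold disjoint_family_on_def, intro ballI impI)
  fix i j :: nat assume "i \<noteq> j"
  have lt: "t \<notin> cell_t r i \<or> t \<notin> cell_t r j" if "i < j" for i j :: nat and t
  proof -
    have "real (i + 1) * h_t P r \<le> real j * h_t P r"
      using that h_t_pos[of r] by (intro mult_right_mono) auto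
    then show ?thesis by (auto simp: cell_t_def)
  qed
  show "cell_t r i \<inter> cell_t r j = {}"
    using \<open>i \<noteq> j\<close> lt[of i j] lt[of j i] by (cases i j rule: linorder_cases) auto
qed

lemma borel_measurable_chi_t[measurable]: "chi_t P r i j \<in> borel_measurable borel"
  unfolding chi_t_eq[abs_def]
  by (intro borel_measurable_times borel_measurable_indicator cell_t_borel borel_measurable_const
      borel_measurable_continuous_onI continuous_intros) (use h_t_pos[of r] in auto)

lemma borel_measurable_bubble_t[measurable]: "bubble_t r \<in> borel_measurable borel"
  unfolding bubble_t_def[abs_def] frac_def by measurable

lemma borel_measurable_t_fun[measurable]: "t_fun r e \<in> borel_measurable borel"
  unfolding t_fun_def[abs_def] by measurable

lemma borel_measurable_t_density[measurable]: "t_density r e \<in> borel_measurable borel"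
  unfolding t_density_def[abs_def] by measurable

lemma sets_time_meas[measurable_cong]: "sets (time_meas P) = sets (restrict_space borel {0..T_end P})"
  unfolding time_meas_def by (intro sets_restrict_space_cong) simp

lemma space_time_meas: "space (time_meas P) = {0..T_end P}"
  by (simp add: time_meas_def space_restrict_space)

lemma measurable_time_measI: "f \<in> measurable borel N \<Longrightarrow> f \<in> measurable (time_meas P) N"
  by (subst measurable_cong_sets[OF sets_time_meas refl]) (rule measurable_restrict_space1)

lemma nn_integral_time: "(\<integral>\<^sup>+t. F t \<partial>time_meas P) = (\<integral>\<^sup>+t. F t * indicator {0..T_end P} t \<partial>lborel)"
  unfolding time_meas_def by (intro nn_integral_restrict_space) auto

sublocale time: finite_measure "time_meas P"
  using T_end_pos by (intro finite_measureI) (simp add: time_meas_def emeasure_restrict_space space_restrict_space)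

lemma emeasure_cell_t: "emeasure lborel (cell_t r i) = ennreal (h_t P r)"
  using h_t_pos[of r] by (simp add: cell_t_def algebra_simps)

lemma nn_integral_t_density_le:
  "(\<integral>\<^sup>+t. ennreal (t_density r e t) \<partial>time_meas P) \<le> ennreal (h_t P r * t_sq r e)"
proof -
  have "(\<integral>\<^sup>+t. ennreal (t_density r e t) \<partial>time_meas P) \<le> (\<integral>\<^sup>+t. ennreal (t_density r e t) \<partial>lborel)"
    unfolding nn_integral_time by (intro nn_integral_mono) (auto split: split_indicator)
  also have "\<dots> = (\<integral>\<^sup>+t. (\<Sum>i<N_t P r. ennreal (\<Sum>j<D_t P. (e i j)\<^sup>2) * indicator (cell_t r i) t) \<partial>lborel)"
  proof (intro nn_integral_cong)
    fix t
    have "ennreal (t_density r e t) = (\<Sum>i<N_t P r. ennreal ((\<Sum>j<D_t P. (e i j)\<^sup>2) * indicator (cell_t r i) t))"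
      unfolding t_density_def by (rule sum_ennreal[symmetric]) (auto intro!: mult_nonneg_nonneg sum_nonneg)
    also have "\<dots> = (\<Sum>i<N_t P r. ennreal (\<Sum>j<D_t P. (e i j)\<^sup>2) * indicator (cell_t r i) t)"
      by (intro sum.cong refl) (auto split: split_indicator)
    finally show "ennreal (t_density r e t) = (\<Sum>i<N_t P r. ennreal (\<Sum>j<D_t P. (e i j)\<^sup>2) * indicator (cell_t r i) t)" .
  qed
  also have "\<dots> = (\<Sum>i<N_t P r. \<integral>\<^sup>+t. ennreal (\<Sum>j<D_t P. (e i j)\<^sup>2) * indicator (cell_t r i) t \<partial>lborel)"
    by (intro nn_integral_sum) auto
  also have "\<dots> = (\<Sum>i<N_t P r. ennreal (\<Sum>j<D_t P. (e i j)\<^sup>2) * ennreal (h_t P r))"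
    by (simp add: nn_integral_cmult_indicator emeasure_cell_t)
  also have "\<dots> = ennreal (h_t P r * t_sq r e)"
    using h_t_pos[of r] by (simp add: t_sq_def sum_nonneg mult.commute sum_distrib_left flip: ennreal_mult)
  finally show ?thesis .
qed

text \<open>The difference bound is linear in the distance, enough for the exponent 3/2 of the
  kernel. In it, one factor 1/h comes from the normalization of the basis and one from rescaling the
  distance to the unit interval.\<close>

lemma t_test_pointwise:
  "\<exists>C>0. (\<forall>r e t. (t_test r e t)\<^sup>2 \<le> t_density r e t * (C / h_t P r)) \<and>
     (\<forall>r e t s. (t_test r e t - t_test r e s)\<^sup>2
        \<le> 2 * (t_density r e t + t_density r e s) * (C / (h_t P r)\<^sup>2 * \<bar>t - s\<bar>))"
proof -
  obtain C where C: "C > 0" "\<And>j \<tau>. j < D_t P \<Longrightarrow> \<tau> \<in> {0..1} \<Longrightarrow> \<bar>poly (chi_ref P j) \<tau>\<bar> \<le> C"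
    "\<And>j \<tau> \<sigma>. j < D_t P \<Longrightarrow> \<tau> \<in> {0..1} \<Longrightarrow> \<sigma> \<in> {0..1} \<Longrightarrow>
       \<bar>\<tau> * (1 - \<tau>) * poly (chi_ref P j) \<tau> - \<sigma> * (1 - \<sigma>) * poly (chi_ref P j) \<sigma>\<bar> \<le> C * \<bar>\<tau> - \<sigma>\<bar>"
    using chi_ref_bounds by metis
  define B where "B = real (D_t P) * C\<^sup>2"
  have B: "0 < B" using C(1) by (simp add: B_def D_t_def)
  have main: "(t_test r e t)\<^sup>2 \<le> t_density r e t * (B / h_t P r) \<and>
     (t_test r e t - t_test r e s)\<^sup>2 \<le> 2 * (t_density r e t + t_density r e s) * (B / (h_t P r)\<^sup>2 * \<bar>t - s\<bar>)" for r e t s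
  proof -
    define h where "h = h_t P r"
    have h: "0 < h" using h_t_pos by (simp add: h_def)
    define \<tau> where "\<tau> i t = (t - real i * h) / h" for i t
    define w where "w i t = (\<Sum>j<D_t P. e i j * (bubble_t r t * chi_t P r i j t))" for i t
    have eq: "t_test r e t = (\<Sum>i<N_t P r. w i t)" for t
      by (simp add: t_fun_def w_def sum_distrib_left mult_ac)
    have supp: "w i t = 0" if "i \<in> {..<N_t P r}" "t \<notin> cell_t r i" for i t
      using that(2) by (simp add: w_def chi_t_eq)
    have \<tau>: "\<tau> i t \<in> {0..1}" if "t \<in> cell_t r i" for i t
      using cell_t_coord[OF that] by (auto simp: \<tau>_def h_def)
    have chi: "chi_t P r i j t = h powr (-1/2) * poly (chi_ref P j) (\<tau> i t)" if "t \<in> cell_t r i" for i j t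
      using that by (simp add: chi_t_eq \<tau>_def h_def)
    have bub: "bubble_t r t = \<tau> i t * (1 - \<tau> i t)" if "t \<in> cell_t r i" for i t
      using bubble_t_eq[OF that] by (simp add: \<tau>_def h_def)
    have hh: "(h powr (-1/2))\<^sup>2 = 1 / h"
    proof -
      have "(h powr (-1/2))\<^sup>2 = h powr (-1/2 + -1/2)" by (simp only: powr_add power2_eq_square)
      then show ?thesis using h by (simp add: powr_minus_divide)
    qed
    have CS: "(\<Sum>j<D_t P. e i j * f j)\<^sup>2 \<le> (\<Sum>j<D_t P. (e i j)\<^sup>2) * (B / h * q)"
      if f: "\<And>j. j < D_t P \<Longrightarrow> \<bar>f j\<bar> \<le> h powr (-1/2) * (C * a)" and q: "a\<^sup>2 \<le> q" for i f a q
    proof -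
      have "(f j)\<^sup>2 \<le> C\<^sup>2 / h * q" if "j < D_t P" for j
      proof -
        have "(f j)\<^sup>2 \<le> (h powr (-1/2) * (C * a))\<^sup>2" using f[OF that] by (intro power2_le_iff_abs_le[THEN iffD2]) auto
        also have "\<dots> = C\<^sup>2 / h * a\<^sup>2" by (simp only: power_mult_distrib hh) simp
        also have "\<dots> \<le> C\<^sup>2 / h * q" using q h by (intro mult_left_mono) auto
        finally show ?thesis .
      qed
      then have "(\<Sum>j<D_t P. (f j)\<^sup>2) \<le> (\<Sum>j<D_t P. C\<^sup>2 / h * q)" by (intro sum_mono) auto
      also have "\<dots> = B / h * q" by (simp add: B_def)
      finally show ?thesis
        by (intro order.trans[OF Cauchy_Schwarz_ineq_sum] mult_left_mono) (auto intro: sum_nonneg)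
    qed
    have w_bound: "(w i t)\<^sup>2 \<le> (\<Sum>j<D_t P. (e i j)\<^sup>2) * (B / h * q)"
      if t: "t \<in> cell_t r i" and q: "(bubble_t r t)\<^sup>2 \<le> q" for i t q
      unfolding w_def
    proof (rule CS[OF _ q])
      fix j assume j: "j < D_t P"
      have "bubble_t r t * (h powr (-1/2) * \<bar>poly (chi_ref P j) (\<tau> i t)\<bar>) \<le> bubble_t r t * (h powr (-1/2) * C)"
        using C(2)[OF j \<tau>[OF t]] bubble_t_bounds by (intro mult_left_mono) auto
      then show "\<bar>bubble_t r t * chi_t P r i j t\<bar> \<le> h powr (-1/2) * (C * bubble_t r t)"
        using bubble_t_bounds by (simp add: chi[OF t] abs_mult mult_ac)
    qed
    have outside: "(w i t)\<^sup>2 \<le> (\<Sum>j<D_t P. (e i j)\<^sup>2) * (B / h\<^sup>2 * \<bar>t - s\<bar>)"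
      if t: "t \<in> cell_t r i" and s: "s \<notin> cell_t r i" for i t s
    proof -
      have "s < real i * h \<or> real (i + 1) * h \<le> s" using s by (auto simp: cell_t_def h_def)
      moreover have "1 - \<tau> i t = (real (i + 1) * h - t) / h" using h by (simp add: \<tau>_def field_simps)
      ultimately have "\<tau> i t \<le> \<bar>t - s\<bar> / h \<or> 1 - \<tau> i t \<le> \<bar>t - s\<bar> / h"
        unfolding \<tau>_def using h by (auto intro!: divide_right_mono)
      moreover have "\<tau> i t * (1 - \<tau> i t) \<le> \<tau> i t * 1" "\<tau> i t * (1 - \<tau> i t) \<le> 1 * (1 - \<tau> i t)"
        using \<tau>[OF t] by (intro mult_left_mono mult_right_mono; simp)+
      ultimately have b: "bubble_t r t \<le> \<bar>t - s\<bar> / h" unfolding bub[OF t] mult_1 mult_1_right by (meson order.trans)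
      \<comment> \<open>A bubble is at most 1, so its square is bounded by the bubble itself, which
        is at most the relative distance to the cell boundary.\<close>
      have "bubble_t r t * bubble_t r t \<le> bubble_t r t * 1" using bubble_t_bounds by (intro mult_left_mono) auto
      then have "(bubble_t r t)\<^sup>2 \<le> \<bar>t - s\<bar> / h" using b by (simp add: power2_eq_square)
      from w_bound[OF t this] show ?thesis by (simp add: power2_eq_square)
    qed
    have "(t_test r e t)\<^sup>2 \<le> t_density r e t * (B / h)"
      unfolding eq t_density_def
    proof (rule sum_disjoint_support_sq_le[OF _ disjoint_cell_t supp])
      fix i assume i: "t \<in> cell_t r i"
      have "(bubble_t r t)\<^sup>2 \<le> 1" using bubble_t_bounds[of r t] by (simp add: power_le_one)
      from w_bound[OF i this] show "(w i t)\<^sup>2 \<le> (\<Sum>j<D_t P. (e i j)\<^sup>2) * (B / h)" by simp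
    qed (use B h in \<open>auto intro: sum_nonneg\<close>)
    moreover have "(t_test r e t - t_test r e s)\<^sup>2 \<le> 2 * (t_density r e t + t_density r e s) * (B / h\<^sup>2 * \<bar>t - s\<bar>)"
      unfolding eq t_density_def
    proof (rule sum_disjoint_support_diff_sq_le[OF _ disjoint_cell_t supp])
      fix i assume t: "t \<in> cell_t r i" and s: "s \<in> cell_t r i"
      have d: "\<tau> i t - \<tau> i s = (t - s) / h" using h by (simp add: \<tau>_def field_simps)
      \<comment> \<open>Local coordinates in one cell differ by at most 1, so a square of their
        difference may be replaced by its absolute value.\<close>
      have "\<bar>\<tau> i t - \<tau> i s\<bar> \<le> 1" using \<tau>[OF t] \<tau>[OF s] by auto
      then have "\<bar>\<tau> i t - \<tau> i s\<bar> * \<bar>\<tau> i t - \<tau> i s\<bar> \<le> \<bar>\<tau> i t - \<tau> i s\<bar> * 1" by (intro mult_left_mono) auto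
      then have "\<bar>\<tau> i t - \<tau> i s\<bar>\<^sup>2 \<le> \<bar>t - s\<bar> / h" using h by (simp add: power2_eq_square d)
      moreover have "\<bar>bubble_t r t * chi_t P r i j t - bubble_t r s * chi_t P r i j s\<bar> \<le> h powr (-1/2) * (C * \<bar>\<tau> i t - \<tau> i s\<bar>)"
        if j: "j < D_t P" for j
      proof -
        have "bubble_t r t * chi_t P r i j t - bubble_t r s * chi_t P r i j s
            = h powr (-1/2) * (\<tau> i t * (1 - \<tau> i t) * poly (chi_ref P j) (\<tau> i t) - \<tau> i s * (1 - \<tau> i s) * poly (chi_ref P j) (\<tau> i s))"
          using bub[OF t] bub[OF s] by (simp add: chi[OF t] chi[OF s] right_diff_distrib mult_ac)
        then show ?thesis
          using C(3)[OF j \<tau>[OF t] \<tau>[OF s]] by (simp add: abs_mult mult_left_mono)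
      qed
      ultimately have "(\<Sum>j<D_t P. e i j * (bubble_t r t * chi_t P r i j t - bubble_t r s * chi_t P r i j s))\<^sup>2
          \<le> (\<Sum>j<D_t P. (e i j)\<^sup>2) * (B / h * (\<bar>t - s\<bar> / h))"
        by (intro CS[where a = "\<bar>\<tau> i t - \<tau> i s\<bar>"]) auto
      then show "(w i t - w i s)\<^sup>2 \<le> (\<Sum>j<D_t P. (e i j)\<^sup>2) * (B / h\<^sup>2 * \<bar>t - s\<bar>)"
        by (simp add: w_def sum_subtractf right_diff_distrib power2_eq_square)
    next
      fix i assume "s \<in> cell_t r i" "t \<notin> cell_t r i"
      then show "(w i s)\<^sup>2 \<le> (\<Sum>j<D_t P. (e i j)\<^sup>2) * (B / h\<^sup>2 * \<bar>t - s\<bar>)"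
        using outside[of s i t] by (simp add: abs_minus_commute)
    qed (use B h outside in \<open>auto intro: sum_nonneg\<close>)
    ultimately show ?thesis by (simp add: h_def)
  qed
  then show ?thesis using B by (intro exI[of _ B]) blast
qed

lemma L2_t_test_le:
  "\<exists>C>0. \<forall>r e. (\<integral>\<^sup>+t. ennreal ((t_test r e t)\<^sup>2) \<partial>time_meas P) \<le> ennreal (C * t_sq r e)"
proof -
  obtain C where C: "C > 0" "\<And>r e t. (t_test r e t)\<^sup>2 \<le> t_density r e t * (C / h_t P r)"
    using t_test_pointwise by blast
  have "(\<integral>\<^sup>+t. ennreal ((t_test r e t)\<^sup>2) \<partial>time_meas P) \<le> ennreal (C * t_sq r e)" for r e
  proof -
    note h = h_t_pos[of r]
    have "(\<integral>\<^sup>+t. ennreal ((t_test r e t)\<^sup>2) \<partial>time_meas P)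
        \<le> (\<integral>\<^sup>+t. ennreal (C / h_t P r) * ennreal (t_density r e t) \<partial>time_meas P)"
      using C h t_density_nonneg
      by (intro nn_integral_mono) (simp add: ennreal_leI mult.commute flip: ennreal_mult)
    also have "\<dots> = ennreal (C / h_t P r) * (\<integral>\<^sup>+t. ennreal (t_density r e t) \<partial>time_meas P)"
      by (intro nn_integral_cmult measurable_time_measI) measurable
    also have "\<dots> \<le> ennreal (C / h_t P r) * ennreal (h_t P r * t_sq r e)"
      by (intro mult_left_mono nn_integral_t_density_le) auto
    also have "\<dots> = ennreal (C * t_sq r e)"
      using C(1) h t_sq_nonneg by (simp flip: ennreal_mult)
    finally show ?thesis .
  qed
  then show ?thesis using C(1) by blast
qed

lemma H_quarter_t_test_le:
  "\<exists>C>0. \<forall>r e. (\<integral>\<^sup>+t. \<integral>\<^sup>+s. ennreal ((t_test r e t - t_test r e s)\<^sup>2) / ennreal (\<bar>t - s\<bar> powr (3/2))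
      \<partial>time_meas P \<partial>time_meas P) \<le> ennreal (C * 4 ^ r * t_sq r e)"
proof -
  obtain C where C: "C > 0" "\<And>r e t s. (t_test r e t - t_test r e s)\<^sup>2
        \<le> 2 * (t_density r e t + t_density r e s) * (C / (h_t P r)\<^sup>2 * \<bar>t - s\<bar>)"
    using t_test_pointwise by blast
  define T where "T = 4 * sqrt (T_end P)"
  have T: "0 < T" using T_end_pos by (simp add: T_def)
  \<comment> \<open>Integrating the density gains one factor \<open>h_t\<close> against the two lost
    in the pointwise bound, and 1 / h_t is \<open>4 ^ r / h_t P 0\<close>.\<close>
  define C' where "C' = 4 * C * T / h_t P 0"
  have C': "0 < C'" using C(1) T h_t_pos[of 0] by (simp add: C'_def)
  interpret pair_sigma_finite "time_meas P" "time_meas P" ..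
  have "(\<integral>\<^sup>+t. \<integral>\<^sup>+s. ennreal ((t_test r e t - t_test r e s)\<^sup>2) / ennreal (\<bar>t - s\<bar> powr (3/2))
      \<partial>time_meas P \<partial>time_meas P) \<le> ennreal (C' * 4 ^ r * t_sq r e)" for r e
  proof -
    define h where "h = h_t P r"
    have h: "0 < h" using h_t_pos by (simp add: h_def)
    define a where "a t = ennreal (t_density r e t)" for t
    define N where "N t s = ennreal (\<bar>t - s\<bar> powr (-1/2))" for t s :: real
    define c where "c = ennreal (2 * C / h\<^sup>2)"
    have a[measurable]: "a \<in> borel_measurable (time_meas P)"
      unfolding a_def by (intro measurable_time_measI) measurable
    have N1[measurable]: "(\<lambda>s. N t s) \<in> borel_measurable (time_meas P)" for t
      unfolding N_def by (intro measurable_time_measI) measurable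
    have N2[measurable]: "(\<lambda>z. N (fst z) (snd z)) \<in> borel_measurable (time_meas P \<Otimes>\<^sub>M time_meas P)"
    proof -
      have [measurable]: "(\<lambda>t. t) \<in> borel_measurable (time_meas P)" by (intro measurable_time_measI) simp
      show ?thesis unfolding N_def by measurable
    qed
    have pt: "ennreal ((t_test r e t - t_test r e s)\<^sup>2) / ennreal (\<bar>t - s\<bar> powr (3/2)) \<le> c * (a t * N t s + a s * N t s)" for t s
    proof (cases "t = s")
      case False
      then have d: "0 < \<bar>t - s\<bar>" by simp
      have p: "\<bar>t - s\<bar> / \<bar>t - s\<bar> powr (3/2) = \<bar>t - s\<bar> powr (-1/2)"
      proof -
        have "\<bar>t - s\<bar> / \<bar>t - s\<bar> powr (3/2) = \<bar>t - s\<bar> powr 1 / \<bar>t - s\<bar> powr (3/2)" using d by simp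
        also have "\<dots> = \<bar>t - s\<bar> powr (1 - 3/2)" by (simp only: powr_diff)
        finally show ?thesis by simp
      qed
      have "(t_test r e t - t_test r e s)\<^sup>2 / \<bar>t - s\<bar> powr (3/2)
          \<le> 2 * (t_density r e t + t_density r e s) * (C / h\<^sup>2 * \<bar>t - s\<bar>) / \<bar>t - s\<bar> powr (3/2)"
        using C(2) by (intro divide_right_mono) (auto simp: h_def)
      also have "\<dots> = (2 * C / h\<^sup>2) * ((t_density r e t + t_density r e s) * (\<bar>t - s\<bar> / \<bar>t - s\<bar> powr (3/2)))"
        by simp
      also have "\<dots> = (2 * C / h\<^sup>2) * (t_density r e t * \<bar>t - s\<bar> powr (-1/2) + t_density r e s * \<bar>t - s\<bar> powr (-1/2))"
        unfolding p by (simp only: distrib_right)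
      finally have "ennreal ((t_test r e t - t_test r e s)\<^sup>2 / \<bar>t - s\<bar> powr (3/2)) \<le> c * (a t * N t s + a s * N t s)"
        using C(1) h t_density_nonneg
        by (simp add: c_def a_def N_def ennreal_leI flip: ennreal_mult ennreal_plus)
      then show ?thesis using d by (simp add: divide_ennreal)
    qed simp
    have NT: "(\<integral>\<^sup>+s. N t s \<partial>time_meas P) \<le> ennreal T" if t: "t \<in> {0..T_end P}" for t
    proof -
      have "(\<integral>\<^sup>+s. N t s \<partial>time_meas P) \<le> (\<integral>\<^sup>+s. ennreal (\<bar>t - s\<bar> powr (-1/2)) * indicator {s. \<bar>t - s\<bar> \<le> T_end P} s \<partial>lborel)"
        unfolding nn_integral_time N_def using t by (intro nn_integral_mono) (auto split: split_indicator)
      also have "\<dots> \<le> ennreal T" unfolding T_def using T_end_pos by (intro nn_integral_inverse_sqrt_le) simp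
      finally show ?thesis .
    qed
    have I: "(\<integral>\<^sup>+t. \<integral>\<^sup>+s. a t * N t s \<partial>time_meas P \<partial>time_meas P) \<le> ennreal T * (\<integral>\<^sup>+t. a t \<partial>time_meas P)"
    proof -
      have "(\<integral>\<^sup>+t. \<integral>\<^sup>+s. a t * N t s \<partial>time_meas P \<partial>time_meas P) = (\<integral>\<^sup>+t. a t * (\<integral>\<^sup>+s. N t s \<partial>time_meas P) \<partial>time_meas P)"
        by (intro nn_integral_cong nn_integral_cmult) measurable
      also have "\<dots> \<le> (\<integral>\<^sup>+t. a t * ennreal T \<partial>time_meas P)"
        using NT by (intro nn_integral_mono mult_left_mono) (auto simp: space_time_meas)
      also have "\<dots> = ennreal T * (\<integral>\<^sup>+t. a t \<partial>time_meas P)"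
        by (subst nn_integral_multc) (auto simp: mult.commute)
      finally show ?thesis .
    qed
    have swap: "(\<integral>\<^sup>+t. \<integral>\<^sup>+s. a s * N t s \<partial>time_meas P \<partial>time_meas P) = (\<integral>\<^sup>+t. \<integral>\<^sup>+s. a t * N t s \<partial>time_meas P \<partial>time_meas P)"
    proof -
      have "(\<integral>\<^sup>+t. \<integral>\<^sup>+s. a s * N t s \<partial>time_meas P \<partial>time_meas P) = (\<integral>\<^sup>+s. \<integral>\<^sup>+t. a s * N t s \<partial>time_meas P \<partial>time_meas P)"
        by (rule Fubini'[symmetric]) (simp add: case_prod_unfold)
      then show ?thesis by (simp add: N_def abs_minus_commute)
    qed
    have "(\<integral>\<^sup>+t. \<integral>\<^sup>+s. ennreal ((t_test r e t - t_test r e s)\<^sup>2) / ennreal (\<bar>t - s\<bar> powr (3/2)) \<partial>time_meas P \<partial>time_meas P)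
        \<le> (\<integral>\<^sup>+t. \<integral>\<^sup>+s. c * (a t * N t s + a s * N t s) \<partial>time_meas P \<partial>time_meas P)"
      by (intro nn_integral_mono pt)
    also have "\<dots> = c * ((\<integral>\<^sup>+t. \<integral>\<^sup>+s. a t * N t s \<partial>time_meas P \<partial>time_meas P) + (\<integral>\<^sup>+t. \<integral>\<^sup>+s. a s * N t s \<partial>time_meas P \<partial>time_meas P))"
      by (simp add: nn_integral_cmult nn_integral_add case_prod_unfold)
    also have "\<dots> \<le> c * (ennreal T * (\<integral>\<^sup>+t. a t \<partial>time_meas P) + ennreal T * (\<integral>\<^sup>+t. a t \<partial>time_meas P))"
      unfolding swap by (intro mult_left_mono add_mono I) auto
    also have "\<dots> \<le> c * (ennreal T * ennreal (h * t_sq r e) + ennreal T * ennreal (h * t_sq r e))"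
      unfolding a_def h_def by (intro mult_left_mono add_mono nn_integral_t_density_le) auto
    also have "\<dots> = ennreal ((2 * C / h\<^sup>2) * (T * (h * t_sq r e) + T * (h * t_sq r e)))"
      using C(1) T h t_sq_nonneg by (simp add: c_def flip: ennreal_mult ennreal_plus)
    also have "(2 * C / h\<^sup>2) * (T * (h * t_sq r e) + T * (h * t_sq r e)) = 4 * C * T / h * t_sq r e"
      using h by (simp add: power2_eq_square field_simps)
    also have "4 * C * T / h = C' * 4 ^ r"
      using h_t_eq[of r] by (simp add: C'_def h_def)
    finally show ?thesis .
  qed
  then show ?thesis using C' by blast
qed

text \<open>The substitution to the unit interval yields a factor h that cancels the squared
  normalization of the basis, so the bound carries no power of h.\<close>

lemma t_coercive:
  "\<exists>\<kappa>>0. \<forall>r e. ennreal (\<kappa> * t_sq r e) \<le> (\<integral>\<^sup>+t. ennreal (bubble_t r t * (t_fun r e t)\<^sup>2) \<partial>time_meas P)"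
proof -
  obtain \<kappa> where \<kappa>: "\<kappa> > 0" "\<And>d. ennreal (\<kappa> * (\<Sum>j<D_t P. (d j)\<^sup>2))
     \<le> (\<integral>\<^sup>+\<tau>. ennreal (\<tau> * (1 - \<tau>) * (\<Sum>j<D_t P. d j * poly (chi_ref P j) \<tau>)\<^sup>2) * indicator {0<..<1} \<tau> \<partial>lborel)"
    using chi_ref_coercive by blast
  have "ennreal (\<kappa> * t_sq r e) \<le> (\<integral>\<^sup>+t. ennreal (bubble_t r t * (t_fun r e t)\<^sup>2) \<partial>time_meas P)" for r e
  proof -
    define h where "h = h_t P r"
    have h: "0 < h" using h_t_pos by (simp add: h_def)
    define F where "F t = ennreal (bubble_t r t * (t_fun r e t)\<^sup>2)" for t
    have [measurable]: "F \<in> borel_measurable borel" unfolding F_def by measurable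
    have cell: "ennreal (\<kappa> * (\<Sum>j<D_t P. (e i j)\<^sup>2)) \<le> (\<integral>\<^sup>+t. F t * indicator (cell_t r i) t \<partial>lborel)" if i: "i < N_t P r" for i
    proof -
      have "ennreal (\<kappa> * (\<Sum>j<D_t P. (e i j)\<^sup>2))
          \<le> (\<integral>\<^sup>+\<tau>. ennreal (\<tau> * (1 - \<tau>) * (\<Sum>j<D_t P. e i j * poly (chi_ref P j) \<tau>)\<^sup>2) * indicator {0<..<1} \<tau> \<partial>lborel)"
        by (rule \<kappa>)
      also have "\<dots> \<le> (\<integral>\<^sup>+\<tau>. ennreal h * (F (real i * h + h * \<tau>) * indicator (cell_t r i) (real i * h + h * \<tau>)) \<partial>lborel)"
      proof (rule nn_integral_mono)
        fix \<tau> :: real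
        show "ennreal (\<tau> * (1 - \<tau>) * (\<Sum>j<D_t P. e i j * poly (chi_ref P j) \<tau>)\<^sup>2) * indicator {0<..<1} \<tau>
          \<le> ennreal h * (F (real i * h + h * \<tau>) * indicator (cell_t r i) (real i * h + h * \<tau>))"
        proof (cases "\<tau> \<in> {0<..<1}")
          case True
          define t where "t = real i * h + h * \<tau>"
          have t: "t \<in> cell_t r i" using True h by (auto simp: t_def cell_t_def h_def[symmetric] algebra_simps)
          have co: "(t - real i * h_t P r) / h_t P r = \<tau>" using h by (simp add: t_def flip: h_def)
          have b: "bubble_t r t = \<tau> * (1 - \<tau>)" using bubble_t_eq[OF t] unfolding co .
          have "t_fun r e t = (\<Sum>j<D_t P. e i j * chi_t P r i j t)"
            unfolding t_fun_def
            by (rule sum_disjoint_support[OF _ disjoint_cell_t[of r "{..<N_t P r}"] _ _ t]) (use i in \<open>auto simp: chi_t_eq\<close>)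
          also have "\<dots> = h powr (-1/2) * (\<Sum>j<D_t P. e i j * poly (chi_ref P j) \<tau>)"
            using t by (simp add: chi_t_eq co h_def sum_distrib_left mult_ac)
          finally have f: "(t_fun r e t)\<^sup>2 = (h powr (-1/2))\<^sup>2 * (\<Sum>j<D_t P. e i j * poly (chi_ref P j) \<tau>)\<^sup>2"
            by (simp add: power_mult_distrib)
          have "(h powr (-1/2))\<^sup>2 = h powr (-1/2 + -1/2)" by (simp only: powr_add power2_eq_square)
          then have hh: "h * (h powr (-1/2))\<^sup>2 = 1" using h by (simp add: powr_minus_divide)
          have "h * (bubble_t r t * (t_fun r e t)\<^sup>2) = (h * (h powr (-1/2))\<^sup>2) * (\<tau> * (1 - \<tau>) * (\<Sum>j<D_t P. e i j * poly (chi_ref P j) \<tau>)\<^sup>2)"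
            unfolding b f by (simp only: mult_ac)
          then have "h * (bubble_t r t * (t_fun r e t)\<^sup>2) = \<tau> * (1 - \<tau>) * (\<Sum>j<D_t P. e i j * poly (chi_ref P j) \<tau>)\<^sup>2"
            unfolding hh by simp
          then have "ennreal h * F t = ennreal (\<tau> * (1 - \<tau>) * (\<Sum>j<D_t P. e i j * poly (chi_ref P j) \<tau>)\<^sup>2)"
            unfolding F_def using h bubble_t_bounds by (simp flip: ennreal_mult)
          then show ?thesis using t True by (simp flip: t_def)
        qed simp
      qed
      also have "\<dots> = (\<integral>\<^sup>+t. F t * indicator (cell_t r i) t \<partial>lborel)"
        using h nn_integral_real_affine[of "\<lambda>t. F t * indicator (cell_t r i) t" h "real i * h"]
        by (simp add: nn_integral_cmult)
      finally show ?thesis .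
    qed
    have "ennreal (\<kappa> * t_sq r e) = (\<Sum>i<N_t P r. ennreal (\<kappa> * (\<Sum>j<D_t P. (e i j)\<^sup>2)))"
      using \<kappa>(1) by (simp add: t_sq_def sum_distrib_left sum_nonneg)
    also have "\<dots> \<le> (\<Sum>i<N_t P r. \<integral>\<^sup>+t. F t * indicator (cell_t r i) t \<partial>lborel)"
      using cell by (intro sum_mono) auto
    also have "\<dots> = (\<integral>\<^sup>+t. (\<Sum>i<N_t P r. F t * indicator (cell_t r i) t) \<partial>lborel)"
      by (rule nn_integral_sum[symmetric]) measurable
    also have "\<dots> \<le> (\<integral>\<^sup>+t. F t * indicator {0..T_end P} t \<partial>lborel)"
    proof (rule nn_integral_mono)
      fix t
      have "(\<Sum>i<N_t P r. indicator (cell_t r i) t :: ennreal) = indicator (\<Union>i<N_t P r. cell_t r i) t"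
        by (rule indicator_UN_disjoint[symmetric]) (auto simp: disjoint_cell_t)
      also have "\<dots> \<le> indicator {0..T_end P} t"
      proof -
        have "cell_t r i \<subseteq> {0..T_end P}" if "i < N_t P r" for i
        proof -
          have "real (i + 1) * h_t P r \<le> real (N_t P r) * h_t P r"
            using that h_t_pos[of r] by (intro mult_right_mono) auto
          also have "\<dots> = T_end P" using N_t_pos[of r] by (simp add: h_t_def)
          moreover have "0 \<le> real i * h_t P r" using h_t_pos[of r] by simp
          ultimately show ?thesis unfolding cell_t_def by force
        qed
        then have "(\<Union>i<N_t P r. cell_t r i) \<subseteq> {0..T_end P}" by blast
        then show ?thesis by (rule indicator_leI[OF subsetD])
      qed
      finally have "F t * (\<Sum>i<N_t P r. indicator (cell_t r i) t) \<le> F t * indicator {0..T_end P} t"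
        by (intro mult_left_mono) auto
      then show "(\<Sum>i<N_t P r. F t * indicator (cell_t r i) t) \<le> F t * indicator {0..T_end P} t"
        by (simp add: sum_distrib_left)
    qed
    finally show ?thesis unfolding nn_integral_time F_def .
  qed
  then show ?thesis using \<kappa>(1) by blast
qed

end

section \<open>The inverse estimate\<close>

lemma sum4_swap:
  "(\<Sum>i\<in>I. \<Sum>j\<in>J. \<Sum>k\<in>K. \<Sum>m\<in>M. g i j k m) = (\<Sum>k\<in>K. \<Sum>m\<in>M. \<Sum>i\<in>I. \<Sum>j\<in>J. g i j k m)"
proof -
  have "(\<Sum>i\<in>I. \<Sum>j\<in>J. \<Sum>k\<in>K. \<Sum>m\<in>M. g i j k m)
      = (\<Sum>z\<in>I \<times> J. \<Sum>w\<in>K \<times> M. g (fst z) (snd z) (fst w) (snd w))"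
    by (simp add: sum.cartesian_product')
  also have "\<dots> = (\<Sum>w\<in>K \<times> M. \<Sum>z\<in>I \<times> J. g (fst z) (snd z) (fst w) (snd w))"
    by (rule sum.swap)
  finally show ?thesis by (simp add: sum.cartesian_product')
qed

lemma sum_sum_ennreal:
  assumes "\<And>k m. 0 \<le> f k m"
  shows "(\<Sum>k\<in>K. \<Sum>m\<in>M. ennreal (f k m)) = ennreal (\<Sum>k\<in>K. \<Sum>m\<in>M. f k m)"
  using assms by (simp add: sum_nonneg)

lemma nn_integral_cmult_sum_sum:
  fixes f :: "'k \<Rightarrow> 'm \<Rightarrow> 'x \<Rightarrow> ennreal"
  assumes f: "\<And>k m. f k m \<in> borel_measurable N"
  shows "(\<integral>\<^sup>+x. a * (\<Sum>k\<in>K. \<Sum>m\<in>M. f k m x) \<partial>N) = a * (\<Sum>k\<in>K. \<Sum>m\<in>M. \<integral>\<^sup>+x. f k m x \<partial>N)"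
proof -
  have "(\<integral>\<^sup>+x. a * (\<Sum>k\<in>K. \<Sum>m\<in>M. f k m x) \<partial>N) = a * (\<integral>\<^sup>+x. (\<Sum>k\<in>K. \<Sum>m\<in>M. f k m x) \<partial>N)"
    by (intro nn_integral_cmult borel_measurable_sum f)
  also have "(\<integral>\<^sup>+x. (\<Sum>k\<in>K. \<Sum>m\<in>M. f k m x) \<partial>N) = (\<Sum>k\<in>K. \<integral>\<^sup>+x. (\<Sum>m\<in>M. f k m x) \<partial>N)"
    by (intro nn_integral_sum borel_measurable_sum f)
  also have "\<dots> = (\<Sum>k\<in>K. \<Sum>m\<in>M. \<integral>\<^sup>+x. f k m x \<partial>N)"
    by (intro sum.cong refl nn_integral_sum f)
  finally show ?thesis .
qed

context heat_bem_setup
begin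

definition time_coeff :: "(dof \<Rightarrow> real) \<Rightarrow> nat \<Rightarrow> nat \<Rightarrow> nat \<Rightarrow> nat \<Rightarrow> real" where
  "time_coeff c k m i j = c (i, j, k, m)"

text \<open>The function \<open>fun_of\<close> times the space-time bubbles. Time enters through the
  coefficients of a spatial test function: the spatial lemmas apply for fixed \<open>t\<close>, the
  temporal ones for fixed \<open>(k, m)\<close>.\<close>

definition test_fun :: "nat \<Rightarrow> (dof \<Rightarrow> real) \<Rightarrow> (real^3) \<times> real \<Rightarrow> real" where
  "test_fun r c = (\<lambda>(x, t). s_test r (\<lambda>k m. t_test r (time_coeff c k m) t) x)"

lemma fun_of_eq: "fun_of P r c (x, t) = s_fun r (\<lambda>k m. t_fun r (time_coeff c k m) t) x"
proof -
  have "fun_of P r c (x, t) = (\<Sum>i<N_t P r. \<Sum>j<D_t P. \<Sum>k<N_s P r. \<Sum>m<D_s P. c (i, j, k, m) * (chi_t P r i j t * phi P r k m x))"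
    by (simp add: fun_of_def dofs_def sum.cartesian_product')
  also have "\<dots> = (\<Sum>k<N_s P r. \<Sum>m<D_s P. \<Sum>i<N_t P r. \<Sum>j<D_t P. c (i, j, k, m) * (chi_t P r i j t * phi P r k m x))"
    by (rule sum4_swap)
  finally show ?thesis
    by (simp add: s_fun_def t_fun_def time_coeff_def sum_distrib_right mult.assoc)
qed

lemma sum_t_sq_time_coeff: "(\<Sum>k<N_s P r. \<Sum>m<D_s P. t_sq r (time_coeff c k m)) = (L2_set c (dofs P r))\<^sup>2"
proof -
  have "(L2_set c (dofs P r))\<^sup>2 = (\<Sum>i<N_t P r. \<Sum>j<D_t P. \<Sum>k<N_s P r. \<Sum>m<D_s P. (c (i, j, k, m))\<^sup>2)"
    unfolding L2_set_sq dofs_def by (simp add: sum.cartesian_product')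
  also have "\<dots> = (\<Sum>k<N_s P r. \<Sum>m<D_s P. \<Sum>i<N_t P r. \<Sum>j<D_t P. (c (i, j, k, m))\<^sup>2)"
    by (rule sum4_swap)
  finally show ?thesis by (simp add: t_sq_def time_coeff_def)
qed

lemma s_test_diff: "s_test r d x - s_test r d' x = s_test r (\<lambda>k m. d k m - d' k m) x"
  by (simp add: s_test_def left_diff_distrib sum_subtractf)

lemma s_test_scale: "s_test r (\<lambda>k m. b * d k m) x = b * s_test r d x"
  by (simp add: s_test_def sum_distrib_left mult.assoc)

lemma t_fun_scale: "t_fun r (\<lambda>i j. b * e i j) t = b * t_fun r e t"
  by (simp add: t_fun_def sum_distrib_left mult.assoc)

lemma test_fun_scale: "test_fun r (\<lambda>a. b * c a) z = b * test_fun r c z"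
proof -
  have "time_coeff (\<lambda>a. b * c a) k m = (\<lambda>i j. b * time_coeff c k m i j)" for k m
    by (simp add: time_coeff_def[abs_def])
  then show ?thesis
    by (simp add: test_fun_def case_prod_unfold t_fun_scale mult.left_commute[of _ b] s_test_scale)
qed

section \<open>The space-time pairing and the dual norm\<close>

abbreviation st_meas :: "((real^3) \<times> real) measure" where
  "st_meas \<equiv> surf P \<Otimes>\<^sub>M time_meas P"

lemma borel_measurable_t_fun_snd: "(\<lambda>z. t_fun r e (snd z)) \<in> borel_measurable st_meas"
  and borel_measurable_bubble_t_snd: "(\<lambda>z. bubble_t r (snd z)) \<in> borel_measurable st_meas"
  by (rule measurable_compose[OF measurable_snd measurable_time_measI[OF borel_measurable_t_fun]],
      rule measurable_compose[OF measurable_snd measurable_time_measI[OF borel_measurable_bubble_t]])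

lemma borel_measurable_phi_fst: "k < N_s P r \<Longrightarrow> m < D_s P \<Longrightarrow> (\<lambda>z. phi P r k m (fst z)) \<in> borel_measurable st_meas"
  and borel_measurable_bubble_s_fst: "k < N_s P r \<Longrightarrow> (\<lambda>z. bubble_s r k (fst z)) \<in> borel_measurable st_meas"
  by (rule measurable_compose[OF measurable_fst], simp add: measurable_cong_sets[OF sets_surf refl])+

lemma borel_measurable_fun_of: "fun_of P r c \<in> borel_measurable st_meas"
proof -
  have "fun_of P r c = (\<lambda>z. \<Sum>k<N_s P r. \<Sum>m<D_s P. t_fun r (time_coeff c k m) (snd z) * phi P r k m (fst z))"
    by (auto simp: fun_of_eq s_fun_def)
  then show ?thesis
    by (simp only:) (intro borel_measurable_sum borel_measurable_times borel_measurable_t_fun_snd borel_measurable_phi_fst; simp)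
qed

lemma borel_measurable_test_fun: "test_fun r c \<in> borel_measurable st_meas"
proof -
  have "test_fun r c = (\<lambda>z. \<Sum>k<N_s P r. \<Sum>m<D_s P. (bubble_t r (snd z) * t_fun r (time_coeff c k m) (snd z))
      * (bubble_s r k (fst z) * phi P r k m (fst z)))"
    by (auto simp: test_fun_def s_test_def)
  then show ?thesis
    by (simp only:) (intro borel_measurable_sum borel_measurable_times borel_measurable_t_fun_snd borel_measurable_phi_fst
        borel_measurable_bubble_t_snd borel_measurable_bubble_s_fst; simp)
qed

lemma bounded_fun_of: "\<exists>B\<ge>0. \<forall>z. \<bar>fun_of P r c z\<bar> \<le> B"
proof -
  obtain A where A: "A > 0" "\<And>j \<tau>. j < D_t P \<Longrightarrow> \<tau> \<in> {0..1} \<Longrightarrow> \<bar>poly (chi_ref P j) \<tau>\<bar> \<le> A"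
    using chi_ref_bounded by blast
  obtain C where C: "C > 0" "\<And>m u. m < D_s P \<Longrightarrow> u \<in> ref_triangle \<Longrightarrow> \<bar>phi_ref P m u\<bar> \<le> C"
    using phi_ref_bounds by blast
  have chi: "\<bar>chi_t P r i j t\<bar> \<le> h_t P r powr (-1/2) * A" if "j < D_t P" for i j t
    using A(1) A(2)[OF that] cell_t_coord[of t r i]
    by (cases "t \<in> cell_t r i") (auto simp: chi_t_eq abs_mult intro!: mult_left_mono)
  have phi: "\<bar>phi P r k m x\<bar> \<le> C" if "k < N_s P r" "m < D_s P" for k m x
    using C that by (auto simp: phi_def patch_def pullback_patch)
  define B where "B = (\<Sum>a\<in>dofs P r. \<bar>c a\<bar> * ((h_t P r powr (-1/2) * A) * C))"
  have "\<bar>fun_of P r c z\<bar> \<le> B" for z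
  proof -
    obtain x t where z: "z = (x, t)" by (cases z)
    have "\<bar>fun_of P r c z\<bar> \<le> (\<Sum>a\<in>dofs P r. \<bar>case a of (i, j, k, m) \<Rightarrow> c (i, j, k, m) * (chi_t P r i j t * phi P r k m x)\<bar>)"
      unfolding z fun_of_def prod.case by (rule sum_abs)
    also have "\<dots> \<le> B"
      unfolding B_def
    proof (rule sum_mono)
      fix a assume a: "a \<in> dofs P r"
      obtain i j k m where ijkm: "a = (i, j, k, m)" by (cases a)
      have "\<bar>chi_t P r i j t\<bar> * \<bar>phi P r k m x\<bar> \<le> (h_t P r powr (-1/2) * A) * C"
        using a A(1) by (intro mult_mono chi phi) (auto simp: dofs_def ijkm)
      then show "\<bar>case a of (i, j, k, m) \<Rightarrow> c (i, j, k, m) * (chi_t P r i j t * phi P r k m x)\<bar>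
          \<le> \<bar>c a\<bar> * ((h_t P r powr (-1/2) * A) * C)"
        by (simp add: ijkm abs_mult mult_left_mono)
    qed
    finally show ?thesis .
  qed
  moreover have "0 \<le> B" unfolding B_def using A C by (intro sum_nonneg) auto
  ultimately show ?thesis by blast
qed

lemma nn_integral_st:
  assumes "F \<in> borel_measurable st_meas"
  shows "(\<integral>\<^sup>+z. F z \<partial>st_meas) = (\<integral>\<^sup>+t. \<integral>\<^sup>+x. F (x, t) \<partial>surf P \<partial>time_meas P)"
proof -
  interpret pair_sigma_finite "surf P" "time_meas P" ..
  show ?thesis using nn_integral_snd[OF assms] by simp
qed

text \<open>The pairing is finite because \<open>q\<close> is bounded and \<open>v\<close> is square integrable.\<close>

lemma nn_integral_pairing_le:
  assumes q: "\<And>z. \<bar>q z\<bar> \<le> B" and v: "v \<in> borel_measurable st_meas" and H: "H_aniso_sq P v \<le> 1"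
  shows "(\<integral>\<^sup>+z. ennreal \<bar>q z * v z\<bar> \<partial>st_meas) \<le> ennreal B * (emeasure st_meas (space st_meas) + 1)"
proof -
  have B: "0 \<le> B" using q[of undefined] by linarith
  have "\<bar>q z * v z\<bar> \<le> B * (1 + (v z)\<^sup>2)" for z
  proof -
    have "\<bar>v z\<bar> \<le> 1 + (v z)\<^sup>2"
    proof (cases "\<bar>v z\<bar> \<le> 1")
      case False
      then have "\<bar>v z\<bar> * 1 \<le> \<bar>v z\<bar> * \<bar>v z\<bar>" by (intro mult_left_mono) auto
      then show ?thesis by (simp add: power2_eq_square)
    qed (simp add: add_increasing2)
    then show ?thesis unfolding abs_mult using q B by (intro mult_mono) auto
  qed
  then have "(\<integral>\<^sup>+z. ennreal \<bar>q z * v z\<bar> \<partial>st_meas) \<le> (\<integral>\<^sup>+z. ennreal B * (1 + ennreal ((v z)\<^sup>2)) \<partial>st_meas)"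
    using B by (intro nn_integral_mono) (simp add: ennreal_leI ennreal_plus[symmetric] ennreal_mult[symmetric] del: ennreal_plus flip: ennreal_1)
  also have "\<dots> = ennreal B * (emeasure st_meas (space st_meas) + (\<integral>\<^sup>+z. ennreal ((v z)\<^sup>2) \<partial>st_meas))"
    using v by (simp add: nn_integral_cmult nn_integral_add)
  also have "(\<integral>\<^sup>+z. ennreal ((v z)\<^sup>2) \<partial>st_meas) = (\<integral>\<^sup>+t. L2_Gam_sq P (\<lambda>x. v (x, t)) \<partial>time_meas P)"
    unfolding L2_Gam_sq_def using v by (intro nn_integral_st) simp
  also have "\<dots> \<le> H_aniso_sq P v"
    unfolding H_aniso_sq_def by (rule add_increasing[OF zero_le add_increasing2[OF zero_le order.refl]])
  also have "\<dots> \<le> 1" by (rule H)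
  finally show ?thesis by (simp add: mult_left_mono add_left_mono)
qed

lemma emeasure_st_finite: "emeasure st_meas (space st_meas) < \<infinity>"
proof -
  interpret pair_sigma_finite "surf P" "time_meas P" ..
  have "emeasure st_meas (space (surf P) \<times> space (time_meas P))
      = emeasure (surf P) (space (surf P)) * emeasure (time_meas P) (space (time_meas P))"
    by (rule time.emeasure_pair_measure_Times) auto
  moreover have "emeasure (surf P) (space (surf P)) < \<infinity>" "emeasure (time_meas P) (space (time_meas P)) < \<infinity>"
    using surf.emeasure_finite time.emeasure_finite by (simp_all add: less_top[symmetric])
  ultimately show ?thesis
    by (simp add: space_pair_measure ennreal_mult_less_top)
qed

text \<open>A supremum of reals dominates its members only if it is bounded, so this is what allows
  testing the dual norm with a single function. A product that is not integrable has integral 0 by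
  default and does no harm.\<close>

lemma bdd_above_pairing:
  assumes q: "\<And>z. \<bar>q z\<bar> \<le> B"
  shows "bdd_above ((\<lambda>v. \<bar>LINT z|st_meas. q z * v z\<bar>) ` {v \<in> borel_measurable st_meas. H_aniso_sq P v \<le> 1})"
proof (rule bdd_aboveI2)
  have B: "0 \<le> B" using q[of undefined] by linarith
  define A where "A = enn2real (ennreal B * (emeasure st_meas (space st_meas) + 1))"
  have A: "ennreal B * (emeasure st_meas (space st_meas) + 1) = ennreal A"
    unfolding A_def using emeasure_st_finite
    by (intro ennreal_enn2real[symmetric]) (auto simp: ennreal_mult_less_top)
  fix v assume "v \<in> {v \<in> borel_measurable st_meas. H_aniso_sq P v \<le> 1}"
  then have v: "v \<in> borel_measurable st_meas" "H_aniso_sq P v \<le> 1" by auto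
  show "\<bar>LINT z|st_meas. q z * v z\<bar> \<le> A"
  proof (cases "integrable st_meas (\<lambda>z. q z * v z)")
    case True
    have "ennreal \<bar>LINT z|st_meas. q z * v z\<bar> \<le> (\<integral>\<^sup>+z. ennreal \<bar>q z * v z\<bar> \<partial>st_meas)"
      using integral_norm_bound_ennreal[OF True] by simp
    also have "\<dots> \<le> ennreal A" unfolding A[symmetric] by (rule nn_integral_pairing_le[OF q v])
    finally show ?thesis by (simp add: A_def)
  qed (simp add: not_integrable_integral_eq A_def)
qed

lemma H_aniso_sq_zero: "H_aniso_sq P (\<lambda>_. 0) = 0"
  by (simp add: H_aniso_sq_def H_half_Gam_sq_def L2_Gam_sq_def)

lemma H_dual_norm_nonneg:
  assumes q: "\<And>z. \<bar>q z\<bar> \<le> B"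
  shows "0 \<le> H_dual_norm P q"
  unfolding H_dual_norm_def
  by (rule cSUP_upper2[OF bdd_above_pairing[OF q], of "\<lambda>_. 0"]) (auto simp: H_aniso_sq_zero)

lemma H_dual_norm_zero: "H_dual_norm P (\<lambda>_. 0) = 0"
proof -
  have "(\<lambda>_. 0) \<in> {v \<in> borel_measurable st_meas. H_aniso_sq P v \<le> 1}" by (simp add: H_aniso_sq_zero)
  then have "{v \<in> borel_measurable st_meas. H_aniso_sq P v \<le> 1} \<noteq> {}" by blast
  then show ?thesis unfolding H_dual_norm_def by simp
qed

text \<open>In the temporal seminorm the spatial L2 norm of a difference contributes the cell area
  (1/4)^r and the seminorm of the temporal factors contributes 4^r. These cancel because an interval
  is cut into four whenever the mesh width in space is halved.\<close>

lemma H_aniso_test_fun_le: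
  "\<exists>C>0. \<forall>r c. H_aniso_sq P (test_fun r c) \<le> ennreal (C * (L2_set c (dofs P r))\<^sup>2)"
proof -
  obtain C1 where C1: "C1 > 0" "\<And>r d. H_half_Gam_sq P (s_test r d) \<le> ennreal (C1 * s_sq r d)"
    using H_half_s_test_le by blast
  obtain C2 where C2: "C2 > 0" "\<And>r d. L2_Gam_sq P (s_test r d) \<le> ennreal (C2 * (1/4) ^ r * s_sq r d)"
    using L2_s_test_le by blast
  obtain C3 where C3: "C3 > 0" "\<And>r e. (\<integral>\<^sup>+t. ennreal ((t_test r e t)\<^sup>2) \<partial>time_meas P) \<le> ennreal (C3 * t_sq r e)"
    using L2_t_test_le by blast
  obtain C4 where C4: "C4 > 0" "\<And>r e. (\<integral>\<^sup>+t. \<integral>\<^sup>+s. ennreal ((t_test r e t - t_test r e s)\<^sup>2) / ennreal (\<bar>t - s\<bar> powr (3/2))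
      \<partial>time_meas P \<partial>time_meas P) \<le> ennreal (C4 * 4 ^ r * t_sq r e)"
    using H_quarter_t_test_le by blast
  have "H_aniso_sq P (test_fun r c) \<le> ennreal ((C1 * C3 + (C2 * C3 + C2 * C4)) * (L2_set c (dofs P r))\<^sup>2)" for r c
  proof -
    define N where "N = (L2_set c (dofs P r))\<^sup>2"
    define d where "d t k m = t_test r (time_coeff c k m) t" for t k m
    have N: "N = (\<Sum>k<N_s P r. \<Sum>m<D_s P. t_sq r (time_coeff c k m))" "0 \<le> N"
      by (simp_all add: N_def sum_t_sq_time_coeff)
    have v: "(\<lambda>x. test_fun r c (x, t)) = s_test r (d t)" for t
      by (simp add: test_fun_def d_def[abs_def])
    have d_meas: "(\<lambda>t. d t k m) \<in> borel_measurable borel" for k m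
      unfolding d_def by measurable
    have sq: "ennreal (s_sq r e) = (\<Sum>k<N_s P r. \<Sum>m<D_s P. ennreal ((e k m)\<^sup>2))" for e
      by (simp add: s_sq_def sum_nonneg flip: sum_ennreal)
    have I: "(\<integral>\<^sup>+t. ennreal (s_sq r (d t)) \<partial>time_meas P) \<le> ennreal (C3 * N)"
    proof -
      have "(\<integral>\<^sup>+t. ennreal (s_sq r (d t)) \<partial>time_meas P) = (\<Sum>k<N_s P r. \<Sum>m<D_s P. \<integral>\<^sup>+t. ennreal ((d t k m)\<^sup>2) \<partial>time_meas P)"
        unfolding sq
        by (subst nn_integral_sum, (intro borel_measurable_sum measurable_time_measI, use d_meas in measurable),
            intro sum.cong refl nn_integral_sum measurable_time_measI, use d_meas in measurable)
      also have "\<dots> \<le> (\<Sum>k<N_s P r. \<Sum>m<D_s P. ennreal (C3 * t_sq r (time_coeff c k m)))"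
        unfolding d_def by (intro sum_mono C3)
      also have "\<dots> = ennreal (C3 * N)"
        using C3(1) t_sq_nonneg by (simp add: N(1) sum_distrib_left sum_nonneg)
      finally show ?thesis .
    qed
    have sq_meas: "(\<lambda>t. ennreal (s_sq r (d t))) \<in> borel_measurable (time_meas P)"
      unfolding s_sq_def by (intro measurable_time_measI measurable_compose[OF _ measurable_ennreal] borel_measurable_sum borel_measurable_power d_meas)
    have scaled: "(\<integral>\<^sup>+t. ennreal (a * s_sq r (d t)) \<partial>time_meas P) \<le> ennreal (a * (C3 * N))" if a: "0 \<le> a" for a
    proof -
      have "(\<integral>\<^sup>+t. ennreal (a * s_sq r (d t)) \<partial>time_meas P) = ennreal a * (\<integral>\<^sup>+t. ennreal (s_sq r (d t)) \<partial>time_meas P)"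
        using a s_sq_nonneg sq_meas by (simp add: ennreal_mult nn_integral_cmult)
      also have "\<dots> \<le> ennreal a * ennreal (C3 * N)" by (intro mult_left_mono I) simp
      finally show ?thesis using a C3(1) N(2) by (simp add: ennreal_mult)
    qed
    have 1: "(\<integral>\<^sup>+t. H_half_Gam_sq P (s_test r (d t)) \<partial>time_meas P) \<le> ennreal (C1 * (C3 * N))"
      using C1 by (intro order.trans[OF nn_integral_mono scaled]) auto
    have 2: "(\<integral>\<^sup>+t. L2_Gam_sq P (s_test r (d t)) \<partial>time_meas P) \<le> ennreal (C2 * (C3 * N))"
    proof (intro order.trans[OF nn_integral_mono scaled])
      fix t
      have "C2 * (1/4) ^ r * s_sq r (d t) \<le> C2 * 1 * s_sq r (d t)"
        using C2(1) s_sq_nonneg by (intro mult_right_mono mult_left_mono power_le_one) auto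
      then show "L2_Gam_sq P (s_test r (d t)) \<le> ennreal (C2 * s_sq r (d t))"
        using C2(2)[of r "d t"] by (auto intro: order.trans ennreal_leI)
    qed (use C2 in simp)
    \<comment> \<open>The reciprocal of the distance weight in \<open>ennreal\<close>, infinite on
      the diagonal. There the squared difference \<open>D\<close> vanishes, and 0 times infinity is
      0.\<close>
    define w where "w t s = (if t = s then top else ennreal (inverse (\<bar>t - s\<bar> powr (3/2))))" for t s :: real
    have w: "inverse (ennreal (\<bar>t - s\<bar> powr (3/2))) = w t s" for t s
      by (simp add: w_def inverse_ennreal)
    define D where "D k m t s = ennreal ((d t k m - d s k m)\<^sup>2)" for k m t s
    have D1: "(\<lambda>s. D k m t s * w t s) \<in> borel_measurable (time_meas P)" for k m t
    proof (intro measurable_time_measI)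
      have "{s \<in> space borel. t = s} \<in> sets borel" by (simp add: borel_closed)
      then have [measurable]: "(\<lambda>s. w t s) \<in> borel_measurable borel"
        unfolding w_def by (intro measurable_If) measurable
      have [measurable]: "(\<lambda>s. D k m t s) \<in> borel_measurable borel"
        unfolding D_def using d_meas by measurable
      show "(\<lambda>s. D k m t s * w t s) \<in> borel_measurable borel" by measurable
    qed
    have D2: "(\<lambda>t. \<integral>\<^sup>+s. D k m t s * w t s \<partial>time_meas P) \<in> borel_measurable (time_meas P)" for k m
    proof -
      have [measurable]: "(\<lambda>t. t) \<in> borel_measurable (time_meas P)" by (intro measurable_time_measI) simp
      have "(\<lambda>z. D k m (fst z) (snd z) * w (fst z) (snd z)) \<in> borel_measurable (time_meas P \<Otimes>\<^sub>M time_meas P)"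
        unfolding D_def w_def d_def by measurable
      from time.borel_measurable_nn_integral_fst[OF this] show ?thesis by simp
    qed
    have 3: "(\<integral>\<^sup>+t. \<integral>\<^sup>+s. L2_Gam_sq P (\<lambda>x. s_test r (d t) x - s_test r (d s) x) / ennreal (\<bar>t - s\<bar> powr (3/2))
       \<partial>time_meas P \<partial>time_meas P) \<le> ennreal (C2 * (C4 * N))"
    proof -
      have "(\<integral>\<^sup>+t. \<integral>\<^sup>+s. L2_Gam_sq P (\<lambda>x. s_test r (d t) x - s_test r (d s) x) / ennreal (\<bar>t - s\<bar> powr (3/2))
         \<partial>time_meas P \<partial>time_meas P)
         \<le> (\<integral>\<^sup>+t. \<integral>\<^sup>+s. ennreal (C2 * (1/4) ^ r) * (\<Sum>k<N_s P r. \<Sum>m<D_s P. D k m t s * w t s) \<partial>time_meas P \<partial>time_meas P)"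
      proof (intro nn_integral_mono)
        fix t s
        have "L2_Gam_sq P (\<lambda>x. s_test r (d t) x - s_test r (d s) x) \<le> ennreal (C2 * (1/4) ^ r * s_sq r (\<lambda>k m. d t k m - d s k m))"
          unfolding s_test_diff by (rule C2)
        also have "\<dots> = ennreal (C2 * (1/4) ^ r) * (\<Sum>k<N_s P r. \<Sum>m<D_s P. D k m t s)"
          using C2(1) s_sq_nonneg by (simp add: ennreal_mult sq D_def)
        finally have "L2_Gam_sq P (\<lambda>x. s_test r (d t) x - s_test r (d s) x) * w t s
            \<le> ennreal (C2 * (1/4) ^ r) * (\<Sum>k<N_s P r. \<Sum>m<D_s P. D k m t s) * w t s"
          by (intro mult_right_mono) auto
        then show "L2_Gam_sq P (\<lambda>x. s_test r (d t) x - s_test r (d s) x) / ennreal (\<bar>t - s\<bar> powr (3/2))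
            \<le> ennreal (C2 * (1/4) ^ r) * (\<Sum>k<N_s P r. \<Sum>m<D_s P. D k m t s * w t s)"
          by (simp add: divide_ennreal_def w sum_distrib_right mult.assoc)
      qed
      also have "\<dots> = (\<integral>\<^sup>+t. ennreal (C2 * (1/4) ^ r) * (\<Sum>k<N_s P r. \<Sum>m<D_s P. \<integral>\<^sup>+s. D k m t s * w t s \<partial>time_meas P) \<partial>time_meas P)"
        by (intro nn_integral_cong nn_integral_cmult_sum_sum D1)
      also have "\<dots> = ennreal (C2 * (1/4) ^ r) * (\<Sum>k<N_s P r. \<Sum>m<D_s P. \<integral>\<^sup>+t. \<integral>\<^sup>+s. D k m t s * w t s \<partial>time_meas P \<partial>time_meas P)"
        by (intro nn_integral_cmult_sum_sum D2)
      also have "\<dots> \<le> ennreal (C2 * (1/4) ^ r) * (\<Sum>k<N_s P r. \<Sum>m<D_s P. ennreal (C4 * 4 ^ r * t_sq r (time_coeff c k m)))"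
        using C4(2) unfolding D_def d_def divide_ennreal_def w by (intro mult_left_mono sum_mono) auto
      also have "\<dots> = ennreal ((C2 * (1/4) ^ r) * (C4 * 4 ^ r * N))"
      proof -
        have "(\<Sum>k<N_s P r. \<Sum>m<D_s P. ennreal (C4 * 4 ^ r * t_sq r (time_coeff c k m))) = ennreal (C4 * 4 ^ r * N)"
          using C4(1) t_sq_nonneg by (subst sum_sum_ennreal) (auto simp: N(1) sum_distrib_left)
        then show ?thesis using C2(1) by (simp only:) (intro ennreal_mult'[symmetric]; simp)
      qed
      also have "(C2 * (1/4) ^ r) * (C4 * 4 ^ r * N) = C2 * (C4 * N)" by (simp add: power_divide)
      finally show ?thesis .
    qed
    have "H_aniso_sq P (test_fun r c) \<le> ennreal (C1 * (C3 * N)) + (ennreal (C2 * (C3 * N)) + ennreal (C2 * (C4 * N)))"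
      unfolding H_aniso_sq_def using 1 2 3 by (intro add_mono) (simp_all add: v test_fun_def d_def[abs_def])
    also have "\<dots> = ennreal ((C1 * C3 + (C2 * C3 + C2 * C4)) * N)"
      using C1(1) C2(1) C3(1) C4(1) N(2) by (simp add: algebra_simps flip: ennreal_plus)
    finally show ?thesis by (simp add: N_def)
  qed
  then show ?thesis using C1(1) C2(1) C3(1) C4(1)
    by (intro exI[of _ "C1 * C3 + (C2 * C3 + C2 * C4)"]) (auto intro!: add_pos_pos)
qed

text \<open>For fixed time the spatial coercivity reduces the pairing to the temporal coefficient
  functions, to which the temporal coercivity is applied one by one. The factor (1/4)^r is the area
  of a spatial cell.\<close>

lemma pairing_test_fun_ge:
  "\<exists>\<kappa>>0. \<forall>r c. \<kappa> * (1/4) ^ r * (L2_set c (dofs P r))\<^sup>2 \<le> (LINT z|st_meas. fun_of P r c z * test_fun r c z)"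
proof -
  obtain \<kappa>1 where \<kappa>1: "\<kappa>1 > 0" "\<And>r d. ennreal (\<kappa>1 * (1/4) ^ r * s_sq r d) \<le> (\<integral>\<^sup>+x. ennreal (s_fun r d x * s_test r d x) \<partial>surf P)"
    using s_coercive by blast
  obtain \<kappa>2 where \<kappa>2: "\<kappa>2 > 0" "\<And>r e. ennreal (\<kappa>2 * t_sq r e) \<le> (\<integral>\<^sup>+t. ennreal (bubble_t r t * (t_fun r e t)\<^sup>2) \<partial>time_meas P)"
    using t_coercive by blast
  obtain C where C: "C > 0" "\<And>r c. H_aniso_sq P (test_fun r c) \<le> ennreal (C * (L2_set c (dofs P r))\<^sup>2)"
    using H_aniso_test_fun_le by blast
  have "\<kappa>1 * \<kappa>2 * (1/4) ^ r * (L2_set c (dofs P r))\<^sup>2 \<le> (LINT z|st_meas. fun_of P r c z * test_fun r c z)" for r c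
  proof -
    define N where "N = (L2_set c (dofs P r))\<^sup>2"
    have N: "N = (\<Sum>k<N_s P r. \<Sum>m<D_s P. t_sq r (time_coeff c k m))" "0 \<le> N"
      by (simp_all add: N_def sum_t_sq_time_coeff)
    define d where "d t k m = t_fun r (time_coeff c k m) t" for t k m
    have qv: "fun_of P r c (x, t) * test_fun r c (x, t) = bubble_t r t * (s_fun r (d t) x * s_test r (d t) x)" for x t
      by (simp add: fun_of_eq test_fun_def s_test_scale d_def[abs_def])
    have nonneg: "0 \<le> fun_of P r c z * test_fun r c z" for z
      using qv[of "fst z" "snd z"] bubble_t_bounds s_fun_s_test_nonneg by simp
    have meas: "(\<lambda>z. fun_of P r c z * test_fun r c z) \<in> borel_measurable st_meas"
      by (intro borel_measurable_times borel_measurable_fun_of borel_measurable_test_fun)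
    obtain B where B: "B \<ge> 0" "\<And>z. \<bar>fun_of P r c z\<bar> \<le> B" using bounded_fun_of by blast
    \<comment> \<open>Finiteness is needed to pass from the nonnegative integral to
      \<open>LINT\<close>. It follows from the pairing bound after scaling the test function to norm
      at most 1.\<close>
    have fin: "(\<integral>\<^sup>+z. ennreal (fun_of P r c z * test_fun r c z) \<partial>st_meas) < \<infinity>"
    proof -
      \<comment> \<open>\<open>N + 1\<close> instead of \<open>N\<close> keeps the scaling factor
        defined when all coefficients vanish.\<close>
      define a where "a = 1 / sqrt (C * (N + 1))"
      have q: "0 < C * (N + 1)" using C(1) N(2) by simp
      then have "a\<^sup>2 = 1 / (C * (N + 1))" by (simp add: a_def power_divide)
      then have "C * (a\<^sup>2 * N) = N / (N + 1)" using C(1) by simp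
      then have a: "0 < a" "C * (a\<^sup>2 * N) \<le> 1" using q N(2) by (simp_all add: a_def)
      have "(L2_set (\<lambda>z. a * c z) (dofs P r))\<^sup>2 = a\<^sup>2 * N"
        by (simp add: L2_set_sq N_def power_mult_distrib sum_distrib_left)
      then have H: "H_aniso_sq P (test_fun r (\<lambda>z. a * c z)) \<le> 1"
        using C(2)[of r "\<lambda>z. a * c z"] a(2) by (auto intro: order.trans simp: ennreal_le_1)
      have "(\<integral>\<^sup>+z. ennreal (fun_of P r c z * test_fun r c z) \<partial>st_meas)
          = (\<integral>\<^sup>+z. ennreal (1 / a) * ennreal \<bar>fun_of P r c z * test_fun r (\<lambda>z. a * c z) z\<bar> \<partial>st_meas)"
      proof (intro nn_integral_cong)
        fix z
        have "fun_of P r c z * test_fun r c z = (1 / a) * \<bar>a * (fun_of P r c z * test_fun r c z)\<bar>"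
        proof -
          have "X = (1 / a) * \<bar>a * X\<bar>" if "0 \<le> X" for X using that a(1) by simp
          then show ?thesis using nonneg[of z] .
        qed
        also have "a * (fun_of P r c z * test_fun r c z) = fun_of P r c z * test_fun r (\<lambda>z. a * c z) z"
          by (simp add: test_fun_scale)
        finally show "ennreal (fun_of P r c z * test_fun r c z) = ennreal (1 / a) * ennreal \<bar>fun_of P r c z * test_fun r (\<lambda>z. a * c z) z\<bar>"
          using a(1) by (simp only: ennreal_mult[symmetric] abs_ge_zero zero_le_divide_1_iff less_imp_le)
      qed
      also have "\<dots> = ennreal (1 / a) * (\<integral>\<^sup>+z. ennreal \<bar>fun_of P r c z * test_fun r (\<lambda>z. a * c z) z\<bar> \<partial>st_meas)"
        by (intro nn_integral_cmult measurable_compose[OF _ measurable_ennreal] borel_measurable_abs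
            borel_measurable_times borel_measurable_fun_of borel_measurable_test_fun)
      also have "\<dots> \<le> ennreal (1 / a) * (ennreal B * (emeasure st_meas (space st_meas) + 1))"
        by (intro mult_left_mono nn_integral_pairing_le B borel_measurable_test_fun H) auto
      also have "\<dots> < \<infinity>" using emeasure_st_finite by (auto simp: ennreal_mult_less_top)
      finally show ?thesis .
    qed
    have "ennreal (\<kappa>1 * (1/4) ^ r * (\<kappa>2 * N)) = ennreal (\<kappa>1 * (1/4) ^ r) * (\<Sum>k<N_s P r. \<Sum>m<D_s P. ennreal (\<kappa>2 * t_sq r (time_coeff c k m)))"
    proof -
      have "(\<Sum>k<N_s P r. \<Sum>m<D_s P. ennreal (\<kappa>2 * t_sq r (time_coeff c k m))) = ennreal (\<kappa>2 * N)"
        using \<kappa>2(1) t_sq_nonneg by (subst sum_sum_ennreal) (auto simp: N(1) sum_distrib_left)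
      then show ?thesis using \<kappa>1(1) by (simp only:) (intro ennreal_mult'; simp)
    qed
    also have "\<dots> \<le> ennreal (\<kappa>1 * (1/4) ^ r) * (\<Sum>k<N_s P r. \<Sum>m<D_s P. \<integral>\<^sup>+t. ennreal (bubble_t r t * (d t k m)\<^sup>2) \<partial>time_meas P)"
      unfolding d_def by (intro mult_left_mono sum_mono \<kappa>2) auto
    also have "\<dots> = (\<integral>\<^sup>+t. ennreal (\<kappa>1 * (1/4) ^ r) * (\<Sum>k<N_s P r. \<Sum>m<D_s P. ennreal (bubble_t r t * (d t k m)\<^sup>2)) \<partial>time_meas P)"
    proof -
      have [measurable]: "(\<lambda>t. ennreal (bubble_t r t * (d t k m)\<^sup>2)) \<in> borel_measurable (time_meas P)" for k m
        unfolding d_def by (intro measurable_time_measI) measurable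
      show ?thesis by (rule nn_integral_cmult_sum_sum[symmetric]) measurable
    qed
    also have "\<dots> \<le> (\<integral>\<^sup>+t. \<integral>\<^sup>+x. ennreal (fun_of P r c (x, t) * test_fun r c (x, t)) \<partial>surf P \<partial>time_meas P)"
    proof (rule nn_integral_mono)
      fix t
      have "ennreal (\<kappa>1 * (1/4) ^ r) * (\<Sum>k<N_s P r. \<Sum>m<D_s P. ennreal (bubble_t r t * (d t k m)\<^sup>2))
          = ennreal (bubble_t r t) * ennreal (\<kappa>1 * (1/4) ^ r * s_sq r (d t))"
      proof -
        have "(\<Sum>k<N_s P r. \<Sum>m<D_s P. ennreal (bubble_t r t * (d t k m)\<^sup>2)) = ennreal (bubble_t r t * s_sq r (d t))"
          using bubble_t_bounds by (subst sum_sum_ennreal) (auto simp: s_sq_def sum_distrib_left)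
        then show ?thesis
          using \<kappa>1(1) bubble_t_bounds[of r t] s_sq_nonneg[of r "d t"] by (simp add: mult_ac flip: ennreal_mult)
      qed
      also have "\<dots> \<le> ennreal (bubble_t r t) * (\<integral>\<^sup>+x. ennreal (s_fun r (d t) x * s_test r (d t) x) \<partial>surf P)"
        by (intro mult_left_mono \<kappa>1) auto
      also have "\<dots> = (\<integral>\<^sup>+x. ennreal (fun_of P r c (x, t) * test_fun r c (x, t)) \<partial>surf P)"
        using bubble_t_bounds by (subst nn_integral_cmult[symmetric]) (auto simp: qv ennreal_mult' )
      finally show "ennreal (\<kappa>1 * (1/4) ^ r) * (\<Sum>k<N_s P r. \<Sum>m<D_s P. ennreal (bubble_t r t * (d t k m)\<^sup>2))
        \<le> (\<integral>\<^sup>+x. ennreal (fun_of P r c (x, t) * test_fun r c (x, t)) \<partial>surf P)" .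
    qed
    also have "\<dots> = (\<integral>\<^sup>+z. ennreal (fun_of P r c z * test_fun r c z) \<partial>st_meas)"
      using meas by (intro nn_integral_st[symmetric]) simp
    also have "\<dots> = ennreal (LINT z|st_meas. fun_of P r c z * test_fun r c z)"
      using meas nonneg fin by (intro nn_integral_eq_integral integrableI_nonneg) auto
    finally have "\<kappa>1 * (1/4) ^ r * (\<kappa>2 * N) \<le> (LINT z|st_meas. fun_of P r c z * test_fun r c z)"
      using nonneg by (subst (asm) ennreal_le_iff) (auto intro: integral_nonneg)
    then show ?thesis by (simp add: N_def mult_ac)
  qed
  then show ?thesis using \<kappa>1(1) \<kappa>2(1) by (intro exI[of _ "\<kappa>1 * \<kappa>2"]) auto
qed

text \<open>Weaker than the sharp inverse estimate by a factor of order \<open>h\<^sub>s powr (-1/2)\<close>, which the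
  tolerances leave room for.\<close>

lemma coefficients_le_H_dual_norm:
  "\<exists>C>0. \<forall>r c. L2_set c (dofs P r) \<le> C * 4 ^ r * H_dual_norm P (fun_of P r c)"
proof -
  obtain C where C: "C > 0" "\<And>r c. H_aniso_sq P (test_fun r c) \<le> ennreal (C * (L2_set c (dofs P r))\<^sup>2)"
    using H_aniso_test_fun_le by blast
  obtain \<kappa> where \<kappa>: "\<kappa> > 0" "\<And>r c. \<kappa> * (1/4) ^ r * (L2_set c (dofs P r))\<^sup>2 \<le> (LINT z|st_meas. fun_of P r c z * test_fun r c z)"
    using pairing_test_fun_ge by blast
  have "L2_set c (dofs P r) \<le> (sqrt C / \<kappa>) * 4 ^ r * H_dual_norm P (fun_of P r c)" for r c
  proof -
    define N where "N = L2_set c (dofs P r)"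
    obtain B where B: "\<And>z. \<bar>fun_of P r c z\<bar> \<le> B" using bounded_fun_of by blast
    show ?thesis
    proof (cases "N = 0")
      case True
      then show ?thesis using H_dual_norm_nonneg[OF B] C(1) \<kappa>(1) by (simp add: N_def)
    next
      case False
      then have N: "0 < N" using L2_set_nonneg[of c "dofs P r"] unfolding N_def by linarith
      \<comment> \<open>This factor normalizes the test function in the squared fractional norm. The
        pairing is quadratic in the coefficients, so one power of \<open>N\<close> remains.\<close>
      define a where "a = 1 / (sqrt C * N)"
      have a: "0 < a" "C * (a\<^sup>2 * N\<^sup>2) = 1"
        using C(1) N by (auto simp: a_def power_divide power_mult_distrib)
      have "(L2_set (\<lambda>z. a * c z) (dofs P r))\<^sup>2 = a\<^sup>2 * N\<^sup>2"
        by (simp add: N_def L2_set_sq power_mult_distrib sum_distrib_left)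
      then have H: "H_aniso_sq P (test_fun r (\<lambda>z. a * c z)) \<le> 1"
        using C(2)[of r "\<lambda>z. a * c z"] a(2) by simp
      have "a * (\<kappa> * (1/4) ^ r * N\<^sup>2) \<le> a * (LINT z|st_meas. fun_of P r c z * test_fun r c z)"
        using \<kappa>(2)[of r c] a(1) by (simp add: N_def)
      also have "\<dots> = (LINT z|st_meas. fun_of P r c z * test_fun r (\<lambda>z. a * c z) z)"
        by (simp add: test_fun_scale mult.left_commute[of _ a])
      also have "\<dots> \<le> \<bar>LINT z|st_meas. fun_of P r c z * test_fun r (\<lambda>z. a * c z) z\<bar>" by simp
      also have "\<dots> \<le> H_dual_norm P (fun_of P r c)"
        unfolding H_dual_norm_def
        by (rule cSUP_upper[OF _ bdd_above_pairing[OF B]]) (use H borel_measurable_test_fun in auto)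
      finally have "a * (\<kappa> * (1/4) ^ r * N\<^sup>2) \<le> H_dual_norm P (fun_of P r c)" .
      moreover have "a * (\<kappa> * (1/4) ^ r * N\<^sup>2) = \<kappa> / (sqrt C * 4 ^ r) * N"
        using N C(1) by (simp add: a_def power2_eq_square power_divide)
      ultimately have "\<kappa> / (sqrt C * 4 ^ r) * N \<le> H_dual_norm P (fun_of P r c)" by simp
      then show ?thesis using \<kappa>(1) C(1) by (simp add: N_def field_simps)
    qed
  qed
  then show ?thesis using C(1) \<kappa>(1) by (intro exI[of _ "sqrt C / \<kappa>"]) auto
qed

section \<open>Coefficient vectors of discrete functions, and the final estimate\<close>

lemma fun_of_diff: "fun_of P r (\<lambda>a. c a - c' a) z = fun_of P r c z - fun_of P r c' z"
  by (cases z) (simp add: fun_of_def case_prod_unfold left_diff_distrib sum_subtractf)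

lemma fun_of_inj:
  assumes "fun_of P r c = fun_of P r c'" "a \<in> dofs P r"
  shows "c a = c' a"
proof -
  obtain C where C: "L2_set (\<lambda>a. c a - c' a) (dofs P r) \<le> C * 4 ^ r * H_dual_norm P (fun_of P r (\<lambda>a. c a - c' a))"
    using coefficients_le_H_dual_norm by blast
  have "fun_of P r (\<lambda>a. c a - c' a) = (\<lambda>_. 0)" using assms(1) by (auto simp: fun_of_diff)
  then have "L2_set (\<lambda>a. c a - c' a) (dofs P r) \<le> 0" using C by (simp add: H_dual_norm_zero)
  then have "L2_set (\<lambda>a. c a - c' a) (dofs P r) = 0" using L2_set_nonneg by (intro antisym)
  moreover have "finite (dofs P r)" by (simp add: dofs_def)
  ultimately show ?thesis using assms(2) by (simp add: L2_set_eq_0_iff)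
qed

lemma coeff_vec_fun_of:
  assumes "a \<in> dofs P r"
  shows "coeff_vec P r (fun_of P r c) a = c a"
proof -
  \<comment> \<open>\<open>coeff_vec\<close> selects the representative that vanishes outside
    \<open>dofs\<close>; the given \<open>c\<close> may be arbitrary there.\<close>
  define c0 where "c0 a = (if a \<in> dofs P r then c a else 0)" for a
  have "fun_of P r c = fun_of P r c0"
    unfolding fun_of_def by (intro ext) (auto simp: c0_def intro!: sum.cong)
  then have "fun_of P r c = fun_of P r c0 \<and> (\<forall>a. a \<notin> dofs P r \<longrightarrow> c0 a = 0)" by (simp add: c0_def)
  moreover have "c' = c0" if "fun_of P r c = fun_of P r c' \<and> (\<forall>a. a \<notin> dofs P r \<longrightarrow> c' a = 0)" for c'
  proof
    fix a
    show "c' a = c0 a"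
    proof (cases "a \<in> dofs P r")
      case True
      then show ?thesis using that fun_of_inj[of r c' c a] by (simp add: c0_def)
    next
      case False
      then have "c' a = 0" using that by blast
      then show ?thesis using False by (simp add: c0_def)
    qed
  qed
  ultimately have "coeff_vec P r (fun_of P r c) = c0"
    unfolding coeff_vec_def by (rule the_equality)
  then show ?thesis using assms by (simp add: c0_def)
qed

lemma op_form_fun_of: "op_form P r A (fun_of P r c) (fun_of P r d) = mat_form P r A c d"
  unfolding op_form_def mat_form_def by (intro sum.cong refl) (simp add: coeff_vec_fun_of)

lemma h_s_nonneg: "0 \<le> h_s P r"
proof -
  have "bounded (patch P r 0)" using compact_patch[OF N_s_pos] by (rule compact_imp_bounded)
  then have "0 \<le> diameter (patch P r 0)" by (rule diameter_ge_0)
  also have "\<dots> \<le> h_s P r" unfolding h_s_def using N_s_pos by (intro Max_ge) auto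
  finally show ?thesis .
qed

end

theorem theorem6p4:
  fixes P :: heat_bem
  assumes "bem_setup P"
    and "\<exists>a>0. \<exists>b>0. \<forall>r. a * (h_s P r)\<^sup>2 \<le> h_t P r \<and> h_t P r \<le> b * (h_s P r)\<^sup>2"
  shows "\<exists>C>0. \<forall>r p \<epsilon> B F f g cf cg.
           2 \<le> p \<longrightarrow> 0 < \<epsilon> \<longrightarrow>
           near_approx P r (eps_near P r \<epsilon>) B \<longrightarrow>
           far_approx P r p (eps_far P r p \<epsilon>) F \<longrightarrow>
           f \<in> S_space P r \<longrightarrow> f = fun_of P r cf \<longrightarrow>
           g \<in> S_space P r \<longrightarrow> g = fun_of P r cg \<longrightarrow>
           op_form P r (V_mat P r p) f g - op_form P r (blocked_matrix P r p B F) f g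
             = mat_form P r (\<lambda>a b. V_mat P r p a b - blocked_matrix P r p B F a b) cf cg \<and>
           mat_form P r (\<lambda>a b. V_mat P r p a b - blocked_matrix P r p B F a b) cf cg
             \<le> C * \<epsilon> * h_s P r powr (-2) * H_dual_norm P f * H_dual_norm P g"
proof -
  interpret heat_bem_setup P by (unfold_locales) (rule assms(1))
  obtain a b where ab: "a > 0" "b > 0" "\<And>r. a * (h_s P r)\<^sup>2 \<le> h_t P r" "\<And>r. h_t P r \<le> b * (h_s P r)\<^sup>2"
    using assms(2) by blast
  obtain C1 where C1: "C1 > 0" "\<And>r p \<epsilon> B F x y. 2 \<le> p \<Longrightarrow> 0 < \<epsilon> \<Longrightarrow> 0 \<le> h_s P r \<Longrightarrow>
     near_approx P r (eps_near P r \<epsilon>) B \<Longrightarrow> far_approx P r p (eps_far P r p \<epsilon>) F \<Longrightarrow>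
     mat_form P r (\<lambda>a b. V_mat P r p a b - blocked_matrix P r p B F a b) x y
       \<le> C1 * \<epsilon> * (h_s P r * h_t P r powr (1/2)) * (L2_set x (dofs P r) * L2_set y (dofs P r))"
    using mat_form_error_le by blast
  obtain C2 where C2: "C2 > 0" "\<And>r c. L2_set c (dofs P r) \<le> C2 * 4 ^ r * H_dual_norm P (fun_of P r c)"
    using coefficients_le_H_dual_norm by blast
  \<comment> \<open>Here \<open>4 ^ r\<close> is \<open>h_t P 0 / h_t P r\<close>, which accounts
    for the square of the initial step. The first factor comes from
    \<open>s\<^sup>2 \<le> h / a\<close>, the second from bounding \<open>s * sqrt h\<close> by a
    multiple of \<open>h\<close>.\<close>
  define C3 where "C3 = (1 / a) * (1 + 1 / a) * (h_t P 0)\<^sup>2"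
  have C3: "0 < C3" using ab(1) h_t_pos[of 0] by (simp add: C3_def add_pos_pos)
  have scale: "h_s P r * h_t P r powr (1/2) * (4 ^ r * 4 ^ r) \<le> C3 * h_s P r powr (-2)" for r
  proof -
    define s where "s = h_s P r"
    define h where "h = h_t P r"
    have h: "0 < h" "h * 4 ^ r = h_t P 0" using h_t_pos h_t_eq[of r] by (auto simp: h_def)
    \<comment> \<open>A vanishing mesh width would force \<open>h_t\<close> to be nonpositive by the
      upper comparison; the claim divides by \<open>s\<^sup>2\<close>.\<close>
    have "s \<noteq> 0" using ab(4)[of r] h(1) by (auto simp: s_def h_def)
    then have s: "0 < s" using h_s_nonneg[of r] by (simp add: s_def)
    have s2: "s\<^sup>2 \<le> h / a" using ab(1) ab(3)[of r] by (simp add: s_def h_def field_simps)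
    have "2 * (s * sqrt h) \<le> s\<^sup>2 + h" using sum_squares_bound[of s "sqrt h"] h(1) by simp
    moreover have "0 \<le> h / a" using h(1) ab(1) by simp
    ultimately have sh: "s * sqrt h \<le> (1 + 1 / a) * h" using s2 s h(1) by (simp add: distrib_right)
    have "s\<^sup>2 * (s * sqrt h) \<le> (h / a) * ((1 + 1 / a) * h)"
      using s h(1) ab(1) by (intro mult_mono[OF s2 sh]) auto
    then have "s\<^sup>2 * (s * sqrt h) * (4 ^ r * 4 ^ r) \<le> (h / a) * ((1 + 1 / a) * h) * (4 ^ r * 4 ^ r)"
      by (intro mult_right_mono) auto
    also have "\<dots> = (1 / a) * (1 + 1 / a) * ((h * 4 ^ r) * (h * 4 ^ r))" by simp
    also have "\<dots> = C3" unfolding h(2) C3_def by (simp add: power2_eq_square)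
    finally have "s * sqrt h * (4 ^ r * 4 ^ r) \<le> C3 / s\<^sup>2" using s by (simp add: field_simps)
    then show ?thesis using s h(1) by (simp add: powr_half_sqrt powr_minus_divide flip: s_def h_def)
  qed
  define C where "C = C1 * C2\<^sup>2 * C3"
  have "0 < C" using C1(1) C2(1) C3 by (simp add: C_def)
  moreover have "op_form P r (V_mat P r p) (fun_of P r cf) (fun_of P r cg) - op_form P r (blocked_matrix P r p B F) (fun_of P r cf) (fun_of P r cg)
             = mat_form P r (\<lambda>a b. V_mat P r p a b - blocked_matrix P r p B F a b) cf cg" for r p B F cf cg
    unfolding op_form_fun_of by (simp add: mat_form_def right_diff_distrib left_diff_distrib sum_subtractf)
  moreover have "mat_form P r (\<lambda>a b. V_mat P r p a b - blocked_matrix P r p B F a b) cf cg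
             \<le> C * \<epsilon> * h_s P r powr (-2) * H_dual_norm P (fun_of P r cf) * H_dual_norm P (fun_of P r cg)"
    if p: "2 \<le> p" and \<epsilon>: "0 < \<epsilon>" and near: "near_approx P r (eps_near P r \<epsilon>) B"
      and far: "far_approx P r p (eps_far P r p \<epsilon>) F" for r p \<epsilon> B F cf cg
  proof -
    let ?Hf = "H_dual_norm P (fun_of P r cf)" and ?Hg = "H_dual_norm P (fun_of P r cg)"
    have H0: "0 \<le> H_dual_norm P (fun_of P r c)" for c
      using bounded_fun_of[of r c] H_dual_norm_nonneg by blast
    have "mat_form P r (\<lambda>a b. V_mat P r p a b - blocked_matrix P r p B F a b) cf cg
        \<le> C1 * \<epsilon> * (h_s P r * h_t P r powr (1/2)) * (L2_set cf (dofs P r) * L2_set cg (dofs P r))"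
      by (rule C1(2)[OF p \<epsilon> h_s_nonneg near far])
    also have "\<dots> \<le> C1 * \<epsilon> * (h_s P r * h_t P r powr (1/2)) * ((C2 * 4 ^ r * ?Hf) * (C2 * 4 ^ r * ?Hg))"
      using C1(1) \<epsilon> h_s_nonneg H0 C2(1)
      by (intro mult_left_mono mult_mono C2(2)) (auto simp: L2_set_nonneg)
    also have "\<dots> = C1 * C2\<^sup>2 * \<epsilon> * (?Hf * ?Hg) * (h_s P r * h_t P r powr (1/2) * (4 ^ r * 4 ^ r))"
      by (simp add: power2_eq_square mult_ac)
    also have "\<dots> \<le> C1 * C2\<^sup>2 * \<epsilon> * (?Hf * ?Hg) * (C3 * h_s P r powr (-2))"
      using C1(1) C2(1) \<epsilon> H0 by (intro mult_left_mono scale) auto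
    also have "\<dots> = C * \<epsilon> * h_s P r powr (-2) * ?Hf * ?Hg" by (simp add: C_def mult_ac)
    finally show ?thesis .
  qed
  ultimately show ?thesis by blast
qed

end
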